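(* Let $X$ be a locally Noetherian scheme and $Z$ a locally principal subscheme of $X$. Let $T_Z$ be the subset of $X$ given by the union of the underlying sets of $\overline{\{x\}}$ for all $x\in \mathrm{Ass}(X)\cap Z$. Let $V$ be its complement in $X$. Then $V$ is an open subscheme of $X$ and its schematic closure $\overline{V}\hookrightarrow X$ is the blow up of $X$ along $Z$.
   Context: $\mathrm{Ass}(X)$ is the set of associated points of $X$. A locally principal subscheme is a closed subscheme whose ideal sheaf is locally generated by a single element. The schematic closure of an open subscheme $V$ of $X$ is the scheme theoretic image of the open embedding $V\hookrightarrow X$, i.e. the smallest closed subscheme of $X$ through which $V\hookrightarrow X$ factorises. The blow up of $X$ along $Z$ is the morphism to $X$ that is terminal among morphisms $T\to X$ such that the preimage of $Z$ is an effective Cartier divisor (ideal sheaf locally generated by a regular element) of $T$. *)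

theory Defs
  imports "HOL-Analysis.Abstract_Topology" "HOL-Algebra.Ring_Divisibility"
    "HOL-Algebra.QuotRing" "HOL-Library.FuncSet"
begin

section \<open>Commutative algebra\<close>

definition local_ring :: "('a, 'm) ring_scheme \<Rightarrow> bool" where
  "local_ring R \<longleftrightarrow> cring R \<and> (\<exists>!M. maximalideal M R)"

definition max_ideal :: "('a, 'm) ring_scheme \<Rightarrow> 'a set" where
  "max_ideal R = (THE M. maximalideal M R)"

definition annihilator :: "('a, 'm) ring_scheme \<Rightarrow> 'a \<Rightarrow> 'a set" where
  "annihilator R a = {r \<in> carrier R. r \<otimes>\<^bsub>R\<^esub> a = \<zero>\<^bsub>R\<^esub>}"

definition associated_prime :: "('a, 'm) ring_scheme \<Rightarrow> 'a set \<Rightarrow> bool" where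
  "associated_prime R p \<longleftrightarrow> primeideal p R \<and> (\<exists>a \<in> carrier R. p = annihilator R a)"

definition regular_element :: "('a, 'm) ring_scheme \<Rightarrow> 'a \<Rightarrow> bool" where
  "regular_element R f \<longleftrightarrow> f \<in> carrier R \<and>
     (\<forall>a \<in> carrier R. a \<otimes>\<^bsub>R\<^esub> f = \<zero>\<^bsub>R\<^esub> \<longrightarrow> a = \<zero>\<^bsub>R\<^esub>)"

text \<open>The fraction \<open>a / s\<close>, as an equivalence class of pairs. The operations of the
  localization are the unions over all representatives; since they do not depend on the
  representatives when \<open>S\<close> is multiplicatively closed, these are unions of equal sets.\<close>

definition fraction :: "('a, 'm) ring_scheme \<Rightarrow> 'a set \<Rightarrow> 'a \<Rightarrow> 'a \<Rightarrow> ('a \<times> 'a) set" where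
  "fraction R S a s = {(b, t). b \<in> carrier R \<and> t \<in> S \<and>
     (\<exists>u \<in> S. u \<otimes>\<^bsub>R\<^esub> (t \<otimes>\<^bsub>R\<^esub> a) = u \<otimes>\<^bsub>R\<^esub> (s \<otimes>\<^bsub>R\<^esub> b))}"

definition localization :: "('a, 'm) ring_scheme \<Rightarrow> 'a set \<Rightarrow> ('a \<times> 'a) set ring" where
  "localization R S =
     \<lparr>carrier = {fraction R S a s |a s. a \<in> carrier R \<and> s \<in> S},
      mult = (\<lambda>x y. \<Union>(a, s) \<in> x. \<Union>(b, t) \<in> y. fraction R S (a \<otimes>\<^bsub>R\<^esub> b) (s \<otimes>\<^bsub>R\<^esub> t)),
      one = fraction R S \<one>\<^bsub>R\<^esub> \<one>\<^bsub>R\<^esub>,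
      zero = fraction R S \<zero>\<^bsub>R\<^esub> \<one>\<^bsub>R\<^esub>,
      add = (\<lambda>x y. \<Union>(a, s) \<in> x. \<Union>(b, t) \<in> y.
               fraction R S ((a \<otimes>\<^bsub>R\<^esub> t) \<oplus>\<^bsub>R\<^esub> (b \<otimes>\<^bsub>R\<^esub> s)) (s \<otimes>\<^bsub>R\<^esub> t))\<rparr>"

abbreviation local_at :: "('a, 'm) ring_scheme \<Rightarrow> 'a set \<Rightarrow> ('a \<times> 'a) set ring" where
  "local_at R p \<equiv> localization R (carrier R - p)"

text \<open>The set \<open>C\<close> of functions on \<open>U\<close> with values \<open>s x\<close> in \<open>A x\<close>, as a ring under pointwise
  operations.\<close>

definition pointwise_ring :: "'x set \<Rightarrow> ('x \<Rightarrow> 'c ring) \<Rightarrow> ('x \<Rightarrow> 'c) set \<Rightarrow> ('x \<Rightarrow> 'c) ring" where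
  "pointwise_ring U A C =
     \<lparr>carrier = C,
      mult = (\<lambda>s t. \<lambda>x \<in> U. s x \<otimes>\<^bsub>A x\<^esub> t x),
      one = (\<lambda>x \<in> U. \<one>\<^bsub>A x\<^esub>),
      zero = (\<lambda>x \<in> U. \<zero>\<^bsub>A x\<^esub>),
      add = (\<lambda>s t. \<lambda>x \<in> U. s x \<oplus>\<^bsub>A x\<^esub> t x)\<rparr>"


section \<open>Locally ringed spaces\<close>

text \<open>\<open>rs_res X U V\<close> is the restriction from \<open>U\<close> to \<open>V\<close>; only its values for open
  \<open>V \<subseteq> U\<close> are meaningful.\<close>

record ('a, 'b) rspace =
  rs_top :: "'a topology"
  rs_sec :: "'a set \<Rightarrow> 'b ring"
  rs_res :: "'a set \<Rightarrow> 'a set \<Rightarrow> 'b \<Rightarrow> 'b"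

abbreviation pts :: "('a, 'b) rspace \<Rightarrow> 'a set" where
  "pts X \<equiv> topspace (rs_top X)"

abbreviation opn :: "('a, 'b) rspace \<Rightarrow> 'a set \<Rightarrow> bool" where
  "opn X U \<equiv> openin (rs_top X) U"

abbreviation sec :: "('a, 'b) rspace \<Rightarrow> 'a set \<Rightarrow> 'b set" where
  "sec X U \<equiv> carrier (rs_sec X U)"

locale ringed_space =
  fixes X :: "('a, 'b) rspace"
  assumes sec_cring: "opn X U \<Longrightarrow> cring (rs_sec X U)"
    and res_hom: "\<lbrakk>opn X U; opn X V; V \<subseteq> U\<rbrakk> \<Longrightarrow> rs_res X U V \<in> ring_hom (rs_sec X U) (rs_sec X V)"
    and res_id: "\<lbrakk>opn X U; s \<in> sec X U\<rbrakk> \<Longrightarrow> rs_res X U U s = s"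
    and res_res: "\<lbrakk>opn X U; opn X V; opn X W; W \<subseteq> V; V \<subseteq> U; s \<in> sec X U\<rbrakk>
      \<Longrightarrow> rs_res X V W (rs_res X U V s) = rs_res X U W s"
    and gluing: "\<lbrakk>\<And>U. U \<in> \<U> \<Longrightarrow> opn X U; \<And>U. U \<in> \<U> \<Longrightarrow> \<sigma> U \<in> sec X U;
        \<And>U V. \<lbrakk>U \<in> \<U>; V \<in> \<U>\<rbrakk> \<Longrightarrow> rs_res X U (U \<inter> V) (\<sigma> U) = rs_res X V (U \<inter> V) (\<sigma> V)\<rbrakk>
      \<Longrightarrow> \<exists>!t. t \<in> sec X (\<Union>\<U>) \<and> (\<forall>U \<in> \<U>. rs_res X (\<Union>\<U>) U t = \<sigma> U)"

text \<open>The germ at \<open>x\<close> of a section \<open>s\<close> over \<open>U\<close>, as an equivalence class; the operations of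
  the stalk are unions over all representatives, as for the localization.\<close>

definition germ :: "('a, 'b) rspace \<Rightarrow> 'a \<Rightarrow> 'a set \<Rightarrow> 'b \<Rightarrow> ('a set \<times> 'b) set" where
  "germ X x U s = {(V, t). opn X V \<and> x \<in> V \<and> t \<in> sec X V \<and>
     (\<exists>W. opn X W \<and> x \<in> W \<and> W \<subseteq> U \<inter> V \<and> rs_res X U W s = rs_res X V W t)}"

definition stalk :: "('a, 'b) rspace \<Rightarrow> 'a \<Rightarrow> ('a set \<times> 'b) set ring" where
  "stalk X x =
     \<lparr>carrier = {germ X x U s |U s. opn X U \<and> x \<in> U \<and> s \<in> sec X U},
      mult = (\<lambda>a b. \<Union>(U, s) \<in> a. \<Union>(V, t) \<in> b. germ X x (U \<inter> V)
                (rs_res X U (U \<inter> V) s \<otimes>\<^bsub>rs_sec X (U \<inter> V)\<^esub> rs_res X V (U \<inter> V) t)),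
      one = germ X x (pts X) \<one>\<^bsub>rs_sec X (pts X)\<^esub>,
      zero = germ X x (pts X) \<zero>\<^bsub>rs_sec X (pts X)\<^esub>,
      add = (\<lambda>a b. \<Union>(U, s) \<in> a. \<Union>(V, t) \<in> b. germ X x (U \<inter> V)
                (rs_res X U (U \<inter> V) s \<oplus>\<^bsub>rs_sec X (U \<inter> V)\<^esub> rs_res X V (U \<inter> V) t))\<rparr>"

locale locally_ringed_space = ringed_space +
  assumes stalk_local: "x \<in> pts X \<Longrightarrow> local_ring (stalk X x)"

text \<open>A morphism \<open>f\<close> from \<open>X\<close> to \<open>Y\<close>: a map on points and, for open \<open>V\<close> in \<open>Y\<close>, a map from
  the sections of \<open>Y\<close> over \<open>V\<close> to those of \<open>X\<close> over the preimage of \<open>V\<close>. The record does not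
  know its source and target, so these are passed explicitly where needed, and morphisms are
  compared by \<open>mor_eq\<close>, which ignores irrelevant arguments.\<close>

record ('a, 'b, 'c, 'd) rs_mor =
  mor_pt :: "'a \<Rightarrow> 'c"
  mor_sec :: "'c set \<Rightarrow> 'd \<Rightarrow> 'b"

definition preim :: "('a, 'b) rspace \<Rightarrow> ('a, 'b, 'c, 'd) rs_mor \<Rightarrow> 'c set \<Rightarrow> 'a set" where
  "preim X f V = {x \<in> pts X. mor_pt f x \<in> V}"

definition stalk_map ::
  "('a, 'b) rspace \<Rightarrow> ('a, 'b, 'c, 'd) rs_mor \<Rightarrow> 'a \<Rightarrow> ('c set \<times> 'd) set \<Rightarrow> ('a set \<times> 'b) set"
where
  "stalk_map X f x a = (\<Union>(V, t) \<in> a. germ X x (preim X f V) (mor_sec f V t))"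

definition ringed_morphism ::
  "('a, 'b) rspace \<Rightarrow> ('c, 'd) rspace \<Rightarrow> ('a, 'b, 'c, 'd) rs_mor \<Rightarrow> bool"
where
  "ringed_morphism X Y f \<longleftrightarrow>
     continuous_map (rs_top X) (rs_top Y) (mor_pt f) \<and>
     (\<forall>V. opn Y V \<longrightarrow> mor_sec f V \<in> ring_hom (rs_sec Y V) (rs_sec X (preim X f V))) \<and>
     (\<forall>V W. opn Y V \<and> opn Y W \<and> W \<subseteq> V \<longrightarrow>
        (\<forall>s \<in> sec Y V. rs_res X (preim X f V) (preim X f W) (mor_sec f V s)
                      = mor_sec f W (rs_res Y V W s)))"

definition lrs_morphism ::
  "('a, 'b) rspace \<Rightarrow> ('c, 'd) rspace \<Rightarrow> ('a, 'b, 'c, 'd) rs_mor \<Rightarrow> bool"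
where
  "lrs_morphism X Y f \<longleftrightarrow> ringed_morphism X Y f \<and>
     (\<forall>x \<in> pts X. stalk_map X f x ` max_ideal (stalk Y (mor_pt f x)) \<subseteq> max_ideal (stalk X x))"

definition mor_eq ::
  "('a, 'b) rspace \<Rightarrow> ('c, 'd) rspace \<Rightarrow> ('a, 'b, 'c, 'd) rs_mor \<Rightarrow> ('a, 'b, 'c, 'd) rs_mor \<Rightarrow> bool"
where
  "mor_eq X Y f g \<longleftrightarrow> (\<forall>x \<in> pts X. mor_pt f x = mor_pt g x) \<and>
     (\<forall>V. opn Y V \<longrightarrow> (\<forall>s \<in> sec Y V. mor_sec f V s = mor_sec g V s))"

definition mor_id :: "('a, 'b, 'a, 'b) rs_mor" where
  "mor_id = \<lparr>mor_pt = (\<lambda>x. x), mor_sec = (\<lambda>U s. s)\<rparr>"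

text \<open>\<open>mor_comp Y g f\<close> is the composite of \<open>f\<close> (into \<open>Y\<close>) followed by \<open>g\<close> (from \<open>Y\<close>).\<close>

definition mor_comp ::
  "('c, 'd) rspace \<Rightarrow> ('c, 'd, 'e, 'f) rs_mor \<Rightarrow> ('a, 'b, 'c, 'd) rs_mor \<Rightarrow> ('a, 'b, 'e, 'f) rs_mor"
where
  "mor_comp Y g f = \<lparr>mor_pt = (\<lambda>x. mor_pt g (mor_pt f x)),
     mor_sec = (\<lambda>W s. mor_sec f (preim Y g W) (mor_sec g W s))\<rparr>"

definition lrs_isomorphic :: "('a, 'b) rspace \<Rightarrow> ('c, 'd) rspace \<Rightarrow> bool" where
  "lrs_isomorphic X Y \<longleftrightarrow> (\<exists>f g. lrs_morphism X Y f \<and> lrs_morphism Y X g \<and>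
     mor_eq X X (mor_comp Y g f) mor_id \<and> mor_eq Y Y (mor_comp X f g) mor_id)"

definition factors_through ::
  "('a, 'b) rspace \<Rightarrow> ('e, 'f) rspace \<Rightarrow> ('a, 'b, 'e, 'f) rs_mor \<Rightarrow>
   ('c, 'd) rspace \<Rightarrow> ('c, 'd, 'e, 'f) rs_mor \<Rightarrow> bool"
where
  "factors_through S X f Y g \<longleftrightarrow> (\<exists>h. lrs_morphism S Y h \<and> mor_eq S X (mor_comp Y g h) f)"


section \<open>Schemes\<close>

definition prime_spec :: "('r, 'm) ring_scheme \<Rightarrow> 'r set set" where
  "prime_spec R = {p. primeideal p R}"

text \<open>The Zariski topology, generated by the sets \<open>D(f)\<close>.\<close>

definition zariski :: "('r, 'm) ring_scheme \<Rightarrow> 'r set topology" where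
  "zariski R = topology_generated_by {{p \<in> prime_spec R. f \<notin> p} |f. f \<in> carrier R}"

text \<open>Sections over \<open>U\<close> are the functions on \<open>U\<close> with values in the local rings that are
  locally given by a fraction.\<close>

definition spec_sections ::
  "('r, 'm) ring_scheme \<Rightarrow> 'r set set \<Rightarrow> ('r set \<Rightarrow> ('r \<times> 'r) set) set"
where
  "spec_sections R U = {s \<in> (\<Pi>\<^sub>E p \<in> U. carrier (local_at R p)).
     \<forall>p \<in> U. \<exists>W a f. openin (zariski R) W \<and> p \<in> W \<and> W \<subseteq> U \<and> a \<in> carrier R \<and> f \<in> carrier R \<and>
       (\<forall>q \<in> W. f \<notin> q \<and> s q = fraction R (carrier R - q) a f)}"

definition Spec :: "('r, 'm) ring_scheme \<Rightarrow> ('r set, 'r set \<Rightarrow> ('r \<times> 'r) set) rspace" where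
  "Spec R = \<lparr>rs_top = zariski R,
     rs_sec = (\<lambda>U. pointwise_ring U (local_at R) (spec_sections R U)),
     rs_res = (\<lambda>U V s. restrict s V)\<rparr>"

definition open_sub :: "('a, 'b) rspace \<Rightarrow> 'a set \<Rightarrow> ('a, 'b) rspace" where
  "open_sub X U = X\<lparr>rs_top := subtopology (rs_top X) U\<rparr>"

definition open_incl :: "('a, 'b) rspace \<Rightarrow> 'a set \<Rightarrow> ('a, 'b, 'a, 'b) rs_mor" where
  "open_incl X U = \<lparr>mor_pt = (\<lambda>x. x), mor_sec = (\<lambda>V s. rs_res X V (U \<inter> V) s)\<rparr>"

text \<open>An affine open is isomorphic to the spectrum of its ring of sections, so it is no
  restriction that the rings below range over the type of sections of \<open>X\<close>.\<close>

definition scheme :: "('a, 'b) rspace \<Rightarrow> bool" where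
  "scheme X \<longleftrightarrow> locally_ringed_space X \<and>
     (\<forall>x \<in> pts X. \<exists>U (R :: 'b ring). opn X U \<and> x \<in> U \<and> cring R \<and>
        lrs_isomorphic (open_sub X U) (Spec R))"

definition locally_noetherian_scheme :: "('a, 'b) rspace \<Rightarrow> bool" where
  "locally_noetherian_scheme X \<longleftrightarrow> scheme X \<and>
     (\<forall>x \<in> pts X. \<exists>U (R :: 'b ring). opn X U \<and> x \<in> U \<and> cring R \<and> noetherian_ring R \<and>
        lrs_isomorphic (open_sub X U) (Spec R))"

definition open_subscheme :: "('a, 'b) rspace \<Rightarrow> 'a set \<Rightarrow> bool" where
  "open_subscheme X U \<longleftrightarrow> opn X U \<and> scheme (open_sub X U)"

text \<open>The associated points of the structure sheaf.\<close>

definition Ass :: "('a, 'b) rspace \<Rightarrow> 'a set" where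
  "Ass X = {x \<in> pts X. associated_prime (stalk X x) (max_ideal (stalk X x))}"


section \<open>Closed subschemes\<close>

text \<open>A sheaf of ideals \<open>J\<close> is given by its ideals of sections; only the values \<open>J U\<close> for open
  \<open>U\<close> are meaningful.\<close>

definition ideal_sheaf :: "('a, 'b) rspace \<Rightarrow> ('a set \<Rightarrow> 'b set) \<Rightarrow> bool" where
  "ideal_sheaf X J \<longleftrightarrow>
     (\<forall>U. opn X U \<longrightarrow> ideal (J U) (rs_sec X U)) \<and>
     (\<forall>U V. opn X U \<and> opn X V \<and> V \<subseteq> U \<longrightarrow> rs_res X U V ` J U \<subseteq> J V) \<and>
     (\<forall>U. \<forall>s \<in> sec X U. opn X U \<and>
        (\<forall>x \<in> U. \<exists>V. opn X V \<and> x \<in> V \<and> V \<subseteq> U \<and> rs_res X U V s \<in> J V) \<longrightarrow> s \<in> J U)"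

definition stalk_ideal ::
  "('a, 'b) rspace \<Rightarrow> ('a set \<Rightarrow> 'b set) \<Rightarrow> 'a \<Rightarrow> ('a set \<times> 'b) set set"
where
  "stalk_ideal X J x = {germ X x U s |U s. opn X U \<and> x \<in> U \<and> s \<in> J U}"

text \<open>The support of the quotient of the structure sheaf by \<open>J\<close>.\<close>

definition supp :: "('a, 'b) rspace \<Rightarrow> ('a set \<Rightarrow> 'b set) \<Rightarrow> 'a set" where
  "supp X J = {x \<in> pts X. stalk_ideal X J x \<noteq> carrier (stalk X x)}"

text \<open>The ringed space with underlying space \<open>supp X J\<close> and structure sheaf the quotient of the
  structure sheaf of \<open>X\<close> by \<open>J\<close>: sections of this (sheafified) quotient are families of
  elements of its stalks that are locally induced by a section on \<open>X\<close>.\<close>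

abbreviation quot_stalk ::
  "('a, 'b) rspace \<Rightarrow> ('a set \<Rightarrow> 'b set) \<Rightarrow> 'a \<Rightarrow> ('a set \<times> 'b) set set ring"
where
  "quot_stalk X J x \<equiv> stalk X x Quot stalk_ideal X J x"

definition quot_germ ::
  "('a, 'b) rspace \<Rightarrow> ('a set \<Rightarrow> 'b set) \<Rightarrow> 'a \<Rightarrow> 'a set \<Rightarrow> 'b \<Rightarrow> ('a set \<times> 'b) set set"
where
  "quot_germ X J x U s = stalk_ideal X J x +>\<^bsub>stalk X x\<^esub> germ X x U s"

definition quot_sections ::
  "('a, 'b) rspace \<Rightarrow> ('a set \<Rightarrow> 'b set) \<Rightarrow> 'a set \<Rightarrow> ('a \<Rightarrow> ('a set \<times> 'b) set set) set"
where
  "quot_sections X J W = {s \<in> (\<Pi>\<^sub>E x \<in> W. carrier (quot_stalk X J x)).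
     \<forall>x \<in> W. \<exists>U t. opn X U \<and> x \<in> U \<and> U \<inter> supp X J \<subseteq> W \<and> t \<in> sec X U \<and>
       (\<forall>y \<in> U \<inter> supp X J. s y = quot_germ X J y U t)}"

definition closed_sub ::
  "('a, 'b) rspace \<Rightarrow> ('a set \<Rightarrow> 'b set) \<Rightarrow> ('a, 'a \<Rightarrow> ('a set \<times> 'b) set set) rspace"
where
  "closed_sub X J = \<lparr>rs_top = subtopology (rs_top X) (supp X J),
     rs_sec = (\<lambda>W. pointwise_ring W (quot_stalk X J) (quot_sections X J W)),
     rs_res = (\<lambda>U V s. restrict s V)\<rparr>"

definition closed_incl ::
  "('a, 'b) rspace \<Rightarrow> ('a set \<Rightarrow> 'b set) \<Rightarrow> ('a, 'a \<Rightarrow> ('a set \<times> 'b) set set, 'a, 'b) rs_mor"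
where
  "closed_incl X J = \<lparr>mor_pt = (\<lambda>x. x),
     mor_sec = (\<lambda>U t. \<lambda>x \<in> U \<inter> supp X J. quot_germ X J x U t)\<rparr>"

text \<open>A closed subscheme of \<open>X\<close> is given by an ideal sheaf \<open>J\<close> for which the closed subspace
  above is a scheme (which amounts to quasi-coherence of \<open>J\<close>); the subscheme itself is
  \<open>closed_sub X J\<close>, with inclusion \<open>closed_incl X J\<close>.\<close>

definition closed_subscheme :: "('a, 'b) rspace \<Rightarrow> ('a set \<Rightarrow> 'b set) \<Rightarrow> bool" where
  "closed_subscheme X J \<longleftrightarrow> ideal_sheaf X J \<and> scheme (closed_sub X J)"

text \<open>On \<open>U\<close>, the ideal sheaf \<open>J\<close> is the sheaf of ideals generated by the section \<open>f\<close>.\<close>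

definition generated_on ::
  "('a, 'b) rspace \<Rightarrow> ('a set \<Rightarrow> 'b set) \<Rightarrow> 'a set \<Rightarrow> 'b \<Rightarrow> bool"
where
  "generated_on X J U f \<longleftrightarrow> f \<in> J U \<and>
     (\<forall>W s x. opn X W \<and> W \<subseteq> U \<and> s \<in> J W \<and> x \<in> W \<longrightarrow>
        (\<exists>W'. opn X W' \<and> x \<in> W' \<and> W' \<subseteq> W \<and>
           (\<exists>a \<in> sec X W'. rs_res X W W' s = a \<otimes>\<^bsub>rs_sec X W'\<^esub> rs_res X U W' f)))"

definition locally_principal_subscheme :: "('a, 'b) rspace \<Rightarrow> ('a set \<Rightarrow> 'b set) \<Rightarrow> bool" where
  "locally_principal_subscheme X J \<longleftrightarrow> closed_subscheme X J \<and>
     (\<forall>x \<in> pts X. \<exists>U f. opn X U \<and> x \<in> U \<and> generated_on X J U f)"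

text \<open>A section over \<open>U\<close> is regular if multiplication by it is injective as a map of sheaves,
  i.e. on the sections over all open subsets of \<open>U\<close>.\<close>

definition effective_cartier :: "('a, 'b) rspace \<Rightarrow> ('a set \<Rightarrow> 'b set) \<Rightarrow> bool" where
  "effective_cartier X J \<longleftrightarrow> closed_subscheme X J \<and>
     (\<forall>x \<in> pts X. \<exists>U f. opn X U \<and> x \<in> U \<and> generated_on X J U f \<and>
        (\<forall>W. opn X W \<and> W \<subseteq> U \<longrightarrow> regular_element (rs_sec X W) (rs_res X U W f)))"

text \<open>The preimage of the closed subscheme of \<open>X\<close> given by \<open>J\<close> under a morphism \<open>t\<close> from \<open>T\<close> to
  \<open>X\<close>: its ideal sheaf is the inverse image ideal sheaf, i.e. the sheaf of ideals on \<open>T\<close>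
  generated by the pullbacks of the sections of \<open>J\<close>.\<close>

definition preimage_ideal ::
  "('c, 'd) rspace \<Rightarrow> ('a, 'b) rspace \<Rightarrow> ('c, 'd, 'a, 'b) rs_mor \<Rightarrow> ('a set \<Rightarrow> 'b set) \<Rightarrow>
   'c set \<Rightarrow> 'd set"
where
  "preimage_ideal T X t J W = {s \<in> sec T W. \<forall>x \<in> W.
     germ T x W s \<in> Idl\<^bsub>stalk T x\<^esub> (stalk_map T t x ` stalk_ideal X J (mor_pt t x))}"


section \<open>Schematic image and blow up\<close>

text \<open>The closed subscheme of \<open>X\<close> given by \<open>J\<close> is the smallest one through which \<open>f\<close>, from \<open>S\<close>
  to \<open>X\<close>, factors.\<close>

definition schematic_image ::
  "('c, 'd) rspace \<Rightarrow> ('a, 'b) rspace \<Rightarrow> ('c, 'd, 'a, 'b) rs_mor \<Rightarrow> ('a set \<Rightarrow> 'b set) \<Rightarrow> bool"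
where
  "schematic_image S X f J \<longleftrightarrow> closed_subscheme X J \<and>
     factors_through S X f (closed_sub X J) (closed_incl X J) \<and>
     (\<forall>J'. closed_subscheme X J' \<and> factors_through S X f (closed_sub X J') (closed_incl X J') \<longrightarrow>
        factors_through (closed_sub X J) X (closed_incl X J) (closed_sub X J') (closed_incl X J'))"

definition schematic_closure :: "('a, 'b) rspace \<Rightarrow> 'a set \<Rightarrow> ('a set \<Rightarrow> 'b set) \<Rightarrow> bool" where
  "schematic_closure X V J \<longleftrightarrow> schematic_image (open_sub X V) X (open_incl X V) J"

text \<open>\<open>b\<close>, from \<open>B\<close> to \<open>X\<close>, is the blow up of \<open>X\<close> along the closed subscheme given by \<open>J\<close>. Types
  cannot be quantified inside a formula, so the type of the test schemes \<open>T\<close> is a parameter;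
  in theorems it should be instantiated with type variables not occurring elsewhere.\<close>

definition blow_up ::
  "('c, 'd) rspace itself \<Rightarrow> ('a, 'b) rspace \<Rightarrow> ('a set \<Rightarrow> 'b set) \<Rightarrow>
   ('e, 'f) rspace \<Rightarrow> ('e, 'f, 'a, 'b) rs_mor \<Rightarrow> bool"
where
  "blow_up _ X J B b \<longleftrightarrow>
     scheme B \<and> lrs_morphism B X b \<and> effective_cartier B (preimage_ideal B X b J) \<and>
     (\<forall>(T :: ('c, 'd) rspace) t. scheme T \<and> lrs_morphism T X t \<and>
        effective_cartier T (preimage_ideal T X t J) \<longrightarrow>
        (\<exists>g. lrs_morphism T B g \<and> mor_eq T X (mor_comp B b g) t \<and>
           (\<forall>g'. lrs_morphism T B g' \<and> mor_eq T X (mor_comp B b g') t \<longrightarrow> mor_eq T B g' g)))"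

end

theory Submission
  imports Defs "HOL-Algebra.Subrings"
begin

text \<open>
  Locally let \<open>Z\<close> be cut out by \<open>f\<close> in the Noetherian ring \<open>R\<close>. The point \<open>y\<close> lies in \<open>V\<close> iff \<open>f\<close> is
  regular in the local ring at \<open>y\<close>: a maximal annihilator of an element \<open>b\<close> that is killed by \<open>f\<close> and
  is nonzero at \<open>y\<close> is an associated prime containing \<open>f\<close> and specializing to \<open>y\<close>. In particular \<open>V\<close>
  is open, and it contains the locus where \<open>f\<close> is invertible. The schematic closure of \<open>V\<close> is given
  by the ideal sheaf \<open>K\<close> of the sections that vanish on \<open>V\<close>, and a local section \<open>a\<close> is in \<open>K\<close> iff it
  is annihilated by some power of \<open>f\<close>: if \<open>a\<close> vanishes where \<open>f\<close> is invertible then \<open>f ^ n * a = 0\<close> for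
  some \<open>n\<close>, and conversely \<open>f\<close> is regular on \<open>V\<close>. The same description shows that \<open>K\<close> is quasi-coherent and
  that \<open>f\<close> is regular modulo \<open>K\<close>. If \<open>f\<close> becomes regular on a test scheme \<open>T\<close>, then every \<open>a\<close> with
  \<open>f ^ n * a = 0\<close> becomes zero on \<open>T\<close>, hence \<open>T\<close> maps uniquely to the closed subscheme given by \<open>K\<close>.

  Instead of passing to spectra, the argument works on affine charts inside \<open>X\<close>, on which
  sections, germs and points are related by fractions as in a spectrum.
\<close>

section \<open>Commutative rings\<close>

text \<open>Germs on an open subspace, on a closed subspace and on the ambient space are different
  sets, so stalks cannot simply be identified. What they share is which germs are units: local rings
  are recognized by \<open>a\<close> or \<open>\<one> \<ominus> a\<close> being a unit, local
  homomorphisms by reflecting units, and a unit germ is described by sections alone. Spectra and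
  closed subspaces are both sheaves of functions with values in given rings. A morphism into such a
  sheaf is built from homomorphisms of stalks, which reduces factoring through a closed subspace to
  killing its ideal. The ring of a chart need not be the ring of all sections; thus fractions with
  powers of one denominator, and images in a closed subspace, again give charts, and no ring of
  sections over a spectrum is computed. Spectra enter only to extract charts from the hypothesis and
  to return from charts to the definition of a scheme. The Noetherian hypothesis is carried along as
  the maximal condition on ideals. It gives associated points, openness of the regular locus, and
  the primes behind the powers of \<open>f\<close>.\<close>

lemma (in cring) unitI:
  assumes "a \<in> carrier R" "b \<in> carrier R" "a \<otimes> b = \<one>"
  shows "a \<in> Units R"
  using assms m_comm unfolding Units_def by force

lemma (in cring) unit_factors:
  assumes "a \<otimes> b \<in> Units R" "a \<in> carrier R" "b \<in> carrier R"
  shows "a \<in> Units R" "b \<in> Units R"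
  using unit_factor[of a b] unit_factor[of b a] assms by (auto simp: m_comm)

lemma (in cring) unit_eq_zeroD:
  assumes "u \<in> Units R" "a \<in> carrier R" "u \<otimes> a = \<zero>"
  shows "a = \<zero>"
  using assms Units_l_cancel[of u a \<zero>] by (simp add: Units_closed)

lemma (in cring) minus_eq_zeroD:
  assumes "a \<ominus> b = \<zero>" "a \<in> carrier R" "b \<in> carrier R"
  shows "a = b"
  using assms by (simp add: r_right_minus_eq)

lemma (in cring) idealI':
  assumes "I \<subseteq> carrier R" "\<zero> \<in> I"
    and "\<And>a b. a \<in> I \<Longrightarrow> b \<in> I \<Longrightarrow> a \<oplus> b \<in> I"
    and "\<And>a x. a \<in> I \<Longrightarrow> x \<in> carrier R \<Longrightarrow> x \<otimes> a \<in> I"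
  shows "ideal I R"
proof (rule idealI[OF ring_axioms])
  have "\<ominus> a \<in> I" if "a \<in> I" for a
  proof -
    have "(\<ominus> \<one>) \<otimes> a \<in> I" using assms(4)[OF that] by simp
    moreover have "(\<ominus> \<one>) \<otimes> a = \<ominus> a" using that assms(1) l_minus by auto
    ultimately show ?thesis by simp
  qed
  then show "subgroup I (add_monoid R)"
    using assms by (auto intro!: add.subgroupI)
  show "x \<otimes> a \<in> I" if "a \<in> I" "x \<in> carrier R" for a x using assms(4) that by blast
  then show "a \<otimes> x \<in> I" if "a \<in> I" "x \<in> carrier R" for a x
    using that assms(1) m_comm by (metis subsetD)
qed

section \<open>Local rings described by their units\<close>

lemma (in cring) exists_maximalideal:
  assumes I: "ideal I R" and "\<one> \<notin> I"
  shows "\<exists>M. maximalideal M R \<and> I \<subseteq> M"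
proof -
  let ?A = "{J. ideal J R \<and> I \<subseteq> J \<and> \<one> \<notin> J}"
  have "\<exists>M\<in>?A. \<forall>X\<in>?A. M \<subseteq> X \<longrightarrow> X = M"
  proof (rule subset_Zorn_nonempty)
    show "?A \<noteq> {}" using assms by blast
    fix C assume C: "C \<noteq> {}" "subset.chain ?A C"
    have "subset.chain {I. ideal I R} C" using C(2) unfolding pred_on.chain_def by blast
    from chain_Union_is_ideal[OF this] C(1) have "ideal (\<Union>C) R" by simp
    then show "\<Union>C \<in> ?A" using C unfolding pred_on.chain_def by blast
  qed
  then obtain M where "M \<in> ?A" and "\<forall>X\<in>?A. M \<subseteq> X \<longrightarrow> X = M" by (elim bexE)
  then have M: "ideal M R" "I \<subseteq> M" "\<one> \<notin> M"
    and max: "\<And>X. ideal X R \<Longrightarrow> I \<subseteq> X \<Longrightarrow> \<one> \<notin> X \<Longrightarrow> M \<subseteq> X \<Longrightarrow> X = M" by auto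
  have "maximalideal M R"
  proof (rule maximalidealI[OF M(1)])
    show "carrier R \<noteq> M" using M(3) by auto
    show "J = M \<or> J = carrier R" if "ideal J R" "M \<subseteq> J" "J \<subseteq> carrier R" for J
      using max[of J] that M(2) ideal.one_imp_carrier[OF that(1)] by blast
  qed
  with M show ?thesis by blast
qed

text \<open>The criterion speaks of single elements only, so it can be checked on germs, fractions
  and cosets, and it carries over along maps that preserve and reflect units. It makes the nonunits
  an ideal, which then contains every proper ideal.\<close>

lemma (in cring) local_ringI:
  assumes "\<one> \<noteq> \<zero>" "\<And>a. a \<in> carrier R \<Longrightarrow> a \<in> Units R \<or> \<one> \<ominus> a \<in> Units R"
  shows "local_ring R" "max_ideal R = carrier R - Units R" "maximalideal (carrier R - Units R) R"
proof -
  let ?M = "carrier R - Units R"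
  have "ideal ?M R"
  proof (rule idealI')
    show "\<zero> \<in> ?M" using assms(1) unfolding Units_def by auto
    fix a b assume ab: "a \<in> ?M" "b \<in> ?M"
    show "a \<oplus> b \<in> ?M"
    proof (rule ccontr)
      assume "a \<oplus> b \<notin> ?M"
      then have u: "a \<oplus> b \<in> Units R" using ab by auto
      define w where "w = inv (a \<oplus> b)"
      have w: "w \<in> carrier R" "w \<otimes> (a \<oplus> b) = \<one>" using u by (auto simp: w_def)
      \<comment> \<open>With \<open>w\<close> the inverse of \<open>a \<oplus> b\<close>, the
        products \<open>w \<otimes> a\<close> and \<open>w \<otimes> b\<close> add up to
        \<open>\<one>\<close>, so one of them is a unit, and with it \<open>a\<close> or
        \<open>b\<close>.\<close>
      have "\<one> \<ominus> w \<otimes> a = w \<otimes> b"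
      proof -
        have e: "w \<otimes> a \<oplus> w \<otimes> b = \<one>" using w ab by (simp add: r_distr)
        have "(w \<otimes> a \<oplus> w \<otimes> b) \<ominus> w \<otimes> a = w \<otimes> b"
          using w(1) ab(1)[THEN DiffD1] ab(2)[THEN DiffD1] by algebra
        then show ?thesis by (simp only: e)
      qed
      then have "w \<otimes> a \<in> Units R \<or> w \<otimes> b \<in> Units R" using assms(2)[of "w \<otimes> a"] w ab by auto
      then show False using unit_factors w ab by blast
    qed
  next
    fix a x assume "a \<in> ?M" "x \<in> carrier R"
    then show "x \<otimes> a \<in> ?M" using unit_factors by blast
  qed auto
  have sub: "J \<subseteq> ?M" if "ideal J R" "J \<noteq> carrier R" for J
  proof
    fix a assume "a \<in> J"
    then have "a \<in> carrier R" using ideal.Icarr[OF that(1)] by auto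
    moreover have "a \<notin> Units R"
    proof
      assume "a \<in> Units R"
      then have "inv a \<otimes> a \<in> J" using ideal.I_l_closed[OF that(1) \<open>a \<in> J\<close>, of "inv a"] by auto
      then show False using ideal.one_imp_carrier[OF that(1)] that(2) \<open>a \<in> Units R\<close> by auto
    qed
    ultimately show "a \<in> ?M" by auto
  qed
  show max: "maximalideal ?M R"
  proof (rule maximalidealI[OF \<open>ideal ?M R\<close>])
    show "carrier R \<noteq> ?M" using Units_one_closed by blast
  qed (use sub in auto)
  moreover have uniq: "N = ?M" if "maximalideal N R" for N
  proof -
    have N: "ideal N R" "carrier R \<noteq> N" using maximalideal.axioms(1)[OF that] maximalideal.I_notcarr[OF that] by auto
    then have "?M = N \<or> ?M = carrier R"
      using maximalideal.I_maximal[OF that \<open>ideal ?M R\<close>] sub[of N] by auto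
    then show ?thesis using Units_one_closed by blast
  qed
  ultimately show "local_ring R" unfolding local_ring_def using is_cring by (auto intro!: ex1I[of _ ?M])
  show "max_ideal R = ?M" unfolding max_ideal_def using max uniq by (rule the_equality)
qed

text \<open>The converse of the criterion: a nonunit generates a proper ideal and so lies in the
  only maximal ideal \<open>M\<close>; if \<open>a\<close> and \<open>\<one> \<ominus> a\<close>
  were both nonunits, their sum \<open>\<one>\<close> would lie in \<open>M\<close>.\<close>

lemma local_ringD:
  fixes R (structure)
  assumes "local_ring R"
  shows "cring R" "\<one> \<noteq> \<zero>"
    "\<And>a. a \<in> carrier R \<Longrightarrow> a \<in> Units R \<or> \<one> \<ominus> a \<in> Units R"
    "max_ideal R = carrier R - Units R" "maximalideal (carrier R - Units R) R"
proof -
  show "cring R" using assms by (auto simp: local_ring_def)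
  then interpret cring R .
  obtain M where M: "maximalideal M R" and uniq: "\<And>N. maximalideal N R \<Longrightarrow> N = M"
    using assms by (auto simp: local_ring_def)
  interpret M: maximalideal M R by (rule M)
  show 1: "\<one> \<noteq> \<zero>"
    using M.I_notcarr M.zero_closed M.one_imp_carrier by auto
  show 2: "a \<in> Units R \<or> \<one> \<ominus> a \<in> Units R" if a: "a \<in> carrier R" for a
  proof (rule ccontr)
    assume n: "\<not> ?thesis"
    have mem: "b \<in> M" if b: "b \<in> carrier R" "b \<notin> Units R" for b
    proof -
      have "\<one> \<notin> PIdl b"
      proof
        assume "\<one> \<in> PIdl b"
        then obtain x where "x \<in> carrier R" "\<one> = x \<otimes> b" unfolding cgenideal_def by blast
        then show False using b unitI[of b x] by (simp add: m_comm)
      qed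
      then obtain N where "maximalideal N R" "PIdl b \<subseteq> N"
        using exists_maximalideal[OF cgenideal_ideal[OF b(1)]] by blast
      then show ?thesis using uniq cgenideal_self[OF b(1)] by blast
    qed
    have "a \<oplus> (\<one> \<ominus> a) \<in> M" using M.a_closed[OF mem mem] n a by auto
    moreover have "a \<oplus> (\<one> \<ominus> a) = \<one>" using a by algebra
    ultimately show False using M.one_imp_carrier M.I_notcarr by auto
  qed
  from local_ringI[OF 1 2] show "max_ideal R = carrier R - Units R" "maximalideal (carrier R - Units R) R" by auto
qed

lemma ring_hom_cring_lemmas:
  assumes "h \<in> ring_hom A B" "cring A" "cring B"
  shows ring_hom_zero': "h \<zero>\<^bsub>A\<^esub> = \<zero>\<^bsub>B\<^esub>"
    and ring_hom_uminus': "a \<in> carrier A \<Longrightarrow> h (\<ominus>\<^bsub>A\<^esub> a) = \<ominus>\<^bsub>B\<^esub> h a"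
    and ring_hom_minus': "a \<in> carrier A \<Longrightarrow> b \<in> carrier A \<Longrightarrow> h (a \<ominus>\<^bsub>A\<^esub> b) = h a \<ominus>\<^bsub>B\<^esub> h b"
    and ring_hom_Units': "a \<in> Units A \<Longrightarrow> h a \<in> Units B"
    and ring_hom_pow': "a \<in> carrier A \<Longrightarrow> h (a [^]\<^bsub>A\<^esub> (n::nat)) = h a [^]\<^bsub>B\<^esub> n"
proof -
  interpret A: cring A by fact
  interpret B: cring B by fact
  interpret ring_hom_cring A B h
    using assms(1) by (intro ring_hom_cring.intro ring_hom_cring_axioms.intro assms)
  show "h \<zero>\<^bsub>A\<^esub> = \<zero>\<^bsub>B\<^esub>" "a \<in> carrier A \<Longrightarrow> h (\<ominus>\<^bsub>A\<^esub> a) = \<ominus>\<^bsub>B\<^esub> h a" by simp_all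
  then show "a \<in> carrier A \<Longrightarrow> b \<in> carrier A \<Longrightarrow> h (a \<ominus>\<^bsub>A\<^esub> b) = h a \<ominus>\<^bsub>B\<^esub> h b"
    by (simp add: a_minus_def)
  show "h a \<in> Units B" if "a \<in> Units A"
  proof (rule B.unitI)
    show "h a \<otimes>\<^bsub>B\<^esub> h (inv\<^bsub>A\<^esub> a) = \<one>\<^bsub>B\<^esub>"
      using that by (simp add: A.Units_closed flip: hom_mult)
  qed (use that in \<open>auto\<close>)
  show "a \<in> carrier A \<Longrightarrow> h (a [^]\<^bsub>A\<^esub> n) = h a [^]\<^bsub>B\<^esub> n" by (rule ring.hom_nat_pow)
qed

text \<open>The Noetherian condition in the form in which it is used, for families of annihilators
  and of ideals avoiding powers. It is transferred by merely comparing ideals with their preimages,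
  which serves homomorphic images and localizations alike.\<close>

definition max_cond :: "('a, 'm) ring_scheme \<Rightarrow> bool" where
  "max_cond R \<longleftrightarrow> (\<forall>F. F \<noteq> {} \<and> (\<forall>I \<in> F. ideal I R) \<longrightarrow> (\<exists>M \<in> F. \<forall>I \<in> F. M \<subseteq> I \<longrightarrow> I = M))"

lemma max_condD:
  assumes "max_cond R" "I \<in> F" "\<And>I. I \<in> F \<Longrightarrow> ideal I R"
  obtains M where "M \<in> F" "\<And>I. I \<in> F \<Longrightarrow> M \<subseteq> I \<Longrightarrow> I = M"
proof -
  have "\<exists>M\<in>F. \<forall>I\<in>F. M \<subseteq> I \<longrightarrow> I = M"
    using assms(1)[unfolded max_cond_def, rule_format, of F] assms(2,3) by auto
  then show thesis using that by (elim bexE) auto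
qed

text \<open>Every nonempty chain of ideals contains its own union, so Zorn's lemma applies within an
  arbitrary family.\<close>

lemma (in noetherian_ring) max_cond: "max_cond R"
  unfolding max_cond_def
proof (intro allI impI)
  fix F assume F: "F \<noteq> {} \<and> (\<forall>I\<in>F. ideal I R)"
  show "\<exists>M\<in>F. \<forall>I\<in>F. M \<subseteq> I \<longrightarrow> I = M"
  proof (rule subset_Zorn_nonempty)
    fix C assume C: "C \<noteq> {}" "subset.chain F C"
    then have "subset.chain {I. ideal I R} C" using F unfolding pred_on.chain_def by blast
    from ideal_chain_is_trivial[OF C(1) this] show "\<Union>C \<in> F" using C unfolding pred_on.chain_def by blast
  qed (use F in auto)
qed

text \<open>An ideal that is maximal among those containing \<open>I\<close> and no power of
  \<open>g\<close> is prime. In a chart this yields a point at which \<open>g\<close> is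
  invertible.\<close>

lemma (in cring) exists_primeideal_avoiding:
  assumes "max_cond R" and I: "ideal I R" and g: "g \<in> carrier R" "\<And>n::nat. g [^] n \<notin> I"
  obtains P where "primeideal P R" "I \<subseteq> P" "g \<notin> P"
proof -
  let ?F = "{J. ideal J R \<and> I \<subseteq> J \<and> (\<forall>n::nat. g [^] n \<notin> J)}"
  obtain P where P: "P \<in> ?F" and max: "\<And>J. J \<in> ?F \<Longrightarrow> P \<subseteq> J \<Longrightarrow> J = P"
    by (rule max_condD[OF assms(1), of I ?F]) (use assms in auto)
  interpret P: ideal P R using P by auto
  \<comment> \<open>If \<open>b\<close> lies outside \<open>P\<close>, the ideal of all
    \<open>x\<close> with \<open>a \<otimes> x \<in> P\<close> is strictly larger than
    \<open>P\<close>, so by maximality it contains a power of \<open>g\<close>.\<close>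
  have step: "\<exists>n::nat. a \<otimes> g [^] n \<in> P"
    if ab: "a \<in> carrier R" "b \<in> carrier R" "a \<otimes> b \<in> P" "b \<notin> P" for a b
  proof (rule ccontr)
    assume n: "\<not> ?thesis"
    let ?J = "{x \<in> carrier R. a \<otimes> x \<in> P}"
    have "ideal ?J R" using P.helper_max_prime[OF is_cring ab(1)] .
    moreover have "P \<subseteq> ?J" using P.I_l_closed ab(1) P.Icarr by auto
    ultimately have "?J = P" using max[of ?J] n P by blast
    then show False using ab by auto
  qed
  have "primeideal P R"
  proof (rule primeidealI[OF P.is_ideal is_cring])
    have "\<one> \<notin> P" using P nat_pow_0 by (metis (mono_tags, lifting) mem_Collect_eq)
    then show "carrier R \<noteq> P" by auto
    fix a b assume ab: "a \<in> carrier R" "b \<in> carrier R" "a \<otimes> b \<in> P"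
    show "a \<in> P \<or> b \<in> P"
    proof (rule ccontr)
      assume n: "\<not> ?thesis"
      \<comment> \<open>The step is used twice: once to trade \<open>b\<close> for a power of
        \<open>g\<close>, and once, with that power as first factor, to trade \<open>a\<close> for a
        second power.\<close>
      then obtain n :: nat where n': "a \<otimes> g [^] n \<in> P" using step[of a b] ab by blast
      then obtain m :: nat where "g [^] n \<otimes> g [^] m \<in> P"
        using step[of "g [^] n" a] ab g n by (auto simp: m_comm)
      then have "g [^] (n + m) \<in> P" using g by (simp add: nat_pow_mult)
      then show False using P by blast
    qed
  qed
  moreover have "g \<notin> P" using P g(1) nat_pow_eone by (metis (mono_tags, lifting) mem_Collect_eq)
  ultimately show thesis using that P by blast
qed

section \<open>Localization\<close>

text \<open>Products and sums in localizations and stalks are unions over all representatives. If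
  every pair of representatives gives the same set \<open>c\<close>, the union is \<open>c\<close>,
  provided that it is not empty; hence the two given members.\<close>

lemma UN_pairs_eq:
  assumes "\<And>a s b t. (a, s) \<in> x \<Longrightarrow> (b, t) \<in> y \<Longrightarrow> F a s b t = c" "(a', s') \<in> x" "(b', t') \<in> y"
  shows "(\<Union>(a, s) \<in> x. \<Union>(b, t) \<in> y. F a s b t) = c"
proof -
  have "(\<Union>(b, t) \<in> y. F a s b t) = c" if "(a, s) \<in> x" for a s
    by (rule SUP_eq_const) (use assms(1)[OF that] assms(3) in auto)
  then have "(case p of (a, s) \<Rightarrow> \<Union>(b, t) \<in> y. F a s b t) = c" if "p \<in> x" for p
    using that by (cases p) (simp only: prod.case)
  then show ?thesis using assms(2) by (intro SUP_eq_const) auto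
qed

locale mult_subset = cring R for R (structure) +
  fixes S
  assumes S_sub: "S \<subseteq> carrier R" and S_one [simp]: "\<one> \<in> S"
    and S_mult [simp]: "\<And>s t. s \<in> S \<Longrightarrow> t \<in> S \<Longrightarrow> s \<otimes> t \<in> S"
begin

lemma S_carrier [simp, intro]: "s \<in> S \<Longrightarrow> s \<in> carrier R"
  using S_sub by blast

text \<open>Transitivity of the relation between fractions: the multiplier for the composite is the
  product of both multipliers and the denominator \<open>s\<close> of the middle fraction.\<close>

lemma fraction_eqI:
  assumes c: "a \<in> carrier R" "b \<in> carrier R" "s \<in> S" "t \<in> S"
    and u: "u \<in> S" "u \<otimes> (t \<otimes> a) = u \<otimes> (s \<otimes> b)"
  shows "fraction R S a s \<subseteq> fraction R S b t"
proof
  fix x assume "x \<in> fraction R S a s"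
  then obtain c r v where x: "x = (c, r)" "c \<in> carrier R" "r \<in> S" "v \<in> S" "v \<otimes> (r \<otimes> a) = v \<otimes> (s \<otimes> c)"
    by (auto simp: fraction_def)
  have "(v \<otimes> u \<otimes> s) \<otimes> (r \<otimes> b) = (v \<otimes> r) \<otimes> (u \<otimes> (s \<otimes> b))"
    using x(2-4) c u(1) S_sub by (simp add: m_ac S_carrier)
  also have "\<dots> = (v \<otimes> r) \<otimes> (u \<otimes> (t \<otimes> a))" using u by simp
  also have "\<dots> = (u \<otimes> t) \<otimes> (v \<otimes> (r \<otimes> a))"
    using x(2-4) c u(1) by (simp add: m_ac)
  also have "\<dots> = (u \<otimes> t) \<otimes> (v \<otimes> (s \<otimes> c))" using x by simp
  also have "\<dots> = (v \<otimes> u \<otimes> s) \<otimes> (t \<otimes> c)"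
    using x(2-4) c u(1) by (simp add: m_ac)
  finally show "x \<in> fraction R S b t"
    using x c u by (auto simp: fraction_def intro!: bexI[of _ "v \<otimes> u \<otimes> s"])
qed

lemma fraction_self: "a \<in> carrier R \<Longrightarrow> s \<in> S \<Longrightarrow> (a, s) \<in> fraction R S a s"
  using S_one by (auto simp: fraction_def intro!: bexI[of _ \<one>])

lemma fraction_eq_iff:
  assumes c: "a \<in> carrier R" "b \<in> carrier R" "s \<in> S" "t \<in> S"
  shows "fraction R S a s = fraction R S b t \<longleftrightarrow> (\<exists>u\<in>S. u \<otimes> (t \<otimes> a) = u \<otimes> (s \<otimes> b))"
proof
  assume "fraction R S a s = fraction R S b t"
  then have "(b, t) \<in> fraction R S a s" using fraction_self c by simp
  then show "\<exists>u\<in>S. u \<otimes> (t \<otimes> a) = u \<otimes> (s \<otimes> b)" by (auto simp: fraction_def)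
next
  assume "\<exists>u\<in>S. u \<otimes> (t \<otimes> a) = u \<otimes> (s \<otimes> b)"
  then show "fraction R S a s = fraction R S b t" using fraction_eqI c by (metis subset_antisym)
qed

lemma fraction_eqI':
  assumes "a \<in> carrier R" "b \<in> carrier R" "s \<in> S" "t \<in> S" "t \<otimes> a = s \<otimes> b"
  shows "fraction R S a s = fraction R S b t"
  using assms by (auto simp: fraction_eq_iff intro!: bexI[of _ \<one>])

lemma fraction_memD:
  assumes "(b, t) \<in> fraction R S a s" "a \<in> carrier R" "s \<in> S"
  shows "b \<in> carrier R" "t \<in> S" "fraction R S b t = fraction R S a s"
proof -
  show bt: "b \<in> carrier R" "t \<in> S" using assms(1) by (auto simp: fraction_def)
  obtain u where "u \<in> S" "u \<otimes> (t \<otimes> a) = u \<otimes> (s \<otimes> b)" using assms(1) by (auto simp: fraction_def)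
  then show "fraction R S b t = fraction R S a s"
    using bt assms(2,3) by (subst fraction_eq_iff) (auto intro!: bexI[of _ u])
qed

lemma loc_carrierE:
  assumes "x \<in> carrier (localization R S)"
  obtains a s where "a \<in> carrier R" "s \<in> S" "x = fraction R S a s"
  using assms by (auto simp: localization_def)

lemma loc_carrierI [simp]: "a \<in> carrier R \<Longrightarrow> s \<in> S \<Longrightarrow> fraction R S a s \<in> carrier (localization R S)"
  by (auto simp: localization_def)

lemma loc_mult [simp]:
  assumes c: "a \<in> carrier R" "b \<in> carrier R" "s \<in> S" "t \<in> S"
  shows "fraction R S a s \<otimes>\<^bsub>localization R S\<^esub> fraction R S b t = fraction R S (a \<otimes> b) (s \<otimes> t)"
proof -
  have eq: "fraction R S (a' \<otimes> b') (s' \<otimes> t') = fraction R S (a \<otimes> b) (s \<otimes> t)"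
    if m: "(a', s') \<in> fraction R S a s" "(b', t') \<in> fraction R S b t" for a' s' b' t'
  proof -
    note m1 = fraction_memD[OF m(1) c(1,3)] and m2 = fraction_memD[OF m(2) c(2,4)]
    obtain u where u: "u \<in> S" "u \<otimes> (s \<otimes> a') = u \<otimes> (s' \<otimes> a)"
      using m1 fraction_eq_iff c by blast
    obtain v where v: "v \<in> S" "v \<otimes> (t \<otimes> b') = v \<otimes> (t' \<otimes> b)"
      using m2 fraction_eq_iff c by blast
    have "(u \<otimes> v) \<otimes> ((s \<otimes> t) \<otimes> (a' \<otimes> b')) = (u \<otimes> (s \<otimes> a')) \<otimes> (v \<otimes> (t \<otimes> b'))"
      using c m1 m2 u(1) v(1) by (simp add: m_ac)
    also have "\<dots> = (u \<otimes> (s' \<otimes> a)) \<otimes> (v \<otimes> (t' \<otimes> b))" using u v by simp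
    also have "\<dots> = (u \<otimes> v) \<otimes> ((s' \<otimes> t') \<otimes> (a \<otimes> b))"
      using c m1 m2 u(1) v(1) by (simp add: m_ac)
    finally show ?thesis
      using c m1(1,2) m2(1,2) u(1) v(1) by (subst fraction_eq_iff) (auto intro!: bexI[of _ "u \<otimes> v"])
  qed
  then show ?thesis
    unfolding localization_def monoid.simps by (rule UN_pairs_eq) (use fraction_self c in auto)
qed

lemma loc_add [simp]:
  assumes c: "a \<in> carrier R" "b \<in> carrier R" "s \<in> S" "t \<in> S"
  shows "fraction R S a s \<oplus>\<^bsub>localization R S\<^esub> fraction R S b t = fraction R S (a \<otimes> t \<oplus> b \<otimes> s) (s \<otimes> t)"
proof -
  have eq: "fraction R S (a' \<otimes> t' \<oplus> b' \<otimes> s') (s' \<otimes> t') = fraction R S (a \<otimes> t \<oplus> b \<otimes> s) (s \<otimes> t)"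
    if m: "(a', s') \<in> fraction R S a s" "(b', t') \<in> fraction R S b t" for a' s' b' t'
  proof -
    note m1 = fraction_memD[OF m(1) c(1,3)] and m2 = fraction_memD[OF m(2) c(2,4)]
    note m = m1(1,2) m2(1,2)
    obtain u where u: "u \<in> S" "u \<otimes> (s \<otimes> a') = u \<otimes> (s' \<otimes> a)"
      using m1 fraction_eq_iff c by blast
    obtain v where v: "v \<in> S" "v \<otimes> (t \<otimes> b') = v \<otimes> (t' \<otimes> b)"
      using m2 fraction_eq_iff c by blast
    have "(u \<otimes> v) \<otimes> ((s \<otimes> t) \<otimes> (a' \<otimes> t' \<oplus> b' \<otimes> s'))
        = (u \<otimes> (s \<otimes> a')) \<otimes> (v \<otimes> t \<otimes> t') \<oplus> (v \<otimes> (t \<otimes> b')) \<otimes> (u \<otimes> s \<otimes> s')"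
      using c m u(1) v(1) by (simp add: m_ac r_distr)
    also have "\<dots> = (u \<otimes> (s' \<otimes> a)) \<otimes> (v \<otimes> t \<otimes> t') \<oplus> (v \<otimes> (t' \<otimes> b)) \<otimes> (u \<otimes> s \<otimes> s')" using u v by simp
    also have "\<dots> = (u \<otimes> v) \<otimes> ((s' \<otimes> t') \<otimes> (a \<otimes> t \<oplus> b \<otimes> s))"
      using c m u(1) v(1) by (simp add: m_ac r_distr)
    finally show ?thesis
      using c m u(1) v(1) by (subst fraction_eq_iff) (auto intro!: bexI[of _ "u \<otimes> v"])
  qed
  then show ?thesis
    unfolding localization_def ring.simps by (rule UN_pairs_eq) (use fraction_self c in auto)
qed

lemma loc_one: "\<one>\<^bsub>localization R S\<^esub> = fraction R S \<one> \<one>"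
  and loc_zero: "\<zero>\<^bsub>localization R S\<^esub> = fraction R S \<zero> \<one>"
  by (auto simp: localization_def)

lemma loc_eq_zero_iff:
  assumes "a \<in> carrier R" "s \<in> S"
  shows "fraction R S a s = \<zero>\<^bsub>localization R S\<^esub> \<longleftrightarrow> (\<exists>u\<in>S. u \<otimes> a = \<zero>)"
  using assms by (auto simp: loc_zero fraction_eq_iff)

lemma loc_cring: "cring (localization R S)"
proof (rule cringI)
  show "abelian_group (localization R S)"
  proof (rule abelian_groupI)
    fix x y z assume "x \<in> carrier (localization R S)" "y \<in> carrier (localization R S)" "z \<in> carrier (localization R S)"
    then show "(x \<oplus>\<^bsub>localization R S\<^esub> y) \<oplus>\<^bsub>localization R S\<^esub> z = x \<oplus>\<^bsub>localization R S\<^esub> (y \<oplus>\<^bsub>localization R S\<^esub> z)"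
      by (elim loc_carrierE) (auto intro!: fraction_eqI' simp: m_ac r_distr a_ac)
  next
    fix x y assume "x \<in> carrier (localization R S)" "y \<in> carrier (localization R S)"
    then show "x \<oplus>\<^bsub>localization R S\<^esub> y \<in> carrier (localization R S)" 
      "x \<oplus>\<^bsub>localization R S\<^esub> y = y \<oplus>\<^bsub>localization R S\<^esub> x"
      by (elim loc_carrierE; force intro!: fraction_eqI' simp: m_ac r_distr a_ac)+
  next
    fix x assume x: "x \<in> carrier (localization R S)"
    then show "\<zero>\<^bsub>localization R S\<^esub> \<oplus>\<^bsub>localization R S\<^esub> x = x" 
      by (elim loc_carrierE) (simp add: loc_zero)
    from x obtain a s where "a \<in> carrier R" "s \<in> S" "x = fraction R S a s" by (elim loc_carrierE)
    then show "\<exists>y\<in>carrier (localization R S). y \<oplus>\<^bsub>localization R S\<^esub> x = \<zero>\<^bsub>localization R S\<^esub>"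
      by (intro bexI[of _ "fraction R S (\<ominus> a) s"])
        (simp_all add: loc_zero l_minus l_neg, rule fraction_eqI', auto)
  qed (simp add: loc_zero)
  show "comm_monoid (localization R S)"
    by (rule comm_monoidI; (elim loc_carrierE)?) (auto simp: loc_one m_ac)
  fix x y z assume "x \<in> carrier (localization R S)" "y \<in> carrier (localization R S)" "z \<in> carrier (localization R S)"
  then show "(x \<oplus>\<^bsub>localization R S\<^esub> y) \<otimes>\<^bsub>localization R S\<^esub> z
     = x \<otimes>\<^bsub>localization R S\<^esub> z \<oplus>\<^bsub>localization R S\<^esub> y \<otimes>\<^bsub>localization R S\<^esub> z"
    by (elim loc_carrierE) (simp, rule fraction_eqI', auto simp: m_ac r_distr l_distr a_ac)
qed

text \<open>The universal property of the localization. The value on \<open>a / s\<close> is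
  characterized by its product with \<open>\<phi> s\<close>, so that later uses need no inverses in
  \<open>A\<close>.\<close>

lemma loc_lift:
  assumes A: "cring A" and \<phi>: "\<phi> \<in> ring_hom R A" and unit: "\<And>s. s \<in> S \<Longrightarrow> \<phi> s \<in> Units A"
  obtains \<mu> where "\<mu> \<in> ring_hom (localization R S) A"
    "\<And>a s. a \<in> carrier R \<Longrightarrow> s \<in> S \<Longrightarrow> \<phi> s \<otimes>\<^bsub>A\<^esub> \<mu> (fraction R S a s) = \<phi> a"
proof -
  interpret A: cring A by (rule A)
  define v where "v = (\<lambda>(a, s). inv\<^bsub>A\<^esub> (\<phi> s) \<otimes>\<^bsub>A\<^esub> \<phi> a)"
  note \<phi>s = ring_hom_closed[OF \<phi>] ring_hom_mult[OF \<phi>] ring_hom_add[OF \<phi>] ring_hom_one[OF \<phi>]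
  have v_closed: "v (a, s) \<in> carrier A" if "a \<in> carrier R" "s \<in> S" for a s
    using that unit \<phi>s by (auto simp: v_def)
  have v1: "\<phi> s \<otimes>\<^bsub>A\<^esub> v (a, s) = \<phi> a" if "a \<in> carrier R" "s \<in> S" for a s
    using that unit[of s] \<phi>s by (simp add: v_def flip: A.m_assoc)
  have v_eqI: "v (a, s) = z" if "a \<in> carrier R" "s \<in> S" "z \<in> carrier A" "\<phi> s \<otimes>\<^bsub>A\<^esub> z = \<phi> a" for a s z
    using that v1[OF that(1,2)] A.Units_l_cancel[OF unit[OF that(2)] v_closed[OF that(1,2)] that(3)] by simp
  have v_eq: "v (b, t) = v (a, s)" if bt: "(b, t) \<in> fraction R S a s" and "a \<in> carrier R" "s \<in> S" for a b s t
  proof -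
    note b = fraction_memD[OF that]
    obtain u where u: "u \<in> S" "u \<otimes> (t \<otimes> a) = u \<otimes> (s \<otimes> b)"
      using bt by (auto simp: fraction_def)
    have "\<phi> u \<otimes>\<^bsub>A\<^esub> (\<phi> t \<otimes>\<^bsub>A\<^esub> \<phi> a) = \<phi> u \<otimes>\<^bsub>A\<^esub> (\<phi> s \<otimes>\<^bsub>A\<^esub> \<phi> b)"
      using arg_cong[OF u(2), of \<phi>] u(1) that b by (simp add: \<phi>s)
    then have "\<phi> t \<otimes>\<^bsub>A\<^esub> \<phi> a = \<phi> s \<otimes>\<^bsub>A\<^esub> \<phi> b"
      using unit[OF u(1)] that b by (simp add: \<phi>s)
    then have "\<phi> s \<otimes>\<^bsub>A\<^esub> (\<phi> t \<otimes>\<^bsub>A\<^esub> v (a, s)) = \<phi> s \<otimes>\<^bsub>A\<^esub> \<phi> b"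
      using v1[OF that(2,3)] v_closed[OF that(2,3)] b that A.m_lcomm[of "\<phi> s" "\<phi> t" "v (a, s)"]
      by (simp add: \<phi>s)
    then have "\<phi> t \<otimes>\<^bsub>A\<^esub> v (a, s) = \<phi> b"
      using unit[OF that(3)] b that v_closed[OF that(2,3)] by (simp add: \<phi>s)
    then show ?thesis using v_eqI[OF b(1,2) v_closed[OF that(2,3)]] by simp
  qed
  define \<mu> where "\<mu> x = v (SOME p. p \<in> x)" for x
  have \<mu>: "\<mu> (fraction R S a s) = v (a, s)" if "a \<in> carrier R" "s \<in> S" for a s
    unfolding \<mu>_def using v_eq[OF _ that] someI[of "\<lambda>p. p \<in> fraction R S a s", OF fraction_self[OF that]]
    by (metis surj_pair)
  have "\<mu> \<in> ring_hom (localization R S) A"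
  proof (rule ring_hom_memI)
    show "\<mu> x \<in> carrier A" if "x \<in> carrier (localization R S)" for x
      using that by (elim loc_carrierE) (simp add: \<mu> v_closed)
    show "\<mu> \<one>\<^bsub>localization R S\<^esub> = \<one>\<^bsub>A\<^esub>" unfolding loc_one by (simp add: \<mu>) (rule v_eqI; simp add: \<phi>s)
    fix x y assume "x \<in> carrier (localization R S)" "y \<in> carrier (localization R S)"
    then obtain a s b t where xy: "a \<in> carrier R" "s \<in> S" "x = fraction R S a s"
      "b \<in> carrier R" "t \<in> S" "y = fraction R S b t" by (metis loc_carrierE)
    note v' = v1[OF xy(1,2)] v1[OF xy(4,5)] v_closed[OF xy(1,2)] v_closed[OF xy(4,5)]
    have "v (a \<otimes> b, s \<otimes> t) = v (a, s) \<otimes>\<^bsub>A\<^esub> v (b, t)"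
    proof (rule v_eqI)
      have "\<phi> (s \<otimes> t) \<otimes>\<^bsub>A\<^esub> (v (a, s) \<otimes>\<^bsub>A\<^esub> v (b, t)) = (\<phi> s \<otimes>\<^bsub>A\<^esub> v (a, s)) \<otimes>\<^bsub>A\<^esub> (\<phi> t \<otimes>\<^bsub>A\<^esub> v (b, t))"
        using xy v'(3,4) by (simp add: \<phi>s A.m_ac)
      then show "\<phi> (s \<otimes> t) \<otimes>\<^bsub>A\<^esub> (v (a, s) \<otimes>\<^bsub>A\<^esub> v (b, t)) = \<phi> (a \<otimes> b)" using xy v' by (simp add: \<phi>s)
    qed (use xy v' in auto)
    then show "\<mu> (x \<otimes>\<^bsub>localization R S\<^esub> y) = \<mu> x \<otimes>\<^bsub>A\<^esub> \<mu> y" using xy by (simp add: \<mu>)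
    have "v (a \<otimes> t \<oplus> b \<otimes> s, s \<otimes> t) = v (a, s) \<oplus>\<^bsub>A\<^esub> v (b, t)"
    proof (rule v_eqI)
      have "\<phi> (s \<otimes> t) \<otimes>\<^bsub>A\<^esub> (v (a, s) \<oplus>\<^bsub>A\<^esub> v (b, t))
        = (\<phi> s \<otimes>\<^bsub>A\<^esub> v (a, s)) \<otimes>\<^bsub>A\<^esub> \<phi> t \<oplus>\<^bsub>A\<^esub> (\<phi> t \<otimes>\<^bsub>A\<^esub> v (b, t)) \<otimes>\<^bsub>A\<^esub> \<phi> s"
        using xy v'(3,4) by (simp add: \<phi>s A.m_ac A.r_distr)
      then show "\<phi> (s \<otimes> t) \<otimes>\<^bsub>A\<^esub> (v (a, s) \<oplus>\<^bsub>A\<^esub> v (b, t)) = \<phi> (a \<otimes> t \<oplus> b \<otimes> s)" using xy v' by (simp add: \<phi>s)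
    qed (use xy v' in auto)
    then show "\<mu> (x \<oplus>\<^bsub>localization R S\<^esub> y) = \<mu> x \<oplus>\<^bsub>A\<^esub> \<mu> y" using xy by (simp add: \<mu>)
  qed
  moreover have "\<phi> s \<otimes>\<^bsub>A\<^esub> \<mu> (fraction R S a s) = \<phi> a" if "a \<in> carrier R" "s \<in> S" for a s
    using that by (simp add: \<mu> v1)
  ultimately show thesis using that by blast
qed

text \<open>Recognizes \<open>A\<close> as the localization: \<open>surj\<close> says that every
  element is a fraction, \<open>inj\<close> that only elements killed by some member of
  \<open>S\<close> become zero.\<close>

lemma loc_iso:
  assumes A: "cring A" and \<phi>: "\<phi> \<in> ring_hom R A" and unit: "\<And>s. s \<in> S \<Longrightarrow> \<phi> s \<in> Units A"
    and surj: "\<And>z. z \<in> carrier A \<Longrightarrow> \<exists>a\<in>carrier R. \<exists>s\<in>S. \<phi> s \<otimes>\<^bsub>A\<^esub> z = \<phi> a"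
    and inj: "\<And>a. a \<in> carrier R \<Longrightarrow> \<phi> a = \<zero>\<^bsub>A\<^esub> \<Longrightarrow> \<exists>s\<in>S. s \<otimes> a = \<zero>"
  obtains \<mu> where "\<mu> \<in> ring_hom (localization R S) A"
    "bij_betw \<mu> (carrier (localization R S)) (carrier A)"
    "\<And>a s. a \<in> carrier R \<Longrightarrow> s \<in> S \<Longrightarrow> \<phi> s \<otimes>\<^bsub>A\<^esub> \<mu> (fraction R S a s) = \<phi> a"
proof -
  interpret A: cring A by (rule A)
  interpret L: cring "localization R S" by (rule loc_cring)
  obtain \<mu> where \<mu>: "\<mu> \<in> ring_hom (localization R S) A"
    and eq: "\<And>a s. a \<in> carrier R \<Longrightarrow> s \<in> S \<Longrightarrow> \<phi> s \<otimes>\<^bsub>A\<^esub> \<mu> (fraction R S a s) = \<phi> a"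
    using loc_lift[OF assms(1-3)] by blast
  have ker: "x = \<zero>\<^bsub>localization R S\<^esub>" if x: "x \<in> carrier (localization R S)" "\<mu> x = \<zero>\<^bsub>A\<^esub>" for x
  proof -
    obtain a s where as: "a \<in> carrier R" "s \<in> S" "x = fraction R S a s" using x(1) by (elim loc_carrierE)
    then have "\<phi> a = \<zero>\<^bsub>A\<^esub>" using eq[of a s] x(2) ring_hom_closed[OF \<phi>, of s] by simp
    then show ?thesis using inj[OF as(1)] as loc_eq_zero_iff by blast
  qed
  have "inj_on \<mu> (carrier (localization R S))"
  proof (rule inj_onI)
    fix x y assume xy: "x \<in> carrier (localization R S)" "y \<in> carrier (localization R S)" "\<mu> x = \<mu> y"
    then have "\<mu> (x \<ominus>\<^bsub>localization R S\<^esub> y) = \<zero>\<^bsub>A\<^esub>"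
      using ring_hom_closed[OF \<mu>] by (simp add: ring_hom_minus'[OF \<mu> L.is_cring A] A.r_right_minus_eq)
    then show "x = y" using xy L.minus_eq_zeroD[OF ker] by blast
  qed
  moreover have "z \<in> \<mu> ` carrier (localization R S)" if z: "z \<in> carrier A" for z
  proof -
    obtain a s where as: "a \<in> carrier R" "s \<in> S" "\<phi> s \<otimes>\<^bsub>A\<^esub> z = \<phi> a" using surj[OF z] by blast
    then have "\<phi> s \<otimes>\<^bsub>A\<^esub> z = \<phi> s \<otimes>\<^bsub>A\<^esub> \<mu> (fraction R S a s)" using eq by simp
    then have "z = \<mu> (fraction R S a s)"
      using unit[OF as(2)] z ring_hom_closed[OF \<mu> loc_carrierI[OF as(1,2)]] by simp
    then show ?thesis using as by simp
  qed
  ultimately have "bij_betw \<mu> (carrier (localization R S)) (carrier A)"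
    using ring_hom_closed[OF \<mu>] by (auto simp: bij_betw_def)
  with \<mu> eq show thesis using that by blast
qed

declare S_carrier [simp del, rule del] \<comment> \<open>loops when \<open>S\<close> is a complement \<open>carrier R - I\<close>\<close>

end

lemma (in primeideal) mult_subset_compl: "mult_subset R (carrier R - I)"
proof -
  have "\<one> \<notin> I" using I_notcarr one_imp_carrier by blast
  then show ?thesis using I_prime by unfold_locales auto
qed

section \<open>Stalks of a ringed space\<close>

context ringed_space
begin

lemma res_closed [simp]:
  "\<lbrakk>opn X U; opn X V; V \<subseteq> U; s \<in> sec X U\<rbrakk> \<Longrightarrow> rs_res X U V s \<in> sec X V"
  using ring_hom_closed[OF res_hom] .

lemma germ_self:
  "\<lbrakk>opn X U; x \<in> U; s \<in> sec X U\<rbrakk> \<Longrightarrow> (U, s) \<in> germ X x U s"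
  by (auto simp: germ_def)

lemma germ_subset:
  assumes "opn X U" "s \<in> sec X U" "opn X V" "t \<in> sec X V"
    and W: "opn X W" "x \<in> W" "W \<subseteq> U \<inter> V" "rs_res X U W s = rs_res X V W t"
  shows "germ X x U s \<subseteq> germ X x V t"
proof
  fix p assume "p \<in> germ X x U s"
  then obtain N n M where p: "p = (N, n)" "opn X N" "x \<in> N" "n \<in> sec X N"
    and M: "opn X M" "x \<in> M" "M \<subseteq> U \<inter> N" "rs_res X U M s = rs_res X N M n"
    by (auto simp: germ_def)
  have o: "opn X (W \<inter> M)" using W M by auto
  have "rs_res X V (W \<inter> M) t = rs_res X W (W \<inter> M) (rs_res X V W t)"
    using assms o by (subst res_res) auto
  also have "\<dots> = rs_res X U (W \<inter> M) s"
    using assms o unfolding W(4)[symmetric] by (subst res_res) auto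
  also have "\<dots> = rs_res X M (W \<inter> M) (rs_res X U M s)"
    using assms M o by (subst res_res) auto
  also have "\<dots> = rs_res X N (W \<inter> M) n"
    using p M o unfolding M(4) by (subst res_res) auto
  finally show "p \<in> germ X x V t"
    using p W M o by (auto simp: germ_def intro!: exI[of _ "W \<inter> M"])
qed

lemma germ_eq_iff:
  assumes "opn X U" "x \<in> U" "s \<in> sec X U" "opn X V" "x \<in> V" "t \<in> sec X V"
  shows "germ X x U s = germ X x V t \<longleftrightarrow>
    (\<exists>W. opn X W \<and> x \<in> W \<and> W \<subseteq> U \<inter> V \<and> rs_res X U W s = rs_res X V W t)"
proof
  assume "germ X x U s = germ X x V t"
  then have "(V, t) \<in> germ X x U s" using germ_self assms by simp
  then show "\<exists>W. opn X W \<and> x \<in> W \<and> W \<subseteq> U \<inter> V \<and> rs_res X U W s = rs_res X V W t"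
    by (auto simp: germ_def)
next
  assume "\<exists>W. opn X W \<and> x \<in> W \<and> W \<subseteq> U \<inter> V \<and> rs_res X U W s = rs_res X V W t"
  then obtain W where W: "opn X W" "x \<in> W" "W \<subseteq> U \<inter> V" "rs_res X U W s = rs_res X V W t" by blast
  show "germ X x U s = germ X x V t"
  proof
    show "germ X x U s \<subseteq> germ X x V t" using assms W by (intro germ_subset[of U s V t W]) auto
    show "germ X x V t \<subseteq> germ X x U s" using assms W by (intro germ_subset[of V t U s W]) auto
  qed
qed

lemma germ_memD:
  assumes "(V, t) \<in> germ X x U s" "opn X U" "x \<in> U" "s \<in> sec X U"
  shows "opn X V" "x \<in> V" "t \<in> sec X V" "germ X x V t = germ X x U s"
proof -
  show *: "opn X V" "x \<in> V" "t \<in> sec X V" using assms(1) by (auto simp: germ_def)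
  obtain W where W: "opn X W" "x \<in> W" "W \<subseteq> U \<inter> V" "rs_res X U W s = rs_res X V W t"
    using assms(1) by (auto simp: germ_def)
  then show "germ X x V t = germ X x U s"
    using * assms(2-) by (subst germ_eq_iff) (auto intro!: exI[of _ W])
qed

lemma germ_res:
  assumes "opn X U" "opn X W" "W \<subseteq> U" "x \<in> W" "s \<in> sec X U"
  shows "germ X x W (rs_res X U W s) = germ X x U s"
  using assms by (subst germ_eq_iff) (auto intro!: exI[of _ W] simp: res_id)

lemma germ_in_stalk [simp]:
  "\<lbrakk>opn X U; x \<in> U; s \<in> sec X U\<rbrakk> \<Longrightarrow> germ X x U s \<in> carrier (stalk X x)"
  by (auto simp: stalk_def)

lemma stalkE:
  assumes "z \<in> carrier (stalk X x)"
  obtains U s where "opn X U" "x \<in> U" "s \<in> sec X U" "z = germ X x U s"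
  using assms by (auto simp: stalk_def)

lemma stalk_nbhdE:
  assumes "z \<in> carrier (stalk X x)" "opn X V" "x \<in> V"
  obtains U s where "opn X U" "x \<in> U" "U \<subseteq> V" "s \<in> sec X U" "z = germ X x U s"
proof -
  obtain U s where U: "opn X U" "x \<in> U" "s \<in> sec X U" "z = germ X x U s" using assms(1) by (rule stalkE)
  show thesis
    using that[of "U \<inter> V" "rs_res X U (U \<inter> V) s"] germ_res[of U "U \<inter> V" x s] U assms
    by (auto simp: openin_Int)
qed

text \<open>Puts germs on a common neighbourhood, after which the operations of the stalk are those
  of a ring of sections and the ring laws can be read off there.\<close>

lemma stalk_common2:
  assumes "z \<in> carrier (stalk X x)" "w \<in> carrier (stalk X x)"
  obtains U s t where "opn X U" "x \<in> U" "s \<in> sec X U" "t \<in> sec X U" "z = germ X x U s" "w = germ X x U t"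
proof -
  obtain U s where U: "opn X U" "x \<in> U" "s \<in> sec X U" "z = germ X x U s" using assms(1) by (rule stalkE)
  obtain V t where V: "opn X V" "x \<in> V" "V \<subseteq> U" "t \<in> sec X V" "w = germ X x V t"
    using assms(2) U(1,2) by (rule stalk_nbhdE)
  show thesis using that[of V "rs_res X U V s" t] U V by (auto simp: germ_res)
qed

lemma stalk_common3:
  assumes "z \<in> carrier (stalk X x)" "w \<in> carrier (stalk X x)" "v \<in> carrier (stalk X x)"
  obtains U s t r where "opn X U" "x \<in> U" "s \<in> sec X U" "t \<in> sec X U" "r \<in> sec X U"
    "z = germ X x U s" "w = germ X x U t" "v = germ X x U r"
proof -
  obtain U s t where U: "opn X U" "x \<in> U" "s \<in> sec X U" "t \<in> sec X U" "z = germ X x U s" "w = germ X x U t"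
    using assms(1,2) by (rule stalk_common2)
  obtain V r where V: "opn X V" "x \<in> V" "V \<subseteq> U" "r \<in> sec X V" "v = germ X x V r"
    using assms(3) U(1,2) by (rule stalk_nbhdE)
  show thesis using that[of V "rs_res X U V s" "rs_res X U V t" r] U V by (auto simp: germ_res)
qed

text \<open>The operation \<open>f\<close> takes the ring as an argument, so one proof of
  independence of representatives covers both multiplication and addition.\<close>

lemma germ_opI:
  fixes f :: "('b ring) \<Rightarrow> 'b \<Rightarrow> 'b \<Rightarrow> 'b"
  assumes hom: "\<And>U V s t. \<lbrakk>opn X U; opn X V; V \<subseteq> U; s \<in> sec X U; t \<in> sec X U\<rbrakk> \<Longrightarrow>
        rs_res X U V (f (rs_sec X U) s t) = f (rs_sec X V) (rs_res X U V s) (rs_res X U V t)"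
    and cl: "\<And>U s t. \<lbrakk>opn X U; s \<in> sec X U; t \<in> sec X U\<rbrakk> \<Longrightarrow> f (rs_sec X U) s t \<in> sec X U"
    and U: "opn X U" "x \<in> U" "s \<in> sec X U" and V: "opn X V" "x \<in> V" "t \<in> sec X V"
  shows "(\<Union>(U, s) \<in> germ X x U s. \<Union>(V, t) \<in> germ X x V t. germ X x (U \<inter> V)
           (f (rs_sec X (U \<inter> V)) (rs_res X U (U \<inter> V) s) (rs_res X V (U \<inter> V) t)))
       = germ X x (U \<inter> V) (f (rs_sec X (U \<inter> V)) (rs_res X U (U \<inter> V) s) (rs_res X V (U \<inter> V) t))"
proof (rule UN_pairs_eq)
  show "(U, s) \<in> germ X x U s" "(V, t) \<in> germ X x V t" using germ_self U V by auto
next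
  fix U' s' V' t' assume m: "(U', s') \<in> germ X x U s" "(V', t') \<in> germ X x V t"
  note U' = germ_memD[OF m(1) U] and V' = germ_memD[OF m(2) V]
  obtain W where W: "opn X W" "x \<in> W" "W \<subseteq> U' \<inter> U" "rs_res X U' W s' = rs_res X U W s"
    using U'(4) U U' by (auto simp: germ_eq_iff)
  obtain N where N: "opn X N" "x \<in> N" "N \<subseteq> V' \<inter> V" "rs_res X V' N t' = rs_res X V N t"
    using V'(4) V V' by (auto simp: germ_eq_iff)
  have o: "opn X (W \<inter> N)" "opn X (U \<inter> V)" "opn X (U' \<inter> V')" using W N U V U' V' by auto
  have 1: "rs_res X U' (W \<inter> N) s' = rs_res X U (W \<inter> N) s"
  proof -
    have "rs_res X U' (W \<inter> N) s' = rs_res X W (W \<inter> N) (rs_res X U' W s')"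
      using U' W o by (subst res_res) auto
    also have "\<dots> = rs_res X U (W \<inter> N) s" using U W o by (subst W(4), subst res_res) auto
    finally show ?thesis .
  qed
  have 2: "rs_res X V' (W \<inter> N) t' = rs_res X V (W \<inter> N) t"
  proof -
    have "rs_res X V' (W \<inter> N) t' = rs_res X N (W \<inter> N) (rs_res X V' N t')"
      using V' N o by (subst res_res) auto
    also have "\<dots> = rs_res X V (W \<inter> N) t" using V N o by (subst N(4), subst res_res) auto
    finally show ?thesis .
  qed
  show "germ X x (U' \<inter> V') (f (rs_sec X (U' \<inter> V')) (rs_res X U' (U' \<inter> V') s') (rs_res X V' (U' \<inter> V') t'))
      = germ X x (U \<inter> V) (f (rs_sec X (U \<inter> V)) (rs_res X U (U \<inter> V) s) (rs_res X V (U \<inter> V) t))"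
  proof (subst germ_eq_iff)
    show "\<exists>M. opn X M \<and> x \<in> M \<and> M \<subseteq> U' \<inter> V' \<inter> (U \<inter> V) \<and>
      rs_res X (U' \<inter> V') M (f (rs_sec X (U' \<inter> V')) (rs_res X U' (U' \<inter> V') s') (rs_res X V' (U' \<inter> V') t'))
      = rs_res X (U \<inter> V) M (f (rs_sec X (U \<inter> V)) (rs_res X U (U \<inter> V) s) (rs_res X V (U \<inter> V) t))"
    proof (intro exI conjI)
      show "W \<inter> N \<subseteq> U' \<inter> V' \<inter> (U \<inter> V)" using W N by auto
      have "W \<inter> N \<subseteq> U' \<inter> V'" "W \<inter> N \<subseteq> U \<inter> V" using W N by auto
      then show "rs_res X (U' \<inter> V') (W \<inter> N) (f (rs_sec X (U' \<inter> V')) (rs_res X U' (U' \<inter> V') s') (rs_res X V' (U' \<inter> V') t'))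
        = rs_res X (U \<inter> V) (W \<inter> N) (f (rs_sec X (U \<inter> V)) (rs_res X U (U \<inter> V) s) (rs_res X V (U \<inter> V) t))"
        using U V U' V' o by (simp add: hom res_res 1 2)
    qed (use W N o in auto)
  qed (use U V U' V' o in \<open>auto intro!: cl\<close>)
qed

lemma stalk_mult_germ:
  assumes "opn X U" "x \<in> U" "s \<in> sec X U" "t \<in> sec X U"
  shows "germ X x U s \<otimes>\<^bsub>stalk X x\<^esub> germ X x U t = germ X x U (s \<otimes>\<^bsub>rs_sec X U\<^esub> t)"
proof -
  have "germ X x U s \<otimes>\<^bsub>stalk X x\<^esub> germ X x U t
      = germ X x (U \<inter> U) (rs_res X U (U \<inter> U) s \<otimes>\<^bsub>rs_sec X (U \<inter> U)\<^esub> rs_res X U (U \<inter> U) t)"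
    unfolding stalk_def monoid.simps
    by (rule germ_opI[where f = mult])
      (use assms in \<open>simp_all add: ring_hom_mult[OF res_hom] cring.cring_simprules[OF sec_cring]\<close>)
  then show ?thesis using assms by (simp add: res_id)
qed

lemma stalk_add_germ:
  assumes "opn X U" "x \<in> U" "s \<in> sec X U" "t \<in> sec X U"
  shows "germ X x U s \<oplus>\<^bsub>stalk X x\<^esub> germ X x U t = germ X x U (s \<oplus>\<^bsub>rs_sec X U\<^esub> t)"
proof -
  have "germ X x U s \<oplus>\<^bsub>stalk X x\<^esub> germ X x U t
      = germ X x (U \<inter> U) (rs_res X U (U \<inter> U) s \<oplus>\<^bsub>rs_sec X (U \<inter> U)\<^esub> rs_res X U (U \<inter> U) t)"
    unfolding stalk_def ring.simps
    by (rule germ_opI[where f = add])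
      (use assms in \<open>simp_all add: ring_hom_add[OF res_hom] cring.cring_simprules[OF sec_cring]\<close>)
  then show ?thesis using assms by (simp add: res_id)
qed

lemma res_one: "\<lbrakk>opn X U; opn X V; V \<subseteq> U\<rbrakk> \<Longrightarrow> rs_res X U V \<one>\<^bsub>rs_sec X U\<^esub> = \<one>\<^bsub>rs_sec X V\<^esub>"
  using ring_hom_one[OF res_hom] .

lemma res_zero: "\<lbrakk>opn X U; opn X V; V \<subseteq> U\<rbrakk> \<Longrightarrow> rs_res X U V \<zero>\<^bsub>rs_sec X U\<^esub> = \<zero>\<^bsub>rs_sec X V\<^esub>"
  using ring_hom_zero'[OF res_hom] sec_cring by simp

lemma sec_one [simp]: "opn X U \<Longrightarrow> \<one>\<^bsub>rs_sec X U\<^esub> \<in> sec X U"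
  by (simp add: cring.cring_simprules(6)[OF sec_cring])

lemma sec_zero [simp]: "opn X U \<Longrightarrow> \<zero>\<^bsub>rs_sec X U\<^esub> \<in> sec X U"
  by (simp add: cring.cring_simprules(2)[OF sec_cring])

lemma stalk_one_germ: "\<lbrakk>opn X U; x \<in> U\<rbrakk> \<Longrightarrow> \<one>\<^bsub>stalk X x\<^esub> = germ X x U \<one>\<^bsub>rs_sec X U\<^esub>"
  using germ_res[of "pts X" U x "\<one>\<^bsub>rs_sec X (pts X)\<^esub>"] openin_subset[of "rs_top X" U]
  by (simp add: res_one) (simp add: stalk_def)

lemma stalk_zero_germ: "\<lbrakk>opn X U; x \<in> U\<rbrakk> \<Longrightarrow> \<zero>\<^bsub>stalk X x\<^esub> = germ X x U \<zero>\<^bsub>rs_sec X U\<^esub>"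
  using germ_res[of "pts X" U x "\<zero>\<^bsub>rs_sec X (pts X)\<^esub>"] openin_subset[of "rs_top X" U]
  by (simp add: res_zero) (simp add: stalk_def)

lemma stalk_cring:
  assumes x: "x \<in> pts X"
  shows "cring (stalk X x)"
proof (rule cringI)
  note op = stalk_mult_germ stalk_add_germ cring.cring_simprules[OF sec_cring]
  have one: "\<one>\<^bsub>stalk X x\<^esub> \<in> carrier (stalk X x)" and zero: "\<zero>\<^bsub>stalk X x\<^esub> \<in> carrier (stalk X x)"
    using x by (simp_all add: stalk_one_germ[of "pts X"] stalk_zero_germ[of "pts X"])
  show "abelian_group (stalk X x)"
  proof (rule abelian_groupI)
    fix a b c assume "a \<in> carrier (stalk X x)" "b \<in> carrier (stalk X x)" "c \<in> carrier (stalk X x)"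
    then show "a \<oplus>\<^bsub>stalk X x\<^esub> b \<oplus>\<^bsub>stalk X x\<^esub> c = a \<oplus>\<^bsub>stalk X x\<^esub> (b \<oplus>\<^bsub>stalk X x\<^esub> c)"
      by (rule stalk_common3) (simp add: op)
  next
    fix a b assume "a \<in> carrier (stalk X x)" "b \<in> carrier (stalk X x)"
    then obtain U s t where "opn X U" "x \<in> U" "s \<in> sec X U" "t \<in> sec X U" "a = germ X x U s" "b = germ X x U t"
      by (rule stalk_common2)
    then show "a \<oplus>\<^bsub>stalk X x\<^esub> b = b \<oplus>\<^bsub>stalk X x\<^esub> a" "a \<oplus>\<^bsub>stalk X x\<^esub> b \<in> carrier (stalk X x)"
      by (simp_all add: op)
  next
    fix a assume "a \<in> carrier (stalk X x)"
    then obtain U s where U: "opn X U" "x \<in> U" "s \<in> sec X U" "a = germ X x U s" by (rule stalkE)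
    then show "\<zero>\<^bsub>stalk X x\<^esub> \<oplus>\<^bsub>stalk X x\<^esub> a = a" by (simp add: op stalk_zero_germ[of U])
    show "\<exists>b\<in>carrier (stalk X x). b \<oplus>\<^bsub>stalk X x\<^esub> a = \<zero>\<^bsub>stalk X x\<^esub>"
      using U by (intro bexI[of _ "germ X x U (\<ominus>\<^bsub>rs_sec X U\<^esub> s)"]) (simp_all add: op stalk_zero_germ[of U])
  qed (rule zero)
  show "comm_monoid (stalk X x)"
  proof (rule comm_monoidI)
    fix a b c assume "a \<in> carrier (stalk X x)" "b \<in> carrier (stalk X x)" "c \<in> carrier (stalk X x)"
    then show "a \<otimes>\<^bsub>stalk X x\<^esub> b \<otimes>\<^bsub>stalk X x\<^esub> c = a \<otimes>\<^bsub>stalk X x\<^esub> (b \<otimes>\<^bsub>stalk X x\<^esub> c)"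
      by (rule stalk_common3) (simp add: op)
  next
    fix a b assume "a \<in> carrier (stalk X x)" "b \<in> carrier (stalk X x)"
    then obtain U s t where "opn X U" "x \<in> U" "s \<in> sec X U" "t \<in> sec X U" "a = germ X x U s" "b = germ X x U t"
      by (rule stalk_common2)
    then show "a \<otimes>\<^bsub>stalk X x\<^esub> b = b \<otimes>\<^bsub>stalk X x\<^esub> a" "a \<otimes>\<^bsub>stalk X x\<^esub> b \<in> carrier (stalk X x)"
      by (simp_all add: op)
  next
    fix a assume "a \<in> carrier (stalk X x)"
    then obtain U s where U: "opn X U" "x \<in> U" "s \<in> sec X U" "a = germ X x U s" by (rule stalkE)
    interpret U: cring "rs_sec X U" using sec_cring U(1) .
    show "\<one>\<^bsub>stalk X x\<^esub> \<otimes>\<^bsub>stalk X x\<^esub> a = a" using U by (simp add: stalk_mult_germ stalk_one_germ[of U])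
  qed (rule one)
  fix a b c assume "a \<in> carrier (stalk X x)" "b \<in> carrier (stalk X x)" "c \<in> carrier (stalk X x)"
  then show "(a \<oplus>\<^bsub>stalk X x\<^esub> b) \<otimes>\<^bsub>stalk X x\<^esub> c = a \<otimes>\<^bsub>stalk X x\<^esub> c \<oplus>\<^bsub>stalk X x\<^esub> b \<otimes>\<^bsub>stalk X x\<^esub> c"
    by (rule stalk_common3) (simp add: op)
qed

lemma germ_hom: "\<lbrakk>opn X U; x \<in> U\<rbrakk> \<Longrightarrow> germ X x U \<in> ring_hom (rs_sec X U) (stalk X x)"
  by (rule ring_hom_memI) (auto simp: stalk_mult_germ stalk_add_germ stalk_one_germ)

lemma pts_open: "\<lbrakk>opn X U; x \<in> U\<rbrakk> \<Longrightarrow> x \<in> pts X"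
  using openin_subset by blast

lemma stalk_cring': "\<lbrakk>opn X U; x \<in> U\<rbrakk> \<Longrightarrow> cring (stalk X x)"
  using stalk_cring pts_open by blast

lemma germ_minus:
  "\<lbrakk>opn X U; x \<in> U; s \<in> sec X U; t \<in> sec X U\<rbrakk> \<Longrightarrow>
    germ X x U (s \<ominus>\<^bsub>rs_sec X U\<^esub> t) = germ X x U s \<ominus>\<^bsub>stalk X x\<^esub> germ X x U t"
  using ring_hom_minus'[OF germ_hom sec_cring stalk_cring'] by blast

lemma germ_pow:
  "\<lbrakk>opn X U; x \<in> U; s \<in> sec X U\<rbrakk> \<Longrightarrow>
    germ X x U (s [^]\<^bsub>rs_sec X U\<^esub> (n::nat)) = germ X x U s [^]\<^bsub>stalk X x\<^esub> n"
  using ring_hom_pow'[OF germ_hom sec_cring stalk_cring'] by blast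

section \<open>Sections determined by their germs and glued from them\<close>

lemma germ_eq_nbhd:
  assumes "opn X U" "x \<in> U" "s \<in> sec X U" "opn X V" "x \<in> V" "t \<in> sec X V" "germ X x U s = germ X x V t"
  obtains W where "opn X W" "x \<in> W" "W \<subseteq> U" "W \<subseteq> V" "rs_res X U W s = rs_res X V W t"
    "\<And>y. y \<in> W \<Longrightarrow> germ X y U s = germ X y V t"
proof -
  obtain W where W: "opn X W" "x \<in> W" "W \<subseteq> U" "W \<subseteq> V" "rs_res X U W s = rs_res X V W t"
    using assms(7) by (auto simp: germ_eq_iff[OF assms(1-6)])
  have "germ X y U s = germ X y V t" if "y \<in> W" for y
    using germ_res[OF assms(1) W(1,3) that assms(3)] germ_res[OF assms(4) W(1,4) that assms(6)] W(5) by simp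
  with W that show thesis by blast
qed

text \<open>The uniqueness half of \<open>gluing\<close>, for the cover of \<open>U\<close> by all
  open subsets on which \<open>s\<close> and \<open>t\<close> have the same restriction.\<close>

lemma section_eqI:
  assumes U: "opn X U" "s \<in> sec X U" "t \<in> sec X U" and eq: "\<And>x. x \<in> U \<Longrightarrow> germ X x U s = germ X x U t"
  shows "s = t"
proof -
  define \<U> where "\<U> = {W. opn X W \<and> W \<subseteq> U \<and> rs_res X U W s = rs_res X U W t}"
  have Un: "\<Union>\<U> = U"
  proof
    show "U \<subseteq> \<Union>\<U>"
    proof
      fix x assume "x \<in> U"
      then obtain W where "opn X W" "x \<in> W" "W \<subseteq> U" "rs_res X U W s = rs_res X U W t"
        using U eq germ_eq_nbhd[of U x s U t] by metis
      then show "x \<in> \<Union>\<U>" by (auto simp: \<U>_def)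
    qed
  qed (auto simp: \<U>_def)
  have "\<exists>!r. r \<in> sec X (\<Union>\<U>) \<and> (\<forall>W\<in>\<U>. rs_res X (\<Union>\<U>) W r = rs_res X U W s)"
    by (rule gluing) (use U in \<open>auto simp: \<U>_def res_res openin_Int\<close>)
  then have "\<exists>!r. r \<in> sec X U \<and> (\<forall>W\<in>\<U>. rs_res X U W r = rs_res X U W s)" unfolding Un .
  moreover have "\<forall>W\<in>\<U>. rs_res X U W t = rs_res X U W s" by (auto simp: \<U>_def)
  ultimately show "s = t" using U by auto
qed

text \<open>The usual way below to construct a section: prescribe its germs and check that they are
  locally the germs of a section. The compatibility demanded by \<open>gluing\<close> then follows
  from \<open>section_eqI\<close>.\<close>

lemma glue_germs:
  assumes W: "opn X W"
    and loc: "\<And>x. x \<in> W \<Longrightarrow> \<exists>N s. opn X N \<and> x \<in> N \<and> N \<subseteq> W \<and> s \<in> sec X N \<and> (\<forall>z\<in>N. germ X z N s = \<gamma> z)"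
  shows "\<exists>!t. t \<in> sec X W \<and> (\<forall>z\<in>W. germ X z W t = \<gamma> z)"
proof -
  define \<U> where "\<U> = {N. opn X N \<and> N \<subseteq> W \<and> (\<exists>s. s \<in> sec X N \<and> (\<forall>z\<in>N. germ X z N s = \<gamma> z))}"
  have "\<forall>N\<in>\<U>. \<exists>s. s \<in> sec X N \<and> (\<forall>z\<in>N. germ X z N s = \<gamma> z)" by (auto simp: \<U>_def)
  then obtain \<sigma> where \<sigma>: "\<And>N. N \<in> \<U> \<Longrightarrow> \<sigma> N \<in> sec X N" "\<And>N z. N \<in> \<U> \<Longrightarrow> z \<in> N \<Longrightarrow> germ X z N (\<sigma> N) = \<gamma> z"
    by (metis (no_types, lifting))
  have Uo: "opn X N" "N \<subseteq> W" if "N \<in> \<U>" for N using that by (auto simp: \<U>_def)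
  have "\<exists>N\<in>\<U>. x \<in> N" if "x \<in> W" for x
    using loc[OF that] unfolding \<U>_def by (elim exE conjE) (intro bexI CollectI conjI exI; assumption)
  then have Un: "\<Union>\<U> = W" using Uo(2) by fast
  have "\<exists>!t. t \<in> sec X (\<Union>\<U>) \<and> (\<forall>N\<in>\<U>. rs_res X (\<Union>\<U>) N t = \<sigma> N)"
  proof (rule gluing)
    fix N M assume NM: "N \<in> \<U>" "M \<in> \<U>"
    show "rs_res X N (N \<inter> M) (\<sigma> N) = rs_res X M (N \<inter> M) (\<sigma> M)"
      by (rule section_eqI[of "N \<inter> M"])
        (use NM Uo \<sigma> in \<open>auto simp: germ_res openin_Int\<close>)
  qed (use Uo \<sigma> in auto)
  then obtain t where t: "t \<in> sec X W" "\<And>N. N \<in> \<U> \<Longrightarrow> rs_res X W N t = \<sigma> N" unfolding Un by blast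
  have "germ X z W t = \<gamma> z" if z: "z \<in> W" for z
  proof -
    obtain N where N: "N \<in> \<U>" "z \<in> N" using Un z by blast
    then have "germ X z W t = germ X z N (\<sigma> N)" using germ_res[of W N z t] t Uo W by auto
    then show ?thesis using \<sigma> N by simp
  qed
  moreover have "r = t" if "r \<in> sec X W \<and> (\<forall>z\<in>W. germ X z W r = \<gamma> z)" for r
    by (rule section_eqI[OF W]) (use that t(1) calculation in auto)
  ultimately show ?thesis using t(1) by (intro ex1I[of _ t]) auto
qed

section \<open>Invertible germs and invertible sections\<close>

lemma germ_unit_nbhd:
  assumes U: "opn X U" "x \<in> U" "s \<in> sec X U" and u: "germ X x U s \<in> Units (stalk X x)"
  obtains W t where "opn X W" "x \<in> W" "W \<subseteq> U" "t \<in> sec X W" "rs_res X U W s \<otimes>\<^bsub>rs_sec X W\<^esub> t = \<one>\<^bsub>rs_sec X W\<^esub>"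
proof -
  interpret S: cring "stalk X x" using stalk_cring' U by blast
  have "inv\<^bsub>stalk X x\<^esub> (germ X x U s) \<in> carrier (stalk X x)" using u by simp
  then obtain V t where V: "opn X V" "x \<in> V" "V \<subseteq> U" "t \<in> sec X V"
    and t: "inv\<^bsub>stalk X x\<^esub> (germ X x U s) = germ X x V t" using U(1,2) by (rule stalk_nbhdE)
  interpret V: cring "rs_sec X V" using sec_cring V by blast
  have "germ X x V (rs_res X U V s \<otimes>\<^bsub>rs_sec X V\<^esub> t) = germ X x V \<one>\<^bsub>rs_sec X V\<^esub>"
    using U V u t by (simp add: germ_res flip: stalk_mult_germ stalk_one_germ) (metis S.Units_r_inv)
  moreover have "rs_res X U V s \<otimes>\<^bsub>rs_sec X V\<^esub> t \<in> sec X V" using U V by simp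
  ultimately obtain W where W: "opn X W" "x \<in> W" "W \<subseteq> V"
    "rs_res X V W (rs_res X U V s \<otimes>\<^bsub>rs_sec X V\<^esub> t) = rs_res X V W \<one>\<^bsub>rs_sec X V\<^esub>"
    using V(1,2) sec_one[OF V(1)] by (metis germ_eq_nbhd)
  then have "rs_res X U W s \<otimes>\<^bsub>rs_sec X W\<^esub> rs_res X V W t = \<one>\<^bsub>rs_sec X W\<^esub>"
    using U V by (simp add: ring_hom_mult[OF res_hom] res_res res_one)
  then show thesis using that[of W "rs_res X V W t"] U V W by auto
qed

lemma germ_unitI:
  assumes "opn X U" "s \<in> sec X U" "opn X W" "x \<in> W" "W \<subseteq> U" "t \<in> sec X W"
    "rs_res X U W s \<otimes>\<^bsub>rs_sec X W\<^esub> t = \<one>\<^bsub>rs_sec X W\<^esub>"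
  shows "germ X x U s \<in> Units (stalk X x)"
proof -
  interpret S: cring "stalk X x" using stalk_cring' assms by blast
  have "germ X x U s \<otimes>\<^bsub>stalk X x\<^esub> germ X x W t = \<one>\<^bsub>stalk X x\<^esub>"
    using assms by (simp add: stalk_mult_germ stalk_one_germ[of W] flip: germ_res[of U W x s])
  then show ?thesis using assms S.unitI[of "germ X x U s" "germ X x W t"] by auto
qed

lemma unit_locus_open:
  assumes U: "opn X U" "s \<in> sec X U"
  shows "opn X {y \<in> U. germ X y U s \<in> Units (stalk X y)}"
proof (subst openin_subopen, intro ballI)
  fix x assume "x \<in> {y \<in> U. germ X y U s \<in> Units (stalk X y)}"
  then obtain W t where W: "opn X W" "x \<in> W" "W \<subseteq> U" "t \<in> sec X W"
    "rs_res X U W s \<otimes>\<^bsub>rs_sec X W\<^esub> t = \<one>\<^bsub>rs_sec X W\<^esub>"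
    using germ_unit_nbhd[OF U(1) _ U(2)] by (metis (mono_tags, lifting) mem_Collect_eq)
  then show "\<exists>T. opn X T \<and> x \<in> T \<and> T \<subseteq> {y \<in> U. germ X y U s \<in> Units (stalk X y)}"
    using germ_unitI[OF U W(1) _ W(3-5)] by (intro exI[of _ W]) auto
qed

text \<open>An invertible germ has an inverse on a neighbourhood, and inverses are unique; so the
  inverses of the germs are locally the germs of a section and glue.\<close>

lemma sec_unitI:
  assumes U: "opn X U" "s \<in> sec X U" and u: "\<And>y. y \<in> U \<Longrightarrow> germ X y U s \<in> Units (stalk X y)"
  shows "s \<in> Units (rs_sec X U)"
proof -
  interpret U: cring "rs_sec X U" using sec_cring U by blast
  have "\<exists>!t. t \<in> sec X U \<and> (\<forall>z\<in>U. germ X z U t = inv\<^bsub>stalk X z\<^esub> (germ X z U s))"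
  proof (rule glue_germs[OF U(1)])
    fix x assume x: "x \<in> U"
    obtain W t where W: "opn X W" "x \<in> W" "W \<subseteq> U" "t \<in> sec X W"
      "rs_res X U W s \<otimes>\<^bsub>rs_sec X W\<^esub> t = \<one>\<^bsub>rs_sec X W\<^esub>"
      using germ_unit_nbhd[OF U(1) x U(2) u[OF x]] by blast
    have "germ X z W t = inv\<^bsub>stalk X z\<^esub> (germ X z U s)" if z: "z \<in> W" for z
    proof -
      interpret S: cring "stalk X z" using stalk_cring' W z by blast
      have "germ X z U s \<otimes>\<^bsub>stalk X z\<^esub> germ X z W t = \<one>\<^bsub>stalk X z\<^esub>"
        using U W z by (simp add: stalk_mult_germ stalk_one_germ[of W] flip: germ_res[of U W z s])
      then show ?thesis using U W z by (intro S.comm_inv_char[symmetric]) auto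
    qed
    then show "\<exists>N t. opn X N \<and> x \<in> N \<and> N \<subseteq> U \<and> t \<in> sec X N \<and>
        (\<forall>z\<in>N. germ X z N t = inv\<^bsub>stalk X z\<^esub> (germ X z U s))" using W by blast
  qed
  then obtain t where t: "t \<in> sec X U" "\<And>z. z \<in> U \<Longrightarrow> germ X z U t = inv\<^bsub>stalk X z\<^esub> (germ X z U s)" by blast
  have "s \<otimes>\<^bsub>rs_sec X U\<^esub> t = \<one>\<^bsub>rs_sec X U\<^esub>"
  proof (rule section_eqI[OF U(1)])
    fix z assume z: "z \<in> U"
    interpret S: cring "stalk X z" using stalk_cring' U z by blast
    show "germ X z U (s \<otimes>\<^bsub>rs_sec X U\<^esub> t) = germ X z U \<one>\<^bsub>rs_sec X U\<^esub>"
      using U t u[OF z] z by (simp flip: stalk_mult_germ stalk_one_germ)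
  qed (use U t in auto)
  then show ?thesis using U.unitI U t by blast
qed

text \<open>The right-hand side mentions only open sets, sections and restrictions inside
  \<open>U\<close>. Two spaces that share these have the same unit germs although their stalks are
  different sets.\<close>

lemma germ_unit_iff:
  assumes U: "opn X U" "x \<in> U" "s \<in> sec X U"
  shows "germ X x U s \<in> Units (stalk X x) \<longleftrightarrow>
    (\<exists>W t. opn X W \<and> x \<in> W \<and> W \<subseteq> U \<and> t \<in> sec X W \<and> rs_res X U W s \<otimes>\<^bsub>rs_sec X W\<^esub> t = \<one>\<^bsub>rs_sec X W\<^esub>)"
  using germ_unit_nbhd[OF U] germ_unitI[OF U(1,3)] by metis

end

section \<open>Sheaves of functions\<close>

lemma pointwise_ring_simps [simp]:
  "carrier (pointwise_ring U A C) = C"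
  "s \<otimes>\<^bsub>pointwise_ring U A C\<^esub> t = (\<lambda>x\<in>U. s x \<otimes>\<^bsub>A x\<^esub> t x)"
  "s \<oplus>\<^bsub>pointwise_ring U A C\<^esub> t = (\<lambda>x\<in>U. s x \<oplus>\<^bsub>A x\<^esub> t x)"
  "\<one>\<^bsub>pointwise_ring U A C\<^esub> = (\<lambda>x\<in>U. \<one>\<^bsub>A x\<^esub>)"
  "\<zero>\<^bsub>pointwise_ring U A C\<^esub> = (\<lambda>x\<in>U. \<zero>\<^bsub>A x\<^esub>)"
  by (simp_all add: pointwise_ring_def)

lemma pointwise_cring:
  assumes A: "\<And>x. x \<in> U \<Longrightarrow> cring (A x)" and C: "C \<subseteq> (\<Pi>\<^sub>E x \<in> U. carrier (A x))"
    and "(\<lambda>x\<in>U. \<one>\<^bsub>A x\<^esub>) \<in> C" "(\<lambda>x\<in>U. \<zero>\<^bsub>A x\<^esub>) \<in> C"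
    and "\<And>s t. s \<in> C \<Longrightarrow> t \<in> C \<Longrightarrow> (\<lambda>x\<in>U. s x \<oplus>\<^bsub>A x\<^esub> t x) \<in> C"
    and "\<And>s t. s \<in> C \<Longrightarrow> t \<in> C \<Longrightarrow> (\<lambda>x\<in>U. s x \<otimes>\<^bsub>A x\<^esub> t x) \<in> C"
    and "\<And>s. s \<in> C \<Longrightarrow> (\<lambda>x\<in>U. \<ominus>\<^bsub>A x\<^esub> s x) \<in> C"
  shows "cring (pointwise_ring U A C)"
proof -
  have val: "s x \<in> carrier (A x)" if "s \<in> C" "x \<in> U" for s x using that C by blast
  have ext: "s x = undefined" if "s \<in> C" "x \<notin> U" for s x using that C by (metis PiE_arb subsetD)
  have neg: "a \<oplus>\<^bsub>A x\<^esub> \<ominus>\<^bsub>A x\<^esub> a = \<zero>\<^bsub>A x\<^esub>" "a \<otimes>\<^bsub>A x\<^esub> \<one>\<^bsub>A x\<^esub> = a" if "x \<in> U" "a \<in> carrier (A x)" for x a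
  proof -
    interpret cring "A x" using A that(1) .
    show "a \<oplus>\<^bsub>A x\<^esub> \<ominus>\<^bsub>A x\<^esub> a = \<zero>\<^bsub>A x\<^esub>" "a \<otimes>\<^bsub>A x\<^esub> \<one>\<^bsub>A x\<^esub> = a" using that(2) by (simp_all add: r_neg)
  qed
  note r = val cring.cring_simprules[OF A] neg
  show ?thesis
  proof (rule cringI)
    show "abelian_group (pointwise_ring U A C)"
    proof (rule abelian_groupI)
      fix s assume "s \<in> carrier (pointwise_ring U A C)"
      then show "\<exists>t\<in>carrier (pointwise_ring U A C). t \<oplus>\<^bsub>pointwise_ring U A C\<^esub> s = \<zero>\<^bsub>pointwise_ring U A C\<^esub>"
        using assms(7)[of s] by (intro bexI[of _ "\<lambda>y\<in>U. \<ominus>\<^bsub>A y\<^esub> s y"]) (auto simp: fun_eq_iff r)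
    qed (use assms(3-) in \<open>auto simp: fun_eq_iff r restrict_def ext\<close>)
    show "comm_monoid (pointwise_ring U A C)"
      by (rule comm_monoidI) (use assms(3-) in \<open>auto simp: fun_eq_iff r restrict_def ext\<close>)
  qed (auto simp: fun_eq_iff r)
qed

text \<open>The common pattern of the spectrum, with \<open>L\<close> the fractions, and of a closed
  subspace, with \<open>L\<close> the families induced by sections of \<open>X\<close>.
  \<open>L_germ\<close> and \<open>L_surj\<close> make \<open>A x\<close> the stalk at
  \<open>x\<close> of the sheaf that \<open>L\<close> generates.\<close>

locale local_functions =
  fixes T :: "'x topology" and A :: "'x \<Rightarrow> 'c ring" and L :: "'x set \<Rightarrow> ('x \<Rightarrow> 'c) set"
  assumes A_cring: "x \<in> topspace T \<Longrightarrow> cring (A x)"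
    and L_mono: "\<lbrakk>openin T V; openin T U; V \<subseteq> U\<rbrakk> \<Longrightarrow> L U \<subseteq> L V"
    and L_val: "\<lbrakk>openin T U; l \<in> L U; x \<in> U\<rbrakk> \<Longrightarrow> l x \<in> carrier (A x)"
    and L_one: "openin T U \<Longrightarrow> (\<lambda>x. \<one>\<^bsub>A x\<^esub>) \<in> L U"
    and L_zero: "openin T U \<Longrightarrow> (\<lambda>x. \<zero>\<^bsub>A x\<^esub>) \<in> L U"
    and L_add: "\<lbrakk>openin T U; l \<in> L U; k \<in> L U\<rbrakk> \<Longrightarrow> (\<lambda>x. l x \<oplus>\<^bsub>A x\<^esub> k x) \<in> L U"
    and L_mult: "\<lbrakk>openin T U; l \<in> L U; k \<in> L U\<rbrakk> \<Longrightarrow> (\<lambda>x. l x \<otimes>\<^bsub>A x\<^esub> k x) \<in> L U"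
    and L_uminus: "\<lbrakk>openin T U; l \<in> L U\<rbrakk> \<Longrightarrow> (\<lambda>x. \<ominus>\<^bsub>A x\<^esub> l x) \<in> L U"
    and L_germ: "\<lbrakk>openin T U; l \<in> L U; k \<in> L U; x \<in> U; l x = k x\<rbrakk>
      \<Longrightarrow> \<exists>W. openin T W \<and> x \<in> W \<and> W \<subseteq> U \<and> (\<forall>y\<in>W. l y = k y)"
    and L_surj: "\<lbrakk>x \<in> topspace T; a \<in> carrier (A x)\<rbrakk> \<Longrightarrow> \<exists>U l. openin T U \<and> x \<in> U \<and> l \<in> L U \<and> l x = a"
begin

definition C :: "'x set \<Rightarrow> ('x \<Rightarrow> 'c) set" where
  "C U = {s \<in> (\<Pi>\<^sub>E x \<in> U. carrier (A x)).
     \<forall>x \<in> U. \<exists>W l. openin T W \<and> x \<in> W \<and> W \<subseteq> U \<and> l \<in> L W \<and> (\<forall>y \<in> W. s y = l y)}"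

lemma C_val: "s \<in> C U \<Longrightarrow> x \<in> U \<Longrightarrow> s x \<in> carrier (A x)"
  by (auto simp: C_def)

lemma C_ext: "s \<in> C U \<Longrightarrow> restrict s U = s"
  by (auto simp: C_def PiE_def extensional_restrict)

lemma C_locE:
  assumes "s \<in> C U" "x \<in> U"
  obtains W l where "openin T W" "x \<in> W" "W \<subseteq> U" "l \<in> L W" "\<And>y. y \<in> W \<Longrightarrow> s y = l y"
  using assms by (force simp: C_def)

lemma C_I:
  assumes "\<And>x. x \<in> U \<Longrightarrow> \<exists>W l. openin T W \<and> x \<in> W \<and> W \<subseteq> U \<and> l \<in> L W \<and> (\<forall>y \<in> W. s y = l y)"
  shows "restrict s U \<in> C U"
proof -
  have "s x \<in> carrier (A x)" if "x \<in> U" for x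
    using assms[OF that] L_val by metis
  moreover have "\<exists>W l. openin T W \<and> x \<in> W \<and> W \<subseteq> U \<and> l \<in> L W \<and> (\<forall>y\<in>W. restrict s U y = l y)" if "x \<in> U" for x
    using assms[OF that] by (smt (verit) restrict_apply' subsetD)
  ultimately show ?thesis by (auto simp: C_def)
qed

lemma C_restrict:
  assumes "openin T V" "V \<subseteq> U" "s \<in> C U"
  shows "restrict s V \<in> C V"
proof (rule C_I)
  fix x assume "x \<in> V"
  then obtain W l where W: "openin T W" "x \<in> W" "W \<subseteq> U" "l \<in> L W" "\<And>y. y \<in> W \<Longrightarrow> s y = l y"
    using C_locE[of s U x] assms(2,3) by blast
  then show "\<exists>W l. openin T W \<and> x \<in> W \<and> W \<subseteq> V \<and> l \<in> L W \<and> (\<forall>y\<in>W. s y = l y)"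
    using L_mono[of "W \<inter> V" W] assms \<open>x \<in> V\<close>
    by (intro exI[of _ "W \<inter> V"] exI[of _ l]) auto
qed

lemma L_C: "openin T U \<Longrightarrow> l \<in> L U \<Longrightarrow> restrict l U \<in> C U"
  by (rule C_I) blast

text \<open>Both functions are given by members of \<open>L\<close> on a common smaller
  neighbourhood. Since \<open>f\<close> may depend on the point, this covers sums, products and, by
  ignoring an argument, negatives.\<close>

lemma C_binop:
  assumes L: "\<And>U l k. openin T U \<Longrightarrow> l \<in> L U \<Longrightarrow> k \<in> L U \<Longrightarrow> (\<lambda>x. f x (l x) (k x)) \<in> L U"
    and "s \<in> C U" "t \<in> C U"
  shows "(\<lambda>x\<in>U. f x (s x) (t x)) \<in> C U"
proof (rule C_I)
  fix x assume x: "x \<in> U"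
  obtain W l where W: "openin T W" "x \<in> W" "W \<subseteq> U" "l \<in> L W" "\<And>y. y \<in> W \<Longrightarrow> s y = l y"
    using C_locE[OF assms(2) x] by metis
  obtain V k where V: "openin T V" "x \<in> V" "V \<subseteq> U" "k \<in> L V" "\<And>y. y \<in> V \<Longrightarrow> t y = k y"
    using C_locE[OF assms(3) x] by metis
  have o: "openin T (W \<inter> V)" using W V by auto
  have "l \<in> L (W \<inter> V)" "k \<in> L (W \<inter> V)" using W(4) V(4) L_mono[OF o W(1)] L_mono[OF o V(1)] by auto
  then have "(\<lambda>x. f x (l x) (k x)) \<in> L (W \<inter> V)" using W V by (intro L) auto
  with W V show "\<exists>W l. openin T W \<and> x \<in> W \<and> W \<subseteq> U \<and> l \<in> L W \<and> (\<forall>y\<in>W. f y (s y) (t y) = l y)"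
    by (intro exI[of _ "W \<inter> V"] exI[of _ "\<lambda>x. f x (l x) (k x)"]) auto
qed

lemma C_cring:
  assumes U: "openin T U"
  shows "cring (pointwise_ring U A (C U))"
proof (rule pointwise_cring)
  show "cring (A x)" if "x \<in> U" for x using A_cring openin_subset[OF U] that by auto
  show "C U \<subseteq> (\<Pi>\<^sub>E x\<in>U. carrier (A x))" by (auto simp: C_def)
  show "(\<lambda>x\<in>U. \<one>\<^bsub>A x\<^esub>) \<in> C U" "(\<lambda>x\<in>U. \<zero>\<^bsub>A x\<^esub>) \<in> C U" using L_C[OF U] L_one[OF U] L_zero[OF U] by blast+
  show "(\<lambda>x\<in>U. s x \<oplus>\<^bsub>A x\<^esub> t x) \<in> C U" if "s \<in> C U" "t \<in> C U" for s t
    by (rule C_binop[OF L_add that])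
  show "(\<lambda>x\<in>U. s x \<otimes>\<^bsub>A x\<^esub> t x) \<in> C U" if "s \<in> C U" "t \<in> C U" for s t
    by (rule C_binop[OF L_mult that])
  show "(\<lambda>x\<in>U. \<ominus>\<^bsub>A x\<^esub> s x) \<in> C U" if "s \<in> C U" for s
    by (rule C_binop[where f = "\<lambda>x a b. \<ominus>\<^bsub>A x\<^esub> a", OF L_uminus that that])
qed

end

text \<open>The section rings of \<open>F\<close> are only prescribed on open sets, since \<open>closed_sub\<close> has unrelated
  values elsewhere.\<close>

locale function_space = local_functions T A L
  for T :: "'x topology" and A :: "'x \<Rightarrow> 'c ring" and L +
  fixes F :: "('x, 'x \<Rightarrow> 'c) rspace"
  assumes F_top [simp]: "rs_top F = T"
    and F_sec [simp]: "openin T U \<Longrightarrow> rs_sec F U = pointwise_ring U A (C U)"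
    and F_res [simp]: "rs_res F U V s = restrict s V"
begin

lemma F_ringed: "ringed_space F"
proof (rule ringed_space.intro)
  show "cring (rs_sec F U)" if "opn F U" for U using that C_cring by simp
  show "rs_res F U V \<in> ring_hom (rs_sec F U) (rs_sec F V)" if "opn F U" "opn F V" "V \<subseteq> U" for U V
    by (rule ring_hom_memI) (use that C_restrict in \<open>auto simp: fun_eq_iff restrict_def\<close>)
  show "rs_res F U U s = s" if "opn F U" "s \<in> sec F U" for U s using that C_ext by simp
  show "rs_res F V W (rs_res F U V s) = rs_res F U W s"
    if "opn F U" "opn F V" "opn F W" "W \<subseteq> V" "V \<subseteq> U" "s \<in> sec F U" for U V W s
    using that by (simp add: Int_absorb1)
  fix \<U> \<sigma>
  assume op: "\<And>U. U \<in> \<U> \<Longrightarrow> opn F U" and sec: "\<And>U. U \<in> \<U> \<Longrightarrow> \<sigma> U \<in> sec F U"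
    and eq: "\<And>U V. \<lbrakk>U \<in> \<U>; V \<in> \<U>\<rbrakk> \<Longrightarrow> rs_res F U (U \<inter> V) (\<sigma> U) = rs_res F V (U \<inter> V) (\<sigma> V)"
  \<comment> \<open>The glued function takes at \<open>x\<close> the value of any member of the
    family that is defined at \<open>x\<close>; compatibility on overlaps makes the choice
    irrelevant.\<close>
  define t where "t x = \<sigma> (SOME U. U \<in> \<U> \<and> x \<in> U) x" for x
  have t: "t x = \<sigma> U x" if "U \<in> \<U>" "x \<in> U" for U x
  proof -
    define V where "V = (SOME U. U \<in> \<U> \<and> x \<in> U)"
    have "V \<in> \<U> \<and> x \<in> V" unfolding V_def by (rule someI[of _ U]) (use that in auto)
    then have "rs_res F U (U \<inter> V) (\<sigma> U) x = rs_res F V (U \<inter> V) (\<sigma> V) x" using eq that by metis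
    then show ?thesis using \<open>V \<in> \<U> \<and> x \<in> V\<close> that by (simp add: t_def flip: V_def)
  qed
  have "restrict t (\<Union>\<U>) \<in> C (\<Union>\<U>)"
  proof (rule C_I)
    fix x assume "x \<in> \<Union>\<U>"
    then obtain U where U: "U \<in> \<U>" "x \<in> U" by blast
    then obtain W l where W: "openin T W" "x \<in> W" "W \<subseteq> U" "l \<in> L W" "\<And>y. y \<in> W \<Longrightarrow> \<sigma> U y = l y"
      using sec[of U] op[of U] C_locE[of "\<sigma> U" U x] by auto
    then have "\<forall>y\<in>W. t y = l y" using t[OF U(1)] by auto
    then show "\<exists>W l. openin T W \<and> x \<in> W \<and> W \<subseteq> \<Union>\<U> \<and> l \<in> L W \<and> (\<forall>y\<in>W. t y = l y)"
      using W U by blast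
  qed
  moreover have "restrict (restrict t (\<Union>\<U>)) U = \<sigma> U" if "U \<in> \<U>" for U
  proof -
    have "restrict (restrict t (\<Union>\<U>)) U = restrict (\<sigma> U) U"
      using that t[OF that] by (auto simp: fun_eq_iff restrict_def)
    then show ?thesis using sec[OF that] op[OF that] C_ext by simp
  qed
  moreover have "r = restrict t (\<Union>\<U>)" if r: "r \<in> C (\<Union>\<U>)" "\<And>U. U \<in> \<U> \<Longrightarrow> restrict r U = \<sigma> U" for r
  proof -
    have "restrict r (\<Union>\<U>) = restrict t (\<Union>\<U>)"
    proof (rule restrict_ext)
      fix x assume "x \<in> \<Union>\<U>"
      then obtain U where U: "U \<in> \<U>" "x \<in> U" by blast
      then have "r x = \<sigma> U x" using r(2)[OF U(1)] by (metis restrict_apply')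
      then show "r x = t x" using t[OF U] by simp
    qed
    then show ?thesis using C_ext[OF r(1)] by simp
  qed
  moreover have "sec F (\<Union>\<U>) = C (\<Union>\<U>)" using op by (simp add: openin_Union)
  ultimately show "\<exists>!t. t \<in> sec F (\<Union>\<U>) \<and> (\<forall>U\<in>\<U>. rs_res F (\<Union>\<U>) U t = \<sigma> U)"
    unfolding F_res by (intro ex1I[of _ "restrict t (\<Union>\<U>)"] conjI ballI) blast+
qed

sublocale F: ringed_space F by (rule F_ringed)

text \<open>By \<open>L_germ\<close>, agreement of two functions at the single point
  \<open>x\<close> already forces agreement near \<open>x\<close>, so a germ carries no more
  information than its value.\<close>

lemma F_germ_eq_iff:
  assumes U: "openin T U" "x \<in> U" "s \<in> C U" and V: "openin T V" "x \<in> V" "t \<in> C V"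
  shows "germ F x U s = germ F x V t \<longleftrightarrow> s x = t x"
proof
  assume "germ F x U s = germ F x V t"
  then obtain W where "x \<in> W" "restrict s W = restrict t W"
    using assms by (subst (asm) F.germ_eq_iff) auto
  then show "s x = t x" by (metis restrict_apply')
next
  assume eq: "s x = t x"
  obtain W l where W: "openin T W" "x \<in> W" "W \<subseteq> U" "l \<in> L W" "\<And>y. y \<in> W \<Longrightarrow> s y = l y"
    using C_locE[OF U(3,2)] by metis
  obtain N k where N: "openin T N" "x \<in> N" "N \<subseteq> V" "k \<in> L N" "\<And>y. y \<in> N \<Longrightarrow> t y = k y"
    using C_locE[OF V(3,2)] by metis
  have o: "openin T (W \<inter> N)" using W N by auto
  have "l \<in> L (W \<inter> N)" "k \<in> L (W \<inter> N)" using W(4) N(4) L_mono[OF o W(1)] L_mono[OF o N(1)] by auto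
  then obtain M where M: "openin T M" "x \<in> M" "M \<subseteq> W \<inter> N" "\<And>y. y \<in> M \<Longrightarrow> l y = k y"
    using L_germ[OF o, of l k x] W N eq by auto
  then have "restrict s M = restrict t M" using W(5) N(5) by (intro restrict_ext) (metis IntE subsetD)
  then show "germ F x U s = germ F x V t"
    using U V W N M by (subst F.germ_eq_iff) (auto intro!: exI[of _ M])
qed

text \<open>The isomorphism is evaluation at \<open>x\<close>: injective because a germ is
  determined by its value, surjective by \<open>L_surj\<close>.\<close>

lemma F_stalk_iso:
  assumes x: "x \<in> topspace T"
  obtains e where "e \<in> ring_hom (stalk F x) (A x)" "bij_betw e (carrier (stalk F x)) (carrier (A x))"
    "\<And>U s. openin T U \<Longrightarrow> x \<in> U \<Longrightarrow> s \<in> C U \<Longrightarrow> e (germ F x U s) = s x"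
proof -
  define e where "e z = (THE a. \<exists>U s. openin T U \<and> x \<in> U \<and> s \<in> C U \<and> z = germ F x U s \<and> a = s x)" for z
  have e: "e (germ F x U s) = s x" if "openin T U" "x \<in> U" "s \<in> C U" for U s
    unfolding e_def by (rule the_equality) (use that F_germ_eq_iff in blast)+
  have rep: "\<exists>U s. openin T U \<and> x \<in> U \<and> s \<in> C U \<and> z = germ F x U s" if "z \<in> carrier (stalk F x)" for z
    using F.stalkE[OF that] by (metis F_top F_sec pointwise_ring_simps(1))
  have "e \<in> ring_hom (stalk F x) (A x)"
  proof (rule ring_hom_memI)
    show "e z \<in> carrier (A x)" if "z \<in> carrier (stalk F x)" for z
      using rep[OF that] e C_val by auto
    fix z w assume zw: "z \<in> carrier (stalk F x)" "w \<in> carrier (stalk F x)"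
    obtain U s t where U: "openin T U" "x \<in> U" "s \<in> C U" "t \<in> C U" "z = germ F x U s" "w = germ F x U t"
      using F.stalk_common2[OF zw] by (metis F_top F_sec pointwise_ring_simps(1))
    interpret S: cring "pointwise_ring U A (C U)" using C_cring U by blast
    show "e (z \<otimes>\<^bsub>stalk F x\<^esub> w) = e z \<otimes>\<^bsub>A x\<^esub> e w"
      using U S.m_closed[of s t] by (simp add: F.stalk_mult_germ e)
    show "e (z \<oplus>\<^bsub>stalk F x\<^esub> w) = e z \<oplus>\<^bsub>A x\<^esub> e w"
      using U S.a_closed[of s t] by (simp add: F.stalk_add_germ e)
  next
    interpret S: cring "pointwise_ring (topspace T) A (C (topspace T))" using C_cring by blast
    show "e \<one>\<^bsub>stalk F x\<^esub> = \<one>\<^bsub>A x\<^esub>"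
      using x S.one_closed by (simp add: F.stalk_one_germ[of "topspace T"] e)
  qed
  moreover have "inj_on e (carrier (stalk F x))"
  proof (rule inj_onI)
    fix z w assume zw: "z \<in> carrier (stalk F x)" "w \<in> carrier (stalk F x)" "e z = e w"
    obtain U s where U: "openin T U" "x \<in> U" "s \<in> C U" "z = germ F x U s" using rep[OF zw(1)] by blast
    obtain V t where V: "openin T V" "x \<in> V" "t \<in> C V" "w = germ F x V t" using rep[OF zw(2)] by blast
    show "z = w" using zw(3) e[OF U(1-3)] e[OF V(1-3)] F_germ_eq_iff[OF U(1-3) V(1-3)] U(4) V(4) by simp
  qed
  moreover have "a \<in> e ` carrier (stalk F x)" if a: "a \<in> carrier (A x)" for a
  proof -
    obtain U l where U: "openin T U" "x \<in> U" "l \<in> L U" "l x = a" using L_surj[OF x a] by blast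
    then have "e (germ F x U (restrict l U)) = a" using e[OF U(1,2) L_C] by simp
    then show ?thesis using F.germ_in_stalk[of U x "restrict l U"] U L_C by force
  qed
  ultimately show thesis using that[of e] e ring_hom_closed[of e "stalk F x" "A x"] by (auto simp: bij_betw_def)
qed

end

section \<open>Units and locality along bijective homomorphisms\<close>

lemma iso_reflects_Units:
  assumes e: "e \<in> ring_hom R S" "bij_betw e (carrier R) (carrier S)" and "cring R" "cring S" "a \<in> carrier R"
  shows "e a \<in> Units S \<longleftrightarrow> a \<in> Units R"
proof
  interpret R: cring R by fact
  interpret S: cring S by fact
  assume u: "e a \<in> Units S"
  then obtain b where b: "b \<in> carrier R" "e b = inv\<^bsub>S\<^esub> (e a)"
    using e(2) by (metis S.Units_inv_closed bij_betw_def imageE)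
  then have "e (a \<otimes>\<^bsub>R\<^esub> b) = e \<one>\<^bsub>R\<^esub>"
    using u assms(5) ring_hom_mult[OF e(1)] ring_hom_one[OF e(1)] by simp
  then have "a \<otimes>\<^bsub>R\<^esub> b = \<one>\<^bsub>R\<^esub>" using e(2) b assms(5) by (auto simp: bij_betw_def inj_on_def)
  then show "a \<in> Units R" using R.unitI assms(5) b by blast
qed (use ring_hom_Units'[OF e(1) assms(3,4)] in blast)

lemma local_ring_iso:
  assumes e: "e \<in> ring_hom R S" "bij_betw e (carrier R) (carrier S)" and "cring R" "local_ring S"
  shows "local_ring R"
proof -
  interpret R: cring R by fact
  note S = local_ringD[OF assms(4)]
  interpret S: cring S by (rule S)
  show ?thesis
  proof (rule R.local_ringI)
    show "\<one>\<^bsub>R\<^esub> \<noteq> \<zero>\<^bsub>R\<^esub>" using S(2) ring_hom_one[OF e(1)] ring_hom_zero'[OF e(1) R.is_cring S(1)] by auto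
    fix a assume a: "a \<in> carrier R"
    then show "a \<in> Units R \<or> \<one>\<^bsub>R\<^esub> \<ominus>\<^bsub>R\<^esub> a \<in> Units R"
      using S(3)[OF ring_hom_closed[OF e(1) a]] iso_reflects_Units[OF e R.is_cring S(1)]
        ring_hom_minus'[OF e(1) R.is_cring S(1) _ a, of "\<one>\<^bsub>R\<^esub>"] ring_hom_one[OF e(1)] R.minus_closed
      by (metis R.one_closed)
  qed
qed

context function_space
begin

lemma F_unit_iff:
  assumes U: "openin T U" "x \<in> U" "s \<in> C U"
  shows "germ F x U s \<in> Units (stalk F x) \<longleftrightarrow> s x \<in> Units (A x)"
proof -
  have x: "x \<in> topspace T" using U openin_subset by blast
  obtain e where e: "e \<in> ring_hom (stalk F x) (A x)" "bij_betw e (carrier (stalk F x)) (carrier (A x))"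
    "\<And>U s. openin T U \<Longrightarrow> x \<in> U \<Longrightarrow> s \<in> C U \<Longrightarrow> e (germ F x U s) = s x"
    using F_stalk_iso[OF x] by metis
  show ?thesis
    using iso_reflects_Units[OF e(1,2) F.stalk_cring A_cring[OF x], of "germ F x U s"] x U e(3)[OF U]
      F.germ_in_stalk[of U x s] by simp
qed

lemma F_locally_ringed:
  assumes "\<And>x. x \<in> topspace T \<Longrightarrow> local_ring (A x)"
  shows "locally_ringed_space F"
proof
  fix x assume "x \<in> pts F"
  then have x: "x \<in> topspace T" by simp
  obtain e where "e \<in> ring_hom (stalk F x) (A x)" "bij_betw e (carrier (stalk F x)) (carrier (A x))"
    using F_stalk_iso[OF x] by metis
  then show "local_ring (stalk F x)" using local_ring_iso F.stalk_cring assms[OF x] x by auto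
qed

end

section \<open>Morphisms\<close>

locale ringed_mor = X: ringed_space X + Y: ringed_space Y
  for X :: "('a, 'b) rspace" and Y :: "('c, 'd) rspace" +
  fixes f :: "('a, 'b, 'c, 'd) rs_mor"
  assumes mor: "ringed_morphism X Y f"
begin

lemma pt [simp]: "x \<in> pts X \<Longrightarrow> mor_pt f x \<in> pts Y"
  using mor by (auto simp: ringed_morphism_def continuous_map_def)

lemma preim_open [simp]: "opn Y V \<Longrightarrow> opn X (preim X f V)"
  using mor by (auto simp: ringed_morphism_def preim_def continuous_map_def)

lemma sec_hom: "opn Y V \<Longrightarrow> mor_sec f V \<in> ring_hom (rs_sec Y V) (rs_sec X (preim X f V))"
  using mor by (auto simp: ringed_morphism_def)

lemma sec_closed [simp]: "opn Y V \<Longrightarrow> s \<in> sec Y V \<Longrightarrow> mor_sec f V s \<in> sec X (preim X f V)"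
  using ring_hom_closed[OF sec_hom] .

lemma natural:
  "\<lbrakk>opn Y V; opn Y W; W \<subseteq> V; s \<in> sec Y V\<rbrakk> \<Longrightarrow>
    rs_res X (preim X f V) (preim X f W) (mor_sec f V s) = mor_sec f W (rs_res Y V W s)"
  using mor by (auto simp: ringed_morphism_def)

lemma preim_mono: "W \<subseteq> V \<Longrightarrow> preim X f W \<subseteq> preim X f V"
  by (auto simp: preim_def)

text \<open>\<open>stalk_map\<close> is a union over representatives; compatibility with
  restrictions makes all of them contribute the same germ.\<close>

lemma stalk_map_germ:
  assumes x: "x \<in> pts X" and V: "opn Y V" "mor_pt f x \<in> V" "t \<in> sec Y V"
  shows "stalk_map X f x (germ Y (mor_pt f x) V t) = germ X x (preim X f V) (mor_sec f V t)"
proof -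
  have "germ X x (preim X f W) (mor_sec f W s) = germ X x (preim X f V) (mor_sec f V t)"
    if m: "(W, s) \<in> germ Y (mor_pt f x) V t" for W s
  proof -
    note W = Y.germ_memD[OF m V]
    then obtain N where N: "opn Y N" "mor_pt f x \<in> N" "N \<subseteq> W \<inter> V" "rs_res Y W N s = rs_res Y V N t"
      using V by (subst (asm) Y.germ_eq_iff) auto
    have p: "x \<in> preim X f N" "x \<in> preim X f V" "x \<in> preim X f W" using x N V W by (auto simp: preim_def)
    have "rs_res X (preim X f W) (preim X f N) (mor_sec f W s)
        = rs_res X (preim X f V) (preim X f N) (mor_sec f V t)"
      using N W V by (simp add: natural)
    then show ?thesis
      using N W V p preim_mono[of N V] preim_mono[of N W]
      by (subst X.germ_eq_iff) (auto intro!: exI[of _ "preim X f N"])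
  qed
  then have "(case p of (W, s) \<Rightarrow> germ X x (preim X f W) (mor_sec f W s)) = germ X x (preim X f V) (mor_sec f V t)"
    if "p \<in> germ Y (mor_pt f x) V t" for p using that by (cases p) simp
  then show ?thesis unfolding stalk_map_def
    by (intro SUP_eq_const) (use Y.germ_self[OF V] in auto)
qed

lemma stalk_map_hom:
  assumes x: "x \<in> pts X"
  shows "stalk_map X f x \<in> ring_hom (stalk Y (mor_pt f x)) (stalk X x)"
proof (rule ring_hom_memI)
  have p: "x \<in> preim X f V" if "mor_pt f x \<in> V" for V using x that by (auto simp: preim_def)
  show "stalk_map X f x z \<in> carrier (stalk X x)" if "z \<in> carrier (stalk Y (mor_pt f x))" for z
    using that by (rule Y.stalkE) (simp add: stalk_map_germ x p)
  fix z w assume "z \<in> carrier (stalk Y (mor_pt f x))" "w \<in> carrier (stalk Y (mor_pt f x))"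
  then obtain V s t where V: "opn Y V" "mor_pt f x \<in> V" "s \<in> sec Y V" "t \<in> sec Y V"
    "z = germ Y (mor_pt f x) V s" "w = germ Y (mor_pt f x) V t"
    by (rule Y.stalk_common2)
  interpret V: cring "rs_sec Y V" using Y.sec_cring V by blast
  show "stalk_map X f x (z \<otimes>\<^bsub>stalk Y (mor_pt f x)\<^esub> w) = stalk_map X f x z \<otimes>\<^bsub>stalk X x\<^esub> stalk_map X f x w"
    using V x by (simp add: Y.stalk_mult_germ X.stalk_mult_germ stalk_map_germ p ring_hom_mult[OF sec_hom])
  show "stalk_map X f x (z \<oplus>\<^bsub>stalk Y (mor_pt f x)\<^esub> w) = stalk_map X f x z \<oplus>\<^bsub>stalk X x\<^esub> stalk_map X f x w"
    using V x by (simp add: Y.stalk_add_germ X.stalk_add_germ stalk_map_germ p ring_hom_add[OF sec_hom])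
next
  have "preim X f (pts Y) = pts X" using pt by (auto simp: preim_def)
  then show "stalk_map X f x \<one>\<^bsub>stalk Y (mor_pt f x)\<^esub> = \<one>\<^bsub>stalk X x\<^esub>"
    using x ring_hom_one[OF sec_hom[of "pts Y"]]
    by (simp add: Y.stalk_one_germ[of "pts Y"] X.stalk_one_germ[of "pts X"] stalk_map_germ)
qed

end

text \<open>In a local ring the maximal ideal is the complement of the units, so mapping one maximal
  ideal into the other means reflecting units. The locality checks below go through this
  form.\<close>

lemma lrs_morphism_iff:
  assumes "locally_ringed_space X" "locally_ringed_space Y" "ringed_morphism X Y f"
  shows "lrs_morphism X Y f \<longleftrightarrow> (\<forall>x \<in> pts X. \<forall>z \<in> carrier (stalk Y (mor_pt f x)).
    stalk_map X f x z \<in> Units (stalk X x) \<longrightarrow> z \<in> Units (stalk Y (mor_pt f x)))"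
proof -
  interpret X: locally_ringed_space X by fact
  interpret Y: locally_ringed_space Y by fact
  interpret ringed_mor X Y f by (unfold_locales) (rule assms)
  have "stalk_map X f x ` max_ideal (stalk Y (mor_pt f x)) \<subseteq> max_ideal (stalk X x) \<longleftrightarrow>
     (\<forall>z \<in> carrier (stalk Y (mor_pt f x)). stalk_map X f x z \<in> Units (stalk X x) \<longrightarrow> z \<in> Units (stalk Y (mor_pt f x)))"
    if x: "x \<in> pts X" for x
    using ring_hom_closed[OF stalk_map_hom[OF x]]
    by (auto simp: local_ringD(4)[OF X.stalk_local[OF x]] local_ringD(4)[OF Y.stalk_local[OF pt[OF x]]])
  then show ?thesis using assms(3) by (simp add: lrs_morphism_def)
qed

lemma mor_comp_simps [simp]:
  "mor_pt (mor_comp Y g f) x = mor_pt g (mor_pt f x)"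
  "mor_sec (mor_comp Y g f) W s = mor_sec f (preim Y g W) (mor_sec g W s)"
  by (simp_all add: mor_comp_def)

lemma mor_id_simps [simp]: "mor_pt mor_id x = x" "mor_sec mor_id W s = s"
  by (simp_all add: mor_id_def)

section \<open>Open subspaces\<close>

lemma open_sub_simps [simp]:
  "rs_sec (open_sub X V) = rs_sec X" "rs_res (open_sub X V) = rs_res X"
  by (simp_all add: open_sub_def)

lemma opn_open_sub: "opn X V \<Longrightarrow> opn (open_sub X V) W \<longleftrightarrow> opn X W \<and> W \<subseteq> V"
  by (simp add: open_sub_def openin_open_subtopology)

lemma pts_open_sub: "opn X V \<Longrightarrow> pts (open_sub X V) = V"
  using openin_subset[of "rs_top X" V] by (auto simp: open_sub_def)

context ringed_space
begin

lemma open_sub_ringed: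
  assumes V: "opn X V"
  shows "ringed_space (open_sub X V)"
proof (rule ringed_space.intro)
  fix \<U> \<sigma>
  assume "\<And>U. U \<in> \<U> \<Longrightarrow> opn (open_sub X V) U" "\<And>U. U \<in> \<U> \<Longrightarrow> \<sigma> U \<in> sec (open_sub X V) U"
    "\<And>U W. \<lbrakk>U \<in> \<U>; W \<in> \<U>\<rbrakk> \<Longrightarrow> rs_res (open_sub X V) U (U \<inter> W) (\<sigma> U) = rs_res (open_sub X V) W (U \<inter> W) (\<sigma> W)"
  then show "\<exists>!t. t \<in> sec (open_sub X V) (\<Union>\<U>) \<and> (\<forall>U\<in>\<U>. rs_res (open_sub X V) (\<Union>\<U>) U t = \<sigma> U)"
    unfolding opn_open_sub[OF V] open_sub_simps by (intro gluing) blast+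
qed (unfold opn_open_sub[OF V] open_sub_simps, auto simp: sec_cring res_hom res_id res_res)

text \<open>Germs in \<open>open_sub X V\<close> have fewer representatives than germs in
  \<open>X\<close>, so the two stalks differ as sets; invertibility is a statement about sections
  inside \<open>V\<close> and does not see this.\<close>

lemma open_sub_unit_iff:
  assumes V: "opn X V" and U: "opn X U" "U \<subseteq> V" "x \<in> U" "s \<in> sec X U"
  shows "germ (open_sub X V) x U s \<in> Units (stalk (open_sub X V) x) \<longleftrightarrow> germ X x U s \<in> Units (stalk X x)"
proof -
  interpret V: ringed_space "open_sub X V" by (rule open_sub_ringed[OF V])
  have o: "opn (open_sub X V) U" using U opn_open_sub[OF V] by blast
  show ?thesis
    unfolding germ_unit_iff[OF U(1,3,4)] V.germ_unit_iff[OF o U(3) U(4)[folded open_sub_simps(1)[of X V]]]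
      opn_open_sub[OF V] using U(2) by auto
qed

end

text \<open>The unit criterion for local rings passes from \<open>X\<close> to the open subspace
  germ by germ, since the unit germs are the same. A trivial stalk would make the zero germ a unit,
  and this is excluded in the same way.\<close>

lemma (in locally_ringed_space) open_sub_locally_ringed:
  assumes V: "opn X V"
  shows "locally_ringed_space (open_sub X V)"
proof (intro locally_ringed_space.intro locally_ringed_space_axioms.intro)
  show "ringed_space (open_sub X V)" by (rule open_sub_ringed[OF V])
  then interpret V: ringed_space "open_sub X V" .
  fix x assume "x \<in> pts (open_sub X V)"
  then have x: "x \<in> V" using pts_open_sub[OF V] by blast
  then have xX: "x \<in> pts X" using pts_open[OF V] by blast
  have oV: "opn (open_sub X V) V" using V opn_open_sub[OF V] by blast
  note loc = local_ringD[OF stalk_local[OF xX]]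
  interpret S: cring "stalk X x" by (rule loc)
  interpret SV: cring "stalk (open_sub X V) x" using V.stalk_cring' oV x by blast
  show "local_ring (stalk (open_sub X V) x)"
  proof (rule SV.local_ringI)
    show "\<one>\<^bsub>stalk (open_sub X V) x\<^esub> \<noteq> \<zero>\<^bsub>stalk (open_sub X V) x\<^esub>"
    proof
      assume "\<one>\<^bsub>stalk (open_sub X V) x\<^esub> = \<zero>\<^bsub>stalk (open_sub X V) x\<^esub>"
      then have "germ (open_sub X V) x V \<zero>\<^bsub>rs_sec X V\<^esub> \<in> Units (stalk (open_sub X V) x)"
        using V.stalk_zero_germ[OF oV x] SV.Units_one_closed by simp
      then have "germ X x V \<zero>\<^bsub>rs_sec X V\<^esub> \<in> Units (stalk X x)"
        using open_sub_unit_iff[OF V V order_refl x] V by simp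
      then have "\<zero>\<^bsub>stalk X x\<^esub> \<in> Units (stalk X x)" using stalk_zero_germ[OF V x] by simp
      then show False
        using S.Units_r_inv S.l_null[OF S.Units_inv_closed] loc(2) by metis
    qed
    fix a assume "a \<in> carrier (stalk (open_sub X V) x)"
    then obtain U s where U: "opn (open_sub X V) U" "x \<in> U" "s \<in> sec X U" "a = germ (open_sub X V) x U s"
      by (metis V.stalkE open_sub_simps(1))
    then have U': "opn X U" "U \<subseteq> V" using opn_open_sub[OF V] by blast+
    interpret U: cring "rs_sec X U" using sec_cring U' by blast
    have "germ X x U s \<in> Units (stalk X x) \<or> \<one>\<^bsub>stalk X x\<^esub> \<ominus>\<^bsub>stalk X x\<^esub> germ X x U s \<in> Units (stalk X x)"
      using loc(3) U U' by simp
    then have "germ X x U s \<in> Units (stalk X x) \<or> germ X x U (\<one>\<^bsub>rs_sec X U\<^esub> \<ominus>\<^bsub>rs_sec X U\<^esub> s) \<in> Units (stalk X x)"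
      using U U' by (simp add: germ_minus stalk_one_germ[of U])
    then show "a \<in> Units (stalk (open_sub X V) x) \<or> \<one>\<^bsub>stalk (open_sub X V) x\<^esub> \<ominus>\<^bsub>stalk (open_sub X V) x\<^esub> a \<in> Units (stalk (open_sub X V) x)"
      using open_sub_unit_iff[OF V U' U(2,3)] open_sub_unit_iff[OF V U' U(2) U.minus_closed[OF U.one_closed U(3)]]
        U V.germ_minus[OF U(1,2), of "\<one>\<^bsub>rs_sec X U\<^esub>" s]
        V.stalk_one_germ[OF U(1,2)] by simp
  qed
qed

section \<open>The spectrum of a ring\<close>

context primeideal
begin

lemma one_notin [simp]: "\<one> \<notin> I"
  using I_notcarr one_imp_carrier by blast

sublocale compl: mult_subset R "carrier R - I"
  by (rule mult_subset_compl)

lemma frac_unit_iff: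
  assumes "a \<in> carrier R" "s \<in> carrier R - I"
  shows "fraction R (carrier R - I) a s \<in> Units (local_at R I) \<longleftrightarrow> a \<notin> I"
proof
  interpret L: cring "local_at R I" by (rule compl.loc_cring)
  show "fraction R (carrier R - I) a s \<in> Units (local_at R I)" if "a \<notin> I"
    by (rule L.unitI[where b = "fraction R (carrier R - I) s a"])
      (use assms that in \<open>simp_all add: compl.loc_one m_comm\<close>, rule compl.fraction_eqI',
        auto dest: I_prime)
  assume u: "fraction R (carrier R - I) a s \<in> Units (local_at R I)"
  then obtain b t where b: "b \<in> carrier R" "t \<in> carrier R - I"
    "inv\<^bsub>local_at R I\<^esub> (fraction R (carrier R - I) a s) = fraction R (carrier R - I) b t"
    using L.Units_inv_closed compl.loc_carrierE by metis
  then have "fraction R (carrier R - I) a s \<otimes>\<^bsub>local_at R I\<^esub> fraction R (carrier R - I) b t = \<one>\<^bsub>local_at R I\<^esub>"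
    using L.Units_r_inv[OF u] by simp
  then have "fraction R (carrier R - I) (a \<otimes> b) (s \<otimes> t) = fraction R (carrier R - I) \<one> \<one>"
    using assms b compl.loc_mult[of a b s t] by (simp add: compl.loc_one)
  then obtain v where v: "v \<in> carrier R - I" "v \<otimes> (\<one> \<otimes> (a \<otimes> b)) = v \<otimes> ((s \<otimes> t) \<otimes> \<one>)"
    using assms b compl.S_mult[of s t] compl.S_one by (auto simp: compl.fraction_eq_iff)
  have "v \<otimes> (s \<otimes> t) \<notin> I" using compl.S_mult v(1) assms b by blast
  then have "v \<otimes> (a \<otimes> b) \<notin> I" using v assms b by simp
  then show "a \<notin> I" using assms(1) b v I_r_closed I_l_closed by blast
qed

lemma local_at_local: "local_ring (local_at R I)"
proof -
  interpret L: cring "local_at R I" by (rule compl.loc_cring)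
  show ?thesis
  proof (rule L.local_ringI)
    show "\<one>\<^bsub>local_at R I\<^esub> \<noteq> \<zero>\<^bsub>local_at R I\<^esub>"
      unfolding compl.loc_one using compl.loc_eq_zero_iff[of \<one> \<one>] by auto
    fix x assume "x \<in> carrier (local_at R I)"
    then obtain a s where x: "a \<in> carrier R" "s \<in> carrier R - I" "x = fraction R (carrier R - I) a s"
      by (rule compl.loc_carrierE)
    show "x \<in> Units (local_at R I) \<or> \<one>\<^bsub>local_at R I\<^esub> \<ominus>\<^bsub>local_at R I\<^esub> x \<in> Units (local_at R I)"
    proof (cases "a \<in> I")
      case True
      \<comment> \<open>For \<open>a \<in> I\<close> the element \<open>1 - a / s\<close> is
        \<open>(s - a) / s\<close>, and its numerator is outside \<open>I\<close> because
        \<open>s\<close> is.\<close>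
      let ?y = "fraction R (carrier R - I) (s \<ominus> a) s"
      have n: "s \<ominus> a \<notin> I"
      proof
        assume "s \<ominus> a \<in> I"
        then have "(s \<ominus> a) \<oplus> a \<in> I" using True a_closed by blast
        moreover have "(s \<ominus> a) \<oplus> a = s" using x(1) x(2)[THEN DiffD1] by algebra
        ultimately show False using x by simp
      qed
      have "(s \<ominus> a) \<otimes> s \<oplus> a \<otimes> s = s \<otimes> s" using x(1) x(2)[THEN DiffD1] by algebra
      then have "?y \<oplus>\<^bsub>local_at R I\<^esub> x = \<one>\<^bsub>local_at R I\<^esub>"
        using x by (simp add: compl.loc_one) (rule compl.fraction_eqI', auto dest: I_prime)
      moreover have "?y \<in> carrier (local_at R I)" "x \<in> carrier (local_at R I)" using x by auto
      ultimately have "\<one>\<^bsub>local_at R I\<^esub> \<ominus>\<^bsub>local_at R I\<^esub> x = ?y"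
        by (metis L.minus_eq L.add.inv_solve_right L.one_closed)
      then show ?thesis using frac_unit_iff[of "s \<ominus> a" s] n x by simp
    qed (use x frac_unit_iff in auto)
  qed
qed

end

definition basic_open :: "('r, 'm) ring_scheme \<Rightarrow> 'r \<Rightarrow> 'r set set" where
  "basic_open R f = {p \<in> prime_spec R. f \<notin> p}"

lemma openin_basic_open: "f \<in> carrier R \<Longrightarrow> openin (zariski R) (basic_open R f)"
  unfolding zariski_def basic_open_def by (rule topology_generated_by_Basis) blast

lemma topspace_zariski:
  fixes R (structure)
  shows "cring R \<Longrightarrow> topspace (zariski R) = prime_spec R"
proof -
  assume "cring R"
  then interpret cring R .
  have "basic_open R \<one> = prime_spec R"
    using primeideal.one_notin by (auto simp: basic_open_def prime_spec_def)
  then show ?thesis by (auto simp: zariski_def topology_generated_by_topspace basic_open_def)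
qed

text \<open>The generating sets are closed under binary intersections, because D(f) \<inter> D(g) =
  D(f g) by primality; hence they form a basis and not merely a subbasis.\<close>

lemma zariski_basis:
  fixes R (structure)
  assumes R: "cring R" and W: "openin (zariski R) W" "p \<in> W"
  obtains f where "f \<in> carrier R" "p \<in> basic_open R f" "basic_open R f \<subseteq> W"
proof -
  interpret cring R by (rule R)
  have "generate_topology_on {{p \<in> prime_spec R. f \<notin> p} |f. f \<in> carrier R} W"
    using W(1) by (simp add: zariski_def openin_topology_generated_by_iff)
  then have "\<forall>p\<in>W. \<exists>f\<in>carrier R. p \<in> basic_open R f \<and> basic_open R f \<subseteq> W"
  proof induction
    case (Int A B)
    show ?case
    proof
      fix p assume p: "p \<in> A \<inter> B"
      obtain f where f: "f \<in> carrier R" "p \<in> basic_open R f" "basic_open R f \<subseteq> A" using Int(3) p by blast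
      obtain g where g: "g \<in> carrier R" "p \<in> basic_open R g" "basic_open R g \<subseteq> B" using Int(4) p by blast
      have *: "f \<otimes> g \<notin> q \<longleftrightarrow> f \<notin> q \<and> g \<notin> q" if "primeideal q R" for q
        using primeideal.I_prime[OF that f(1) g(1)] primeideal.axioms(1)[OF that] f g
          ideal.I_l_closed ideal.I_r_closed by metis
      then have "basic_open R (f \<otimes> g) = basic_open R f \<inter> basic_open R g"
        by (auto simp: basic_open_def prime_spec_def)
      then show "\<exists>f\<in>carrier R. p \<in> basic_open R f \<and> basic_open R f \<subseteq> A \<inter> B"
        using f g by (intro bexI[of _ "f \<otimes> g"]) auto
    qed
  next
    case (UN K)
    then show ?case by (meson UnionE UnionI Union_upper subset_trans)
  next
    case (Basis s)
    then show ?case by (auto simp: basic_open_def)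
  qed simp
  then show thesis using W(2) that by blast
qed

definition spec_fractions :: "('r, 'm) ring_scheme \<Rightarrow> 'r set set \<Rightarrow> ('r set \<Rightarrow> ('r \<times> 'r) set) set" where
  "spec_fractions R W = {l. \<exists>a\<in>carrier R. \<exists>f\<in>carrier R. \<forall>q\<in>W. f \<notin> q \<and> l q = fraction R (carrier R - q) a f}"

locale spectrum = cring R for R :: "('r, 'm) ring_scheme" (structure)
begin

lemma mult_subset_q: "openin (zariski R) W \<Longrightarrow> q \<in> W \<Longrightarrow> primeideal q R"
  using openin_subset[of "zariski R" W] topspace_zariski[OF is_cring] by (auto simp: prime_spec_def)

lemma fractions_op:
  assumes W: "openin (zariski R) W" and l: "l \<in> spec_fractions R W" and k: "k \<in> spec_fractions R W"
  shows "(\<lambda>q. l q \<oplus>\<^bsub>local_at R q\<^esub> k q) \<in> spec_fractions R W"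
    and "(\<lambda>q. l q \<otimes>\<^bsub>local_at R q\<^esub> k q) \<in> spec_fractions R W"
    and "(\<lambda>q. \<ominus>\<^bsub>local_at R q\<^esub> l q) \<in> spec_fractions R W"
proof -
  obtain a f where a: "a \<in> carrier R" "f \<in> carrier R" "\<And>q. q \<in> W \<Longrightarrow> f \<notin> q \<and> l q = fraction R (carrier R - q) a f"
    using l by (auto simp: spec_fractions_def)
  obtain b g where b: "b \<in> carrier R" "g \<in> carrier R" "\<And>q. q \<in> W \<Longrightarrow> g \<notin> q \<and> k q = fraction R (carrier R - q) b g"
    using k by (auto simp: spec_fractions_def)
  have op: "f \<otimes> g \<notin> q \<and> l q \<oplus>\<^bsub>local_at R q\<^esub> k q = fraction R (carrier R - q) (a \<otimes> g \<oplus> b \<otimes> f) (f \<otimes> g)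
    \<and> l q \<otimes>\<^bsub>local_at R q\<^esub> k q = fraction R (carrier R - q) (a \<otimes> b) (f \<otimes> g)
    \<and> \<ominus>\<^bsub>local_at R q\<^esub> l q = fraction R (carrier R - q) (\<ominus> a) f" if q: "q \<in> W" for q
  proof -
    interpret q: primeideal q R using mult_subset_q[OF W q] .
    interpret L: cring "local_at R q" by (rule q.compl.loc_cring)
    have "fraction R (carrier R - q) (\<ominus> a) f \<oplus>\<^bsub>local_at R q\<^esub> l q = \<zero>\<^bsub>local_at R q\<^esub>"
      using a q by (simp add: q.compl.loc_zero l_minus l_neg) (rule q.compl.fraction_eqI', auto dest: q.I_prime)
    then have "\<ominus>\<^bsub>local_at R q\<^esub> l q = fraction R (carrier R - q) (\<ominus> a) f"
      using a q by (intro L.minus_equality) auto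
    then show ?thesis using a b q q.I_prime[of f g] by auto
  qed
  show "(\<lambda>q. l q \<oplus>\<^bsub>local_at R q\<^esub> k q) \<in> spec_fractions R W"
    unfolding spec_fractions_def
    by (rule CollectI, rule bexI[of _ "a \<otimes> g \<oplus> b \<otimes> f"], rule bexI[of _ "f \<otimes> g"]) (use a(1,2) b(1,2) op in auto)
  show "(\<lambda>q. l q \<otimes>\<^bsub>local_at R q\<^esub> k q) \<in> spec_fractions R W"
    unfolding spec_fractions_def
    by (rule CollectI, rule bexI[of _ "a \<otimes> b"], rule bexI[of _ "f \<otimes> g"]) (use a(1,2) b(1,2) op in auto)
  show "(\<lambda>q. \<ominus>\<^bsub>local_at R q\<^esub> l q) \<in> spec_fractions R W"
    unfolding spec_fractions_def
    by (rule CollectI, rule bexI[of _ "\<ominus> a"], rule bexI[of _ f]) (use a op in auto)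
qed

sublocale frac: local_functions "zariski R" "local_at R" "spec_fractions R"
proof (rule local_functions.intro)
  show "cring (local_at R q)" if "q \<in> topspace (zariski R)" for q
    using that mult_subset_q[of "topspace (zariski R)"] mult_subset.loc_cring primeideal.mult_subset_compl by blast
  fix U assume U: "openin (zariski R) U"
  show "spec_fractions R U \<subseteq> spec_fractions R V" if "openin (zariski R) V" "V \<subseteq> U" for V
    using that unfolding spec_fractions_def by blast
  note one = primeideal.one_notin[OF mult_subset_q[OF U]]
  show "(\<lambda>x. \<one>\<^bsub>local_at R x\<^esub>) \<in> spec_fractions R U"
    unfolding spec_fractions_def localization_def
    by (rule CollectI, rule bexI[of _ \<one>], rule bexI[of _ \<one>]) (use one in auto)
  show "(\<lambda>x. \<zero>\<^bsub>local_at R x\<^esub>) \<in> spec_fractions R U"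
    unfolding spec_fractions_def localization_def
    by (rule CollectI, rule bexI[of _ \<zero>], rule bexI[of _ \<one>]) (use one in auto)
  fix l assume l: "l \<in> spec_fractions R U"
  show "l x \<in> carrier (local_at R x)" if "x \<in> U" for x
  proof -
    interpret x: primeideal x R using mult_subset_q[OF U that] .
    show ?thesis using l that by (auto simp: spec_fractions_def)
  qed
  show "(\<lambda>x. \<ominus>\<^bsub>local_at R x\<^esub> l x) \<in> spec_fractions R U" using fractions_op(3)[OF U l l] .
  fix k assume k: "k \<in> spec_fractions R U"
  show "(\<lambda>x. l x \<oplus>\<^bsub>local_at R x\<^esub> k x) \<in> spec_fractions R U" "(\<lambda>x. l x \<otimes>\<^bsub>local_at R x\<^esub> k x) \<in> spec_fractions R U"
    using fractions_op[OF U l k] by auto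
  fix x assume x: "x \<in> U" "l x = k x"
  interpret x: primeideal x R using mult_subset_q[OF U x(1)] .
  obtain a f where a: "a \<in> carrier R" "f \<in> carrier R" "\<And>q. q \<in> U \<Longrightarrow> f \<notin> q \<and> l q = fraction R (carrier R - q) a f"
    using l by (auto simp: spec_fractions_def)
  obtain b g where b: "b \<in> carrier R" "g \<in> carrier R" "\<And>q. q \<in> U \<Longrightarrow> g \<notin> q \<and> k q = fraction R (carrier R - q) b g"
    using k by (auto simp: spec_fractions_def)
  \<comment> \<open>Equality of the two fractions at \<open>x\<close> is witnessed by one element
    \<open>u\<close> outside \<open>x\<close>, and the same \<open>u\<close> witnesses it at every
    prime of \<open>U\<close> that does not contain \<open>u\<close>.\<close>
  obtain u where u: "u \<in> carrier R" "u \<notin> x" "u \<otimes> (g \<otimes> a) = u \<otimes> (f \<otimes> b)"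
    using x a b by (auto simp: x.compl.fraction_eq_iff)
  have "l y = k y" if y: "y \<in> U \<inter> basic_open R u" for y
  proof -
    interpret y: primeideal y R using mult_subset_q[OF U] y by blast
    have "u \<in> carrier R - y" using u(1) y by (simp add: basic_open_def)
    moreover have "f \<in> carrier R - y" "g \<in> carrier R - y" using a(2) b(2) a(3)[of y] b(3)[of y] y by auto
    ultimately have "fraction R (carrier R - y) a f = fraction R (carrier R - y) b g"
      using y.compl.fraction_eq_iff[OF a(1) b(1)] u(3) by blast
    then show ?thesis using a(3)[of y] b(3)[of y] y by simp
  qed
  then show "\<exists>W. openin (zariski R) W \<and> x \<in> W \<and> W \<subseteq> U \<and> (\<forall>y\<in>W. l y = k y)"
    using U x u openin_basic_open[OF u(1)] x.primeideal
    by (intro exI[of _ "U \<inter> basic_open R u"]) (auto simp: basic_open_def prime_spec_def)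
next
  fix x c assume x: "x \<in> topspace (zariski R)" "c \<in> carrier (local_at R x)"
  interpret x: primeideal x R using mult_subset_q[of "topspace (zariski R)"] x by blast
  obtain a s where "a \<in> carrier R" "s \<in> carrier R - x" "c = fraction R (carrier R - x) a s"
    using x(2) by (rule x.compl.loc_carrierE)
  then show "\<exists>U l. openin (zariski R) U \<and> x \<in> U \<and> l \<in> spec_fractions R U \<and> l x = c"
    using openin_basic_open[of s R] x.primeideal
    by (intro exI[of _ "basic_open R s"] exI[of _ "\<lambda>q. fraction R (carrier R - q) a s"])
      (auto simp: basic_open_def prime_spec_def spec_fractions_def)
qed

lemma spec_sections_eq: "spec_sections R U = frac.C U"
proof -
  have "(\<exists>W a f. openin (zariski R) W \<and> p \<in> W \<and> W \<subseteq> U \<and> a \<in> carrier R \<and> f \<in> carrier R \<and>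
       (\<forall>q \<in> W. f \<notin> q \<and> s q = fraction R (carrier R - q) a f)) \<longleftrightarrow>
     (\<exists>W l. openin (zariski R) W \<and> p \<in> W \<and> W \<subseteq> U \<and> l \<in> spec_fractions R W \<and> (\<forall>y \<in> W. s y = l y))"
    (is "?l \<longleftrightarrow> ?r") for p s
  proof
    assume ?l
    then obtain W a f where "openin (zariski R) W" "p \<in> W" "W \<subseteq> U" "a \<in> carrier R" "f \<in> carrier R"
       "\<forall>q \<in> W. f \<notin> q \<and> s q = fraction R (carrier R - q) a f" by blast
    then show ?r by (intro exI[of _ W] exI[of _ s]) (auto simp: spec_fractions_def)
  next
    assume ?r
    then obtain W l where W: "openin (zariski R) W" "p \<in> W" "W \<subseteq> U" "l \<in> spec_fractions R W" "\<forall>y \<in> W. s y = l y"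
      by blast
    then obtain a f where "a \<in> carrier R" "f \<in> carrier R" "\<forall>q\<in>W. f \<notin> q \<and> l q = fraction R (carrier R - q) a f"
      by (auto simp: spec_fractions_def)
    with W(1-3,5) show ?l by (intro exI[of _ W] exI[of _ a] exI[of _ f] conjI ballI) simp_all
  qed
  then show ?thesis unfolding spec_sections_def frac.C_def by simp
qed

sublocale Spec: function_space "zariski R" "local_at R" "spec_fractions R" "Spec R"
  by unfold_locales (simp_all add: Spec_def spec_sections_eq)

lemma Spec_locally_ringed: "locally_ringed_space (Spec R)"
proof (rule Spec.F_locally_ringed)
  show "local_ring (local_at R q)" if "q \<in> topspace (zariski R)" for q
    using that topspace_zariski[OF is_cring] by (intro primeideal.local_at_local) (simp add: prime_spec_def)
qed

end

section \<open>Quotient rings\<close>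

context ideal
begin

lemma quot_carrierE:
  assumes "c \<in> carrier (R Quot I)"
  obtains a where "a \<in> carrier R" "c = I +> a"
  using assms by (auto simp: FactRing_def A_RCOSETS_def' a_r_coset_def')

lemma quot_eq_iff: "a \<in> carrier R \<Longrightarrow> b \<in> carrier R \<Longrightarrow> I +> a = I +> b \<longleftrightarrow> a \<ominus> b \<in> I"
  using quotient_eq_iff_same_a_r_cos[OF is_ideal] by blast

lemma quot_zero_iff: "a \<in> carrier R \<Longrightarrow> I +> a = \<zero>\<^bsub>R Quot I\<^esub> \<longleftrightarrow> a \<in> I"
  using quot_eq_iff[of a \<zero>] ring_hom_zero[OF rcos_ring_hom ring_axioms quotient_is_ring]
  by (simp add: minus_eq)

lemma quot_lift:
  assumes S: "cring S" and R: "cring R" and h: "h \<in> ring_hom R S" and ker: "\<And>a. a \<in> I \<Longrightarrow> h a = \<zero>\<^bsub>S\<^esub>"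
  obtains \<mu> where "\<mu> \<in> ring_hom (R Quot I) S" "\<And>a. a \<in> carrier R \<Longrightarrow> \<mu> (I +> a) = h a"
proof -
  interpret S: cring S by (rule S)
  define \<mu> where "\<mu> c = h (SOME a. a \<in> carrier R \<and> c = I +> a)" for c
  have \<mu>: "\<mu> (I +> a) = h a" if a: "a \<in> carrier R" for a
  proof -
    let ?b = "SOME b. b \<in> carrier R \<and> I +> a = I +> b"
    have b: "?b \<in> carrier R \<and> I +> a = I +> ?b" by (rule someI[of _ a]) (use a in simp)
    then have "h (a \<ominus> ?b) = \<zero>\<^bsub>S\<^esub>" using quot_eq_iff[OF a, of ?b] ker by simp
    then have "h a \<ominus>\<^bsub>S\<^esub> h ?b = \<zero>\<^bsub>S\<^esub>" using ring_hom_minus'[OF h R S a, of ?b] b by simp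
    from S.minus_eq_zeroD[OF this] have "h a = h ?b" using ring_hom_closed[OF h] a b by blast
    then show ?thesis unfolding \<mu>_def by (rule sym)
  qed
  note hs = rcos_ring_hom[THEN ring_hom_mult, symmetric] rcos_ring_hom[THEN ring_hom_add, symmetric]
  have "\<mu> \<in> ring_hom (R Quot I) S"
  proof (rule ring_hom_memI)
    show "\<mu> c \<in> carrier S" if "c \<in> carrier (R Quot I)" for c
      using that by (rule quot_carrierE) (simp add: \<mu> ring_hom_closed[OF h])
    fix c d assume "c \<in> carrier (R Quot I)" "d \<in> carrier (R Quot I)"
    then obtain a b where "a \<in> carrier R" "c = I +> a" "b \<in> carrier R" "d = I +> b" by (metis quot_carrierE)
    then show "\<mu> (c \<otimes>\<^bsub>R Quot I\<^esub> d) = \<mu> c \<otimes>\<^bsub>S\<^esub> \<mu> d" "\<mu> (c \<oplus>\<^bsub>R Quot I\<^esub> d) = \<mu> c \<oplus>\<^bsub>S\<^esub> \<mu> d"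
      by (simp_all add: hs \<mu> ring_hom_mult[OF h] ring_hom_add[OF h])
  next
    show "\<mu> \<one>\<^bsub>R Quot I\<^esub> = \<one>\<^bsub>S\<^esub>"
      using \<mu>[OF one_closed] ring_hom_one[OF rcos_ring_hom] ring_hom_one[OF h] by simp
  qed
  then show thesis using that \<mu> by blast
qed

text \<open>Elements congruent to \<open>\<one>\<close> modulo a proper ideal of a local ring are
  units, so invertibility modulo \<open>I\<close> already forces invertibility. Thus being nonzero
  at a point means the same on a closed subspace and on the ambient space.\<close>

lemma quot_local:
  assumes R: "local_ring R" and one: "\<one> \<notin> I"
  shows "local_ring (R Quot I)"
    and "a \<in> carrier R \<Longrightarrow> I +> a \<in> Units (R Quot I) \<longleftrightarrow> a \<in> Units R"
proof -
  note loc = local_ringD[OF R]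
  interpret R: cring R by (rule loc)
  interpret Q: cring "R Quot I" by (rule quotient_is_cring[OF R.is_cring])
  show unit: "I +> a \<in> Units (R Quot I) \<longleftrightarrow> a \<in> Units R" if a: "a \<in> carrier R" for a
  proof
    assume u: "I +> a \<in> Units (R Quot I)"
    obtain b where b: "b \<in> carrier R" "inv\<^bsub>R Quot I\<^esub> (I +> a) = I +> b"
      using Q.Units_inv_closed[OF u] by (rule quot_carrierE)
    then have "I +> (a \<otimes> b) = I +> \<one>"
      using Q.Units_r_inv[OF u] a ring_hom_mult[OF rcos_ring_hom] ring_hom_one[OF rcos_ring_hom] by simp
    then have m: "a \<otimes> b \<ominus> \<one> \<in> I" using quot_eq_iff a b by simp
    have "a \<otimes> b \<in> Units R"
    proof (rule ccontr)
      assume "a \<otimes> b \<notin> Units R"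
      then have n: "\<one> \<ominus> a \<otimes> b \<in> Units R" using loc(3)[of "a \<otimes> b"] a b by simp
      have "\<one> \<ominus> a \<otimes> b = \<ominus> (a \<otimes> b \<ominus> \<one>)" using a b(1) by algebra
      then have "\<one> \<ominus> a \<otimes> b \<in> I" using m a_inv_closed by simp
      then have "inv (\<one> \<ominus> a \<otimes> b) \<otimes> (\<one> \<ominus> a \<otimes> b) \<in> I" using n I_l_closed by blast
      then show False using n one by simp
    qed
    then show "a \<in> Units R" using R.unit_factors a b by blast
  next
    assume "a \<in> Units R"
    then show "I +> a \<in> Units (R Quot I)" by (rule ring_hom_Units'[OF rcos_ring_hom R.is_cring Q.is_cring])
  qed
  show "local_ring (R Quot I)"
  proof (rule Q.local_ringI)
    show "\<one>\<^bsub>R Quot I\<^esub> \<noteq> \<zero>\<^bsub>R Quot I\<^esub>"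
      using quot_zero_iff[OF one_closed] ring_hom_one[OF rcos_ring_hom] one by simp
    fix c assume "c \<in> carrier (R Quot I)"
    then obtain a where a: "a \<in> carrier R" "c = I +> a" by (rule quot_carrierE)
    have "\<one>\<^bsub>R Quot I\<^esub> \<ominus>\<^bsub>R Quot I\<^esub> c = I +> (\<one> \<ominus> a)"
      using ring_hom_minus'[OF rcos_ring_hom R.is_cring Q.is_cring one_closed a(1)] ring_hom_one[OF rcos_ring_hom] a by simp
    then show "c \<in> Units (R Quot I) \<or> \<one>\<^bsub>R Quot I\<^esub> \<ominus>\<^bsub>R Quot I\<^esub> c \<in> Units (R Quot I)"
      using loc(3)[OF a(1)] a unit by simp
  qed
qed

end

section \<open>Morphisms to sheaves of functions\<close>

text \<open>A continuous map \<open>\<pi>\<close> and homomorphisms \<open>\<mu>\<close> of stalks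
  give a morphism as soon as members of \<open>L\<close> pull back locally to sections, which is
  condition \<open>loc\<close>. It suffices to check local functions, since all sections of
  \<open>F\<close> are locally of this kind.\<close>

lemma (in function_space) induced_morphism:
  assumes X: "ringed_space X" and cont: "continuous_map (rs_top X) T \<pi>"
    and hom: "\<And>x. x \<in> pts X \<Longrightarrow> \<mu> x \<in> ring_hom (A (\<pi> x)) (stalk X x)"
    and loc: "\<And>W l x. \<lbrakk>openin T W; l \<in> L W; x \<in> pts X; \<pi> x \<in> W\<rbrakk> \<Longrightarrow>
      \<exists>N s. opn X N \<and> x \<in> N \<and> N \<subseteq> {y \<in> pts X. \<pi> y \<in> W} \<and> s \<in> sec X N \<and> (\<forall>z\<in>N. germ X z N s = \<mu> z (l (\<pi> z)))"
  obtains f where "ringed_morphism X F f" "mor_pt f = \<pi>"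
    "\<And>W \<sigma> x. \<lbrakk>openin T W; \<sigma> \<in> C W; x \<in> pts X; \<pi> x \<in> W\<rbrakk> \<Longrightarrow> germ X x (preim X f W) (mor_sec f W \<sigma>) = \<mu> x (\<sigma> (\<pi> x))"
proof -
  interpret X: ringed_space X by (rule X)
  let ?P = "\<lambda>W. {y \<in> pts X. \<pi> y \<in> W}"
  \<comment> \<open>The pulled back section is the unique one with the prescribed germs. Existence
    and uniqueness come from \<open>glue_germs\<close>, and each ring law becomes an identity
    between germs.\<close>
  define g where "g W \<sigma> = (THE t. t \<in> sec X (?P W) \<and> (\<forall>z\<in>?P W. germ X z (?P W) t = \<mu> z (\<sigma> (\<pi> z))))" for W \<sigma>
  have Po: "opn X (?P W)" if "openin T W" for W
    using cont that by (simp add: continuous_map_def)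
  have g: "g W \<sigma> \<in> sec X (?P W)" "\<And>z. z \<in> ?P W \<Longrightarrow> germ X z (?P W) (g W \<sigma>) = \<mu> z (\<sigma> (\<pi> z))"
    if W: "openin T W" and \<sigma>: "\<sigma> \<in> C W" for W \<sigma>
  proof -
    have "\<exists>!t. t \<in> sec X (?P W) \<and> (\<forall>z\<in>?P W. germ X z (?P W) t = \<mu> z (\<sigma> (\<pi> z)))"
    proof (rule X.glue_germs[OF Po[OF W]])
      fix x assume x: "x \<in> ?P W"
      obtain V l where V: "openin T V" "\<pi> x \<in> V" "V \<subseteq> W" "l \<in> L V" "\<And>y. y \<in> V \<Longrightarrow> \<sigma> y = l y"
        using C_locE[OF \<sigma>, of "\<pi> x"] x by blast
      obtain N s where "opn X N" "x \<in> N" "N \<subseteq> ?P V" "s \<in> sec X N" "\<forall>z\<in>N. germ X z N s = \<mu> z (l (\<pi> z))"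
        using loc[OF V(1,4) _ V(2)] x by blast
      with V show "\<exists>N s. opn X N \<and> x \<in> N \<and> N \<subseteq> ?P W \<and> s \<in> sec X N \<and> (\<forall>z\<in>N. germ X z N s = \<mu> z (\<sigma> (\<pi> z)))"
        by (intro exI[of _ N] exI[of _ s]) auto
    qed
    from theI'[OF this] show "g W \<sigma> \<in> sec X (?P W)" "\<And>z. z \<in> ?P W \<Longrightarrow> germ X z (?P W) (g W \<sigma>) = \<mu> z (\<sigma> (\<pi> z))"
      unfolding g_def by auto
  qed
  define f :: "(_, _, _, _) rs_mor" where "f = \<lparr>mor_pt = \<pi>, mor_sec = g\<rparr>"
  have f: "mor_pt f = \<pi>" "mor_sec f = g" "\<And>W. preim X f W = ?P W" by (auto simp: f_def preim_def)
  have "ringed_morphism X F f"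
    unfolding ringed_morphism_def f
  proof (intro conjI allI impI ballI)
    show "continuous_map (rs_top X) (rs_top F) \<pi>" using cont by simp
    fix W assume "opn F W"
    then have W: "openin T W" by simp
    note Pc = X.sec_cring[OF Po[OF W]]
    interpret P: cring "rs_sec X (?P W)" by (rule Pc)
    interpret CW: cring "pointwise_ring W A (C W)" by (rule C_cring[OF W])
    show "g W \<in> ring_hom (rs_sec F W) (rs_sec X (?P W))"
    proof (rule ring_hom_memI)
      show "g W \<sigma> \<in> sec X (?P W)" if "\<sigma> \<in> sec F W" for \<sigma> using g that W by simp
      have *: "g W \<rho> = r" if "\<rho> \<in> C W" "r \<in> sec X (?P W)" "\<And>z. z \<in> ?P W \<Longrightarrow> germ X z (?P W) r = \<mu> z (\<rho> (\<pi> z))" for \<rho> r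
        by (rule X.section_eqI[OF Po[OF W]]) (use g[OF W that(1)] that in auto)
      note h = ring_hom_mult[OF hom] ring_hom_add[OF hom] ring_hom_one[OF hom]
      show "g W \<one>\<^bsub>rs_sec F W\<^esub> = \<one>\<^bsub>rs_sec X (?P W)\<^esub>"
        by (rule *) (use W CW.one_closed X.stalk_one_germ[OF Po[OF W]] h in \<open>auto simp: \<close>)
      fix \<sigma> \<tau> assume "\<sigma> \<in> sec F W" "\<tau> \<in> sec F W"
      then have st: "\<sigma> \<in> C W" "\<tau> \<in> C W" using W by auto
      show "g W (\<sigma> \<otimes>\<^bsub>rs_sec F W\<^esub> \<tau>) = g W \<sigma> \<otimes>\<^bsub>rs_sec X (?P W)\<^esub> g W \<tau>"
      proof (rule *)
        show "\<sigma> \<otimes>\<^bsub>rs_sec F W\<^esub> \<tau> \<in> C W" using CW.m_closed[of \<sigma> \<tau>] st W by simp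
        show "g W \<sigma> \<otimes>\<^bsub>rs_sec X (?P W)\<^esub> g W \<tau> \<in> sec X (?P W)" using g[OF W] st by simp
        show "germ X z (?P W) (g W \<sigma> \<otimes>\<^bsub>rs_sec X (?P W)\<^esub> g W \<tau>) = \<mu> z ((\<sigma> \<otimes>\<^bsub>rs_sec F W\<^esub> \<tau>) (\<pi> z))" if z: "z \<in> ?P W" for z
          using X.stalk_mult_germ[OF Po[OF W] z g(1)[OF W st(1)] g(1)[OF W st(2)], symmetric] z g(2)[OF W] st W C_val
          by (simp add: h)
      qed
      show "g W (\<sigma> \<oplus>\<^bsub>rs_sec F W\<^esub> \<tau>) = g W \<sigma> \<oplus>\<^bsub>rs_sec X (?P W)\<^esub> g W \<tau>"
      proof (rule *)
        show "\<sigma> \<oplus>\<^bsub>rs_sec F W\<^esub> \<tau> \<in> C W" using CW.a_closed[of \<sigma> \<tau>] st W by simp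
        show "g W \<sigma> \<oplus>\<^bsub>rs_sec X (?P W)\<^esub> g W \<tau> \<in> sec X (?P W)" using g[OF W] st by simp
        show "germ X z (?P W) (g W \<sigma> \<oplus>\<^bsub>rs_sec X (?P W)\<^esub> g W \<tau>) = \<mu> z ((\<sigma> \<oplus>\<^bsub>rs_sec F W\<^esub> \<tau>) (\<pi> z))" if z: "z \<in> ?P W" for z
          using X.stalk_add_germ[OF Po[OF W] z g(1)[OF W st(1)] g(1)[OF W st(2)], symmetric] z g(2)[OF W] st W C_val
          by (simp add: h)
      qed
    qed
  next
    fix W V s assume "opn F W \<and> opn F V \<and> V \<subseteq> W" "s \<in> sec F W"
    then have W: "openin T W" "openin T V" "V \<subseteq> W" "s \<in> C W" by auto
    have sub: "?P V \<subseteq> ?P W" using W by auto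
    have sV: "restrict s V \<in> C V" using C_restrict W by blast
    show "rs_res X (?P W) (?P V) (g W s) = g V (rs_res F W V s)"
    proof (rule X.section_eqI[OF Po[OF W(2)]])
      show "rs_res X (?P W) (?P V) (g W s) \<in> sec X (?P V)" using Po W g sub by simp
      show "g V (rs_res F W V s) \<in> sec X (?P V)" using g[OF W(2) sV] by simp
      fix z assume z: "z \<in> ?P V"
      then show "germ X z (?P V) (rs_res X (?P W) (?P V) (g W s)) = germ X z (?P V) (g V (rs_res F W V s))"
        using X.germ_res[OF Po Po sub z g(1)] W g(2)[OF W(1,4), of z] g(2)[OF W(2) sV, of z] by auto
    qed
  qed
  moreover have "germ X x (preim X f W) (mor_sec f W \<sigma>) = \<mu> x (\<sigma> (\<pi> x))"
    if "openin T W" "\<sigma> \<in> C W" "x \<in> pts X" "\<pi> x \<in> W" for W \<sigma> x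
    using g(2)[OF that(1,2), of x] that unfolding f by simp
  ultimately show thesis using that f by blast
qed

section \<open>Closed subspaces\<close>

locale ideal_space = locally_ringed_space X for X :: "('a, 'b) rspace" +
  fixes J :: "'a set \<Rightarrow> 'b set"
  assumes J: "ideal_sheaf X J"
begin

lemma J_ideal: "opn X U \<Longrightarrow> ideal (J U) (rs_sec X U)"
  and J_res: "\<lbrakk>opn X U; opn X V; V \<subseteq> U; s \<in> J U\<rbrakk> \<Longrightarrow> rs_res X U V s \<in> J V"
  using J[unfolded ideal_sheaf_def, THEN conjunct1]
    J[unfolded ideal_sheaf_def, THEN conjunct2, THEN conjunct1, rule_format, of U V] by auto

lemma J_local:
  "\<lbrakk>opn X U; s \<in> sec X U; \<And>x. x \<in> U \<Longrightarrow> \<exists>V. opn X V \<and> x \<in> V \<and> V \<subseteq> U \<and> rs_res X U V s \<in> J V\<rbrakk> \<Longrightarrow> s \<in> J U"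
  using J[unfolded ideal_sheaf_def, THEN conjunct2, THEN conjunct2, rule_format] by blast

lemma J_sec: "opn X U \<Longrightarrow> s \<in> J U \<Longrightarrow> s \<in> sec X U"
  using ideal.Icarr[OF J_ideal] .

abbreviation "Jst x \<equiv> stalk_ideal X J x"

lemma JstI: "\<lbrakk>opn X U; x \<in> U; s \<in> J U\<rbrakk> \<Longrightarrow> germ X x U s \<in> Jst x"
  by (auto simp: stalk_ideal_def)

lemma JstE:
  assumes "z \<in> Jst x"
  obtains U s where "opn X U" "x \<in> U" "s \<in> J U" "z = germ X x U s"
  using assms by (auto simp: stalk_ideal_def)

lemma Jst_germ_iff:
  assumes U: "opn X U" "x \<in> U" "s \<in> sec X U"
  shows "germ X x U s \<in> Jst x \<longleftrightarrow> (\<exists>W. opn X W \<and> x \<in> W \<and> W \<subseteq> U \<and> rs_res X U W s \<in> J W)"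
proof
  assume "germ X x U s \<in> Jst x"
  then obtain V t where V: "opn X V" "x \<in> V" "t \<in> J V" "germ X x U s = germ X x V t" by (rule JstE)
  obtain W where W: "opn X W" "x \<in> W" "W \<subseteq> U" "W \<subseteq> V" "rs_res X U W s = rs_res X V W t"
    by (rule germ_eq_nbhd[OF U V(1,2) J_sec[OF V(1,3)] V(4)])
  then show "\<exists>W. opn X W \<and> x \<in> W \<and> W \<subseteq> U \<and> rs_res X U W s \<in> J W" using J_res[OF V(1) W(1,4) V(3)] by auto
next
  assume "\<exists>W. opn X W \<and> x \<in> W \<and> W \<subseteq> U \<and> rs_res X U W s \<in> J W"
  then show "germ X x U s \<in> Jst x" using JstI germ_res U by metis
qed

lemma Jst_ideal:
  assumes x: "x \<in> pts X"
  shows "ideal (Jst x) (stalk X x)"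
proof -
  interpret S: cring "stalk X x" by (rule stalk_cring[OF x])
  show ?thesis
  proof (rule S.idealI')
    show "Jst x \<subseteq> carrier (stalk X x)" using J_sec by (auto elim!: JstE)
    show "\<zero>\<^bsub>stalk X x\<^esub> \<in> Jst x"
      using x JstI[of "pts X" x "\<zero>\<^bsub>rs_sec X (pts X)\<^esub>"] J_ideal[of "pts X"]
      by (simp add: stalk_zero_germ[of "pts X"] ideal.axioms(1) additive_subgroup.zero_closed)
    fix a assume "a \<in> Jst x"
    then obtain U s where U: "opn X U" "x \<in> U" "s \<in> J U" "a = germ X x U s" by (rule JstE)
    show "b \<otimes>\<^bsub>stalk X x\<^esub> a \<in> Jst x" if b: "b \<in> carrier (stalk X x)" for b
    proof -
      obtain V t where V: "opn X V" "x \<in> V" "V \<subseteq> U" "t \<in> sec X V" "b = germ X x V t"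
        using b U(1,2) by (rule stalk_nbhdE)
      have r: "rs_res X U V s \<in> J V" using J_res U V by blast
      then have "t \<otimes>\<^bsub>rs_sec X V\<^esub> rs_res X U V s \<in> J V" using ideal.I_l_closed[OF J_ideal] V by blast
      moreover have "b \<otimes>\<^bsub>stalk X x\<^esub> a = germ X x V (t \<otimes>\<^bsub>rs_sec X V\<^esub> rs_res X U V s)"
        using U V J_sec r by (simp flip: stalk_mult_germ) (simp add: germ_res)
      ultimately show ?thesis using JstI V by simp
    qed
    fix b assume "b \<in> Jst x"
    then obtain V t where V: "opn X V" "x \<in> V" "t \<in> J V" "b = germ X x V t" by (rule JstE)
    have o: "opn X (U \<inter> V)" "x \<in> U \<inter> V" using U V by auto
    have r: "rs_res X U (U \<inter> V) s \<in> J (U \<inter> V)" "rs_res X V (U \<inter> V) t \<in> J (U \<inter> V)" using J_res o U V by auto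
    then have "rs_res X U (U \<inter> V) s \<oplus>\<^bsub>rs_sec X (U \<inter> V)\<^esub> rs_res X V (U \<inter> V) t \<in> J (U \<inter> V)"
      using additive_subgroup.a_closed[OF ideal.axioms(1)[OF J_ideal]] o by blast
    moreover have "a \<oplus>\<^bsub>stalk X x\<^esub> b = germ X x (U \<inter> V) (rs_res X U (U \<inter> V) s \<oplus>\<^bsub>rs_sec X (U \<inter> V)\<^esub> rs_res X V (U \<inter> V) t)"
      using U V J_sec r o by (simp flip: stalk_add_germ) (simp add: germ_res)
    ultimately show "a \<oplus>\<^bsub>stalk X x\<^esub> b \<in> Jst x" using JstI o by simp
  qed
qed

text \<open>The local condition in \<open>ideal_sheaf\<close> makes membership a stalkwise matter,
  so an ideal sheaf can be handled through its stalks \<open>Jst\<close>.\<close>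

lemma J_iff:
  assumes U: "opn X U" "s \<in> sec X U"
  shows "s \<in> J U \<longleftrightarrow> (\<forall>x\<in>U. germ X x U s \<in> Jst x)"
  using JstI[OF U(1)] J_local[OF U] Jst_germ_iff[OF U(1) _ U(2)] by blast

lemma supp_iff: "x \<in> supp X J \<longleftrightarrow> x \<in> pts X \<and> \<one>\<^bsub>stalk X x\<^esub> \<notin> Jst x"
proof (cases "x \<in> pts X")
  case True
  interpret ideal "Jst x" "stalk X x" by (rule Jst_ideal[OF True])
  show ?thesis using True one_imp_carrier by (auto simp: supp_def)
qed (auto simp: supp_def)

lemma supp_pts: "x \<in> supp X J \<Longrightarrow> x \<in> pts X"
  by (simp add: supp_def)

end

context ideal_space
begin

section \<open>The structure sheaf of a closed subspace\<close>

lemma quot_cring: "x \<in> pts X \<Longrightarrow> cring (quot_stalk X J x)"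
  using ideal.quotient_is_cring[OF Jst_ideal stalk_cring] .

lemma qg_hom:
  assumes U: "opn X U" "x \<in> U"
  shows "quot_germ X J x U \<in> ring_hom (rs_sec X U) (quot_stalk X J x)"
proof -
  have "(+>\<^bsub>stalk X x\<^esub>) (Jst x) \<circ> germ X x U \<in> ring_hom (rs_sec X U) (quot_stalk X J x)"
    using germ_hom[OF U] ideal.rcos_ring_hom[OF Jst_ideal[OF pts_open[OF U]]] by (rule ring_hom_trans)
  then show ?thesis by (simp add: comp_def quot_germ_def[abs_def])
qed

lemma qg_mem: "\<lbrakk>opn X U; x \<in> U; s \<in> sec X U\<rbrakk> \<Longrightarrow> quot_germ X J x U s \<in> carrier (quot_stalk X J x)"
  using ring_hom_closed[OF qg_hom] .

lemma qg_res: "\<lbrakk>opn X U; opn X W; W \<subseteq> U; x \<in> W; s \<in> sec X U\<rbrakk> \<Longrightarrow>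
    quot_germ X J x W (rs_res X U W s) = quot_germ X J x U s"
  by (simp add: quot_germ_def germ_res)

lemma qg_eq_iff:
  assumes "opn X U" "x \<in> U" "s \<in> sec X U" "opn X V" "x \<in> V" "t \<in> sec X V"
  shows "quot_germ X J x U s = quot_germ X J x V t \<longleftrightarrow> germ X x U s \<ominus>\<^bsub>stalk X x\<^esub> germ X x V t \<in> Jst x"
  unfolding quot_germ_def using assms
  by (intro ideal.quot_eq_iff[OF Jst_ideal[OF pts_open[OF assms(1,2)]]]) auto

lemma qg_zero_iff:
  assumes "opn X U" "x \<in> U" "s \<in> sec X U"
  shows "quot_germ X J x U s = \<zero>\<^bsub>quot_stalk X J x\<^esub> \<longleftrightarrow> germ X x U s \<in> Jst x"
  unfolding quot_germ_def using assms
  by (intro ideal.quot_zero_iff[OF Jst_ideal[OF pts_open[OF assms(1,2)]]]) auto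

text \<open>The difference of the two sections has its germ at \<open>x\<close> in
  \<open>Jst x\<close>, hence lies in \<open>J\<close> near \<open>x\<close>. This provides the
  axiom \<open>L_germ\<close> for the quotient sheaf.\<close>

lemma qg_eq_nbhd:
  assumes U: "opn X U" "x \<in> U" "s \<in> sec X U" and V: "opn X V" "x \<in> V" "t \<in> sec X V"
    and eq: "quot_germ X J x U s = quot_germ X J x V t"
  obtains W where "opn X W" "x \<in> W" "W \<subseteq> U" "W \<subseteq> V"
    "\<And>y. y \<in> W \<Longrightarrow> quot_germ X J y U s = quot_germ X J y V t"
proof -
  let ?N = "U \<inter> V"
  have N: "opn X ?N" using U V by auto
  interpret N: cring "rs_sec X ?N" by (rule sec_cring[OF N])
  let ?d = "rs_res X U ?N s \<ominus>\<^bsub>rs_sec X ?N\<^esub> rs_res X V ?N t"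
  have sN: "rs_res X U ?N s \<in> sec X ?N" "rs_res X V ?N t \<in> sec X ?N" using U V N by auto
  then have d: "?d \<in> sec X ?N" by simp
  have g: "germ X y ?N ?d = germ X y U s \<ominus>\<^bsub>stalk X y\<^esub> germ X y V t" if "y \<in> ?N" for y
    using germ_minus[OF N that sN] germ_res[OF U(1) N _ that U(3)] germ_res[OF V(1) N _ that V(3)] by simp
  have "germ X x ?N ?d \<in> Jst x" using eq g U V by (simp add: qg_eq_iff)
  then obtain W where W: "opn X W" "x \<in> W" "W \<subseteq> ?N" "rs_res X ?N W ?d \<in> J W"
    using Jst_germ_iff[OF N _ d, of x] U V by blast
  have "quot_germ X J y U s = quot_germ X J y V t" if y: "y \<in> W" for y
  proof -
    have "germ X y ?N ?d \<in> Jst y" using JstI[OF W(1) y W(4)] germ_res[OF N W(1,3) y d] by simp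
    moreover have "y \<in> ?N" using y W by blast
    ultimately show ?thesis using g[of y] U V qg_eq_iff[of U y s V t] by simp
  qed
  with W that show thesis by auto
qed

text \<open>The intended \<open>W\<close> is open only in the support, so the section that induces
  \<open>l\<close> lives on some open set \<open>U\<close> of \<open>X\<close> containing
  \<open>W\<close>.\<close>

definition quot_L :: "'a set \<Rightarrow> ('a \<Rightarrow> ('a set \<times> 'b) set set) set" where
  "quot_L W = {l. \<exists>U t. opn X U \<and> W \<subseteq> U \<and> t \<in> sec X U \<and> (\<forall>y\<in>W. l y = quot_germ X J y U t)}"

lemma quot_LE:
  assumes "l \<in> quot_L W"
  obtains U t where "opn X U" "W \<subseteq> U" "t \<in> sec X U" "\<And>y. y \<in> W \<Longrightarrow> l y = quot_germ X J y U t"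
  using assms by (auto simp: quot_L_def)

lemma quot_LI: "\<lbrakk>opn X U; W \<subseteq> U; t \<in> sec X U; \<And>y. y \<in> W \<Longrightarrow> l y = quot_germ X J y U t\<rbrakk> \<Longrightarrow> l \<in> quot_L W"
  by (auto simp: quot_L_def)

lemma quot_L_op:
  assumes l: "l \<in> quot_L W" and k: "k \<in> quot_L W"
  shows "(\<lambda>x. l x \<oplus>\<^bsub>quot_stalk X J x\<^esub> k x) \<in> quot_L W" "(\<lambda>x. l x \<otimes>\<^bsub>quot_stalk X J x\<^esub> k x) \<in> quot_L W"
    "(\<lambda>x. \<ominus>\<^bsub>quot_stalk X J x\<^esub> l x) \<in> quot_L W"
proof -
  obtain U t where U: "opn X U" "W \<subseteq> U" "t \<in> sec X U" "\<And>y. y \<in> W \<Longrightarrow> l y = quot_germ X J y U t"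
    using l by (rule quot_LE) blast
  obtain V s where V: "opn X V" "W \<subseteq> V" "s \<in> sec X V" "\<And>y. y \<in> W \<Longrightarrow> k y = quot_germ X J y V s"
    using k by (rule quot_LE) blast
  have N: "opn X (U \<inter> V)" using U V by auto
  interpret N: cring "rs_sec X (U \<inter> V)" by (rule sec_cring[OF N])
  let ?t = "rs_res X U (U \<inter> V) t" and ?s = "rs_res X V (U \<inter> V) s"
  have c: "?t \<in> sec X (U \<inter> V)" "?s \<in> sec X (U \<inter> V)" using U V N by auto
  have y: "y \<in> U \<inter> V" "l y = quot_germ X J y (U \<inter> V) ?t" "k y = quot_germ X J y (U \<inter> V) ?s" if "y \<in> W" for y
  proof -
    show y: "y \<in> U \<inter> V" using that U(2) V(2) by blast
    show "l y = quot_germ X J y (U \<inter> V) ?t" using U(4)[OF that] qg_res[OF U(1) N _ y U(3)] by simp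
    show "k y = quot_germ X J y (U \<inter> V) ?s" using V(4)[OF that] qg_res[OF V(1) N _ y V(3)] by simp
  qed
  show "(\<lambda>x. l x \<oplus>\<^bsub>quot_stalk X J x\<^esub> k x) \<in> quot_L W"
    by (rule quot_LI[OF N, of _ "?t \<oplus>\<^bsub>rs_sec X (U \<inter> V)\<^esub> ?s"])
      (use U(2) V(2) c y ring_hom_add[OF qg_hom[OF N]] in auto)
  show "(\<lambda>x. l x \<otimes>\<^bsub>quot_stalk X J x\<^esub> k x) \<in> quot_L W"
    by (rule quot_LI[OF N, of _ "?t \<otimes>\<^bsub>rs_sec X (U \<inter> V)\<^esub> ?s"])
      (use U(2) V(2) c y ring_hom_mult[OF qg_hom[OF N]] in auto)
  show "(\<lambda>x. \<ominus>\<^bsub>quot_stalk X J x\<^esub> l x) \<in> quot_L W"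
    by (rule quot_LI[OF N, of _ "\<ominus>\<^bsub>rs_sec X (U \<inter> V)\<^esub> ?t"])
      (use U(2) V(2) c y ring_hom_uminus'[OF qg_hom[OF N] N.is_cring quot_cring] pts_open[OF N] in auto)
qed

sublocale quot: local_functions "subtopology (rs_top X) (supp X J)" "quot_stalk X J" quot_L
proof (rule local_functions.intro)
  show "cring (quot_stalk X J x)" if "x \<in> topspace (subtopology (rs_top X) (supp X J))" for x
    using that quot_cring by simp
  fix W assume W: "openin (subtopology (rs_top X) (supp X J)) W"
  then have Wp: "W \<subseteq> pts X" "W \<subseteq> supp X J" using openin_subset by fastforce+
  show "quot_L W \<subseteq> quot_L V" if "V \<subseteq> W" for V using that unfolding quot_L_def by blast
  have p: "opn X (pts X)" by simp
  show "(\<lambda>x. \<one>\<^bsub>quot_stalk X J x\<^esub>) \<in> quot_L W"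
    by (rule quot_LI[OF p Wp(1), of "\<one>\<^bsub>rs_sec X (pts X)\<^esub>"]) (use Wp ring_hom_one[OF qg_hom[OF p]] in auto)
  show "(\<lambda>x. \<zero>\<^bsub>quot_stalk X J x\<^esub>) \<in> quot_L W"
    by (rule quot_LI[OF p Wp(1), of "\<zero>\<^bsub>rs_sec X (pts X)\<^esub>"])
      (use Wp ring_hom_zero'[OF qg_hom[OF p] sec_cring[OF p] quot_cring] in auto)
  fix l assume l: "l \<in> quot_L W"
  show "l x \<in> carrier (quot_stalk X J x)" if "x \<in> W" for x
    using l by (rule quot_LE) (use that qg_mem in auto)
  show "(\<lambda>x. \<ominus>\<^bsub>quot_stalk X J x\<^esub> l x) \<in> quot_L W" using quot_L_op(3)[OF l l] .
  fix k assume k: "k \<in> quot_L W"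
  show "(\<lambda>x. l x \<oplus>\<^bsub>quot_stalk X J x\<^esub> k x) \<in> quot_L W" "(\<lambda>x. l x \<otimes>\<^bsub>quot_stalk X J x\<^esub> k x) \<in> quot_L W"
    using quot_L_op[OF l k] by auto
  fix x assume x: "x \<in> W" "l x = k x"
  obtain U t where U: "opn X U" "W \<subseteq> U" "t \<in> sec X U" "\<And>y. y \<in> W \<Longrightarrow> l y = quot_germ X J y U t"
    using l by (rule quot_LE) blast
  obtain V s where V: "opn X V" "W \<subseteq> V" "s \<in> sec X V" "\<And>y. y \<in> W \<Longrightarrow> k y = quot_germ X J y V s"
    using k by (rule quot_LE) blast
  obtain N where N: "opn X N" "x \<in> N" "N \<subseteq> U" "N \<subseteq> V" "\<And>y. y \<in> N \<Longrightarrow> quot_germ X J y U t = quot_germ X J y V s"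
    by (rule qg_eq_nbhd[OF U(1) subsetD[OF U(2) x(1)] U(3) V(1) subsetD[OF V(2) x(1)] V(3)])
      (use U(4)[OF x(1)] V(4)[OF x(1)] x(2) in auto)
  have "openin (subtopology (rs_top X) (supp X J)) (N \<inter> supp X J)"
    using N(1) by (auto simp: openin_subtopology)
  then have "openin (subtopology (rs_top X) (supp X J)) (N \<inter> supp X J \<inter> W)" using W by blast
  then show "\<exists>V. openin (subtopology (rs_top X) (supp X J)) V \<and> x \<in> V \<and> V \<subseteq> W \<and> (\<forall>y\<in>V. l y = k y)"
    using x Wp N U(4) V(4) by (intro exI[of _ "N \<inter> supp X J \<inter> W"]) auto
next
  fix x c assume x: "x \<in> topspace (subtopology (rs_top X) (supp X J))" "c \<in> carrier (quot_stalk X J x)"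
  then have xs: "x \<in> supp X J" "x \<in> pts X" by auto
  obtain z where z: "z \<in> carrier (stalk X x)" "c = Jst x +>\<^bsub>stalk X x\<^esub> z"
    using x(2) by (rule ideal.quot_carrierE[OF Jst_ideal[OF xs(2)]])
  obtain U s where U: "opn X U" "x \<in> U" "s \<in> sec X U" "z = germ X x U s" using z(1) by (rule stalkE)
  show "\<exists>W l. openin (subtopology (rs_top X) (supp X J)) W \<and> x \<in> W \<and> l \<in> quot_L W \<and> l x = c"
  proof (intro exI conjI)
    show "openin (subtopology (rs_top X) (supp X J)) (U \<inter> supp X J)" using U by (auto simp: openin_subtopology)
    show "(\<lambda>y. quot_germ X J y U s) \<in> quot_L (U \<inter> supp X J)" by (rule quot_LI[OF U(1) _ U(3)]) auto
    show "quot_germ X J x U s = c" using z U by (simp add: quot_germ_def)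
  qed (use U xs in auto)
qed

lemma quot_sections_eq:
  assumes W: "W \<subseteq> supp X J"
  shows "quot_sections X J W = quot.C W"
proof -
  have "(\<exists>U t. opn X U \<and> x \<in> U \<and> U \<inter> supp X J \<subseteq> W \<and> t \<in> sec X U \<and>
       (\<forall>y \<in> U \<inter> supp X J. s y = quot_germ X J y U t)) \<longleftrightarrow>
     (\<exists>V l. openin (subtopology (rs_top X) (supp X J)) V \<and> x \<in> V \<and> V \<subseteq> W \<and> l \<in> quot_L V \<and> (\<forall>y \<in> V. s y = l y))"
    (is "?l \<longleftrightarrow> ?r") if x: "x \<in> W" for x s
  proof
    assume ?l
    then obtain U t where U: "opn X U" "x \<in> U" "U \<inter> supp X J \<subseteq> W" "t \<in> sec X U"
      "\<forall>y \<in> U \<inter> supp X J. s y = quot_germ X J y U t" by blast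
    then have "s \<in> quot_L (U \<inter> supp X J)" by (intro quot_LI[OF U(1) _ U(4)]) auto
    with U x W show ?r by (intro exI[of _ "U \<inter> supp X J"] exI[of _ s]) (auto simp: openin_subtopology)
  next
    assume ?r
    then obtain V l where V: "openin (subtopology (rs_top X) (supp X J)) V" "x \<in> V" "V \<subseteq> W" "l \<in> quot_L V"
      "\<forall>y \<in> V. s y = l y" by blast
    obtain U t where U: "opn X U" "V \<subseteq> U" "t \<in> sec X U" "\<And>y. y \<in> V \<Longrightarrow> l y = quot_germ X J y U t"
      using V(4) by (rule quot_LE) blast
    obtain N where N: "opn X N" "V = N \<inter> supp X J" using V(1) by (auto simp: openin_subtopology)
    have o: "opn X (U \<inter> N)" using U N by auto
    show ?l
      by (intro exI[of _ "U \<inter> N"] exI[of _ "rs_res X U (U \<inter> N) t"])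
        (use U N V o in \<open>auto simp: qg_res\<close>)
  qed
  then show ?thesis unfolding quot_sections_def quot.C_def by (intro Collect_cong conj_cong ball_cong refl) auto
qed

abbreviation "B \<equiv> closed_sub X J"
abbreviation "\<iota> \<equiv> closed_incl X J"

sublocale B: function_space "subtopology (rs_top X) (supp X J)" "quot_stalk X J" quot_L "closed_sub X J"
proof (intro function_space.intro quot.local_functions_axioms function_space_axioms.intro)
  fix W assume "openin (subtopology (rs_top X) (supp X J)) W"
  then have "W \<subseteq> supp X J" using openin_subset by fastforce
  then show "rs_sec B W = pointwise_ring W (quot_stalk X J) (quot.C W)"
    using quot_sections_eq by (simp add: closed_sub_def)
qed (simp_all add: closed_sub_def)

lemma pts_B [simp]: "pts B = supp X J"
  using supp_pts by auto

lemma opn_B: "opn B W \<longleftrightarrow> (\<exists>U. opn X U \<and> W = U \<inter> supp X J)"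
  by (auto simp: openin_subtopology)

lemma opn_BI [simp]: "opn X U \<Longrightarrow> openin (subtopology (rs_top X) (supp X J)) (U \<inter> supp X J)"
  by (auto simp: openin_subtopology)

lemma B_locally_ringed: "locally_ringed_space B"
proof (rule B.F_locally_ringed)
  fix x assume "x \<in> topspace (subtopology (rs_top X) (supp X J))"
  then have "x \<in> pts X" "\<one>\<^bsub>stalk X x\<^esub> \<notin> Jst x" using supp_iff by auto
  then show "local_ring (quot_stalk X J x)" using ideal.quot_local(1)[OF Jst_ideal stalk_local] by blast
qed

lemma incl_simps [simp]: "mor_pt \<iota> x = x" "mor_sec \<iota> U t = (\<lambda>x \<in> U \<inter> supp X J. quot_germ X J x U t)"
  by (simp_all add: closed_incl_def)

lemma preim_incl [simp]: "preim B \<iota> U = U \<inter> supp X J"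
  using pts_B by (auto simp: preim_def simp del: B.F_top)

lemma incl_sec: "opn X U \<Longrightarrow> t \<in> sec X U \<Longrightarrow> mor_sec \<iota> U t \<in> quot.C (U \<inter> supp X J)"
  unfolding incl_simps by (intro quot.L_C quot_LI[of U]) auto

lemma incl_ringed: "ringed_morphism B X \<iota>"
  unfolding ringed_morphism_def preim_incl
proof (intro conjI allI impI ballI)
  show "continuous_map (rs_top B) (rs_top X) (mor_pt \<iota>)"
    by (simp add: closed_incl_def continuous_map_from_subtopology)
  fix U assume U: "opn X U"
  have UW: "openin (subtopology (rs_top X) (supp X J)) (U \<inter> supp X J)" using U by simp
  interpret U: cring "rs_sec X U" by (rule sec_cring[OF U])
  note h = ring_hom_mult[OF qg_hom] ring_hom_add[OF qg_hom] ring_hom_one[OF qg_hom]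
  show "mor_sec \<iota> U \<in> ring_hom (rs_sec X U) (rs_sec B (U \<inter> supp X J))"
    by (rule ring_hom_memI) (use U UW incl_sec in \<open>auto simp: h fun_eq_iff restrict_def\<close>)
next
  fix V W s assume "opn X V \<and> opn X W \<and> W \<subseteq> V" "s \<in> sec X V"
  then show "rs_res B (V \<inter> supp X J) (W \<inter> supp X J) (mor_sec \<iota> V s) = mor_sec \<iota> W (rs_res X V W s)"
    by (auto simp: fun_eq_iff restrict_def qg_res)
qed

sublocale incl: ringed_mor "closed_sub X J" X "closed_incl X J"
  by (intro ringed_mor.intro B.F_ringed ringed_space_axioms ringed_mor_axioms.intro incl_ringed)

lemma incl_stalk_map:
  assumes "opn X U" "x \<in> U" "x \<in> supp X J" "s \<in> sec X U"
  shows "stalk_map B \<iota> x (germ X x U s) = germ B x (U \<inter> supp X J) (mor_sec \<iota> U s)"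
  using incl.stalk_map_germ[of x U s] assms pts_B by (simp del: incl_simps(2) B.F_top)

text \<open>Lifts germs of the closed subspace to \<open>X\<close>: near \<open>x\<close> every
  section of the quotient sheaf is induced by a section of \<open>X\<close>.\<close>

lemma B_stalkE:
  assumes "z \<in> carrier (stalk B x)"
  obtains U s where "opn X U" "x \<in> U" "x \<in> supp X J" "s \<in> sec X U" "z = stalk_map B \<iota> x (germ X x U s)"
proof -
  obtain W \<sigma> where W: "opn B W" "x \<in> W" "\<sigma> \<in> sec B W" "z = germ B x W \<sigma>"
    using assms by (rule B.F.stalkE)
  have xs: "x \<in> supp X J" using B.F.pts_open[OF W(1,2)] by simp
  have o: "openin (subtopology (rs_top X) (supp X J)) W" and \<sigma>: "\<sigma> \<in> quot.C W" using W by auto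
  obtain V l where V: "openin (subtopology (rs_top X) (supp X J)) V" "x \<in> V" "V \<subseteq> W" "l \<in> quot_L V"
    "\<And>y. y \<in> V \<Longrightarrow> \<sigma> y = l y" using quot.C_locE[OF \<sigma> W(2)] by metis
  obtain U t where U: "opn X U" "V \<subseteq> U" "t \<in> sec X U" "\<And>y. y \<in> V \<Longrightarrow> l y = quot_germ X J y U t"
    using V(4) by (rule quot_LE) blast
  have xU: "x \<in> U" using U V by blast
  have "germ B x W \<sigma> = germ B x (U \<inter> supp X J) (mor_sec \<iota> U t)"
    using o W(2) \<sigma> U xU xs V by (subst B.F_germ_eq_iff) (auto intro: incl_sec[unfolded incl_simps])
  then show thesis using that[of U t] U xU xs W(4) incl_stalk_map[of U x t] by simp
qed

text \<open>Evaluation identifies the stalk of the closed subspace with the quotient by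
  \<open>Jst x\<close>. The kernel is then \<open>Jst x\<close>, and units are reflected because a
  nontrivial quotient of a local ring acquires no new ones.\<close>

lemma incl_germ_eq_iff:
  assumes "x \<in> supp X J" "z \<in> carrier (stalk X x)"
  shows "stalk_map B \<iota> x z = \<zero>\<^bsub>stalk B x\<^esub> \<longleftrightarrow> z \<in> Jst x"
    and "stalk_map B \<iota> x z \<in> Units (stalk B x) \<longleftrightarrow> z \<in> Units (stalk X x)"
proof -
  obtain U s where U: "opn X U" "x \<in> U" "s \<in> sec X U" "z = germ X x U s" using assms(2) by (rule stalkE)
  have x: "x \<in> pts X" "\<one>\<^bsub>stalk X x\<^esub> \<notin> Jst x" using assms(1) supp_iff by auto
  have o: "openin (subtopology (rs_top X) (supp X J)) (U \<inter> supp X J)" using U by simp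
  have v: "mor_sec \<iota> U s x = quot_germ X J x U s" using U assms by simp
  have z: "stalk_map B \<iota> x z = germ B x (U \<inter> supp X J) (mor_sec \<iota> U s)"
    using incl_stalk_map U assms by simp
  interpret C: cring "pointwise_ring (U \<inter> supp X J) (quot_stalk X J) (quot.C (U \<inter> supp X J))" by (rule quot.C_cring[OF o])
  have "\<zero>\<^bsub>stalk B x\<^esub> = germ B x (U \<inter> supp X J) (\<lambda>y\<in>U \<inter> supp X J. \<zero>\<^bsub>quot_stalk X J y\<^esub>)"
    using B.F.stalk_zero_germ[of "U \<inter> supp X J" x] o U assms by simp
  then show "stalk_map B \<iota> x z = \<zero>\<^bsub>stalk B x\<^esub> \<longleftrightarrow> z \<in> Jst x"
    using z v B.F_germ_eq_iff[OF o _ incl_sec[OF U(1,3)] o _ , of x "\<lambda>y\<in>U \<inter> supp X J. \<zero>\<^bsub>quot_stalk X J y\<^esub>"] C.zero_closed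
      U assms qg_zero_iff[OF U(1-3)] by simp
  show "stalk_map B \<iota> x z \<in> Units (stalk B x) \<longleftrightarrow> z \<in> Units (stalk X x)"
    using z v B.F_unit_iff[OF o _ incl_sec[OF U(1,3)], of x] U assms
      ideal.quot_local(2)[OF Jst_ideal[OF x(1)] stalk_local[OF x(1)] x(2) assms(2)]
    by (simp add: quot_germ_def)
qed

lemma incl_lrs: "lrs_morphism B X \<iota>"
  using lrs_morphism_iff[OF B_locally_ringed locally_ringed_space_axioms incl_ringed] incl_germ_eq_iff(2) pts_B
  by (simp del: B.F_top)

section \<open>The universal property of a closed subspace\<close>

lemma kills_if_factors:
  assumes f: "factors_through T X t B \<iota>" and T: "locally_ringed_space T" and U: "opn X U" "s \<in> J U"
  shows "mor_sec t U s = \<zero>\<^bsub>rs_sec T (preim T t U)\<^esub>"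
proof -
  obtain h where h: "lrs_morphism T B h" "mor_eq T X (mor_comp B \<iota> h) t" using f by (auto simp: factors_through_def)
  interpret T: locally_ringed_space T by (rule T)
  interpret h: ringed_mor T B h using h(1) by (unfold_locales) (simp add: lrs_morphism_def)
  have s: "s \<in> sec X U" using J_sec U by blast
  have o: "opn B (U \<inter> supp X J)" using U by simp
  have "mor_sec \<iota> U s = \<zero>\<^bsub>rs_sec B (U \<inter> supp X J)\<^esub>"
    using U s o qg_zero_iff[OF U(1) _ s] JstI[OF U(1) _ U(2)] by (auto simp: fun_eq_iff)
  then have "mor_sec h (U \<inter> supp X J) (mor_sec \<iota> U s) = \<zero>\<^bsub>rs_sec T (preim T h (U \<inter> supp X J))\<^esub>"
    using ring_hom_zero'[OF h.sec_hom[OF o]] T.sec_cring[OF h.preim_open[OF o]] B.F.sec_cring[OF o] by simp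
  moreover have "preim T h (U \<inter> supp X J) = preim T t U"
    using h(2) h.pt pts_B by (auto simp: preim_def mor_eq_def simp del: B.F_top)
  moreover have "mor_sec h (U \<inter> supp X J) (mor_sec \<iota> U s) = mor_sec t U s"
    using h(2) U s unfolding mor_eq_def by simp
  ultimately show ?thesis by simp
qed

text \<open>Once \<open>J\<close> is killed, the stalk maps of \<open>t\<close> pass to the
  quotients by \<open>Jst\<close> and assemble to a morphism by \<open>induced_morphism\<close>.
  Locality enters to show that \<open>t\<close> lands in the support; \<open>T\<close> can be any
  locally ringed space.\<close>

theorem closed_sub_universal:
  assumes T: "locally_ringed_space T" and t: "lrs_morphism T X t"
    and kill: "\<And>U s. opn X U \<Longrightarrow> s \<in> J U \<Longrightarrow> mor_sec t U s = \<zero>\<^bsub>rs_sec T (preim T t U)\<^esub>"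
  obtains g where "lrs_morphism T B g" "mor_eq T X (mor_comp B \<iota> g) t"
    "\<And>g'. lrs_morphism T B g' \<Longrightarrow> mor_eq T X (mor_comp B \<iota> g') t \<Longrightarrow> mor_eq T B g' g"
proof -
  interpret T: locally_ringed_space T by (rule T)
  interpret t: ringed_mor T X t using t by unfold_locales (simp add: lrs_morphism_def)
  let ?h = "stalk_map T t"
  have kz: "?h x z = \<zero>\<^bsub>stalk T x\<^esub>" if x: "x \<in> pts T" and z: "z \<in> Jst (mor_pt t x)" for x z
  proof -
    obtain U s where U: "opn X U" "mor_pt t x \<in> U" "s \<in> J U" "z = germ X (mor_pt t x) U s" using z by (rule JstE)
    have p: "x \<in> preim T t U" using x U by (auto simp: preim_def)
    show ?thesis using t.stalk_map_germ[OF x U(1,2) J_sec[OF U(1,3)]] kill[OF U(1,3)] U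
        T.stalk_zero_germ[OF t.preim_open[OF U(1)] p] by simp
  qed
  \<comment> \<open>Outside the support \<open>Jst\<close> contains \<open>\<one>\<close>, which
    would be mapped to zero; this is impossible in the nontrivial local ring
    \<open>stalk T x\<close>.\<close>
  have supp: "mor_pt t x \<in> supp X J" if x: "x \<in> pts T" for x
  proof (rule ccontr)
    assume "\<not> ?thesis"
    then have "\<one>\<^bsub>stalk X (mor_pt t x)\<^esub> \<in> Jst (mor_pt t x)" using supp_iff t.pt[OF x] by blast
    then have "?h x \<one>\<^bsub>stalk X (mor_pt t x)\<^esub> = \<zero>\<^bsub>stalk T x\<^esub>" using kz x by blast
    then show False using ring_hom_one[OF t.stalk_map_hom[OF x]] local_ringD(2)[OF T.stalk_local[OF x]] by simp
  qed
  have "\<exists>\<mu>. \<mu> \<in> ring_hom (quot_stalk X J (mor_pt t x)) (stalk T x) \<and>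
      (\<forall>z\<in>carrier (stalk X (mor_pt t x)). \<mu> (Jst (mor_pt t x) +>\<^bsub>stalk X (mor_pt t x)\<^esub> z) = ?h x z)" if x: "x \<in> pts T" for x
    using ideal.quot_lift[OF Jst_ideal[OF t.pt[OF x]] T.stalk_cring[OF x] stalk_cring[OF t.pt[OF x]] t.stalk_map_hom[OF x] kz[OF x]]
    by metis
  then obtain \<mu> where \<mu>: "\<And>x. x \<in> pts T \<Longrightarrow> \<mu> x \<in> ring_hom (quot_stalk X J (mor_pt t x)) (stalk T x)"
    "\<And>x z. x \<in> pts T \<Longrightarrow> z \<in> carrier (stalk X (mor_pt t x)) \<Longrightarrow>
       \<mu> x (Jst (mor_pt t x) +>\<^bsub>stalk X (mor_pt t x)\<^esub> z) = ?h x z" by metis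
  have "\<exists>g. ringed_morphism T B g \<and> mor_pt g = mor_pt t \<and>
    (\<forall>W \<sigma> x. openin (subtopology (rs_top X) (supp X J)) W \<longrightarrow> \<sigma> \<in> quot.C W \<longrightarrow> x \<in> pts T \<longrightarrow> mor_pt t x \<in> W \<longrightarrow>
       germ T x (preim T g W) (mor_sec g W \<sigma>) = \<mu> x (\<sigma> (mor_pt t x)))"
  proof (rule B.induced_morphism[OF T.ringed_space_axioms _ \<mu>(1)])
    show "continuous_map (rs_top T) (subtopology (rs_top X) (supp X J)) (mor_pt t)"
      using t.mor supp by (auto simp: ringed_morphism_def continuous_map_in_subtopology)
    fix W l x assume W: "openin (subtopology (rs_top X) (supp X J)) W" "l \<in> quot_L W" "x \<in> pts T" "mor_pt t x \<in> W"
    obtain U s where U: "opn X U" "W \<subseteq> U" "s \<in> sec X U" "\<And>y. y \<in> W \<Longrightarrow> l y = quot_germ X J y U s"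
      using W(2) by (rule quot_LE) blast
    obtain N where N: "opn X N" "W = N \<inter> supp X J" using W(1) by (auto simp: openin_subtopology)
    let ?M = "preim T t (U \<inter> N)"
    have o: "opn X (U \<inter> N)" using U N by auto
    have r: "rs_res X U (U \<inter> N) s \<in> sec X (U \<inter> N)" using U o by simp
    have "germ T z ?M (mor_sec t (U \<inter> N) (rs_res X U (U \<inter> N) s)) = \<mu> z (l (mor_pt t z))" if z: "z \<in> ?M" for z
    proof -
      have z': "z \<in> pts T" "mor_pt t z \<in> U \<inter> N" "mor_pt t z \<in> W" using z supp N by (auto simp: preim_def)
      have "germ T z ?M (mor_sec t (U \<inter> N) (rs_res X U (U \<inter> N) s)) = ?h z (germ X (mor_pt t z) U s)"
        using t.stalk_map_germ[OF z'(1) o z'(2) r] germ_res[OF U(1) o _ z'(2) U(3)] by simp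
      then show ?thesis using \<mu>(2)[OF z'(1), of "germ X (mor_pt t z) U s"] U z' by (simp add: quot_germ_def)
    qed
    then show "\<exists>N s. opn T N \<and> x \<in> N \<and> N \<subseteq> {y \<in> pts T. mor_pt t y \<in> W} \<and> s \<in> sec T N \<and>
        (\<forall>z\<in>N. germ T z N s = \<mu> z (l (mor_pt t z)))"
    proof (intro exI[of _ ?M] exI[of _ "mor_sec t (U \<inter> N) (rs_res X U (U \<inter> N) s)"] conjI ballI)
      show "x \<in> ?M" using W U N by (auto simp: preim_def)
      show "?M \<subseteq> {y \<in> pts T. mor_pt t y \<in> W}" using N supp by (auto simp: preim_def)
    qed (use t.preim_open[OF o] t.sec_closed[OF o r] in simp_all)
  qed (assumption, intro exI conjI allI impI, assumption, assumption, simp)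
  then obtain g where g': "ringed_morphism T B g" "mor_pt g = mor_pt t"
    "\<forall>W \<sigma> x. openin (subtopology (rs_top X) (supp X J)) W \<longrightarrow> \<sigma> \<in> quot.C W \<longrightarrow> x \<in> pts T \<longrightarrow> mor_pt t x \<in> W \<longrightarrow>
       germ T x (preim T g W) (mor_sec g W \<sigma>) = \<mu> x (\<sigma> (mor_pt t x))" by (elim exE conjE) (rule that)
  note g = g'(1,2) g'(3)[rule_format]
  interpret g: ringed_mor T B g using g(1) by unfold_locales
  \<comment> \<open>Composed with the surjection from the stalk of \<open>X\<close>, the stalk map
    of \<open>g\<close> is that of \<open>t\<close>; so reflection of units is inherited from
    \<open>t\<close>.\<close>
  have gs: "stalk_map T g x (stalk_map B \<iota> (mor_pt t x) z) = ?h x z" if x: "x \<in> pts T" and z: "z \<in> carrier (stalk X (mor_pt t x))" for x z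
  proof -
    obtain U s where U: "opn X U" "mor_pt t x \<in> U" "s \<in> sec X U" "z = germ X (mor_pt t x) U s" using z by (rule stalkE)
    have o: "openin (subtopology (rs_top X) (supp X J)) (U \<inter> supp X J)" using U by simp
    show ?thesis
      using U x supp[OF x] o g.stalk_map_germ[OF x, of "U \<inter> supp X J" "mor_sec \<iota> U s"]
        g(3)[OF o incl_sec[OF U(1,3)] x] incl_sec[OF U(1,3)] \<mu>(2)[OF x z] incl_stalk_map[OF U(1,2) supp[OF x] U(3)]
      by (simp add: g(2) quot_germ_def)
  qed
  have glrs: "lrs_morphism T B g"
  proof (subst lrs_morphism_iff[OF T B_locally_ringed g(1)], intro ballI impI)
    fix x z assume x: "x \<in> pts T" "z \<in> carrier (stalk B (mor_pt g x))" "stalk_map T g x z \<in> Units (stalk T x)"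
    obtain U s where U: "opn X U" "mor_pt t x \<in> U" "mor_pt t x \<in> supp X J" "s \<in> sec X U"
      "z = stalk_map B \<iota> (mor_pt t x) (germ X (mor_pt t x) U s)" using x(2) unfolding g(2) by (rule B_stalkE)
    have m: "germ X (mor_pt t x) U s \<in> carrier (stalk X (mor_pt t x))" using U by simp
    have "?h x (germ X (mor_pt t x) U s) \<in> Units (stalk T x)" using x(3) gs[OF x(1) m] U by simp
    then have "germ X (mor_pt t x) U s \<in> Units (stalk X (mor_pt t x))"
      using t lrs_morphism_iff[OF T locally_ringed_space_axioms t.mor] x(1) m by blast
    then show "z \<in> Units (stalk B (mor_pt g x))" using incl_germ_eq_iff(2)[OF U(3) m] U g(2) by simp
  qed
  have comp: "preim T h (U \<inter> supp X J) = preim T t U" "mor_sec h (U \<inter> supp X J) (mor_sec \<iota> U s) = mor_sec t U s"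
    if "\<And>x. x \<in> pts T \<Longrightarrow> mor_pt h x = mor_pt t x" and "mor_eq T X (mor_comp B \<iota> h) t" "opn X U" "s \<in> sec X U" for h U s
  proof -
    show "preim T h (U \<inter> supp X J) = preim T t U" using that(1) supp by (auto simp: preim_def)
    show "mor_sec h (U \<inter> supp X J) (mor_sec \<iota> U s) = mor_sec t U s"
      using that(2-4) unfolding mor_eq_def by simp
  qed
  have eq: "mor_eq T X (mor_comp B \<iota> g) t"
    unfolding mor_eq_def
  proof (intro conjI ballI allI impI)
    show "mor_pt (mor_comp B \<iota> g) x = mor_pt t x" for x using g(2) by simp
    fix U s assume U: "opn X U" "s \<in> sec X U"
    have o: "openin (subtopology (rs_top X) (supp X J)) (U \<inter> supp X J)" using U by simp
    have p: "preim T g (U \<inter> supp X J) = preim T t U" using g(2) supp by (auto simp: preim_def)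
    have "mor_sec g (U \<inter> supp X J) (mor_sec \<iota> U s) = mor_sec t U s"
    proof (rule T.section_eqI[OF t.preim_open[OF U(1)]])
      show "mor_sec g (U \<inter> supp X J) (mor_sec \<iota> U s) \<in> sec T (preim T t U)"
        using g.sec_closed[of "U \<inter> supp X J" "mor_sec \<iota> U s"] o incl_sec[OF U] p by simp
      fix x assume "x \<in> preim T t U"
      then have x: "x \<in> pts T" "mor_pt t x \<in> U" by (auto simp: preim_def)
      show "germ T x (preim T t U) (mor_sec g (U \<inter> supp X J) (mor_sec \<iota> U s)) = germ T x (preim T t U) (mor_sec t U s)"
        using g(3)[OF o incl_sec[OF U] x(1)] x supp[OF x(1)] p \<mu>(2)[OF x(1), of "germ X (mor_pt t x) U s"] U
          t.stalk_map_germ[OF x(1) U(1) x(2) U(2)] by (simp add: quot_germ_def)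
    qed (use U in auto)
    then show "mor_sec (mor_comp B \<iota> g) U s = mor_sec t U s" by simp
  qed
  have uniq: "mor_eq T B g' g" if g': "lrs_morphism T B g'" "mor_eq T X (mor_comp B \<iota> g') t" for g'
  proof -
    have pt': "mor_pt g' x = mor_pt t x" if "x \<in> pts T" for x using g'(2) that by (simp add: mor_eq_def)
    interpret g': ringed_mor T B g' using g'(1) by unfold_locales (simp add: lrs_morphism_def)
    have pp: "preim T g' W = preim T g W" for W using pt' g(2) by (auto simp: preim_def)
    \<comment> \<open>Germs of \<open>B\<close> come from germs of \<open>X\<close>, where both
      stalk maps are determined by \<open>t\<close>; and sections over \<open>T\<close> are
      determined by their germs.\<close>
    have st: "stalk_map T g' x z = stalk_map T g x z" if x: "x \<in> pts T" and z: "z \<in> carrier (stalk B (mor_pt t x))" for x z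
    proof -
      obtain U s where U: "opn X U" "mor_pt t x \<in> U" "mor_pt t x \<in> supp X J" "s \<in> sec X U"
        "z = stalk_map B \<iota> (mor_pt t x) (germ X (mor_pt t x) U s)" using z by (rule B_stalkE)
      have o: "opn B (U \<inter> supp X J)" "mor_sec \<iota> U s \<in> sec B (U \<inter> supp X J)" using U incl_sec[OF U(1,4)] by auto
      have z': "z = germ B (mor_pt t x) (U \<inter> supp X J) (mor_sec \<iota> U s)" using U incl_stalk_map by simp
      show ?thesis
        using g.stalk_map_germ[OF x o(1) _ o(2)] g'.stalk_map_germ[OF x o(1) _ o(2)] U(2,3) pt'[OF x] g(2)
          comp[OF _ eq U(1,4)] comp[OF _ g'(2) U(1,4)] pt' z' by simp
    qed
    show ?thesis unfolding mor_eq_def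
    proof (intro conjI ballI allI impI)
      show "mor_pt g' x = mor_pt g x" if "x \<in> pts T" for x using pt' that g(2) by simp
      fix W \<sigma> assume W: "opn B W" "\<sigma> \<in> sec B W"
      show "mor_sec g' W \<sigma> = mor_sec g W \<sigma>"
      proof (rule T.section_eqI[OF g.preim_open[OF W(1)]])
        show "mor_sec g' W \<sigma> \<in> sec T (preim T g W)" using g'.sec_closed[OF W] pp by simp
        show "mor_sec g W \<sigma> \<in> sec T (preim T g W)" using g.sec_closed[OF W] .
        fix x assume "x \<in> preim T g W"
        then have x: "x \<in> pts T" "mor_pt t x \<in> W" using g(2) by (auto simp: preim_def)
        show "germ T x (preim T g W) (mor_sec g' W \<sigma>) = germ T x (preim T g W) (mor_sec g W \<sigma>)"
          using g.stalk_map_germ[OF x(1) W(1) _ W(2)] g'.stalk_map_germ[OF x(1) W(1) _ W(2)] x pt'[OF x(1)] g(2) pp[of W]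
            st[OF x(1), of "germ B (mor_pt t x) W \<sigma>"] B.F.germ_in_stalk[OF W(1) x(2) W(2)] by simp
      qed
    qed
  qed
  show thesis using that glrs eq uniq by blast
qed

end

section \<open>Affine charts\<close>

text \<open>An intrinsic form of ``\<open>U\<close> is isomorphic to the spectrum of \<open>R\<close>'': a subring \<open>R\<close> of the sections
  over \<open>U\<close> whose primes are the points of \<open>U\<close>, whose nonvanishing loci form a basis, and whose localizations
  are the stalks (\<open>frac\<close> and \<open>ann\<close> say that \<open>R\<close> maps to the stalk with the properties of a localization).
  It is not required that \<open>R\<close> consists of all sections over \<open>U\<close>.\<close>

locale chart = locally_ringed_space X for X :: "('a, 'b) rspace" +
  fixes U :: "'a set" and R :: "'b set"
  assumes U: "opn X U" and R: "subring R (rs_sec X U)"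
    and inj: "\<lbrakk>y \<in> U; z \<in> U; \<And>a. a \<in> R \<Longrightarrow> germ X y U a \<in> Units (stalk X y) \<longleftrightarrow> germ X z U a \<in> Units (stalk X z)\<rbrakk> \<Longrightarrow> y = z"
    and surj: "primeideal P (rs_sec X U\<lparr>carrier := R\<rparr>) \<Longrightarrow> \<exists>y\<in>U. P = {a \<in> R. germ X y U a \<notin> Units (stalk X y)}"
    and basis: "\<lbrakk>opn X W; W \<subseteq> U; y \<in> W\<rbrakk> \<Longrightarrow>
      \<exists>f\<in>R. germ X y U f \<in> Units (stalk X y) \<and> {z \<in> U. germ X z U f \<in> Units (stalk X z)} \<subseteq> W"
    and frac: "\<lbrakk>opn X W; W \<subseteq> U; y \<in> W; s \<in> sec X W\<rbrakk> \<Longrightarrow>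
      \<exists>a\<in>R. \<exists>h\<in>R. germ X y U h \<in> Units (stalk X y) \<and> germ X y W (rs_res X U W h \<otimes>\<^bsub>rs_sec X W\<^esub> s) = germ X y U a"
    and ann: "\<lbrakk>y \<in> U; a \<in> R; germ X y U a = germ X y U \<zero>\<^bsub>rs_sec X U\<^esub>\<rbrakk> \<Longrightarrow>
      \<exists>u\<in>R. germ X y U u \<in> Units (stalk X y) \<and> u \<otimes>\<^bsub>rs_sec X U\<^esub> a = \<zero>\<^bsub>rs_sec X U\<^esub>"
begin

abbreviation "A \<equiv> rs_sec X U\<lparr>carrier := R\<rparr>"

abbreviation "\<pi> y \<equiv> {a \<in> R. germ X y U a \<notin> Units (stalk X y)}"

sublocale \<Gamma>: cring "rs_sec X U"
  by (rule sec_cring[OF U])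

lemma R_sec [simp]: "a \<in> R \<Longrightarrow> a \<in> sec X U"
  using subringE(1)[OF R] by blast

lemma A_cring: "cring A"
  using \<Gamma>.subcring_iff[OF subringE(1)[OF R]] \<Gamma>.subcringI'[OF R] by simp

sublocale A: cring A
  rewrites "carrier A = R" and "mult A = mult (rs_sec X U)" and "add A = add (rs_sec X U)"
    and "one A = one (rs_sec X U)" and "zero A = zero (rs_sec X U)"
  by (rule A_cring) simp_all

lemma germ_R [simp]: "y \<in> U \<Longrightarrow> a \<in> R \<Longrightarrow> germ X y U a \<in> carrier (stalk X y)"
  using U by simp

lemma germ_A_hom: "y \<in> U \<Longrightarrow> germ X y U \<in> ring_hom A (stalk X y)"
  using germ_hom[OF U] by (auto simp: ring_hom_def)

lemma germ_R_mult: "\<lbrakk>y \<in> U; a \<in> R; b \<in> R\<rbrakk> \<Longrightarrow> germ X y U (a \<otimes>\<^bsub>rs_sec X U\<^esub> b) = germ X y U a \<otimes>\<^bsub>stalk X y\<^esub> germ X y U b"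
  using stalk_mult_germ[OF U] by simp

lemma U_pts: "y \<in> U \<Longrightarrow> y \<in> pts X"
  using pts_open[OF U] .

lemma frac_stalk:
  assumes y: "y \<in> U" and z: "z \<in> carrier (stalk X y)"
  obtains a h where "a \<in> R" "h \<in> R" "germ X y U h \<in> Units (stalk X y)"
    "germ X y U h \<otimes>\<^bsub>stalk X y\<^esub> z = germ X y U a"
proof -
  obtain W s where W: "opn X W" "y \<in> W" "W \<subseteq> U" "s \<in> sec X W" "z = germ X y W s"
    using z U y by (rule stalk_nbhdE)
  obtain a h where "a \<in> R" "h \<in> R" "germ X y U h \<in> Units (stalk X y)"
    "germ X y W (rs_res X U W h \<otimes>\<^bsub>rs_sec X W\<^esub> s) = germ X y U a" using frac[OF W(1,3,2,4)] by blast
  then show thesis using that[of a h] W U by (simp add: germ_res flip: stalk_mult_germ)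
qed

lemma ann_stalk:
  assumes y: "y \<in> U" and a: "a \<in> R" "germ X y U a = \<zero>\<^bsub>stalk X y\<^esub>"
  obtains u where "u \<in> R" "germ X y U u \<in> Units (stalk X y)" "u \<otimes>\<^bsub>rs_sec X U\<^esub> a = \<zero>\<^bsub>rs_sec X U\<^esub>"
  using ann[OF y a(1)] a(2) stalk_zero_germ[OF U y] by metis

text \<open>\<open>\<pi> y\<close> is the preimage in the chart ring of the maximal ideal of the
  stalk, that is, of its nonunits.\<close>

lemma \<pi>_prime:
  assumes y: "y \<in> U"
  shows "primeideal (\<pi> y) A"
proof -
  have "y \<in> pts X" using U_pts[OF y] .
  note loc = local_ringD[OF stalk_local[OF this]]
  interpret S: cring "stalk X y" by (rule loc)
  interpret m: maximalideal "carrier (stalk X y) - Units (stalk X y)" "stalk X y" by (rule loc)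
  have mem: "a \<in> \<pi> y \<longleftrightarrow> a \<in> R \<and> germ X y U a \<in> carrier (stalk X y) - Units (stalk X y)" for a
    using y by auto
  note g = germ_hom[OF U y]
  show ?thesis
  proof (rule primeidealI[OF _ A_cring])
    show "ideal (\<pi> y) A"
    proof (rule cring.idealI'[OF A_cring])
      show "\<zero>\<^bsub>A\<^esub> \<in> \<pi> y" using m.zero_closed A.zero_closed mem stalk_zero_germ[OF U y] by simp
      fix a assume a: "a \<in> \<pi> y"
      show "a \<oplus>\<^bsub>A\<^esub> b \<in> \<pi> y" if "b \<in> \<pi> y" for b
        using m.a_closed[of "germ X y U a" "germ X y U b"] a that A.a_closed[of a b] ring_hom_add[OF g, of a b]
        unfolding mem by simp
      show "x \<otimes>\<^bsub>A\<^esub> a \<in> \<pi> y" if "x \<in> carrier A" for x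
        using m.I_l_closed[of "germ X y U a" "germ X y U x"] a that A.m_closed[of x a] ring_hom_mult[OF g, of x a] y
        unfolding mem by simp
    qed auto
    have "\<one>\<^bsub>rs_sec X U\<^esub> \<notin> \<pi> y" using ring_hom_one[OF g] by simp
    then show "carrier A \<noteq> \<pi> y" using A.one_closed by auto
    fix a b assume ab: "a \<in> carrier A" "b \<in> carrier A" "a \<otimes>\<^bsub>A\<^esub> b \<in> \<pi> y"
    then show "a \<in> \<pi> y \<or> b \<in> \<pi> y" using ring_hom_mult[OF g, of a b] y by auto
  qed
qed

lemma nonvanishing_open: "a \<in> R \<Longrightarrow> opn X {z \<in> U. germ X z U a \<in> Units (stalk X z)}"
  by (rule unit_locus_open[OF U]) simp

text \<open>The axioms \<open>frac\<close> and \<open>ann\<close> are what \<open>loc_iso\<close>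
  requires: every germ at \<open>y\<close> is a fraction of elements of \<open>R\<close>, and an
  element of \<open>R\<close> with zero germ is killed by one invertible at
  \<open>y\<close>.\<close>

lemma stalk_is_localization:
  assumes y: "y \<in> U"
  obtains \<mu> where "\<mu> \<in> ring_hom (local_at A (\<pi> y)) (stalk X y)"
    "bij_betw \<mu> (carrier (local_at A (\<pi> y))) (carrier (stalk X y))"
    "\<And>a s. a \<in> R \<Longrightarrow> s \<in> R \<Longrightarrow> germ X y U s \<in> Units (stalk X y) \<Longrightarrow>
      germ X y U s \<otimes>\<^bsub>stalk X y\<^esub> \<mu> (fraction A (carrier A - \<pi> y) a s) = germ X y U a"
proof -
  show thesis
  proof (rule mult_subset.loc_iso[OF primeideal.mult_subset_compl[OF \<pi>_prime[OF y]]
        stalk_cring[OF U_pts[OF y]] germ_A_hom[OF y]])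
    show "germ X y U s \<in> Units (stalk X y)" if "s \<in> carrier A - \<pi> y" for s using that by auto
    show "\<exists>a\<in>carrier A. \<exists>s\<in>carrier A - \<pi> y. germ X y U s \<otimes>\<^bsub>stalk X y\<^esub> z = germ X y U a"
      if z: "z \<in> carrier (stalk X y)" for z
    proof -
      obtain a h where ah: "a \<in> R" "h \<in> R" "germ X y U h \<in> Units (stalk X y)"
        "germ X y U h \<otimes>\<^bsub>stalk X y\<^esub> z = germ X y U a" using y z by (rule frac_stalk)
      then have "a \<in> carrier A" "h \<in> carrier A - \<pi> y" by simp_all
      then show ?thesis using ah(4) by blast
    qed
    show "\<exists>s\<in>carrier A - \<pi> y. s \<otimes>\<^bsub>A\<^esub> a = \<zero>\<^bsub>A\<^esub>" if a: "a \<in> carrier A" "germ X y U a = \<zero>\<^bsub>stalk X y\<^esub>" for a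
    proof -
      obtain u where "u \<in> R" "germ X y U u \<in> Units (stalk X y)" "u \<otimes>\<^bsub>rs_sec X U\<^esub> a = \<zero>\<^bsub>rs_sec X U\<^esub>"
        by (rule ann_stalk[OF y, of a]) (use a in simp_all)
      then have "u \<in> carrier A - \<pi> y" "u \<otimes>\<^bsub>A\<^esub> a = \<zero>\<^bsub>A\<^esub>" by simp_all
      then show ?thesis by blast
    qed
    fix \<mu> assume "\<mu> \<in> ring_hom (local_at A (\<pi> y)) (stalk X y)"
      "bij_betw \<mu> (carrier (local_at A (\<pi> y))) (carrier (stalk X y))"
      "\<And>a s. a \<in> carrier A \<Longrightarrow> s \<in> carrier A - \<pi> y \<Longrightarrow>
        germ X y U s \<otimes>\<^bsub>stalk X y\<^esub> \<mu> (fraction A (carrier A - \<pi> y) a s) = germ X y U a"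
    then show thesis by (intro that) auto
  qed
qed

sublocale sp: spectrum A
  by (simp add: spectrum_def A_cring)

lemma pts_Spec: "topspace (zariski A) = prime_spec A"
  by (rule topspace_zariski[OF A_cring])

lemma \<pi>_bij: "bij_betw \<pi> U (prime_spec A)"
  unfolding bij_betw_def
proof
  show "inj_on \<pi> U"
  proof (rule inj_onI)
    fix y z assume yz: "y \<in> U" "z \<in> U" "\<pi> y = \<pi> z"
    show "y = z"
    proof (rule inj[OF yz(1,2)])
      fix a assume "a \<in> R"
      moreover have "a \<in> \<pi> y \<longleftrightarrow> a \<in> \<pi> z" using yz(3) by simp
      ultimately show "germ X y U a \<in> Units (stalk X y) \<longleftrightarrow> germ X z U a \<in> Units (stalk X z)" by simp
    qed
  qed
  show "\<pi> ` U = prime_spec A"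
    using \<pi>_prime surj unfolding prime_spec_def by blast
qed

end

text \<open>The axioms of a chart speak of open subsets of \<open>U\<close>, their sections,
  equality of germs and unit germs, and the last two depend only on the first two. Hence a chart can
  be moved between a space and its open subspaces.\<close>

lemma chart_transfer:
  assumes "chart X U R" and Y: "locally_ringed_space Y"
    and o: "\<And>W. W \<subseteq> U \<Longrightarrow> opn Y W \<longleftrightarrow> opn X W" and same: "rs_sec Y = rs_sec X" "rs_res Y = rs_res X"
  shows "chart Y U R"
proof -
  interpret chart X U R by fact
  interpret Y: locally_ringed_space Y by (rule Y)
  have UY: "opn Y U" using U o by blast
  have u: "germ Y y U a \<in> Units (stalk Y y) \<longleftrightarrow> germ X y U a \<in> Units (stalk X y)"
    if "y \<in> U" "a \<in> R" for y a
  proof -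
    have q: "opn Y W \<and> y \<in> W \<and> W \<subseteq> U \<and> Q \<longleftrightarrow> opn X W \<and> y \<in> W \<and> W \<subseteq> U \<and> Q" for W Q using o by blast
    have "a \<in> sec Y U" using that same by simp
    from Y.germ_unit_iff[OF UY that(1) this] show ?thesis
      unfolding germ_unit_iff[OF U that(1) R_sec[OF that(2)]] same q .
  qed
  have e: "germ Y y W s = germ Y y V t \<longleftrightarrow> germ X y W s = germ X y V t"
    if "opn X W" "W \<subseteq> U" "y \<in> W" "s \<in> sec X W" "opn X V" "V \<subseteq> U" "y \<in> V" "t \<in> sec X V" for y W V s t
  proof -
    have "N \<subseteq> W \<inter> V \<Longrightarrow> opn Y N \<longleftrightarrow> opn X N" for N using o that by (meson Int_subset_iff subset_trans)
    then show ?thesis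
      using germ_eq_iff[of W y s V t] Y.germ_eq_iff[of W y s V t] that o unfolding same by auto
  qed
  show ?thesis
  proof (intro chart.intro Y chart_axioms.intro, unfold same)
    show "opn Y U" by (rule UY)
    show "subring R (rs_sec X U)" by (rule R)
    show "y = z" if "y \<in> U" "z \<in> U"
      "\<And>a. a \<in> R \<Longrightarrow> germ Y y U a \<in> Units (stalk Y y) \<longleftrightarrow> germ Y z U a \<in> Units (stalk Y z)" for y z
      using inj[OF that(1,2)] that(3) u[OF that(1)] u[OF that(2)] by simp
    show "\<exists>y\<in>U. P = {a \<in> R. germ Y y U a \<notin> Units (stalk Y y)}" if "primeideal P (rs_sec X U\<lparr>carrier := R\<rparr>)" for P
    proof -
      obtain y where y: "y \<in> U" "P = \<pi> y" using surj[OF \<open>primeideal P _\<close>] by blast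
      have "{a \<in> R. germ Y y U a \<notin> Units (stalk Y y)} = \<pi> y" using u[OF y(1)] by blast
      then show ?thesis using y by blast
    qed
    show "\<exists>f\<in>R. germ Y y U f \<in> Units (stalk Y y) \<and> {z \<in> U. germ Y z U f \<in> Units (stalk Y z)} \<subseteq> W"
      if W: "opn Y W" "W \<subseteq> U" "y \<in> W" for W y
    proof -
      obtain f where f: "f \<in> R" "germ X y U f \<in> Units (stalk X y)" "{z \<in> U. germ X z U f \<in> Units (stalk X z)} \<subseteq> W"
        using basis[of W y] W o by blast
      then show ?thesis using u[OF _ f(1)] W by (intro bexI[of _ f]) auto
    qed
    show "\<exists>a\<in>R. \<exists>h\<in>R. germ Y y U h \<in> Units (stalk Y y) \<and> germ Y y W (rs_res X U W h \<otimes>\<^bsub>rs_sec X W\<^esub> s) = germ Y y U a"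
      if W: "opn Y W" "W \<subseteq> U" "y \<in> W" "s \<in> sec X W" for W y s
    proof -
      have Wo: "opn X W" using W o by blast
      interpret W: cring "rs_sec X W" by (rule sec_cring[OF Wo])
      obtain a h where ah: "a \<in> R" "h \<in> R" "germ X y U h \<in> Units (stalk X y)"
        "germ X y W (rs_res X U W h \<otimes>\<^bsub>rs_sec X W\<^esub> s) = germ X y U a" using frac[OF Wo W(2-4)] by blast
      have "rs_res X U W h \<otimes>\<^bsub>rs_sec X W\<^esub> s \<in> sec X W" using W Wo U ah by simp
      moreover have yU: "y \<in> U" using W by blast
      ultimately have "germ Y y W (rs_res X U W h \<otimes>\<^bsub>rs_sec X W\<^esub> s) = germ Y y U a"
        using e[OF Wo W(2,3) _ U order_refl yU R_sec[OF ah(1)]] ah(4) by blast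
      then show ?thesis using ah(1-3) u[OF yU ah(2)] by blast
    qed
    show "\<exists>v\<in>R. germ Y y U v \<in> Units (stalk Y y) \<and> v \<otimes>\<^bsub>rs_sec X U\<^esub> a = \<zero>\<^bsub>rs_sec X U\<^esub>"
      if y: "y \<in> U" "a \<in> R" "germ Y y U a = germ Y y U \<zero>\<^bsub>rs_sec X U\<^esub>" for y a
    proof -
      have "germ X y U a = germ X y U \<zero>\<^bsub>rs_sec X U\<^esub>" using e[OF U _ y(1) _ U _ y(1)] y U by simp
      from ann[OF y(1,2) this] obtain v where "v \<in> R" "germ X y U v \<in> Units (stalk X y)"
        "v \<otimes>\<^bsub>rs_sec X U\<^esub> a = \<zero>\<^bsub>rs_sec X U\<^esub>" by blast
      then show ?thesis using u[OF y(1)] by blast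
    qed
  qed
qed

lemma (in locally_ringed_space) chart_open_sub_iff:
  assumes V: "opn X V" and U: "U \<subseteq> V"
  shows "chart (open_sub X V) U R \<longleftrightarrow> chart X U R"
proof -
  have "opn (open_sub X V) W \<longleftrightarrow> opn X W" if "W \<subseteq> U" for W using that U opn_open_sub[OF V] by blast
  then show ?thesis
    using chart_transfer[OF _ open_sub_locally_ringed[OF V], of X U R] chart_transfer[OF _ locally_ringed_space_axioms, of "open_sub X V" U R]
    by auto
qed

context chart
begin

section \<open>Comparison of a chart with the spectrum of its ring\<close>

definition stalk_iso :: "'a \<Rightarrow> ('b \<times> 'b) set \<Rightarrow> ('a set \<times> 'b) set" where
  "stalk_iso y = (SOME \<mu>. \<mu> \<in> ring_hom (local_at A (\<pi> y)) (stalk X y) \<and>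
    bij_betw \<mu> (carrier (local_at A (\<pi> y))) (carrier (stalk X y)) \<and>
    (\<forall>a\<in>R. \<forall>s\<in>R. germ X y U s \<in> Units (stalk X y) \<longrightarrow>
      germ X y U s \<otimes>\<^bsub>stalk X y\<^esub> \<mu> (fraction A (carrier A - \<pi> y) a s) = germ X y U a))"

lemma stalk_iso:
  assumes y: "y \<in> U"
  shows "stalk_iso y \<in> ring_hom (local_at A (\<pi> y)) (stalk X y)"
    and "bij_betw (stalk_iso y) (carrier (local_at A (\<pi> y))) (carrier (stalk X y))"
    and "\<lbrakk>a \<in> R; s \<in> R; germ X y U s \<in> Units (stalk X y)\<rbrakk> \<Longrightarrow>
      germ X y U s \<otimes>\<^bsub>stalk X y\<^esub> stalk_iso y (fraction A (carrier A - \<pi> y) a s) = germ X y U a"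
proof -
  let ?P = "\<lambda>\<mu>. \<mu> \<in> ring_hom (local_at A (\<pi> y)) (stalk X y) \<and>
    bij_betw \<mu> (carrier (local_at A (\<pi> y))) (carrier (stalk X y)) \<and>
    (\<forall>a\<in>R. \<forall>s\<in>R. germ X y U s \<in> Units (stalk X y) \<longrightarrow>
      germ X y U s \<otimes>\<^bsub>stalk X y\<^esub> \<mu> (fraction A (carrier A - \<pi> y) a s) = germ X y U a)"
  have "\<exists>\<mu>. ?P \<mu>" by (rule stalk_is_localization[OF y]) (intro exI conjI ballI impI; simp)
  then have "?P (stalk_iso y)" unfolding stalk_iso_def by (rule someI_ex)
  then show "stalk_iso y \<in> ring_hom (local_at A (\<pi> y)) (stalk X y)"
    and "bij_betw (stalk_iso y) (carrier (local_at A (\<pi> y))) (carrier (stalk X y))"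
    and "\<lbrakk>a \<in> R; s \<in> R; germ X y U s \<in> Units (stalk X y)\<rbrakk> \<Longrightarrow>
      germ X y U s \<otimes>\<^bsub>stalk X y\<^esub> stalk_iso y (fraction A (carrier A - \<pi> y) a s) = germ X y U a"
    by blast+
qed

lemma local_at_cring: "y \<in> U \<Longrightarrow> cring (local_at A (\<pi> y))"
  by (rule mult_subset.loc_cring[OF primeideal.mult_subset_compl[OF \<pi>_prime]])

definition stalk_iso_inv :: "'a \<Rightarrow> ('a set \<times> 'b) set \<Rightarrow> ('b \<times> 'b) set" where
  "stalk_iso_inv y = inv_into (carrier (local_at A (\<pi> y))) (stalk_iso y)"

lemma stalk_iso_inv:
  assumes y: "y \<in> U"
  shows "stalk_iso_inv y \<in> ring_hom (stalk X y) (local_at A (\<pi> y))"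
    and "z \<in> carrier (stalk X y) \<Longrightarrow> stalk_iso y (stalk_iso_inv y z) = z"
    and "c \<in> carrier (local_at A (\<pi> y)) \<Longrightarrow> stalk_iso_inv y (stalk_iso y c) = c"
proof -
  have "stalk_iso y \<in> ring_iso (local_at A (\<pi> y)) (stalk X y)"
    using stalk_iso[OF y] by (simp add: ring_iso_def)
  then show "stalk_iso_inv y \<in> ring_hom (stalk X y) (local_at A (\<pi> y))"
    using ring_iso_set_sym[OF cring.axioms(1)[OF local_at_cring[OF y]], of "stalk_iso y" "stalk X y"]
    unfolding stalk_iso_inv_def ring_iso_def by blast
  note b = stalk_iso(2)[OF y]
  show "z \<in> carrier (stalk X y) \<Longrightarrow> stalk_iso y (stalk_iso_inv y z) = z"
    using b unfolding stalk_iso_inv_def bij_betw_def by (simp add: f_inv_into_f)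
  show "c \<in> carrier (local_at A (\<pi> y)) \<Longrightarrow> stalk_iso_inv y (stalk_iso y c) = c"
    using b unfolding stalk_iso_inv_def bij_betw_def by simp
qed

definition \<rho> :: "'b set \<Rightarrow> 'a" where
  "\<rho> = the_inv_into U \<pi>"

lemma \<rho>_\<pi> [simp]: "y \<in> U \<Longrightarrow> \<rho> (\<pi> y) = y"
  using \<pi>_bij the_inv_into_f_f unfolding \<rho>_def bij_betw_def by fastforce

lemma \<rho>: "p \<in> prime_spec A \<Longrightarrow> \<rho> p \<in> U" "p \<in> prime_spec A \<Longrightarrow> \<pi> (\<rho> p) = p"
proof -
  assume "p \<in> prime_spec A"
  then obtain y where "y \<in> U" "p = \<pi> y" using \<pi>_bij unfolding bij_betw_def by blast
  then show "\<rho> p \<in> U" "\<pi> (\<rho> p) = p" using \<rho>_\<pi> by auto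
qed

text \<open>Basic open sets of the spectrum correspond to unit loci of elements of \<open>R\<close>,
  which are open in \<open>X\<close>. The same correspondence together with the axiom
  \<open>basis\<close> gives continuity of the inverse \<open>\<rho>\<close>.\<close>

lemma openin_\<pi>_preimage:
  assumes "openin (zariski A) W"
  shows "opn X {y \<in> U. \<pi> y \<in> W}"
proof (subst openin_subopen, intro ballI)
  fix y assume y: "y \<in> {y \<in> U. \<pi> y \<in> W}"
  then obtain f where f: "f \<in> carrier A" "\<pi> y \<in> basic_open A f" "basic_open A f \<subseteq> W"
    using zariski_basis[OF A_cring assms] by blast
  have "z \<in> {y \<in> U. \<pi> y \<in> W}" if "z \<in> {z \<in> U. germ X z U f \<in> Units (stalk X z)}" for z
    using that f \<pi>_prime[of z] by (auto simp: basic_open_def prime_spec_def)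
  moreover have "y \<in> {z \<in> U. germ X z U f \<in> Units (stalk X z)}" using f y by (auto simp: basic_open_def)
  ultimately show "\<exists>T. opn X T \<and> y \<in> T \<and> T \<subseteq> {y \<in> U. \<pi> y \<in> W}"
    using nonvanishing_open[of f] f(1) by (intro exI[of _ "{z \<in> U. germ X z U f \<in> Units (stalk X z)}"]) auto
qed

lemma openin_\<rho>_preimage:
  assumes "opn X W"
  shows "openin (zariski A) {p \<in> prime_spec A. \<rho> p \<in> W}"
proof (subst openin_subopen, intro ballI)
  fix p assume p: "p \<in> {p \<in> prime_spec A. \<rho> p \<in> W}"
  have "opn X (W \<inter> U)" using assms U by blast
  then obtain f where f: "f \<in> R" "germ X (\<rho> p) U f \<in> Units (stalk X (\<rho> p))" "{z \<in> U. germ X z U f \<in> Units (stalk X z)} \<subseteq> W \<inter> U"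
    using basis[of "W \<inter> U" "\<rho> p"] p \<rho>(1) by blast
  have "p \<in> basic_open A f" using p f(2) \<rho>[of p] by (auto simp: basic_open_def)
  moreover have "q \<in> {p \<in> prime_spec A. \<rho> p \<in> W}" if q: "q \<in> basic_open A f" for q
  proof -
    have qs: "q \<in> prime_spec A" "f \<notin> \<pi> (\<rho> q)" using q \<rho>(2) by (auto simp: basic_open_def)
    then have "\<rho> q \<in> {z \<in> U. germ X z U f \<in> Units (stalk X z)}" using f(1) \<rho>(1) by blast
    then show ?thesis using f(3) qs by blast
  qed
  ultimately show "\<exists>T. openin (zariski A) T \<and> p \<in> T \<and> T \<subseteq> {p \<in> prime_spec A. \<rho> p \<in> W}"
    using openin_basic_open[of f A] f(1) by (intro exI[of _ "basic_open A f"]) auto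
qed

text \<open>The denominator \<open>f\<close> has invertible germs at all points over
  \<open>W\<close>, hence is invertible as a section by \<open>sec_unitI\<close>, and the fraction
  becomes an actual quotient of sections over the whole preimage of \<open>W\<close>.\<close>

lemma fraction_section:
  assumes W: "openin (zariski A) W" and l: "l \<in> spec_fractions A W"
  shows "\<exists>s. s \<in> sec X {y \<in> U. \<pi> y \<in> W} \<and> (\<forall>z\<in>{y \<in> U. \<pi> y \<in> W}. germ X z {y \<in> U. \<pi> y \<in> W} s = stalk_iso z (l (\<pi> z)))"
proof -
  let ?N = "{y \<in> U. \<pi> y \<in> W}"
  obtain a f where a: "a \<in> R" "f \<in> R" "\<And>q. q \<in> W \<Longrightarrow> f \<notin> q \<and> l q = fraction A (carrier A - q) a f"
    using l by (auto simp: spec_fractions_def)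
  have N: "opn X ?N" "?N \<subseteq> U" using openin_\<pi>_preimage[OF W] by auto
  interpret N: cring "rs_sec X ?N" by (rule sec_cring[OF N(1)])
  have fu: "germ X z U f \<in> Units (stalk X z)" if "z \<in> ?N" for z using that a(2) a(3)[of "\<pi> z"] by blast
  let ?f = "rs_res X U ?N f" and ?a = "rs_res X U ?N a"
  have c: "?f \<in> sec X ?N" "?a \<in> sec X ?N" using a N U by auto
  let ?s = "inv\<^bsub>rs_sec X ?N\<^esub> ?f \<otimes>\<^bsub>rs_sec X ?N\<^esub> ?a"
  have "?f \<in> Units (rs_sec X ?N)"
    by (rule sec_unitI[OF N(1) c(1)]) (use germ_res[OF U N] fu a in auto)
  then have s: "?s \<in> sec X ?N" "?f \<otimes>\<^bsub>rs_sec X ?N\<^esub> ?s = ?a" using c by (auto simp flip: N.m_assoc)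
  have "germ X z ?N ?s = stalk_iso z (l (\<pi> z))" if z: "z \<in> ?N" for z
  proof -
    have zU: "z \<in> U" using z by blast
    interpret S: cring "stalk X z" by (rule stalk_cring'[OF U zU])
    have "germ X z U f \<otimes>\<^bsub>stalk X z\<^esub> germ X z ?N ?s = germ X z U a"
      using stalk_mult_germ[OF N(1) z c(1) s(1)] s(2) germ_res[OF U N z] a by simp
    also have "\<dots> = germ X z U f \<otimes>\<^bsub>stalk X z\<^esub> stalk_iso z (l (\<pi> z))"
      using stalk_iso(3)[OF zU a(1,2) fu[OF z]] a(3)[of "\<pi> z"] z by simp
    finally have eq: "germ X z U f \<otimes>\<^bsub>stalk X z\<^esub> germ X z ?N ?s = germ X z U f \<otimes>\<^bsub>stalk X z\<^esub> stalk_iso z (l (\<pi> z))" .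
    have "\<pi> z \<in> W" using z by simp
    from ring_hom_closed[OF stalk_iso(1)[OF zU] sp.frac.L_val[OF W l this]]
    have "stalk_iso z (l (\<pi> z)) \<in> carrier (stalk X z)" .
    from S.Units_l_cancel[OF fu[OF z] germ_in_stalk[OF N(1) z s(1)] this] eq show ?thesis by (rule iffD1)
  qed
  then show ?thesis using s(1) by blast
qed

text \<open>At a given point the germ of \<open>s\<close> is a fraction \<open>a / h\<close>. The
  equation \<open>h s = a\<close> holds on a neighbourhood, and after shrinking to where
  \<open>h\<close> is invertible it represents \<open>s\<close> as this fraction throughout.\<close>

lemma section_fraction:
  assumes W: "opn X W" "W \<subseteq> U" and s: "s \<in> sec X W"
  shows "(\<lambda>p\<in>{p \<in> prime_spec A. \<rho> p \<in> W}. stalk_iso_inv (\<rho> p) (germ X (\<rho> p) W s)) \<in> sp.frac.C {p \<in> prime_spec A. \<rho> p \<in> W}"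
proof (rule sp.frac.C_I)
  fix p assume p: "p \<in> {p \<in> prime_spec A. \<rho> p \<in> W}"
  let ?y = "\<rho> p"
  have y: "?y \<in> W" "?y \<in> U" using p W by auto
  obtain a h where ah: "a \<in> R" "h \<in> R" "germ X ?y U h \<in> Units (stalk X ?y)"
    "germ X ?y U h \<otimes>\<^bsub>stalk X ?y\<^esub> germ X ?y W s = germ X ?y U a"
    by (rule frac_stalk[OF y(2), of "germ X ?y W s"]) (use W y s in auto)
  interpret WR: cring "rs_sec X W" by (rule sec_cring[OF W(1)])
  let ?t = "rs_res X U W h \<otimes>\<^bsub>rs_sec X W\<^esub> s"
  have hW: "rs_res X U W h \<in> sec X W" "?t \<in> sec X W" using W U ah s by auto
  have t: "germ X z W ?t = germ X z U h \<otimes>\<^bsub>stalk X z\<^esub> germ X z W s" if "z \<in> W" for z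
    using stalk_mult_germ[OF W(1) that hW(1) s] germ_res[OF U W that] ah by simp
  obtain N where N: "opn X N" "?y \<in> N" "N \<subseteq> W" "N \<subseteq> U" "rs_res X W N ?t = rs_res X U N a"
    "\<And>z. z \<in> N \<Longrightarrow> germ X z W ?t = germ X z U a"
    by (rule germ_eq_nbhd[OF W(1) y(1) hW(2) U y(2) R_sec[OF ah(1)]]) (use t y ah in auto)
  let ?D = "N \<inter> {z \<in> U. germ X z U h \<in> Units (stalk X z)}"
  have D: "opn X ?D" using N nonvanishing_open[OF ah(2)] by blast
  let ?Q = "{p \<in> prime_spec A. \<rho> p \<in> ?D}"
  have Q: "h \<notin> q \<and> stalk_iso_inv (\<rho> q) (germ X (\<rho> q) W s) = fraction A (carrier A - q) a h" if q: "q \<in> ?Q" for q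
  proof
    let ?z = "\<rho> q"
    have z: "?z \<in> U" "?z \<in> W" "germ X ?z U h \<in> Units (stalk X ?z)" "q = \<pi> ?z" using q N \<rho>[of q] by auto
    show hq: "h \<notin> q" using z by blast
    interpret S: cring "stalk X ?z" by (rule stalk_cring'[OF U z(1)])
    have fr: "fraction A (carrier A - q) a h \<in> carrier (local_at A q)"
      using mult_subset.loc_carrierI[OF primeideal.mult_subset_compl[OF \<pi>_prime[OF z(1)]], of a h] ah hq
      unfolding z(4)[symmetric] by simp
    have "germ X ?z U h \<otimes>\<^bsub>stalk X ?z\<^esub> germ X ?z W s = germ X ?z U h \<otimes>\<^bsub>stalk X ?z\<^esub> stalk_iso ?z (fraction A (carrier A - q) a h)"
      using stalk_iso(3)[OF z(1) ah(1,2) z(3)] N(6)[of ?z] t[OF z(2)] q z(4) by simp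
    then have "germ X ?z W s = stalk_iso ?z (fraction A (carrier A - q) a h)"
      using z W s fr ring_hom_closed[OF stalk_iso(1)[OF z(1)]] by simp
    then show "stalk_iso_inv ?z (germ X ?z W s) = fraction A (carrier A - q) a h"
      using stalk_iso_inv(3)[OF z(1)] fr z(4) by simp
  qed
  show "\<exists>V l. openin (zariski A) V \<and> p \<in> V \<and> V \<subseteq> {p \<in> prime_spec A. \<rho> p \<in> W} \<and> l \<in> spec_fractions A V \<and>
      (\<forall>q\<in>V. stalk_iso_inv (\<rho> q) (germ X (\<rho> q) W s) = l q)"
  proof (intro exI conjI ballI)
    show "openin (zariski A) ?Q" by (rule openin_\<rho>_preimage[OF D])
    show "p \<in> ?Q" using p y N ah by blast
    show "?Q \<subseteq> {p \<in> prime_spec A. \<rho> p \<in> W}" using N by blast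
    show "(\<lambda>q. stalk_iso_inv (\<rho> q) (germ X (\<rho> q) W s)) \<in> spec_fractions A ?Q"
      unfolding spec_fractions_def
      by (rule CollectI, rule bexI[of _ a], rule bexI[of _ h], rule ballI, erule Q) (use ah in simp_all)
  qed simp
qed

theorem isomorphic_Spec_whole:
  assumes UX: "U = pts X"
  shows "lrs_isomorphic X (Spec A)"
proof -
  interpret S: locally_ringed_space "Spec A" by (rule sp.Spec_locally_ringed)
  have "\<exists>f. ringed_morphism X (Spec A) f \<and> mor_pt f = \<pi> \<and> (\<forall>W \<sigma> x. openin (zariski A) W \<longrightarrow> \<sigma> \<in> sp.frac.C W \<longrightarrow> x \<in> pts X
      \<longrightarrow> \<pi> x \<in> W \<longrightarrow> germ X x (preim X f W) (mor_sec f W \<sigma>) = stalk_iso x (\<sigma> (\<pi> x)))"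
  proof (rule sp.Spec.induced_morphism[OF ringed_space_axioms])
    show "continuous_map (rs_top X) (zariski A) \<pi>"
      using openin_\<pi>_preimage \<pi>_prime unfolding continuous_map_def pts_Spec UX[symmetric]
      by (auto simp: prime_spec_def)
    show "stalk_iso x \<in> ring_hom (local_at A (\<pi> x)) (stalk X x)" if "x \<in> pts X" for x
      using stalk_iso(1) that UX by blast
    fix W l x assume W: "openin (zariski A) W" "l \<in> spec_fractions A W" "x \<in> pts X" "\<pi> x \<in> W"
    show "\<exists>N s. opn X N \<and> x \<in> N \<and> N \<subseteq> {y \<in> pts X. \<pi> y \<in> W} \<and> s \<in> sec X N \<and> (\<forall>z\<in>N. germ X z N s = stalk_iso z (l (\<pi> z)))"
      using fraction_section[OF W(1,2)] openin_\<pi>_preimage[OF W(1)] W(3,4) unfolding UX[symmetric]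
      by (intro exI[of _ "{y \<in> U. \<pi> y \<in> W}"]) blast
  qed (intro exI conjI allI impI, assumption, assumption, simp)
  then obtain f where f': "ringed_morphism X (Spec A) f" "mor_pt f = \<pi>"
    "\<forall>W \<sigma> x. openin (zariski A) W \<longrightarrow> \<sigma> \<in> sp.frac.C W \<longrightarrow> x \<in> pts X \<longrightarrow> \<pi> x \<in> W \<longrightarrow>
      germ X x (preim X f W) (mor_sec f W \<sigma>) = stalk_iso x (\<sigma> (\<pi> x))" by (elim exE conjE) (rule that)
  note f = f'(1,2) f'(3)[rule_format]
  interpret f: ringed_mor X "Spec A" f using f(1) by unfold_locales
  \<comment> \<open>Since \<open>X\<close> is not given as a sheaf of functions, the inverse is
    written down directly: a section is sent to the family of its germs, transported to the local
    rings by \<open>stalk_iso_inv\<close>.\<close>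
  define g :: "('b set, 'b set \<Rightarrow> ('b \<times> 'b) set, 'a, 'b) rs_mor" where
    "g = \<lparr>mor_pt = \<rho>, mor_sec = (\<lambda>W s. \<lambda>p\<in>{p \<in> prime_spec A. \<rho> p \<in> W}. stalk_iso_inv (\<rho> p) (germ X (\<rho> p) W s))\<rparr>"
  have g: "mor_pt g = \<rho>" "\<And>W s. mor_sec g W s = (\<lambda>p\<in>{p \<in> prime_spec A. \<rho> p \<in> W}. stalk_iso_inv (\<rho> p) (germ X (\<rho> p) W s))"
    by (simp_all add: g_def)
  have pg: "preim (Spec A) g W = {p \<in> prime_spec A. \<rho> p \<in> W}" for W
    by (simp add: preim_def g(1) pts_Spec)
  have WU: "W \<subseteq> U" if "opn X W" for W using that openin_subset UX by blast
  have gm: "ringed_morphism (Spec A) X g"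
    unfolding ringed_morphism_def pg
  proof (intro conjI allI impI ballI)
    show "continuous_map (rs_top (Spec A)) (rs_top X) (mor_pt g)"
      unfolding continuous_map_def UX[symmetric] g(1) sp.Spec.F_top pts_Spec
      using openin_\<rho>_preimage \<rho>(1) by auto
    fix W assume W: "opn X W"
    let ?Q = "{p \<in> prime_spec A. \<rho> p \<in> W}"
    have Q: "openin (zariski A) ?Q" by (rule openin_\<rho>_preimage[OF W])
    show "mor_sec g W \<in> ring_hom (rs_sec X W) (rs_sec (Spec A) ?Q)"
    proof (rule ring_hom_memI)
      show "mor_sec g W s \<in> sec (Spec A) ?Q" if "s \<in> sec X W" for s
        using section_fraction[OF W WU[OF W] that] Q by (simp add: g(2))
      have h: "stalk_iso_inv (\<rho> p) \<in> ring_hom (stalk X (\<rho> p)) (local_at A p)" if "p \<in> ?Q" for p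
        using stalk_iso_inv(1)[of "\<rho> p"] \<rho>[of p] that by auto
      show "mor_sec g W \<one>\<^bsub>rs_sec X W\<^esub> = \<one>\<^bsub>rs_sec (Spec A) ?Q\<^esub>"
        using Q ring_hom_one[OF h] stalk_one_germ[OF W] by (auto simp: g(2) fun_eq_iff)
      fix s t assume st: "s \<in> sec X W" "t \<in> sec X W"
      show "mor_sec g W (s \<otimes>\<^bsub>rs_sec X W\<^esub> t) = mor_sec g W s \<otimes>\<^bsub>rs_sec (Spec A) ?Q\<^esub> mor_sec g W t"
        using Q ring_hom_mult[OF h] st stalk_mult_germ[OF W _ st, symmetric] W by (auto simp: g(2) fun_eq_iff)
      show "mor_sec g W (s \<oplus>\<^bsub>rs_sec X W\<^esub> t) = mor_sec g W s \<oplus>\<^bsub>rs_sec (Spec A) ?Q\<^esub> mor_sec g W t"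
        using Q ring_hom_add[OF h] st stalk_add_germ[OF W _ st, symmetric] W by (auto simp: g(2) fun_eq_iff)
    qed
  next
    fix V W s assume "opn X V \<and> opn X W \<and> W \<subseteq> V" "s \<in> sec X V"
    then show "rs_res (Spec A) {p \<in> prime_spec A. \<rho> p \<in> V} {p \<in> prime_spec A. \<rho> p \<in> W} (mor_sec g V s) = mor_sec g W (rs_res X V W s)"
      using germ_res[of V W] by (auto simp: g(2) fun_eq_iff restrict_def)
  qed
  interpret g: ringed_mor "Spec A" X g using gm by unfold_locales
  have f_lrs: "lrs_morphism X (Spec A) f"
  proof (subst lrs_morphism_iff[OF locally_ringed_space_axioms S.locally_ringed_space_axioms f(1)], intro ballI impI)
    fix x z assume x: "x \<in> pts X" "z \<in> carrier (stalk (Spec A) (mor_pt f x))" "stalk_map X f x z \<in> Units (stalk X x)"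
    obtain W \<sigma> where W: "opn (Spec A) W" "mor_pt f x \<in> W" "\<sigma> \<in> sec (Spec A) W" "z = germ (Spec A) (mor_pt f x) W \<sigma>"
      using x(2) by (rule sp.Spec.F.stalkE)
    have W': "openin (zariski A) W" "\<sigma> \<in> sp.frac.C W" "\<pi> x \<in> W" using W f(2) by auto
    have "stalk_iso x (\<sigma> (\<pi> x)) \<in> Units (stalk X x)"
      using x(3) f.stalk_map_germ[OF x(1) W(1-3)] f(3)[OF W'(1,2) x(1) W'(3)] W(4) by simp
    then have "\<sigma> (\<pi> x) \<in> Units (local_at A (\<pi> x))"
      using iso_reflects_Units[OF stalk_iso(1,2)[of x] local_at_cring stalk_cring[OF x(1)], of "\<sigma> (\<pi> x)"]
        x(1) UX sp.frac.C_val[OF W'(2,3)] by simp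
    then show "z \<in> Units (stalk (Spec A) (mor_pt f x))"
      using sp.Spec.F_unit_iff[OF W'(1,3,2)] W(4) f(2) by simp
  qed
  have g_lrs: "lrs_morphism (Spec A) X g"
  proof (subst lrs_morphism_iff[OF S.locally_ringed_space_axioms locally_ringed_space_axioms gm], intro ballI impI)
    fix p z assume p: "p \<in> pts (Spec A)" "z \<in> carrier (stalk X (mor_pt g p))" "stalk_map (Spec A) g p z \<in> Units (stalk (Spec A) p)"
    obtain W s where W: "opn X W" "mor_pt g p \<in> W" "s \<in> sec X W" "z = germ X (mor_pt g p) W s"
      using p(2) by (rule stalkE)
    have ps: "p \<in> prime_spec A" using p(1) pts_Spec by simp
    let ?Q = "{p \<in> prime_spec A. \<rho> p \<in> W}"
    have Q: "openin (zariski A) ?Q" "p \<in> ?Q" using openin_\<rho>_preimage[OF W(1)] ps W(2) g(1) by auto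
    have "mor_sec g W s p \<in> Units (local_at A p)"
      using p(3) g.stalk_map_germ[OF p(1) W(1-3)] W(4) pg
        sp.Spec.F_unit_iff[OF Q section_fraction[OF W(1) WU[OF W(1)] W(3), folded g(2)]] by simp
    then have u: "stalk_iso_inv (\<rho> p) z \<in> Units (local_at A (\<pi> (\<rho> p)))" using W(4) g Q(2) \<rho>(2)[OF ps] by simp
    have "stalk_iso (\<rho> p) (stalk_iso_inv (\<rho> p) z) \<in> Units (stalk X (\<rho> p))"
      using ring_hom_Units'[OF stalk_iso(1)[OF \<rho>(1)[OF ps]] local_at_cring[OF \<rho>(1)[OF ps]] stalk_cring'[OF U \<rho>(1)[OF ps]] u] .
    then show "z \<in> Units (stalk X (mor_pt g p))"
      using stalk_iso_inv(2)[OF \<rho>(1)[OF ps], of z] p(2) g(1) by simp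
  qed
  have "mor_eq X X (mor_comp (Spec A) g f) mor_id"
    unfolding mor_eq_def
  proof (intro conjI ballI allI impI)
    show "mor_pt (mor_comp (Spec A) g f) x = mor_pt mor_id x" if "x \<in> pts X" for x
      using that f(2) g(1) unfolding UX[symmetric] by simp
    fix W s assume W: "opn X W" "s \<in> sec X W"
    let ?Q = "{p \<in> prime_spec A. \<rho> p \<in> W}"
    have Q: "openin (zariski A) ?Q" by (rule openin_\<rho>_preimage[OF W(1)])
    have C: "mor_sec g W s \<in> sp.frac.C ?Q" using section_fraction[OF W(1) WU[OF W(1)] W(2)] g(2) by simp
    have pf: "preim X f ?Q = W" unfolding preim_def f(2) UX[symmetric] using WU[OF W(1)] \<pi>_prime by (auto simp: prime_spec_def)
    have "mor_sec f ?Q (mor_sec g W s) = s"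
    proof (rule section_eqI[OF W(1) _ W(2)])
      show "mor_sec f ?Q (mor_sec g W s) \<in> sec X W" using f.sec_closed[of ?Q "mor_sec g W s"] Q C pf by simp
      fix x assume x: "x \<in> W"
      have xU: "x \<in> U" using x WU[OF W(1)] by blast
      have "\<pi> x \<in> ?Q" using x xU \<pi>_prime[OF xU] by (simp add: prime_spec_def)
      then show "germ X x W (mor_sec f ?Q (mor_sec g W s)) = germ X x W s"
        using f(3)[OF Q C, of x] xU pf x W stalk_iso_inv(2)[OF xU, of "germ X x W s"]
        unfolding UX[symmetric] by (simp add: g(2))
    qed
    then show "mor_sec (mor_comp (Spec A) g f) W s = mor_sec mor_id W s" using pg by simp
  qed
  moreover have "mor_eq (Spec A) (Spec A) (mor_comp X f g) mor_id"
    unfolding mor_eq_def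
  proof (intro conjI ballI allI impI)
    show "mor_pt (mor_comp X f g) p = mor_pt mor_id p" if "p \<in> pts (Spec A)" for p
      using that pts_Spec \<rho>(2) f(2) g(1) by simp
    fix W \<sigma> assume "opn (Spec A) W" "\<sigma> \<in> sec (Spec A) W"
    then have W: "openin (zariski A) W" "\<sigma> \<in> sp.frac.C W" by auto
    have Wp: "W \<subseteq> prime_spec A" using openin_subset[OF W(1)] pts_Spec by simp
    let ?P = "preim X f W"
    have P: "{p \<in> prime_spec A. \<rho> p \<in> ?P} = W"
      unfolding preim_def f(2) UX[symmetric] using Wp \<rho> by (auto simp del: mem_Collect_eq)
    have "mor_sec g ?P (mor_sec f W \<sigma>) = \<sigma>"
    proof
      fix p show "mor_sec g ?P (mor_sec f W \<sigma>) p = \<sigma> p"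
      proof (cases "p \<in> W")
        case True
        then have ps: "p \<in> prime_spec A" using Wp by blast
        have "germ X (\<rho> p) ?P (mor_sec f W \<sigma>) = stalk_iso (\<rho> p) (\<sigma> p)"
          using f(3)[OF W, of "\<rho> p"] \<rho>[OF ps] True unfolding UX[symmetric] by simp
        then show ?thesis
          using True stalk_iso_inv(3)[OF \<rho>(1)[OF ps], of "\<sigma> p"] sp.frac.C_val[OF W(2) True] \<rho>(2)[OF ps]
          unfolding g(2) P by simp
      next
        case False
        then show ?thesis using fun_cong[OF sp.frac.C_ext[OF W(2)], of p] unfolding g(2) P by simp
      qed
    qed
    then show "mor_sec (mor_comp X f g) W \<sigma> = mor_sec mor_id W \<sigma>" by simp
  qed
  ultimately show ?thesis unfolding lrs_isomorphic_def using f_lrs g_lrs by blast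
qed

text \<open>\<open>U\<close> is also a chart of the open subspace \<open>open_sub X U\<close>, where
  it is the whole space.\<close>

theorem isomorphic_Spec: "lrs_isomorphic (open_sub X U) (Spec A)"
proof -
  have "chart (open_sub X U) U R" using chart_open_sub_iff[OF U] chart_axioms by simp
  then interpret Y: chart "open_sub X U" U R .
  show ?thesis using Y.isomorphic_Spec_whole pts_open_sub[OF U] by simp
qed

end

lemma (in locally_ringed_space) schemeI:
  assumes "\<And>x. x \<in> pts X \<Longrightarrow> \<exists>U R. x \<in> U \<and> chart X U R"
  shows "scheme X"
  unfolding scheme_def
proof (intro conjI ballI)
  show "locally_ringed_space X" ..
  fix x assume "x \<in> pts X"
  then obtain U R where x: "x \<in> U" and "chart X U R" using assms by blast
  then interpret chart X U R by simp
  show "\<exists>U (R :: 'b ring). opn X U \<and> x \<in> U \<and> cring R \<and> lrs_isomorphic (open_sub X U) (Spec R)"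
    using U x A_cring isomorphic_Spec by blast
qed

section \<open>Charts of a locally Noetherian scheme\<close>

lemma ideal_preimage:
  assumes h: "h \<in> ring_hom R S" and R: "cring R" and S: "cring S" and I: "ideal I S"
  shows "ideal {a \<in> carrier R. h a \<in> I} R"
proof -
  interpret R: cring R by (rule R)
  interpret S: cring S by (rule S)
  interpret I: ideal I S by (rule I)
  show ?thesis
    by (rule R.idealI')
      (auto simp: ring_hom_zero'[OF h R S] ring_hom_add[OF h] ring_hom_mult[OF h] ring_hom_closed[OF h] I.I_l_closed)
qed

lemma primeideal_preimage:
  assumes h: "h \<in> ring_hom R S" and R: "cring R" and S: "cring S" and P: "primeideal P S"
  shows "primeideal {a \<in> carrier R. h a \<in> P} R"
proof -
  interpret R: cring R by (rule R)
  interpret P: primeideal P S by (rule P)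
  show ?thesis
  proof (rule primeidealI[OF ideal_preimage[OF h R S P.is_ideal] R])
    have "\<one>\<^bsub>R\<^esub> \<notin> {a \<in> carrier R. h a \<in> P}" using ring_hom_one[OF h] by simp
    then show "carrier R \<noteq> {a \<in> carrier R. h a \<in> P}" using R.one_closed by blast
    show "a \<in> {a \<in> carrier R. h a \<in> P} \<or> b \<in> {a \<in> carrier R. h a \<in> P}"
      if "a \<in> carrier R" "b \<in> carrier R" "a \<otimes>\<^bsub>R\<^esub> b \<in> {a \<in> carrier R. h a \<in> P}" for a b
      using that P.I_prime[of "h a" "h b"] ring_hom_mult[OF h that(1,2)] ring_hom_closed[OF h] by auto
  qed
qed

lemma subring_image:
  assumes h: "h \<in> ring_hom R S" and R: "cring R" and S: "cring S" and H: "subring H R"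
  shows "subring (h ` H) S"
proof -
  interpret S: cring S by (rule S)
  note H' = subringE[OF H]
  have c: "a \<in> carrier R" if "a \<in> H" for a using H'(1) that by blast
  show ?thesis
  proof (rule S.subringI)
    show "h ` H \<subseteq> carrier S" using ring_hom_closed[OF h] c by blast
    show "\<one>\<^bsub>S\<^esub> \<in> h ` H" using ring_hom_one[OF h] H'(3) by force
    show "\<ominus>\<^bsub>S\<^esub> b \<in> h ` H" if "b \<in> h ` H" for b
      using that ring_hom_uminus'[OF h R S, symmetric] H'(5) c by auto
    show "b1 \<otimes>\<^bsub>S\<^esub> b2 \<in> h ` H" if "b1 \<in> h ` H" "b2 \<in> h ` H" for b1 b2
      using that ring_hom_mult[OF h, symmetric] H'(6) c by auto
    show "b1 \<oplus>\<^bsub>S\<^esub> b2 \<in> h ` H" if "b1 \<in> h ` H" "b2 \<in> h ` H" for b1 b2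
      using that ring_hom_add[OF h, symmetric] H'(7) c by auto
  qed
qed

text \<open>Condition \<open>eq\<close> says that nested ideals of \<open>S\<close> with the same
  preimage are equal, so a member whose preimage is maximal is itself maximal. It holds for
  surjections and for localizations.\<close>

lemma max_cond_transfer:
  assumes max: "max_cond R" and R: "cring R" and S: "cring S" and h: "h \<in> ring_hom R S"
    and eq: "\<And>I I'. ideal I S \<Longrightarrow> ideal I' S \<Longrightarrow> I \<subseteq> I' \<Longrightarrow>
      {a \<in> carrier R. h a \<in> I'} \<subseteq> {a \<in> carrier R. h a \<in> I} \<Longrightarrow> I' \<subseteq> I"
  shows "max_cond S"
  unfolding max_cond_def
proof (intro allI impI)
  fix F assume F: "F \<noteq> {} \<and> (\<forall>I\<in>F. ideal I S)"
  let ?v = "\<lambda>I. {a \<in> carrier R. h a \<in> I}"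
  obtain I0 where I0: "I0 \<in> F" using F by blast
  obtain N where N: "N \<in> ?v ` F" "\<And>I. I \<in> ?v ` F \<Longrightarrow> N \<subseteq> I \<Longrightarrow> I = N"
    by (rule max_condD[OF max, of "?v I0" "?v ` F"]) (use I0 F ideal_preimage[OF h R S] in auto)
  then obtain M where M: "M \<in> F" "N = ?v M" by blast
  have "I = M" if "I \<in> F" "M \<subseteq> I" for I
  proof -
    have "?v I = ?v M" using N(2)[of "?v I"] that M by blast
    then show ?thesis using eq[of M I] F M that by blast
  qed
  then show "\<exists>M\<in>F. \<forall>I\<in>F. M \<subseteq> I \<longrightarrow> I = M" using M by blast
qed

text \<open>The stalk map of the inverse morphism at the image point is inverse to that of
  \<open>f\<close>.\<close>

lemma iso_stalk_bij:
  assumes "ringed_mor X Y f" "ringed_mor Y X g"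
    and gf: "mor_eq X X (mor_comp Y g f) mor_id" and fg: "mor_eq Y Y (mor_comp X f g) mor_id"
    and x: "x \<in> pts X"
  shows "bij_betw (stalk_map X f x) (carrier (stalk Y (mor_pt f x))) (carrier (stalk X x))"
proof -
  interpret f: ringed_mor X Y f by fact
  interpret g: ringed_mor Y X g by fact
  have pt: "mor_pt g (mor_pt f x) = x" if "x \<in> pts X" for x using gf that by (simp add: mor_eq_def)
  have pt': "mor_pt f (mor_pt g y) = y" if "y \<in> pts Y" for y using fg that by (simp add: mor_eq_def)
  have y: "mor_pt f x \<in> pts Y" using x by simp
  show ?thesis
  proof (rule bij_betw_byWitness[where f' = "stalk_map Y g (mor_pt f x)"])
    show "stalk_map X f x ` carrier (stalk Y (mor_pt f x)) \<subseteq> carrier (stalk X x)"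
      using ring_hom_closed[OF f.stalk_map_hom[OF x]] by blast
    show "stalk_map Y g (mor_pt f x) ` carrier (stalk X x) \<subseteq> carrier (stalk Y (mor_pt f x))"
      using ring_hom_closed[OF g.stalk_map_hom[OF y]] pt[OF x] by auto
    show "\<forall>z\<in>carrier (stalk Y (mor_pt f x)). stalk_map Y g (mor_pt f x) (stalk_map X f x z) = z"
    proof
      fix z assume "z \<in> carrier (stalk Y (mor_pt f x))"
      then obtain V t where V: "opn Y V" "mor_pt f x \<in> V" "t \<in> sec Y V" "z = germ Y (mor_pt f x) V t"
        by (rule f.Y.stalkE)
      have p: "preim Y g (preim X f V) = V"
        using openin_subset[OF V(1)] pt' g.pt unfolding preim_def by auto
      have "mor_sec g (preim X f V) (mor_sec f V t) = t" using fg V by (simp add: mor_eq_def)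
      moreover have "mor_pt g (mor_pt f x) \<in> preim X f V" using pt[OF x] x V by (simp add: preim_def)
      ultimately show "stalk_map Y g (mor_pt f x) (stalk_map X f x z) = z"
        using f.stalk_map_germ[OF x V(1-3)] g.stalk_map_germ[OF y f.preim_open[OF V(1)] _ f.sec_closed[OF V(1,3)]]
          pt[OF x] p V(4) by simp
    qed
    show "\<forall>z\<in>carrier (stalk X x). stalk_map X f x (stalk_map Y g (mor_pt f x) z) = z"
    proof
      fix z assume "z \<in> carrier (stalk X x)"
      then obtain V t where V: "opn X V" "x \<in> V" "t \<in> sec X V" "z = germ X x V t" by (rule f.X.stalkE)
      have p: "preim X f (preim Y g V) = V"
        using openin_subset[OF V(1)] pt f.pt unfolding preim_def by auto
      have "mor_sec f (preim Y g V) (mor_sec g V t) = t" using gf V by (simp add: mor_eq_def)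
      moreover have "mor_pt f x \<in> preim Y g V" using pt[OF x] x V y by (simp add: preim_def)
      ultimately show "stalk_map X f x (stalk_map Y g (mor_pt f x) z) = z"
        using g.stalk_map_germ[OF y V(1) _ V(3)] f.stalk_map_germ[OF x g.preim_open[OF V(1)] _ g.sec_closed[OF V(1,3)]]
          pt[OF x] p V(2,4) by simp
    qed
  qed
qed

section \<open>The chart of a space isomorphic to a spectrum\<close>

locale affine_iso = Y: locally_ringed_space Y + spectrum S for Y :: "('a, 'b) rspace" and S :: "('r, 'm) ring_scheme" +
  fixes f and g
  assumes f: "ringed_morphism Y (Spec S) f" and g: "ringed_morphism (Spec S) Y g"
    and gf: "mor_eq Y Y (mor_comp (Spec S) g f) mor_id" and fg: "mor_eq (Spec S) (Spec S) (mor_comp Y f g) mor_id"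
begin

sublocale f: ringed_mor Y "Spec S" f
  by (intro ringed_mor.intro Y.ringed_space_axioms Spec.F_ringed ringed_mor_axioms.intro f)

sublocale g: ringed_mor "Spec S" Y g
  by (intro ringed_mor.intro Y.ringed_space_axioms Spec.F_ringed ringed_mor_axioms.intro g)

lemma pt_gf: "x \<in> pts Y \<Longrightarrow> mor_pt g (mor_pt f x) = x" using gf by (simp add: mor_eq_def)

lemma pts_S: "pts (Spec S) = prime_spec S"
  using topspace_zariski[OF is_cring] by simp

lemma pt_fg: "p \<in> prime_spec S \<Longrightarrow> mor_pt f (mor_pt g p) = p" using fg by (simp add: mor_eq_def flip: pts_S)

lemma f_prime: "x \<in> pts Y \<Longrightarrow> mor_pt f x \<in> prime_spec S" using f.pt pts_S by blast

lemma g_pt: "p \<in> prime_spec S \<Longrightarrow> mor_pt g p \<in> pts Y" using g.pt pts_S by blast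

definition sc :: "'r \<Rightarrow> 'r set \<Rightarrow> ('r \<times> 'r) set" where
  "sc a = (\<lambda>p\<in>prime_spec S. fraction S (carrier S - p) a \<one>\<^bsub>S\<^esub>)"

lemma open_all: "openin (zariski S) (prime_spec S)"
  using openin_topspace[of "zariski S"] topspace_zariski[OF is_cring] by simp

lemma sc_C: "a \<in> carrier S \<Longrightarrow> sc a \<in> frac.C (prime_spec S)"
  unfolding sc_def
proof (rule frac.L_C[OF open_all])
  assume "a \<in> carrier S"
  then show "(\<lambda>p. fraction S (carrier S - p) a \<one>\<^bsub>S\<^esub>) \<in> spec_fractions S (prime_spec S)"
    using primeideal.one_notin unfolding spec_fractions_def prime_spec_def
    by (intro CollectI bexI[of _ a] bexI[of _ "\<one>\<^bsub>S\<^esub>"]) auto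
qed

lemma sc_hom: "sc \<in> ring_hom S (rs_sec (Spec S) (prime_spec S))"
proof -
  have *: "sc (a \<otimes>\<^bsub>S\<^esub> b) p = sc a p \<otimes>\<^bsub>local_at S p\<^esub> sc b p \<and> sc (a \<oplus>\<^bsub>S\<^esub> b) p = sc a p \<oplus>\<^bsub>local_at S p\<^esub> sc b p
"
    if "a \<in> carrier S" "b \<in> carrier S" and p: "p \<in> prime_spec S" for a b p
  proof -
    interpret p: primeideal p S using p by (simp add: prime_spec_def)
    show ?thesis using that by (simp add: sc_def)
  qed
  have 1: "sc \<one>\<^bsub>S\<^esub> = (\<lambda>p\<in>prime_spec S. \<one>\<^bsub>local_at S p\<^esub>)"
    by (simp add: sc_def localization_def)
  have ext: "sc a p = undefined" if "p \<notin> prime_spec S" for a p using that by (simp add: sc_def)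
  show ?thesis
    by (rule ring_hom_memI) (use * sc_C open_all 1 ext in \<open>auto simp: fun_eq_iff\<close>)
qed

text \<open>The ring of the chart will be the image of \<open>S\<close> under this map into the
  global sections of \<open>Y\<close>. In this way the global sections of the spectrum never have to
  be determined.\<close>

definition \<phi> :: "'r \<Rightarrow> 'b" where
  "\<phi> a = mor_sec f (prime_spec S) (sc a)"

lemma preim_all: "preim Y f (prime_spec S) = pts Y"
  using f_prime by (auto simp: preim_def)

lemma \<phi>_hom: "\<phi> \<in> ring_hom S (rs_sec Y (pts Y))"
proof -
  have "mor_sec f (prime_spec S) \<circ> sc \<in> ring_hom S (rs_sec Y (pts Y))"
    using ring_hom_trans[OF sc_hom f.sec_hom] open_all preim_all by simp
  then show ?thesis by (simp add: comp_def \<phi>_def[abs_def])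
qed

lemma \<phi>_germ:
  assumes "y \<in> pts Y" "a \<in> carrier S"
  shows "germ Y y (pts Y) (\<phi> a) = stalk_map Y f y (germ (Spec S) (mor_pt f y) (prime_spec S) (sc a))"
  using f.stalk_map_germ[OF assms(1), of "prime_spec S" "sc a"] open_all sc_C[OF assms(2)] f_prime[OF assms(1)]
  by (simp add: \<phi>_def preim_all)

lemma stalk_bij: "y \<in> pts Y \<Longrightarrow> bij_betw (stalk_map Y f y) (carrier (stalk (Spec S) (mor_pt f y))) (carrier (stalk Y y))"
  by (rule iso_stalk_bij[OF f.ringed_mor_axioms g.ringed_mor_axioms gf fg])

lemma sc_germ [simp]: "p \<in> prime_spec S \<Longrightarrow> a \<in> carrier S \<Longrightarrow> germ (Spec S) p (prime_spec S) (sc a) \<in> carrier (stalk (Spec S) p)"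
  using open_all sc_C by (intro Spec.F.germ_in_stalk) auto

text \<open>Unit germs correspond under the bijective stalk map, a germ on the spectrum is a unit
  iff its value is, and \<open>a / 1\<close> is a unit at a prime iff the prime does not contain
  \<open>a\<close>.\<close>

lemma \<phi>_unit:
  assumes y: "y \<in> pts Y" and a: "a \<in> carrier S"
  shows "germ Y y (pts Y) (\<phi> a) \<in> Units (stalk Y y) \<longleftrightarrow> a \<notin> mor_pt f y"
proof -
  note p = f_prime[OF y]
  interpret p: primeideal "mor_pt f y" S using p by (simp add: prime_spec_def)
  have "germ Y y (pts Y) (\<phi> a) \<in> Units (stalk Y y) \<longleftrightarrow> germ (Spec S) (mor_pt f y) (prime_spec S) (sc a) \<in> Units (stalk (Spec S) (mor_pt f y))"
    unfolding \<phi>_germ[OF y a]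
    by (rule iso_reflects_Units[OF f.stalk_map_hom[OF y] stalk_bij[OF y] Spec.F.stalk_cring Y.stalk_cring[OF y]])
      (use p a pts_S in auto)
  also have "\<dots> \<longleftrightarrow> sc a (mor_pt f y) \<in> Units (local_at S (mor_pt f y))"
    using Spec.F_unit_iff[OF open_all p sc_C[OF a]] .
  also have "\<dots> \<longleftrightarrow> a \<notin> mor_pt f y"
    using p.frac_unit_iff[of a "\<one>\<^bsub>S\<^esub>"] a p by (simp add: sc_def)
  finally show ?thesis .
qed

abbreviation "R \<equiv> \<phi> ` carrier S"

lemma \<phi>_sec [simp]: "a \<in> carrier S \<Longrightarrow> \<phi> a \<in> sec Y (pts Y)"
  using ring_hom_closed[OF \<phi>_hom] .

lemma R_subring: "subring R (rs_sec Y (pts Y))"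
  by (rule subring_image[OF \<phi>_hom is_cring Y.sec_cring carrier_is_subring]) simp

lemma \<phi>_hom': "\<phi> \<in> ring_hom S (rs_sec Y (pts Y)\<lparr>carrier := R\<rparr>)"
  using \<phi>_hom by (auto simp: ring_hom_def)

lemma A_cring: "cring (rs_sec Y (pts Y)\<lparr>carrier := R\<rparr>)"
proof -
  interpret G: cring "rs_sec Y (pts Y)" by (rule Y.sec_cring) simp
  show ?thesis using G.subcring_iff[OF subringE(1)[OF R_subring]] G.subcringI'[OF R_subring] by simp
qed

text \<open>Through \<open>\<phi>_unit\<close> the points of \<open>Y\<close> become the primes of
  \<open>S\<close>, so \<open>inj\<close>, \<open>surj\<close> and \<open>basis\<close> are facts
  about the points and the topology of the spectrum; \<open>frac\<close> and \<open>ann\<close> come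
  from the description of the local rings, carried over by the stalk bijection.\<close>

lemma chart: "chart Y (pts Y) R"
proof (intro chart.intro Y.locally_ringed_space_axioms chart_axioms.intro)
  show "opn Y (pts Y)" by simp
  show "subring R (rs_sec Y (pts Y))" by (rule R_subring)
  fix y z assume yz: "y \<in> pts Y" "z \<in> pts Y"
    "\<And>a. a \<in> R \<Longrightarrow> germ Y y (pts Y) a \<in> Units (stalk Y y) \<longleftrightarrow> germ Y z (pts Y) a \<in> Units (stalk Y z)"
  have "a \<in> mor_pt f y \<longleftrightarrow> a \<in> mor_pt f z" if "a \<in> carrier S" for a
    using yz(3)[of "\<phi> a"] \<phi>_unit[OF yz(1) that] \<phi>_unit[OF yz(2) that] that by blast
  moreover have "mor_pt f y \<subseteq> carrier S" "mor_pt f z \<subseteq> carrier S"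
    using f_prime[OF yz(1)] f_prime[OF yz(2)]
    by (auto simp: prime_spec_def dest: primeideal.axioms(1) ideal.Icarr)
  ultimately have "mor_pt f y = mor_pt f z" by blast
  then show "y = z" using pt_gf yz by metis
next
  fix P assume P: "primeideal P (rs_sec Y (pts Y)\<lparr>carrier := R\<rparr>)"
  let ?p = "{a \<in> carrier S. \<phi> a \<in> P}"
  have p: "?p \<in> prime_spec S"
    using primeideal_preimage[OF \<phi>_hom' is_cring A_cring P] by (simp add: prime_spec_def)
  have PR: "P \<subseteq> R" using ideal.Icarr[OF primeideal.axioms(1)[OF P]] by auto
  let ?y = "mor_pt g ?p"
  have "germ Y ?y (pts Y) (\<phi> a) \<notin> Units (stalk Y ?y) \<longleftrightarrow> \<phi> a \<in> P" if "a \<in> carrier S" for a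
    using \<phi>_unit[OF g_pt[OF p] that] pt_fg[OF p] that by auto
  then have "P = {b \<in> R. germ Y ?y (pts Y) b \<notin> Units (stalk Y ?y)}" using PR by auto
  then show "\<exists>y\<in>pts Y. P = {b \<in> R. germ Y y (pts Y) b \<notin> Units (stalk Y y)}" using g_pt[OF p] by blast
next
  fix W y assume W: "opn Y W" "W \<subseteq> pts Y" "y \<in> W"
  have y: "y \<in> pts Y" using W by blast
  have o: "openin (zariski S) (preim (Spec S) g W)" using g.preim_open[OF W(1)] by simp
  have fy: "mor_pt f y \<in> preim (Spec S) g W" using W y pt_gf f.pt by (simp add: preim_def del: Spec.F_top)
  obtain a where a: "a \<in> carrier S" "mor_pt f y \<in> basic_open S a"
    "basic_open S a \<subseteq> preim (Spec S) g W" by (rule zariski_basis[OF is_cring o fy])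
  have "z \<in> W" if "z \<in> pts Y" "a \<notin> mor_pt f z" for z
    using a(3) that f_prime[OF that(1)] pt_gf[OF that(1)] by (auto simp: basic_open_def preim_def)
  then show "\<exists>b\<in>R. germ Y y (pts Y) b \<in> Units (stalk Y y) \<and> {z \<in> pts Y. germ Y z (pts Y) b \<in> Units (stalk Y z)} \<subseteq> W"
    using a \<phi>_unit[OF _ a(1)] y by (intro bexI[of _ "\<phi> a"]) (auto simp: basic_open_def)
next
  fix W y s assume W: "opn Y W" "W \<subseteq> pts Y" "y \<in> W" "s \<in> sec Y W"
  have y: "y \<in> pts Y" using W by blast
  let ?p = "mor_pt f y"
  have p: "?p \<in> prime_spec S" by (rule f_prime[OF y])
  interpret p: primeideal ?p S using p by (simp add: prime_spec_def)
  interpret St: cring "stalk (Spec S) ?p" by (rule Spec.F.stalk_cring) (use p pts_S in blast)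
  obtain w where w: "w \<in> carrier (stalk (Spec S) ?p)" "stalk_map Y f y w = germ Y y W s"
    using Y.germ_in_stalk[OF W(1,3,4)] unfolding bij_betw_imp_surj_on[OF stalk_bij[OF y], symmetric] by auto
  have pT: "?p \<in> topspace (zariski S)" using p topspace_zariski[OF is_cring] by simp
  obtain e where e: "e \<in> ring_hom (stalk (Spec S) ?p) (local_at S ?p)"
    "bij_betw e (carrier (stalk (Spec S) ?p)) (carrier (local_at S ?p))"
    "\<And>U s. openin (zariski S) U \<Longrightarrow> ?p \<in> U \<Longrightarrow> s \<in> frac.C U \<Longrightarrow> e (germ (Spec S) ?p U s) = s ?p"
    using Spec.F_stalk_iso[OF pT] by metis
  obtain a h where ah: "a \<in> carrier S" "h \<in> carrier S - ?p" "e w = fraction S (carrier S - ?p) a h"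
    using ring_hom_closed[OF e(1) w(1)] by (rule p.compl.loc_carrierE)
  let ?g = "\<lambda>a. germ (Spec S) ?p (prime_spec S) (sc a)"
  have es: "e (?g b) = fraction S (carrier S - ?p) b \<one>\<^bsub>S\<^esub>" if "b \<in> carrier S" for b
    using e(3)[OF open_all p sc_C[OF that]] p by (simp add: sc_def)
  have h: "h \<in> carrier S" using ah by blast
  \<comment> \<open>Clearing the denominator in the local ring: \<open>h / 1\<close> times
    \<open>a / h\<close> is \<open>a / 1\<close>. Injectivity of \<open>e\<close> brings this
    identity back to the stalk of the spectrum.\<close>
  have "fraction S (carrier S - ?p) (h \<otimes>\<^bsub>S\<^esub> a) (\<one>\<^bsub>S\<^esub> \<otimes>\<^bsub>S\<^esub> h) = fraction S (carrier S - ?p) a \<one>\<^bsub>S\<^esub>"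
    by (rule p.compl.fraction_eqI') (use ah h in auto)
  then have "e (?g h \<otimes>\<^bsub>stalk (Spec S) ?p\<^esub> w) = e (?g a)"
    using ring_hom_mult[OF e(1) sc_germ[OF p h] w(1)] es[OF h] es[OF ah(1)] ah h p.compl.loc_mult[of h a "\<one>\<^bsub>S\<^esub>" h] by simp
  then have "?g h \<otimes>\<^bsub>stalk (Spec S) ?p\<^esub> w = ?g a"
    using e(2) sc_germ[OF p h] sc_germ[OF p ah(1)] w(1) unfolding bij_betw_def inj_on_def by simp
  then have "germ Y y (pts Y) (\<phi> h) \<otimes>\<^bsub>stalk Y y\<^esub> germ Y y W s = germ Y y (pts Y) (\<phi> a)"
    using ring_hom_mult[OF f.stalk_map_hom[OF y] sc_germ[OF p h] w(1)] w(2) \<phi>_germ[OF y h] \<phi>_germ[OF y ah(1)] by simp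
  moreover have rc: "rs_res Y (pts Y) W (\<phi> h) \<in> sec Y W" using W h by simp
  ultimately have "germ Y y W (rs_res Y (pts Y) W (\<phi> h) \<otimes>\<^bsub>rs_sec Y W\<^esub> s) = germ Y y (pts Y) (\<phi> a)"
    using Y.stalk_mult_germ[OF W(1,3) rc W(4), symmetric] Y.germ_res[OF _ W(1,2,3), of "\<phi> h"] h by simp
  moreover have "germ Y y (pts Y) (\<phi> h) \<in> Units (stalk Y y)" using \<phi>_unit[OF y h] ah by blast
  ultimately show "\<exists>a\<in>R. \<exists>h\<in>R. germ Y y (pts Y) h \<in> Units (stalk Y y) \<and>
      germ Y y W (rs_res Y (pts Y) W h \<otimes>\<^bsub>rs_sec Y W\<^esub> s) = germ Y y (pts Y) a" using ah h by blast
next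
  fix y b assume y: "y \<in> pts Y" and b: "b \<in> R" "germ Y y (pts Y) b = germ Y y (pts Y) \<zero>\<^bsub>rs_sec Y (pts Y)\<^esub>"
  let ?p = "mor_pt f y"
  have p: "?p \<in> prime_spec S" by (rule f_prime[OF y])
  interpret p: primeideal ?p S using p by (simp add: prime_spec_def)
  obtain a where a: "a \<in> carrier S" "b = \<phi> a" using b by blast
  interpret C: cring "pointwise_ring (prime_spec S) (local_at S) (frac.C (prime_spec S))" by (rule frac.C_cring[OF open_all])
  have zc: "(\<lambda>p\<in>prime_spec S. \<zero>\<^bsub>local_at S p\<^esub>) \<in> frac.C (prime_spec S)" using C.zero_closed by simp
  have z: "\<zero>\<^bsub>stalk (Spec S) ?p\<^esub> = germ (Spec S) ?p (prime_spec S) (\<lambda>p\<in>prime_spec S. \<zero>\<^bsub>local_at S p\<^esub>)"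
    using Spec.F.stalk_zero_germ[of "prime_spec S" ?p] open_all p by simp
  have St: "cring (stalk (Spec S) ?p)" by (rule Spec.F.stalk_cring) (use p pts_S in blast)
  have "stalk_map Y f y (germ (Spec S) ?p (prime_spec S) (sc a)) = stalk_map Y f y \<zero>\<^bsub>stalk (Spec S) ?p\<^esub>"
    using b(2) \<phi>_germ[OF y a(1)] Y.stalk_zero_germ[of "pts Y" y] y a ring_hom_zero'[OF f.stalk_map_hom[OF y] St Y.stalk_cring[OF y]] by simp
  then have "germ (Spec S) ?p (prime_spec S) (sc a) = \<zero>\<^bsub>stalk (Spec S) ?p\<^esub>"
    using stalk_bij[OF y] sc_germ[OF p a(1)] cring.cring_simprules(2)[OF St] unfolding bij_betw_def inj_on_def by blast
  then have "sc a ?p = \<zero>\<^bsub>local_at S ?p\<^esub>"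
    using Spec.F_germ_eq_iff[OF open_all p sc_C[OF a(1)] open_all p zc] z p by simp
  then obtain u where u: "u \<in> carrier S - ?p" "u \<otimes>\<^bsub>S\<^esub> a = \<zero>\<^bsub>S\<^esub>"
    using p p.compl.loc_eq_zero_iff[OF a(1), of "\<one>\<^bsub>S\<^esub>"] by (auto simp: sc_def)
  have "\<phi> u \<otimes>\<^bsub>rs_sec Y (pts Y)\<^esub> b = \<zero>\<^bsub>rs_sec Y (pts Y)\<^esub>"
    using ring_hom_mult[OF \<phi>_hom, of u a] u a ring_hom_zero'[OF \<phi>_hom is_cring Y.sec_cring] by simp
  then show "\<exists>u\<in>R. germ Y y (pts Y) u \<in> Units (stalk Y y) \<and> u \<otimes>\<^bsub>rs_sec Y (pts Y)\<^esub> b = \<zero>\<^bsub>rs_sec Y (pts Y)\<^esub>"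
    using \<phi>_unit[OF y, of u] u by blast
qed

lemma chart_max_cond: "max_cond S \<Longrightarrow> max_cond (rs_sec Y (pts Y)\<lparr>carrier := R\<rparr>)"
proof (rule max_cond_transfer[OF _ is_cring A_cring \<phi>_hom'])
  fix I I' assume "ideal I' (rs_sec Y (pts Y)\<lparr>carrier := R\<rparr>)" "{a \<in> carrier S. \<phi> a \<in> I'} \<subseteq> {a \<in> carrier S. \<phi> a \<in> I}"
  then show "I' \<subseteq> I" using ideal.Icarr[of I' "rs_sec Y (pts Y)\<lparr>carrier := R\<rparr>"] by fastforce
qed

end

text \<open>An affine neighbourhood, viewed as an open subspace, is a chart of itself and hence of
  \<open>X\<close>; the maximal condition passes to the chart ring because that is an image of the
  Noetherian ring.\<close>

theorem locally_noetherian_chart: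
  assumes X: "locally_noetherian_scheme X" and x: "x \<in> pts X"
  obtains U R where "x \<in> U" "chart X U R" "max_cond (rs_sec X U\<lparr>carrier := R\<rparr>)"
proof -
  interpret locally_ringed_space X using X by (simp add: locally_noetherian_scheme_def scheme_def)
  obtain U and S :: "'b ring" where U: "opn X U" "x \<in> U" and S: "cring S" "noetherian_ring S"
    and iso: "lrs_isomorphic (open_sub X U) (Spec S)" using X x unfolding locally_noetherian_scheme_def by blast
  obtain f g where fg: "lrs_morphism (open_sub X U) (Spec S) f" "lrs_morphism (Spec S) (open_sub X U) g"
    "mor_eq (open_sub X U) (open_sub X U) (mor_comp (Spec S) g f) mor_id"
    "mor_eq (Spec S) (Spec S) (mor_comp (open_sub X U) f g) mor_id" using iso unfolding lrs_isomorphic_def by blast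
  interpret affine_iso "open_sub X U" S f g
    by (intro affine_iso.intro affine_iso_axioms.intro open_sub_locally_ringed[OF U(1)] fg(3,4))
      (use fg(1,2) S(1) in \<open>simp_all add: spectrum_def lrs_morphism_def\<close>)
  have "chart (open_sub X U) U R" using chart pts_open_sub[OF U(1)] by simp
  then have "chart X U R" using chart_open_sub_iff[OF U(1) order_refl] by blast
  moreover have "max_cond (rs_sec X U\<lparr>carrier := R\<rparr>)"
    using chart_max_cond noetherian_ring.max_cond[OF S(2)] pts_open_sub[OF U(1)] by simp
  ultimately show thesis using that U(2) by blast
qed

section \<open>Operations on charts\<close>

lemma (in cring) pow_Units: "u \<in> Units R \<Longrightarrow> u [^] (n::nat) \<in> Units R"
  by (induction n) auto

context chart
begin

definition D :: "'b \<Rightarrow> 'a set" where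
  "D g = {y \<in> U. germ X y U g \<in> Units (stalk X y)}"

text \<open>The sections \<open>a / g ^ n\<close> over \<open>D g\<close>, with the denominator
  cleared so that no inverse occurs.\<close>

definition fractions_on :: "'b \<Rightarrow> 'b set" where
  "fractions_on g = {s \<in> sec X (D g). \<exists>a\<in>R. \<exists>n::nat.
     s \<otimes>\<^bsub>rs_sec X (D g)\<^esub> rs_res X U (D g) g [^]\<^bsub>rs_sec X (D g)\<^esub> n = rs_res X U (D g) a}"

lemma D_U: "D g \<subseteq> U"
  by (auto simp: D_def)

lemma D_open: "g \<in> R \<Longrightarrow> opn X (D g)"
  unfolding D_def by (rule nonvanishing_open)

lemma fractions_onE:
  assumes "s \<in> fractions_on g"
  obtains a n where "s \<in> sec X (D g)" "a \<in> R"
    "s \<otimes>\<^bsub>rs_sec X (D g)\<^esub> rs_res X U (D g) g [^]\<^bsub>rs_sec X (D g)\<^esub> (n::nat) = rs_res X U (D g) a"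
  using assms unfolding fractions_on_def by blast

lemma fractions_onI:
  "\<lbrakk>s \<in> sec X (D g); a \<in> R; s \<otimes>\<^bsub>rs_sec X (D g)\<^esub> rs_res X U (D g) g [^]\<^bsub>rs_sec X (D g)\<^esub> (n::nat) = rs_res X U (D g) a\<rbrakk>
    \<Longrightarrow> s \<in> fractions_on g"
  unfolding fractions_on_def by blast

lemma res_germ_D: "\<lbrakk>g \<in> R; y \<in> D g; a \<in> R\<rbrakk> \<Longrightarrow> germ X y (D g) (rs_res X U (D g) a) = germ X y U a"
  using germ_res[OF U D_open D_U] by simp

lemma res_fractions_on:
  assumes "g \<in> R" "a \<in> R"
  shows "rs_res X U (D g) a \<in> fractions_on g"
proof -
  interpret \<Delta>: cring "rs_sec X (D g)" by (rule sec_cring[OF D_open[OF assms(1)]])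
  have "rs_res X U (D g) a \<in> sec X (D g)" using U D_open[OF assms(1)] D_U assms by simp
  then show ?thesis by (intro fractions_onI[of _ _ a 0]) (use assms in simp_all)
qed

text \<open>The chart ring is localized at the powers of \<open>g\<close>. Since \<open>g\<close> is
  a unit on \<open>D g\<close>, a fraction and its numerator differ by a unit; they have the same
  unit locus there and lie in the same ideals, so the axioms descend from \<open>R\<close>.\<close>

theorem chart_D:
  assumes g: "g \<in> R"
  shows "chart X (D g) (fractions_on g)"
    and "max_cond A \<Longrightarrow> max_cond (rs_sec X (D g)\<lparr>carrier := fractions_on g\<rparr>)"
proof -
  let ?D = "D g" and ?F = "fractions_on g" and ?r = "rs_res X U (D g)"
  let ?B = "rs_sec X ?D\<lparr>carrier := ?F\<rparr>"
  have Do: "opn X ?D" and DU: "?D \<subseteq> U" using D_open[OF g] D_U by auto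
  interpret \<Delta>: cring "rs_sec X ?D" by (rule sec_cring[OF Do])
  note rh = res_hom[OF U Do DU]
  have rc [simp]: "?r a \<in> sec X ?D" if "a \<in> R" for a using U Do DU that by simp
  have gu: "?r g \<in> Units (rs_sec X ?D)"
    by (rule sec_unitI[OF Do rc[OF g]]) (use res_germ_D[OF g _ g] in \<open>simp add: D_def\<close>)
  note gn = \<Delta>.pow_Units[OF gu]
  have gnc [simp]: "?r g [^]\<^bsub>rs_sec X ?D\<^esub> (n::nat) \<in> sec X ?D" for n using gn by blast
  have Fsec: "?F \<subseteq> sec X ?D" by (auto simp: fractions_on_def)
  have rpow: "?r g [^]\<^bsub>rs_sec X ?D\<^esub> (n::nat) = ?r (g [^]\<^bsub>A\<^esub> n)" for n
  proof -
    have "g [^]\<^bsub>A\<^esub> n = g [^]\<^bsub>rs_sec X U\<^esub> n" by (induction n) auto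
    then show ?thesis using ring_hom_pow'[OF rh \<Gamma>.is_cring \<Delta>.is_cring, of g n] g by simp
  qed
  have gR [simp]: "g [^]\<^bsub>A\<^esub> (n::nat) \<in> R" for n
    using monoid.nat_pow_closed[OF ring.is_monoid[OF cring.axioms(1)[OF A_cring]], of g n] g by simp
  have subr: "subring ?F (rs_sec X ?D)"
  proof (rule \<Delta>.subringI[OF Fsec])
    show "\<one>\<^bsub>rs_sec X ?D\<^esub> \<in> ?F" using res_fractions_on[OF g A.one_closed] ring_hom_one[OF rh] by simp
  next
    fix s assume "s \<in> ?F"
    then obtain a n where s: "s \<in> sec X ?D" "a \<in> R" "s \<otimes>\<^bsub>rs_sec X ?D\<^esub> ?r g [^]\<^bsub>rs_sec X ?D\<^esub> (n::nat) = ?r a"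
      by (rule fractions_onE)
    have "(\<ominus>\<^bsub>rs_sec X ?D\<^esub> s) \<otimes>\<^bsub>rs_sec X ?D\<^esub> ?r g [^]\<^bsub>rs_sec X ?D\<^esub> n = ?r (\<ominus>\<^bsub>rs_sec X U\<^esub> a)"
      using s by (simp add: \<Delta>.l_minus ring_hom_uminus'[OF rh \<Gamma>.is_cring \<Delta>.is_cring])
    then show "\<ominus>\<^bsub>rs_sec X ?D\<^esub> s \<in> ?F" using s subringE(5)[OF R] by (intro fractions_onI) auto
  next
    fix s t assume "s \<in> ?F" "t \<in> ?F"
    then obtain a n b m where s: "s \<in> sec X ?D" "a \<in> R" "s \<otimes>\<^bsub>rs_sec X ?D\<^esub> ?r g [^]\<^bsub>rs_sec X ?D\<^esub> (n::nat) = ?r a"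
      and t: "t \<in> sec X ?D" "b \<in> R" "t \<otimes>\<^bsub>rs_sec X ?D\<^esub> ?r g [^]\<^bsub>rs_sec X ?D\<^esub> (m::nat) = ?r b"
      by (metis fractions_onE)
    have p: "?r g [^]\<^bsub>rs_sec X ?D\<^esub> (n + m) = ?r g [^]\<^bsub>rs_sec X ?D\<^esub> n \<otimes>\<^bsub>rs_sec X ?D\<^esub> ?r g [^]\<^bsub>rs_sec X ?D\<^esub> m"
      using \<Delta>.nat_pow_mult[OF rc[OF g]] by simp
    have "(s \<otimes>\<^bsub>rs_sec X ?D\<^esub> t) \<otimes>\<^bsub>rs_sec X ?D\<^esub> ?r g [^]\<^bsub>rs_sec X ?D\<^esub> (n + m)
        = (s \<otimes>\<^bsub>rs_sec X ?D\<^esub> ?r g [^]\<^bsub>rs_sec X ?D\<^esub> n) \<otimes>\<^bsub>rs_sec X ?D\<^esub> (t \<otimes>\<^bsub>rs_sec X ?D\<^esub> ?r g [^]\<^bsub>rs_sec X ?D\<^esub> m)"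
      unfolding p using s(1) t(1) by (simp add: \<Delta>.m_ac)
    also have "\<dots> = ?r (a \<otimes>\<^bsub>rs_sec X U\<^esub> b)" using s t by (simp add: ring_hom_mult[OF rh])
    finally show "s \<otimes>\<^bsub>rs_sec X ?D\<^esub> t \<in> ?F" using s t by (intro fractions_onI) auto
    have "(s \<oplus>\<^bsub>rs_sec X ?D\<^esub> t) \<otimes>\<^bsub>rs_sec X ?D\<^esub> ?r g [^]\<^bsub>rs_sec X ?D\<^esub> (n + m)
        = (s \<otimes>\<^bsub>rs_sec X ?D\<^esub> ?r g [^]\<^bsub>rs_sec X ?D\<^esub> n) \<otimes>\<^bsub>rs_sec X ?D\<^esub> ?r g [^]\<^bsub>rs_sec X ?D\<^esub> m
        \<oplus>\<^bsub>rs_sec X ?D\<^esub> (t \<otimes>\<^bsub>rs_sec X ?D\<^esub> ?r g [^]\<^bsub>rs_sec X ?D\<^esub> m) \<otimes>\<^bsub>rs_sec X ?D\<^esub> ?r g [^]\<^bsub>rs_sec X ?D\<^esub> n"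
      unfolding p using s(1) t(1) by (simp add: \<Delta>.m_ac \<Delta>.l_distr \<Delta>.r_distr)
    also have "\<dots> = ?r a \<otimes>\<^bsub>rs_sec X ?D\<^esub> ?r g [^]\<^bsub>rs_sec X ?D\<^esub> m \<oplus>\<^bsub>rs_sec X ?D\<^esub> ?r b \<otimes>\<^bsub>rs_sec X ?D\<^esub> ?r g [^]\<^bsub>rs_sec X ?D\<^esub> n"
      by (simp only: s(3) t(3))
    also have "\<dots> = ?r (a \<otimes>\<^bsub>rs_sec X U\<^esub> g [^]\<^bsub>A\<^esub> m \<oplus>\<^bsub>rs_sec X U\<^esub> b \<otimes>\<^bsub>rs_sec X U\<^esub> g [^]\<^bsub>A\<^esub> n)"
      unfolding rpow using s(2) t(2) by (simp add: ring_hom_mult[OF rh] ring_hom_add[OF rh])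
    finally show "s \<oplus>\<^bsub>rs_sec X ?D\<^esub> t \<in> ?F" using s t by (intro fractions_onI) auto
  qed
  have Bc: "cring ?B" using \<Delta>.subcring_iff[OF Fsec] \<Delta>.subcringI'[OF subr] by simp
  have rB: "?r \<in> ring_hom A ?B"
    using rh res_fractions_on[OF g] by (auto simp: ring_hom_def)
  have gi: "inv\<^bsub>rs_sec X ?D\<^esub> (?r g [^]\<^bsub>rs_sec X ?D\<^esub> (n::nat)) \<in> ?F" for n
    using gn[of n] ring_hom_one[OF rh] A.one_closed by (intro fractions_onI[of _ _ "\<one>\<^bsub>rs_sec X U\<^esub>" n]) auto
  \<comment> \<open>Together with \<open>fwd\<close>: an ideal contains a fraction iff it contains
    the numerator. This serves both to match primes with points of \<open>D g\<close> and to
    transfer the maximal condition.\<close>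
  have bwd: "s \<in> I" if I: "ideal I ?B" and s: "s \<in> ?F" "?r a \<in> I"
    and eq: "s \<otimes>\<^bsub>rs_sec X ?D\<^esub> ?r g [^]\<^bsub>rs_sec X ?D\<^esub> (n::nat) = ?r a" for I s a n
  proof -
    have "?r a \<otimes>\<^bsub>rs_sec X ?D\<^esub> inv\<^bsub>rs_sec X ?D\<^esub> (?r g [^]\<^bsub>rs_sec X ?D\<^esub> n) \<in> I"
      using ideal.I_r_closed[OF I s(2), of "inv\<^bsub>rs_sec X ?D\<^esub> (?r g [^]\<^bsub>rs_sec X ?D\<^esub> n)"] gi by simp
    moreover have "?r a \<otimes>\<^bsub>rs_sec X ?D\<^esub> inv\<^bsub>rs_sec X ?D\<^esub> (?r g [^]\<^bsub>rs_sec X ?D\<^esub> n) = s"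
      unfolding eq[symmetric] using s(1) Fsec gn[of n] by (subst \<Delta>.m_assoc) auto
    ultimately show ?thesis by simp
  qed
  have fwd: "?r a \<in> I" if I: "ideal I ?B" and s: "s \<in> I"
    and eq: "s \<otimes>\<^bsub>rs_sec X ?D\<^esub> ?r g [^]\<^bsub>rs_sec X ?D\<^esub> (n::nat) = ?r a" for I s a n
    using ideal.I_r_closed[OF I s, of "?r g [^]\<^bsub>rs_sec X ?D\<^esub> n"] eq rpow[of n] res_fractions_on[OF g gR[of n]] by simp
  have germ_eq: "germ X y ?D s \<otimes>\<^bsub>stalk X y\<^esub> germ X y U g [^]\<^bsub>stalk X y\<^esub> n = germ X y U a"
    if "y \<in> ?D" "s \<in> sec X ?D" "a \<in> R" "s \<otimes>\<^bsub>rs_sec X ?D\<^esub> ?r g [^]\<^bsub>rs_sec X ?D\<^esub> (n::nat) = ?r a" for y s a n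
    using stalk_mult_germ[OF Do that(1,2) gnc[of n]] germ_pow[OF Do that(1) rc[OF g], of n] that(4)
      res_germ_D[OF g that(1)] that(3) g by simp
  have gyu: "germ X y U g [^]\<^bsub>stalk X y\<^esub> (n::nat) \<in> Units (stalk X y)" if "y \<in> ?D" for y n
    using cring.pow_Units[OF stalk_cring'[OF Do that]] that by (simp add: D_def)
  show "chart X ?D ?F"
  proof (intro chart.intro locally_ringed_space_axioms chart_axioms.intro Do subr)
    fix y z assume yz: "y \<in> ?D" "z \<in> ?D"
      "\<And>a. a \<in> ?F \<Longrightarrow> germ X y ?D a \<in> Units (stalk X y) \<longleftrightarrow> germ X z ?D a \<in> Units (stalk X z)"
    show "y = z"
    proof (rule inj)
      show "germ X y U a \<in> Units (stalk X y) \<longleftrightarrow> germ X z U a \<in> Units (stalk X z)" if "a \<in> R" for a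
        using yz(3)[OF res_fractions_on[OF g that]] res_germ_D[OF g yz(1) that] res_germ_D[OF g yz(2) that] by simp
    qed (use yz DU in auto)
  next
    fix P assume P: "primeideal P ?B"
    interpret P: primeideal P ?B by (rule P)
    have p: "primeideal {a \<in> R. ?r a \<in> P} A" using primeideal_preimage[OF rB A_cring Bc P] by simp
    obtain y where y: "y \<in> U" "{a \<in> R. ?r a \<in> P} = \<pi> y" using surj[OF p] by blast
    have "?r g \<notin> P"
    proof
      assume "?r g \<in> P"
      then have "\<one>\<^bsub>rs_sec X ?D\<^esub> \<in> P"
        using bwd[OF P.is_ideal _ _ , of "\<one>\<^bsub>rs_sec X ?D\<^esub>" g 1] subringE(3)[OF subr] rc[OF g] by simp
      then show False using P.one_notin by simp
    qed
    then have "g \<notin> \<pi> y" using y(2) by blast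
    then have yD: "y \<in> ?D" using y(1) g by (simp add: D_def)
    interpret S: cring "stalk X y" by (rule stalk_cring'[OF Do yD])
    have "s \<in> P \<longleftrightarrow> germ X y ?D s \<notin> Units (stalk X y)" if s: "s \<in> ?F" for s
    proof -
      obtain a n where a: "s \<in> sec X ?D" "a \<in> R" "s \<otimes>\<^bsub>rs_sec X ?D\<^esub> ?r g [^]\<^bsub>rs_sec X ?D\<^esub> (n::nat) = ?r a"
        using s by (rule fractions_onE)
      have "s \<in> P \<longleftrightarrow> ?r a \<in> P" using bwd[OF P.is_ideal s _ a(3)] fwd[OF P.is_ideal _ a(3)] by blast
      also have "\<dots> \<longleftrightarrow> germ X y U a \<notin> Units (stalk X y)" using y(2) a(2) by blast
      also have "\<dots> \<longleftrightarrow> germ X y ?D s \<notin> Units (stalk X y)"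
        using germ_eq[OF yD a] gyu[OF yD, of n] Do yD a(1) S.Units_m_closed S.unit_factors(1)[of "germ X y ?D s"]
        by (metis S.Units_closed germ_in_stalk)
      finally show ?thesis .
    qed
    moreover have "P \<subseteq> ?F" using P.Icarr by auto
    ultimately have "P = {a \<in> ?F. germ X y ?D a \<notin> Units (stalk X y)}" by blast
    then show "\<exists>y\<in>?D. P = {a \<in> ?F. germ X y ?D a \<notin> Units (stalk X y)}" using yD by blast
  next
    fix W y assume W: "opn X W" "W \<subseteq> ?D" "y \<in> W"
    then obtain h where h: "h \<in> R" "germ X y U h \<in> Units (stalk X y)" "{z \<in> U. germ X z U h \<in> Units (stalk X z)} \<subseteq> W"
      using basis[of W y] DU by blast
    then show "\<exists>f\<in>?F. germ X y ?D f \<in> Units (stalk X y) \<and> {z \<in> ?D. germ X z ?D f \<in> Units (stalk X z)} \<subseteq> W"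
      using res_fractions_on[OF g h(1)] res_germ_D[OF g _ h(1)] W DU by (intro bexI[of _ "?r h"]) auto
  next
    fix W y s assume W: "opn X W" "W \<subseteq> ?D" "y \<in> W" "s \<in> sec X W"
    obtain a h where ah: "a \<in> R" "h \<in> R" "germ X y U h \<in> Units (stalk X y)"
      "germ X y W (rs_res X U W h \<otimes>\<^bsub>rs_sec X W\<^esub> s) = germ X y U a"
      using frac[of W y s] W DU by blast
    have "rs_res X ?D W (?r h) = rs_res X U W h" using res_res[OF U Do W(1,2) DU] ah by simp
    then show "\<exists>a\<in>?F. \<exists>h\<in>?F. germ X y ?D h \<in> Units (stalk X y) \<and> germ X y W (rs_res X ?D W h \<otimes>\<^bsub>rs_sec X W\<^esub> s) = germ X y ?D a"
      using ah res_fractions_on[OF g] res_germ_D[OF g] W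
      by (intro bexI[of _ "?r a"] bexI[of _ "?r h"]) (auto simp: subset_iff)
  next
    fix y s assume y: "y \<in> ?D" and s: "s \<in> ?F" "germ X y ?D s = germ X y ?D \<zero>\<^bsub>rs_sec X ?D\<^esub>"
    obtain a n where a: "s \<in> sec X ?D" "a \<in> R" "s \<otimes>\<^bsub>rs_sec X ?D\<^esub> ?r g [^]\<^bsub>rs_sec X ?D\<^esub> (n::nat) = ?r a"
      using s(1) by (rule fractions_onE)
    interpret S: cring "stalk X y" by (rule stalk_cring'[OF Do y])
    have yU: "y \<in> U" using y DU by blast
    have "germ X y U a = \<zero>\<^bsub>stalk X y\<^esub>"
      using germ_eq[OF y a] S.l_null[OF S.Units_closed[OF gyu[OF y, of n]]]
      unfolding s(2) stalk_zero_germ[OF Do y, symmetric] by simp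
    from ann_stalk[OF yU a(2) this] obtain u where u: "u \<in> R" "germ X y U u \<in> Units (stalk X y)"
      "u \<otimes>\<^bsub>rs_sec X U\<^esub> a = \<zero>\<^bsub>rs_sec X U\<^esub>" by blast
    \<comment> \<open>If \<open>u\<close> kills the numerator, it kills \<open>s\<close> times a
      power of \<open>g\<close>; as that power is a unit on \<open>D g\<close>, it kills
      \<open>s\<close>.\<close>
    have "(?r u \<otimes>\<^bsub>rs_sec X ?D\<^esub> s) \<otimes>\<^bsub>rs_sec X ?D\<^esub> ?r g [^]\<^bsub>rs_sec X ?D\<^esub> n = ?r (u \<otimes>\<^bsub>rs_sec X U\<^esub> a)"
      using a u(1) by (simp add: \<Delta>.m_assoc ring_hom_mult[OF rh])
    then have "?r g [^]\<^bsub>rs_sec X ?D\<^esub> n \<otimes>\<^bsub>rs_sec X ?D\<^esub> (?r u \<otimes>\<^bsub>rs_sec X ?D\<^esub> s) = \<zero>\<^bsub>rs_sec X ?D\<^esub>"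
      using u(3) ring_hom_zero'[OF rh \<Gamma>.is_cring \<Delta>.is_cring] a(1) u(1) \<Delta>.m_comm[of "?r u \<otimes>\<^bsub>rs_sec X ?D\<^esub> s" "?r g [^]\<^bsub>rs_sec X ?D\<^esub> n"]
      by simp
    then have "?r u \<otimes>\<^bsub>rs_sec X ?D\<^esub> s = \<zero>\<^bsub>rs_sec X ?D\<^esub>"
      using \<Delta>.unit_eq_zeroD[OF gn[of n], of "?r u \<otimes>\<^bsub>rs_sec X ?D\<^esub> s"] a(1) u(1) by simp
    then show "\<exists>u\<in>?F. germ X y ?D u \<in> Units (stalk X y) \<and> u \<otimes>\<^bsub>rs_sec X ?D\<^esub> s = \<zero>\<^bsub>rs_sec X ?D\<^esub>"
      using res_fractions_on[OF g u(1)] res_germ_D[OF g y u(1)] u(2) by (intro bexI[of _ "?r u"]) auto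
  qed
  show "max_cond ?B" if "max_cond A"
  proof (rule max_cond_transfer[OF that A_cring Bc rB])
    fix I I' assume I: "ideal I ?B" "ideal I' ?B" "{a \<in> carrier A. ?r a \<in> I'} \<subseteq> {a \<in> carrier A. ?r a \<in> I}"
    show "I' \<subseteq> I"
    proof
      fix s assume s: "s \<in> I'"
      then have sF: "s \<in> ?F" using ideal.Icarr[OF I(2)] by simp
      then obtain a n where a: "s \<in> sec X ?D" "a \<in> R" "s \<otimes>\<^bsub>rs_sec X ?D\<^esub> ?r g [^]\<^bsub>rs_sec X ?D\<^esub> (n::nat) = ?r a"
        by (rule fractions_onE)
      have "?r a \<in> I" using fwd[OF I(2) s a(3)] I(3) a(2) by auto
      then show "s \<in> I" using bwd[OF I(1) sF _ a(3)] by blast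
    qed
  qed
qed

end

lemma (in ideal_space) incl_zero:
  assumes "opn X U" "s \<in> J U"
  shows "mor_sec \<iota> U s = \<zero>\<^bsub>rs_sec B (U \<inter> supp X J)\<^esub>"
  using assms J_sec[OF assms] qg_zero_iff[OF assms(1) _ J_sec[OF assms]] JstI[OF assms(1) _ assms(2)] by (auto simp: fun_eq_iff)

text \<open>Condition \<open>qc\<close> is quasi-coherence of \<open>J\<close> on the chart: what
  lies in \<open>J\<close> at \<open>y\<close> does so on all of \<open>U\<close> after
  multiplication by an element of \<open>R\<close> that is invertible at \<open>y\<close>. It is
  used to place primes in the support and to establish \<open>ann\<close>.\<close>

theorem (in ideal_space) closed_chart:
  assumes "chart X U R"
    and qc: "\<And>y a. \<lbrakk>y \<in> U; a \<in> R; germ X y U a \<in> Jst y\<rbrakk> \<Longrightarrow>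
      \<exists>u\<in>R. germ X y U u \<in> Units (stalk X y) \<and> u \<otimes>\<^bsub>rs_sec X U\<^esub> a \<in> J U"
  shows "chart B (U \<inter> supp X J) (mor_sec \<iota> U ` R)"
proof -
  interpret C: chart X U R by fact
  let ?W = "U \<inter> supp X J" and ?c = "mor_sec \<iota> U"
  let ?A' = "rs_sec B ?W\<lparr>carrier := ?c ` R\<rparr>"
  have W: "opn B ?W" using C.U by simp
  have ch: "?c \<in> ring_hom (rs_sec X U) (rs_sec B ?W)" using incl.sec_hom[OF C.U] by simp
  interpret G: cring "rs_sec B ?W" by (rule B.F.sec_cring[OF W])
  have subr: "subring (?c ` R) (rs_sec B ?W)" by (rule subring_image[OF ch C.\<Gamma>.is_cring G.is_cring C.R])
  have A'c: "cring ?A'" using G.subcring_iff[OF subringE(1)[OF subr]] G.subcringI'[OF subr] by simp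
  have cA: "?c \<in> ring_hom C.A ?A'" using ch by (auto simp: ring_hom_def)
  have gm: "germ B y ?W (?c a) = stalk_map B \<iota> y (germ X y U a)" if "y \<in> ?W" "a \<in> R" for y a
    using incl_stalk_map[of U y a] C.U that by simp
  have un: "germ B y ?W (?c a) \<in> Units (stalk B y) \<longleftrightarrow> germ X y U a \<in> Units (stalk X y)" if "y \<in> ?W" "a \<in> R" for y a
    using gm[OF that] incl_germ_eq_iff(2)[of y "germ X y U a"] that by simp
  show ?thesis
  proof (intro chart.intro B_locally_ringed chart_axioms.intro W subr)
    fix y z assume yz: "y \<in> ?W" "z \<in> ?W"
      "\<And>a. a \<in> ?c ` R \<Longrightarrow> germ B y ?W a \<in> Units (stalk B y) \<longleftrightarrow> germ B z ?W a \<in> Units (stalk B z)"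
    show "y = z"
    proof (rule C.inj)
      show "germ X y U a \<in> Units (stalk X y) \<longleftrightarrow> germ X z U a \<in> Units (stalk X z)" if "a \<in> R" for a
        using yz(3)[of "?c a"] un[OF yz(1) that] un[OF yz(2) that] that by blast
    qed (use yz in auto)
  next
    fix P assume P: "primeideal P ?A'"
    interpret P: primeideal P ?A' by (rule P)
    have p: "primeideal {a \<in> R. ?c a \<in> P} C.A" using primeideal_preimage[OF cA C.A_cring A'c P] by simp
    obtain y where y: "y \<in> U" "{a \<in> R. ?c a \<in> P} = {a \<in> R. germ X y U a \<notin> Units (stalk X y)}" using C.surj[OF p] by blast
    have yX: "y \<in> pts X" using C.U_pts[OF y(1)] .
    \<comment> \<open>Outside the support, \<open>qc\<close> applied to \<open>\<one>\<close> yields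
      an element invertible at \<open>y\<close> that lies in \<open>J U\<close>. Its image is zero
      and so belongs to \<open>P\<close>, contrary to the choice of \<open>y\<close>.\<close>
    have "y \<in> supp X J"
    proof (rule ccontr)
      assume "y \<notin> supp X J"
      then have "germ X y U \<one>\<^bsub>rs_sec X U\<^esub> \<in> Jst y" using supp_iff yX stalk_one_germ[OF C.U y(1)] by simp
      from qc[OF y(1) C.A.one_closed this] obtain u where u: "u \<in> R" "germ X y U u \<in> Units (stalk X y)"
        "u \<otimes>\<^bsub>rs_sec X U\<^esub> \<one>\<^bsub>rs_sec X U\<^esub> \<in> J U" by blast
      then have "?c u = \<zero>\<^bsub>rs_sec B ?W\<^esub>" using incl_zero[OF C.U, of u] by simp
      then have "?c u \<in> P" using additive_subgroup.zero_closed[OF ideal.axioms(1)[OF P.is_ideal]] by simp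
      then show False using y(2) u by blast
    qed
    then have yW: "y \<in> ?W" using y by blast
    have "?c a \<in> P \<longleftrightarrow> germ B y ?W (?c a) \<notin> Units (stalk B y)" if "a \<in> R" for a
      using un[OF yW that] y(2) that by blast
    moreover have "P \<subseteq> ?c ` R" using P.Icarr by auto
    ultimately have "P = {b \<in> ?c ` R. germ B y ?W b \<notin> Units (stalk B y)}" by blast
    then show "\<exists>y\<in>?W. P = {b \<in> ?c ` R. germ B y ?W b \<notin> Units (stalk B y)}" using yW by blast
  next
    fix V y assume V: "opn B V" "V \<subseteq> ?W" "y \<in> V"
    then obtain N where N: "opn X N" "V = N \<inter> supp X J" using opn_B by blast
    have o: "opn X (N \<inter> U)" using N C.U by blast
    then obtain h where h: "h \<in> R" "germ X y U h \<in> Units (stalk X y)" "{z \<in> U. germ X z U h \<in> Units (stalk X z)} \<subseteq> N \<inter> U"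
      using C.basis[OF o, of y] V N by blast
    show "\<exists>f\<in>?c ` R. germ B y ?W f \<in> Units (stalk B y) \<and> {z \<in> ?W. germ B z ?W f \<in> Units (stalk B z)} \<subseteq> V"
    proof (intro bexI conjI subsetI)
      show "germ B y ?W (?c h) \<in> Units (stalk B y)" using un[of y h] h V by blast
      fix z assume "z \<in> {z \<in> ?W. germ B z ?W (?c h) \<in> Units (stalk B z)}"
      then have "z \<in> ?W" "germ X z U h \<in> Units (stalk X z)" using un[of z h] h(1) by blast+
      then show "z \<in> V" using h(3) N by blast
    qed (use h in blast)
  next
    fix V y \<sigma> assume V: "opn B V" "V \<subseteq> ?W" "y \<in> V" "\<sigma> \<in> sec B V"
    have y: "y \<in> ?W" "y \<in> supp X J" "y \<in> U" using V by auto
    note yX = supp_pts[OF y(2)]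
    have yB: "y \<in> pts B" using y pts_B by blast
    obtain N s where N: "opn X N" "y \<in> N" "y \<in> supp X J" "s \<in> sec X N" "germ B y V \<sigma> = stalk_map B \<iota> y (germ X y N s)"
      using B.F.germ_in_stalk[OF V(1,3,4)] by (rule B_stalkE)
    obtain a h where ah: "a \<in> R" "h \<in> R" "germ X y U h \<in> Units (stalk X y)"
      "germ X y U h \<otimes>\<^bsub>stalk X y\<^esub> germ X y N s = germ X y U a"
      by (rule C.frac_stalk[OF y(3), of "germ X y N s"]) (use N in auto)
    have "stalk_map B \<iota> y (germ X y U h) \<otimes>\<^bsub>stalk B y\<^esub> stalk_map B \<iota> y (germ X y N s) = stalk_map B \<iota> y (germ X y U a)"
      using ring_hom_mult[OF incl.stalk_map_hom[OF yB], of "germ X y U h" "germ X y N s"] ah C.germ_R[OF y(3)] N by simp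
    then have e: "germ B y ?W (?c h) \<otimes>\<^bsub>stalk B y\<^esub> germ B y V \<sigma> = germ B y ?W (?c a)"
      using gm[OF y(1)] ah N(5) by simp
    have hs: "?c h \<in> sec B ?W" using ring_hom_closed[OF ch] ah by simp
    have r: "rs_res B ?W V (?c h) \<in> sec B V" by (rule B.F.res_closed[OF W V(1,2) hs])
    have "germ B y V (rs_res B ?W V (?c h) \<otimes>\<^bsub>rs_sec B V\<^esub> \<sigma>) = germ B y ?W (?c a)"
      using B.F.stalk_mult_germ[OF V(1,3) r V(4), symmetric] B.F.germ_res[OF W V(1,2,3) hs] e by simp
    then show "\<exists>a\<in>?c ` R. \<exists>h\<in>?c ` R. germ B y ?W h \<in> Units (stalk B y) \<and>
        germ B y V (rs_res B ?W V h \<otimes>\<^bsub>rs_sec B V\<^esub> \<sigma>) = germ B y ?W a"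
      using ah un[OF y(1) ah(2)] by blast
  next
    fix y b assume y: "y \<in> ?W" and b: "b \<in> ?c ` R" "germ B y ?W b = germ B y ?W \<zero>\<^bsub>rs_sec B ?W\<^esub>"
    obtain a where a: "a \<in> R" "b = ?c a" using b(1) by blast
    \<comment> \<open>A zero germ on the closed subspace means membership in \<open>Jst y\<close>;
      by \<open>qc\<close> the lift is multiplied into \<open>J U\<close>, which becomes zero on the
      closed subspace.\<close>
    have "stalk_map B \<iota> y (germ X y U a) = \<zero>\<^bsub>stalk B y\<^esub>"
      using b(2) a gm[OF y a(1)] B.F.stalk_zero_germ[OF W y] by simp
    then have "germ X y U a \<in> Jst y" using incl_germ_eq_iff(1)[of y "germ X y U a"] y a by simp
    then obtain u where u: "u \<in> R" "germ X y U u \<in> Units (stalk X y)" "u \<otimes>\<^bsub>rs_sec X U\<^esub> a \<in> J U"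
      using qc[of y a] y a by blast
    have "?c u \<otimes>\<^bsub>rs_sec B ?W\<^esub> b = ?c (u \<otimes>\<^bsub>rs_sec X U\<^esub> a)" using ring_hom_mult[OF ch, of u a] u a by simp
    also have "\<dots> = \<zero>\<^bsub>rs_sec B ?W\<^esub>" by (rule incl_zero[OF C.U u(3)])
    finally show "\<exists>u\<in>?c ` R. germ B y ?W u \<in> Units (stalk B y) \<and> u \<otimes>\<^bsub>rs_sec B ?W\<^esub> b = \<zero>\<^bsub>rs_sec B ?W\<^esub>"
      using u un[OF y u(1)] by blast
  qed
qed

section \<open>Locally principal ideals and their inverse images\<close>

text \<open>For ideal sheaves this is \<open>generated_on\<close> read in the stalks. It is the form
  that is convenient for inverse images and for changing the generator by units.\<close>

definition stalkwise_generated :: "('a, 'b) rspace \<Rightarrow> ('a set \<Rightarrow> 'b set) \<Rightarrow> 'a set \<Rightarrow> 'b \<Rightarrow> bool" where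
  "stalkwise_generated X J U f \<longleftrightarrow> opn X U \<and> f \<in> sec X U \<and>
     (\<forall>x\<in>U. stalk_ideal X J x = {c \<otimes>\<^bsub>stalk X x\<^esub> germ X x U f |c. c \<in> carrier (stalk X x)})"

context ideal_space
begin

lemma generated_onD:
  assumes U: "opn X U" and gen: "generated_on X J U f"
  shows "stalkwise_generated X J U f"
  unfolding stalkwise_generated_def
proof (intro conjI ballI Set.set_eqI iffI)
  have fJ: "f \<in> J U" using gen by (simp add: generated_on_def)
  then show f: "f \<in> sec X U" using J_sec U by blast
  fix x assume x: "x \<in> U"
  interpret Jx: ideal "Jst x" "stalk X x" by (rule Jst_ideal[OF pts_open[OF U x]])
  show "z \<in> {c \<otimes>\<^bsub>stalk X x\<^esub> germ X x U f |c. c \<in> carrier (stalk X x)}" if z: "z \<in> Jst x" for z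
  proof -
    obtain V s where V: "opn X V" "x \<in> V" "s \<in> J V" "z = germ X x V s" using z by (rule JstE)
    have W: "opn X (U \<inter> V)" "x \<in> U \<inter> V" using U V x by auto
    have r: "rs_res X V (U \<inter> V) s \<in> J (U \<inter> V)" using J_res[OF V(1) W(1) _ V(3)] by blast
    obtain N a where N: "opn X N" "x \<in> N" "N \<subseteq> U \<inter> V" "a \<in> sec X N"
      "rs_res X (U \<inter> V) N (rs_res X V (U \<inter> V) s) = a \<otimes>\<^bsub>rs_sec X N\<^esub> rs_res X U N f"
      using gen W r unfolding generated_on_def by blast
    have sV: "s \<in> sec X V" using J_sec V by blast
    have NU: "N \<subseteq> U" using N(3) by blast
    have rf: "rs_res X U N f \<in> sec X N" using U N(1) NU f by simp
    have "z = germ X x N (a \<otimes>\<^bsub>rs_sec X N\<^esub> rs_res X U N f)"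
      unfolding N(5)[symmetric] germ_res[OF W(1) N(1,3,2) res_closed[OF V(1) W(1) Int_lower2 sV]]
      using germ_res[OF V(1) W(1) Int_lower2 W(2) sV] V(4) by simp
    also have "\<dots> = germ X x N a \<otimes>\<^bsub>stalk X x\<^esub> germ X x U f"
      using stalk_mult_germ[OF N(1,2,4) rf] germ_res[OF U N(1) NU N(2) f] by simp
    finally show ?thesis using germ_in_stalk[OF N(1,2,4)] by blast
  qed
  show "z \<in> Jst x" if "z \<in> {c \<otimes>\<^bsub>stalk X x\<^esub> germ X x U f |c. c \<in> carrier (stalk X x)}" for z
    using that Jx.I_l_closed[OF JstI[OF U x fJ]] by blast
qed (rule U)

lemma generator_mem:
  assumes gen: "stalkwise_generated X J U f"
  shows "f \<in> J U"
proof -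
  have U: "opn X U" "f \<in> sec X U" using gen by (auto simp: stalkwise_generated_def)
  have "germ X x U f \<in> Jst x" if x: "x \<in> U" for x
  proof -
    interpret S: cring "stalk X x" by (rule stalk_cring'[OF U(1) x])
    have "germ X x U f = \<one>\<^bsub>stalk X x\<^esub> \<otimes>\<^bsub>stalk X x\<^esub> germ X x U f" using U x by simp
    then show ?thesis using gen x S.one_closed unfolding stalkwise_generated_def by blast
  qed
  then show ?thesis using J_iff[OF U] by blast
qed

text \<open>The coefficient is found in the stalk; it extends to a section on a neighbourhood, and
  the equation holds after shrinking once more.\<close>

lemma generated_onI:
  assumes gen: "stalkwise_generated X J U f"
  shows "generated_on X J U f"
  unfolding generated_on_def
proof (intro conjI allI impI generator_mem[OF gen])
  have U: "opn X U" "f \<in> sec X U" using gen by (auto simp: stalkwise_generated_def)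
  fix W s x assume W: "opn X W \<and> W \<subseteq> U \<and> s \<in> J W \<and> x \<in> W"
  then have x: "x \<in> U" and s: "s \<in> sec X W" using J_sec by auto
  have "germ X x W s \<in> Jst x" using JstI W by blast
  then obtain c where c: "c \<in> carrier (stalk X x)" "germ X x W s = c \<otimes>\<^bsub>stalk X x\<^esub> germ X x U f"
    using gen x unfolding stalkwise_generated_def by blast
  obtain N a where N: "opn X N" "x \<in> N" "N \<subseteq> W" "a \<in> sec X N" "c = germ X x N a"
    by (rule stalk_nbhdE[OF c(1), of W]) (use W in auto)
  interpret N: cring "rs_sec X N" by (rule sec_cring[OF N(1)])
  have NU: "N \<subseteq> U" using N W by blast
  have rf: "rs_res X U N f \<in> sec X N" using U N NU by simp
  have rs: "rs_res X W N s \<in> sec X N" using W N s by simp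
  have "germ X x N (rs_res X W N s) = germ X x N (a \<otimes>\<^bsub>rs_sec X N\<^esub> rs_res X U N f)"
    using c(2) N W s U NU rf by (simp add: germ_res flip: stalk_mult_germ)
  then obtain M where M: "opn X M" "x \<in> M" "M \<subseteq> N"
    "rs_res X N M (rs_res X W N s) = rs_res X N M (a \<otimes>\<^bsub>rs_sec X N\<^esub> rs_res X U N f)"
    using germ_eq_nbhd[OF N(1,2) rs N(1,2) N.m_closed[OF N(4) rf]] by metis
  have "rs_res X W M s = rs_res X N M a \<otimes>\<^bsub>rs_sec X M\<^esub> rs_res X U M f"
    using M N W U NU s rf by (simp add: res_res ring_hom_mult[OF res_hom])
  then show "\<exists>W'. opn X W' \<and> x \<in> W' \<and> W' \<subseteq> W \<and> (\<exists>a\<in>sec X W'. rs_res X W W' s = a \<otimes>\<^bsub>rs_sec X W'\<^esub> rs_res X U W' f)"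
    using M N by (intro exI[of _ M]) auto
qed

text \<open>A generator may be altered by a factor that is a unit at each point separately. This
  allows it to be replaced by an element of a chart ring.\<close>

lemma stalkwise_generated_shrink:
  assumes gen: "stalkwise_generated X J U f" and D: "opn X D" "D \<subseteq> U" "a \<in> sec X D"
    and assoc: "\<And>y. y \<in> D \<Longrightarrow> \<exists>u\<in>Units (stalk X y). germ X y D a = u \<otimes>\<^bsub>stalk X y\<^esub> germ X y U f"
  shows "stalkwise_generated X J D a"
  unfolding stalkwise_generated_def
proof (intro conjI ballI D)
  have U: "opn X U" "f \<in> sec X U" using gen by (auto simp: stalkwise_generated_def)
  fix y assume y: "y \<in> D"
  interpret S: cring "stalk X y" by (rule stalk_cring'[OF D(1) y])
  obtain u where u: "u \<in> Units (stalk X y)" "germ X y D a = u \<otimes>\<^bsub>stalk X y\<^esub> germ X y U f" using assoc[OF y] by blast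
  have f: "germ X y U f \<in> carrier (stalk X y)" using U y D by auto
  have "c \<otimes>\<^bsub>stalk X y\<^esub> germ X y U f = (c \<otimes>\<^bsub>stalk X y\<^esub> inv\<^bsub>stalk X y\<^esub> u) \<otimes>\<^bsub>stalk X y\<^esub> germ X y D a"
    if "c \<in> carrier (stalk X y)" for c
  proof -
    have "(c \<otimes>\<^bsub>stalk X y\<^esub> inv\<^bsub>stalk X y\<^esub> u) \<otimes>\<^bsub>stalk X y\<^esub> (u \<otimes>\<^bsub>stalk X y\<^esub> germ X y U f)
      = c \<otimes>\<^bsub>stalk X y\<^esub> (inv\<^bsub>stalk X y\<^esub> u \<otimes>\<^bsub>stalk X y\<^esub> u) \<otimes>\<^bsub>stalk X y\<^esub> germ X y U f"
      using that u(1) f by (simp add: S.m_assoc S.Units_closed del: S.Units_l_inv)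
    then show ?thesis using that u f by simp
  qed
  moreover have "c \<otimes>\<^bsub>stalk X y\<^esub> germ X y D a = (c \<otimes>\<^bsub>stalk X y\<^esub> u) \<otimes>\<^bsub>stalk X y\<^esub> germ X y U f" if "c \<in> carrier (stalk X y)" for c
    using that u f by (simp add: S.m_assoc S.Units_closed)
  ultimately have e: "\<exists>c'\<in>carrier (stalk X y). c \<otimes>\<^bsub>stalk X y\<^esub> germ X y U f = c' \<otimes>\<^bsub>stalk X y\<^esub> germ X y D a"
      "\<exists>c'\<in>carrier (stalk X y). c \<otimes>\<^bsub>stalk X y\<^esub> germ X y D a = c' \<otimes>\<^bsub>stalk X y\<^esub> germ X y U f"
    if "c \<in> carrier (stalk X y)" for c
    using that S.m_closed[OF that S.Units_inv_closed[OF u(1)]] S.m_closed[OF that S.Units_closed[OF u(1)]] by blast+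
  have "{c \<otimes>\<^bsub>stalk X y\<^esub> germ X y U f |c. c \<in> carrier (stalk X y)} = {c \<otimes>\<^bsub>stalk X y\<^esub> germ X y D a |c. c \<in> carrier (stalk X y)}"
    (is "?A = ?B")
  proof (rule Set.set_eqI, rule iffI)
    fix z
    show "z \<in> ?B" if "z \<in> ?A" using that e(1) by fastforce
    show "z \<in> ?A" if "z \<in> ?B" using that e(2) by fastforce
  qed
  moreover have "Jst y = {c \<otimes>\<^bsub>stalk X y\<^esub> germ X y U f |c. c \<in> carrier (stalk X y)}"
    using gen subsetD[OF D(2) y] by (simp add: stalkwise_generated_def)
  ultimately show "Jst y = {c \<otimes>\<^bsub>stalk X y\<^esub> germ X y D a |c. c \<in> carrier (stalk X y)}" by simp
qed

text \<open>If \<open>a = c f\<close> in the stalk with \<open>c = b / h\<close>, then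
  \<open>h a - b f\<close> has zero germ and is killed by some \<open>v\<close> invertible at
  \<open>y\<close>; so \<open>v h a = v b f\<close> holds on all of \<open>U\<close> and is visibly
  in the ideal.\<close>

lemma principal_qc:
  assumes "chart X U R" and f: "f \<in> R" and gen: "stalkwise_generated X J U f"
    and y: "y \<in> U" and a: "a \<in> R" "germ X y U a \<in> Jst y"
  shows "\<exists>u\<in>R. germ X y U u \<in> Units (stalk X y) \<and> u \<otimes>\<^bsub>rs_sec X U\<^esub> a \<in> J U"
proof -
  interpret C: chart X U R by fact
  interpret S: cring "stalk X y" by (rule stalk_cring'[OF C.U y])
  obtain c where c: "c \<in> carrier (stalk X y)" "germ X y U a = c \<otimes>\<^bsub>stalk X y\<^esub> germ X y U f"
    using gen y a unfolding stalkwise_generated_def by blast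
  obtain b h where b: "b \<in> R" "h \<in> R" "germ X y U h \<in> Units (stalk X y)" "germ X y U h \<otimes>\<^bsub>stalk X y\<^esub> c = germ X y U b"
    using y c(1) by (rule C.frac_stalk)
  let ?d = "h \<otimes>\<^bsub>rs_sec X U\<^esub> a \<ominus>\<^bsub>rs_sec X U\<^esub> b \<otimes>\<^bsub>rs_sec X U\<^esub> f"
  have dR: "?d \<in> R"
    using C.A.m_closed[OF b(2) a(1)] C.A.m_closed[OF b(1) f] subringE(5,7)[OF C.R] by (simp add: C.\<Gamma>.minus_eq)
  have "germ X y U h \<otimes>\<^bsub>stalk X y\<^esub> germ X y U a = germ X y U b \<otimes>\<^bsub>stalk X y\<^esub> germ X y U f"
    unfolding c(2) b(4)[symmetric] using c(1) b(2) f y by (simp add: S.m_assoc)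
  then have "germ X y U ?d = \<zero>\<^bsub>stalk X y\<^esub>"
    using germ_minus[OF C.U y] a(1) b f y by (simp add: C.germ_R_mult S.r_right_minus_eq)
  from C.ann_stalk[OF y dR this] obtain v where v: "v \<in> R" "germ X y U v \<in> Units (stalk X y)"
    "v \<otimes>\<^bsub>rs_sec X U\<^esub> ?d = \<zero>\<^bsub>rs_sec X U\<^esub>" by blast
  have sec: "v \<in> sec X U" "h \<in> sec X U" "a \<in> sec X U" "b \<in> sec X U" "f \<in> sec X U" using v b a f by auto
  have "v \<otimes>\<^bsub>rs_sec X U\<^esub> ?d = (v \<otimes>\<^bsub>rs_sec X U\<^esub> h) \<otimes>\<^bsub>rs_sec X U\<^esub> a \<ominus>\<^bsub>rs_sec X U\<^esub> (v \<otimes>\<^bsub>rs_sec X U\<^esub> b) \<otimes>\<^bsub>rs_sec X U\<^esub> f"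
    using sec by (simp add: C.\<Gamma>.minus_eq C.\<Gamma>.r_distr C.\<Gamma>.r_minus C.\<Gamma>.m_assoc)
  then have "(v \<otimes>\<^bsub>rs_sec X U\<^esub> h) \<otimes>\<^bsub>rs_sec X U\<^esub> a = (v \<otimes>\<^bsub>rs_sec X U\<^esub> b) \<otimes>\<^bsub>rs_sec X U\<^esub> f"
    using v(3) sec C.\<Gamma>.minus_eq_zeroD[of "(v \<otimes>\<^bsub>rs_sec X U\<^esub> h) \<otimes>\<^bsub>rs_sec X U\<^esub> a" "(v \<otimes>\<^bsub>rs_sec X U\<^esub> b) \<otimes>\<^bsub>rs_sec X U\<^esub> f"] by simp
  also have "\<dots> \<in> J U" using ideal.I_l_closed[OF J_ideal[OF C.U] generator_mem[OF gen]] sec by simp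
  finally have "(v \<otimes>\<^bsub>rs_sec X U\<^esub> h) \<otimes>\<^bsub>rs_sec X U\<^esub> a \<in> J U" .
  moreover have "germ X y U (v \<otimes>\<^bsub>rs_sec X U\<^esub> h) \<in> Units (stalk X y)"
    using C.germ_R_mult[OF y v(1) b(2)] v(2) b(3) by simp
  ultimately show ?thesis using C.A.m_closed[OF v(1) b(2)] by blast
qed

end

section \<open>Inverse images of ideal sheaves\<close>

locale ideal_pullback = X: ideal_space X J + T: locally_ringed_space T + t: ringed_mor T X t
  for X :: "('a, 'b) rspace" and J and T :: "('c, 'd) rspace" and t
begin

abbreviation "I \<equiv> preimage_ideal T X t J"
abbreviation "G x \<equiv> Idl\<^bsub>stalk T x\<^esub> (stalk_map T t x ` stalk_ideal X J (mor_pt t x))"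

lemma image_sub: "x \<in> pts T \<Longrightarrow> stalk_map T t x ` stalk_ideal X J (mor_pt t x) \<subseteq> carrier (stalk T x)"
  using ring_hom_closed[OF t.stalk_map_hom] ideal.Icarr[OF X.Jst_ideal] by fastforce

lemma G_ideal: "x \<in> pts T \<Longrightarrow> ideal (G x) (stalk T x)"
  using ring.genideal_ideal[OF cring.axioms(1)[OF T.stalk_cring] image_sub] .

lemma preimage_ideal_sheaf: "ideal_sheaf T I"
  unfolding ideal_sheaf_def
proof (intro conjI allI impI ballI)
  fix W assume W: "opn T W"
  interpret W: cring "rs_sec T W" by (rule T.sec_cring[OF W])
  have G: "ideal (G x) (stalk T x)" if "x \<in> W" for x using G_ideal T.pts_open[OF W that] by blast
  show "ideal (I W) (rs_sec T W)"
  proof (rule W.idealI')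
    show "I W \<subseteq> sec T W" by (auto simp: preimage_ideal_def)
    have "germ T x W \<zero>\<^bsub>rs_sec T W\<^esub> \<in> G x" if x: "x \<in> W" for x
      using additive_subgroup.zero_closed[OF ideal.axioms(1)[OF G[OF x]]] T.stalk_zero_germ[OF W x] by simp
    then show "\<zero>\<^bsub>rs_sec T W\<^esub> \<in> I W" by (simp add: preimage_ideal_def)
    fix a assume a: "a \<in> I W"
    show "a \<oplus>\<^bsub>rs_sec T W\<^esub> b \<in> I W" if b: "b \<in> I W" for b
    proof -
      have "germ T x W (a \<oplus>\<^bsub>rs_sec T W\<^esub> b) \<in> G x" if x: "x \<in> W" for x
        using additive_subgroup.a_closed[OF ideal.axioms(1)[OF G[OF x]], of "germ T x W a" "germ T x W b"] a b x
          T.stalk_add_germ[OF W x, of a b] by (simp add: preimage_ideal_def)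
      then show ?thesis using a b by (simp add: preimage_ideal_def)
    qed
    show "b \<otimes>\<^bsub>rs_sec T W\<^esub> a \<in> I W" if b: "b \<in> sec T W" for b
    proof -
      have "germ T x W (b \<otimes>\<^bsub>rs_sec T W\<^esub> a) \<in> G x" if x: "x \<in> W" for x
        using ideal.I_l_closed[OF G[OF x], of "germ T x W a" "germ T x W b"] a b x W
          T.stalk_mult_germ[OF W x, of b a] by (simp add: preimage_ideal_def)
      then show ?thesis using a b by (simp add: preimage_ideal_def)
    qed
  qed
next
  fix U V assume o: "opn T U \<and> opn T V \<and> V \<subseteq> U"
  show "rs_res T U V ` I U \<subseteq> I V"
  proof
    fix r assume "r \<in> rs_res T U V ` I U"
    then obtain s where s: "s \<in> I U" "r = rs_res T U V s" by blast
    have "germ T x V r = germ T x U s" if "x \<in> V" for x using T.germ_res[of U V x s] o that s by (simp add: preimage_ideal_def)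
    then show "r \<in> I V" using s o by (auto simp: preimage_ideal_def)
  qed
next
  fix U s assume s: "s \<in> sec T U"
    and h: "opn T U \<and> (\<forall>x\<in>U. \<exists>V. opn T V \<and> x \<in> V \<and> V \<subseteq> U \<and> rs_res T U V s \<in> I V)"
  have "germ T x U s \<in> G x" if x: "x \<in> U" for x
  proof -
    obtain V where V: "opn T V" "x \<in> V" "V \<subseteq> U" "rs_res T U V s \<in> I V" using h x by blast
    then have "germ T x V (rs_res T U V s) \<in> G x" by (simp add: preimage_ideal_def)
    then show ?thesis unfolding T.germ_res[OF conjunct1[OF h] V(1,3,2) s] .
  qed
  then show "s \<in> I U" using s by (simp add: preimage_ideal_def)
qed

lemma preimage_principal:
  assumes gen: "stalkwise_generated X J U f" and x: "x \<in> pts T" "mor_pt t x \<in> U"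
  shows "G x = {c \<otimes>\<^bsub>stalk T x\<^esub> germ T x (preim T t U) (mor_sec t U f) |c. c \<in> carrier (stalk T x)}"
proof -
  interpret S: cring "stalk T x" by (rule T.stalk_cring[OF x(1)])
  have U: "opn X U" "f \<in> sec X U" using gen by (auto simp: stalkwise_generated_def)
  let ?g = "germ T x (preim T t U) (mor_sec t U f)"
  have g: "stalk_map T t x (germ X (mor_pt t x) U f) = ?g" by (rule t.stalk_map_germ[OF x(1) U(1) x(2) U(2)])
  have gf: "germ X (mor_pt t x) U f \<in> carrier (stalk X (mor_pt t x))" using U x by simp
  have gc: "?g \<in> carrier (stalk T x)" using ring_hom_closed[OF t.stalk_map_hom[OF x(1)] gf] g by simp
  have st: "stalk_ideal X J (mor_pt t x) = {c \<otimes>\<^bsub>stalk X (mor_pt t x)\<^esub> germ X (mor_pt t x) U f |c. c \<in> carrier (stalk X (mor_pt t x))}"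
    using gen x(2) by (simp add: stalkwise_generated_def)
  have P: "{c \<otimes>\<^bsub>stalk T x\<^esub> ?g |c. c \<in> carrier (stalk T x)} = PIdl\<^bsub>stalk T x\<^esub> ?g"
    by (simp add: cgenideal_def)
  have "G x \<subseteq> PIdl\<^bsub>stalk T x\<^esub> ?g"
  proof (rule S.genideal_minimal[OF S.cgenideal_ideal[OF gc]])
    show "stalk_map T t x ` stalk_ideal X J (mor_pt t x) \<subseteq> PIdl\<^bsub>stalk T x\<^esub> ?g"
      unfolding st P[symmetric]
      using ring_hom_mult[OF t.stalk_map_hom[OF x(1)] _ gf] ring_hom_closed[OF t.stalk_map_hom[OF x(1)]] g by auto
  qed
  moreover have "?g \<in> G x"
  proof -
    have "germ X (mor_pt t x) U f \<in> stalk_ideal X J (mor_pt t x)"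
      using X.JstI[OF U(1) x(2) X.generator_mem[OF gen]] .
    then show ?thesis using S.genideal_self[OF image_sub[OF x(1)]] g by force
  qed
  then have "PIdl\<^bsub>stalk T x\<^esub> ?g \<subseteq> G x"
    by (rule S.cgenideal_minimal[OF G_ideal[OF x(1)]])
  ultimately show ?thesis unfolding P by blast
qed

text \<open>\<open>preimage_ideal\<close> is defined by conditions on germs, so at first its stalk
  is only contained in \<open>G x\<close>. For the other inclusion a multiple of the pulled back
  generator is extended to a neighbourhood, where its germs are still multiples and hence stay in
  \<open>G\<close>.\<close>

lemma preimage_generated:
  assumes gen: "stalkwise_generated X J U f"
  shows "stalkwise_generated T I (preim T t U) (mor_sec t U f)"
proof -
  have U: "opn X U" "f \<in> sec X U" using gen by (auto simp: stalkwise_generated_def)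
  let ?W = "preim T t U" and ?f = "mor_sec t U f"
  have W: "opn T ?W" "?f \<in> sec T ?W" using U by auto
  have GW: "G x = {c \<otimes>\<^bsub>stalk T x\<^esub> germ T x ?W ?f |c. c \<in> carrier (stalk T x)}" if "x \<in> ?W" for x
    using preimage_principal[OF gen] that by (simp add: preim_def)
  have "stalk_ideal T I x = G x" if x: "x \<in> ?W" for x
  proof
    show "stalk_ideal T I x \<subseteq> G x" by (auto simp: stalk_ideal_def preimage_ideal_def)
    show "G x \<subseteq> stalk_ideal T I x"
    proof
      fix z assume "z \<in> G x"
      then obtain c where c: "c \<in> carrier (stalk T x)" "z = c \<otimes>\<^bsub>stalk T x\<^esub> germ T x ?W ?f" using GW[OF x] by blast
      obtain N r where N: "opn T N" "x \<in> N" "N \<subseteq> ?W" "r \<in> sec T N" "c = germ T x N r"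
        using c(1) W(1) x by (rule T.stalk_nbhdE)
      interpret N: cring "rs_sec T N" by (rule T.sec_cring[OF N(1)])
      have rf: "rs_res T ?W N ?f \<in> sec T N" using N W by simp
      have g: "germ T y N (r \<otimes>\<^bsub>rs_sec T N\<^esub> rs_res T ?W N ?f) = germ T y N r \<otimes>\<^bsub>stalk T y\<^esub> germ T y ?W ?f" if "y \<in> N" for y
        using T.stalk_mult_germ[OF N(1) that N(4) rf] T.germ_res[OF W(1) N(1,3) that W(2)] by simp
      have "germ T y N (r \<otimes>\<^bsub>rs_sec T N\<^esub> rs_res T ?W N ?f) \<in> G y" if y: "y \<in> N" for y
        using g[OF y] GW[of y] y N T.germ_in_stalk[OF N(1) y N(4)] by blast
      then have "r \<otimes>\<^bsub>rs_sec T N\<^esub> rs_res T ?W N ?f \<in> I N"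
        using N(4) rf by (simp add: preimage_ideal_def)
      moreover have "z = germ T x N (r \<otimes>\<^bsub>rs_sec T N\<^esub> rs_res T ?W N ?f)" using g[OF N(2)] c(2) N(5) by simp
      ultimately show "z \<in> stalk_ideal T I x" using N(1,2) by (auto simp: stalk_ideal_def)
    qed
  qed
  then show ?thesis using W GW by (simp add: stalkwise_generated_def)
qed

end

section \<open>The regular locus of a local equation\<close>

lemma (in cring) cancel_pow:
  assumes f: "f \<in> carrier R" "\<And>z. \<lbrakk>z \<in> carrier R; f \<otimes> z = \<zero>\<rbrakk> \<Longrightarrow> z = \<zero>"
    and z: "z \<in> carrier R" "f [^] (n::nat) \<otimes> z = \<zero>"
  shows "z = \<zero>"
  using z(2)
proof (induction n)
  case 0
  then show ?case using z(1) by simp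
next
  case (Suc n)
  then have "f \<otimes> (f [^] n \<otimes> z) = \<zero>" using f(1) z(1) by (simp add: m_ac)
  then have "f [^] n \<otimes> z = \<zero>" using f(2) m_closed[OF nat_pow_closed[OF f(1)] z(1)] by blast
  then show ?case by (rule Suc.IH)
qed

locale good_chart = chart X U R + ideal_space X Z
  for X :: "('a, 'b) rspace" and U R and Z :: "'a set \<Rightarrow> 'b set" +
  fixes f
  assumes max: "max_cond (rs_sec X U\<lparr>carrier := R\<rparr>)" and f [simp]: "f \<in> R"
    and gen: "stalkwise_generated X Z U f"
begin

definition reg :: "'a \<Rightarrow> bool" where
  "reg y \<longleftrightarrow> (\<forall>z\<in>carrier (stalk X y). germ X y U f \<otimes>\<^bsub>stalk X y\<^esub> z = \<zero>\<^bsub>stalk X y\<^esub> \<longrightarrow> z = \<zero>\<^bsub>stalk X y\<^esub>)"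

lemma regD: "\<lbrakk>reg y; z \<in> carrier (stalk X y); germ X y U f \<otimes>\<^bsub>stalk X y\<^esub> z = \<zero>\<^bsub>stalk X y\<^esub>\<rbrakk> \<Longrightarrow> z = \<zero>\<^bsub>stalk X y\<^esub>"
  by (simp add: reg_def)

lemma unit_reg:
  assumes "y \<in> U" "germ X y U f \<in> Units (stalk X y)"
  shows "reg y"
  unfolding reg_def using cring.unit_eq_zeroD[OF stalk_cring'[OF U assms(1)] assms(2)] by blast

lemma regD_pow:
  assumes "reg y" "y \<in> U" "z \<in> carrier (stalk X y)" "germ X y U f [^]\<^bsub>stalk X y\<^esub> (n::nat) \<otimes>\<^bsub>stalk X y\<^esub> z = \<zero>\<^bsub>stalk X y\<^esub>"
  shows "z = \<zero>\<^bsub>stalk X y\<^esub>"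
  by (rule cring.cancel_pow[OF stalk_cring'[OF U assms(2)] germ_R[OF assms(2) f] regD[OF assms(1)] assms(3,4)])

lemma supp_unit: "y \<in> U \<Longrightarrow> y \<in> supp X Z \<longleftrightarrow> germ X y U f \<notin> Units (stalk X y)"
proof -
  assume y: "y \<in> U"
  interpret S: cring "stalk X y" by (rule stalk_cring'[OF U y])
  have st: "Jst y = {c \<otimes>\<^bsub>stalk X y\<^esub> germ X y U f |c. c \<in> carrier (stalk X y)}"
    using gen y by (simp add: stalkwise_generated_def)
  have fc: "germ X y U f \<in> carrier (stalk X y)" using y by simp
  have "\<one>\<^bsub>stalk X y\<^esub> \<in> Jst y \<longleftrightarrow> germ X y U f \<in> Units (stalk X y)"
  proof
    assume "\<one>\<^bsub>stalk X y\<^esub> \<in> Jst y"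
    then obtain c where "c \<in> carrier (stalk X y)" "\<one>\<^bsub>stalk X y\<^esub> = c \<otimes>\<^bsub>stalk X y\<^esub> germ X y U f" unfolding st by blast
    then show "germ X y U f \<in> Units (stalk X y)" using S.unitI[OF fc] S.m_comm[OF fc] by simp
  next
    assume u: "germ X y U f \<in> Units (stalk X y)"
    show "\<one>\<^bsub>stalk X y\<^esub> \<in> Jst y" unfolding st using S.Units_l_inv[OF u, symmetric] S.Units_inv_closed[OF u] by blast
  qed
  then show ?thesis using supp_iff U_pts[OF y] by blast
qed

text \<open>Clear the denominator of \<open>z\<close>, then multiply by the \<open>v\<close> that
  kills \<open>f\<close> times the numerator. Annihilation by \<open>f\<close> at one point thus
  becomes a relation in the chart ring, which can be read at all other points of
  \<open>U\<close>.\<close>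

lemma annihilated:
  assumes y: "y \<in> U" and z: "z \<in> carrier (stalk X y)" "germ X y U f \<otimes>\<^bsub>stalk X y\<^esub> z = \<zero>\<^bsub>stalk X y\<^esub>"
  obtains b h where "b \<in> R" "h \<in> R" "germ X y U h \<in> Units (stalk X y)" "germ X y U h \<otimes>\<^bsub>stalk X y\<^esub> z = germ X y U b"
    "f \<otimes>\<^bsub>rs_sec X U\<^esub> b = \<zero>\<^bsub>rs_sec X U\<^esub>"
proof -
  interpret S: cring "stalk X y" by (rule stalk_cring'[OF U y])
  obtain a h where a: "a \<in> R" "h \<in> R" "germ X y U h \<in> Units (stalk X y)" "germ X y U h \<otimes>\<^bsub>stalk X y\<^esub> z = germ X y U a"
    using y z(1) by (rule frac_stalk)
  have fc: "germ X y U f \<in> carrier (stalk X y)" "germ X y U h \<in> carrier (stalk X y)" using y a by simp_all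
  have "germ X y U (f \<otimes>\<^bsub>rs_sec X U\<^esub> a) = germ X y U h \<otimes>\<^bsub>stalk X y\<^esub> (germ X y U f \<otimes>\<^bsub>stalk X y\<^esub> z)"
    unfolding germ_R_mult[OF y f a(1)] a(4)[symmetric] using fc z(1) by (simp add: S.m_ac)
  also have "\<dots> = \<zero>\<^bsub>stalk X y\<^esub>" using z(2) fc by simp
  finally obtain v where v: "v \<in> R" "germ X y U v \<in> Units (stalk X y)" "v \<otimes>\<^bsub>rs_sec X U\<^esub> (f \<otimes>\<^bsub>rs_sec X U\<^esub> a) = \<zero>\<^bsub>rs_sec X U\<^esub>"
    using ann_stalk[OF y A.m_closed[OF f a(1)]] by blast
  show thesis
  proof (rule that[of "v \<otimes>\<^bsub>rs_sec X U\<^esub> a" "v \<otimes>\<^bsub>rs_sec X U\<^esub> h"])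
    show "germ X y U (v \<otimes>\<^bsub>rs_sec X U\<^esub> h) \<in> Units (stalk X y)" using germ_R_mult[OF y v(1) a(2)] v(2) a(3) by simp
    show "germ X y U (v \<otimes>\<^bsub>rs_sec X U\<^esub> h) \<otimes>\<^bsub>stalk X y\<^esub> z = germ X y U (v \<otimes>\<^bsub>rs_sec X U\<^esub> a)"
      unfolding germ_R_mult[OF y v(1) a(2)] germ_R_mult[OF y v(1) a(1)] a(4)[symmetric]
      using fc z(1) v(1) y by (simp add: S.m_assoc)
    show "f \<otimes>\<^bsub>rs_sec X U\<^esub> (v \<otimes>\<^bsub>rs_sec X U\<^esub> a) = \<zero>\<^bsub>rs_sec X U\<^esub>" using v a by (simp add: A.m_lcomm)
  qed (use v a in auto)
qed

lemma ann_ideal: "u \<in> R \<Longrightarrow> ideal {a \<in> R. u \<otimes>\<^bsub>rs_sec X U\<^esub> a = \<zero>\<^bsub>rs_sec X U\<^esub>} A"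
proof (rule cring.idealI'[OF A_cring])
  assume u: "u \<in> R"
  fix a x assume "a \<in> {a \<in> R. u \<otimes>\<^bsub>rs_sec X U\<^esub> a = \<zero>\<^bsub>rs_sec X U\<^esub>}" "x \<in> carrier A"
  then show "x \<otimes>\<^bsub>A\<^esub> a \<in> {a \<in> R. u \<otimes>\<^bsub>rs_sec X U\<^esub> a = \<zero>\<^bsub>rs_sec X U\<^esub>}" using u A.m_lcomm[of u x a] by simp
qed (auto simp: A.r_distr)

text \<open>The annihilator of \<open>f\<close> is finitely generated, so if it vanishes in one stalk then it vanishes nearby.\<close>

lemma reg_open:
  assumes y: "y \<in> U" "reg y"
  obtains u where "u \<in> R" "y \<in> D u" "\<And>z. z \<in> D u \<Longrightarrow> reg z"
proof -
  interpret Sy: cring "stalk X y" by (rule stalk_cring'[OF U y(1)])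
  let ?N = "{a \<in> R. f \<otimes>\<^bsub>rs_sec X U\<^esub> a = \<zero>\<^bsub>rs_sec X U\<^esub>}"
  let ?I = "\<lambda>u. ?N \<inter> {a \<in> R. u \<otimes>\<^bsub>rs_sec X U\<^esub> a = \<zero>\<^bsub>rs_sec X U\<^esub>}"
  let ?F = "{?I u |u. u \<in> R \<and> germ X y U u \<in> Units (stalk X y)}"
  have id: "ideal (?I u) A" if "u \<in> R" for u
    using ring.i_intersect[OF cring.axioms(1)[OF A_cring] ann_ideal[OF f] ann_ideal[OF that]] .
  have one: "?I \<one>\<^bsub>rs_sec X U\<^esub> \<in> ?F" 
  proof -
    have "germ X y U \<one>\<^bsub>rs_sec X U\<^esub> \<in> Units (stalk X y)" using Sy.Units_one_closed unfolding stalk_one_germ[OF U y(1)] .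
    then show ?thesis using A.one_closed by blast
  qed
  \<comment> \<open>\<open>?I u\<close> collects the elements killed by both \<open>f\<close> and
    \<open>u\<close>. A maximal one must contain everything killed by \<open>f\<close>, since
    otherwise multiplying \<open>u\<close> by an element that kills a further \<open>a\<close> would
    enlarge it.\<close>
  obtain M where M: "M \<in> ?F" "\<And>I. I \<in> ?F \<Longrightarrow> M \<subseteq> I \<Longrightarrow> I = M"
    by (rule max_condD[OF max one]) (use id in auto)
  obtain u where u: "u \<in> R" "germ X y U u \<in> Units (stalk X y)" "M = ?I u" using M(1) by blast
  have all: "u \<otimes>\<^bsub>rs_sec X U\<^esub> a = \<zero>\<^bsub>rs_sec X U\<^esub>" if a: "a \<in> ?N" for a
  proof -
    have aR: "a \<in> R" using a by blast
    have "germ X y U f \<otimes>\<^bsub>stalk X y\<^esub> germ X y U a = \<zero>\<^bsub>stalk X y\<^esub>"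
      using germ_R_mult[OF y(1) f aR] a stalk_zero_germ[OF U y(1)] by simp
    then have "germ X y U a = \<zero>\<^bsub>stalk X y\<^esub>" using regD[OF y(2)] y(1) aR by simp
    from ann_stalk[OF y(1) aR this] obtain v where v: "v \<in> R" "germ X y U v \<in> Units (stalk X y)"
      "v \<otimes>\<^bsub>rs_sec X U\<^esub> a = \<zero>\<^bsub>rs_sec X U\<^esub>" by blast
    let ?w = "v \<otimes>\<^bsub>rs_sec X U\<^esub> u"
    have w: "?w \<in> R" "germ X y U ?w \<in> Units (stalk X y)" using germ_R_mult[OF y(1) v(1) u(1)] v u by simp_all
    have "?I u \<subseteq> ?I ?w" using u(1) v(1) by (auto simp: A.m_assoc)
    then have "?I ?w = ?I u" using M(2)[of "?I ?w"] w u(3) by blast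
    moreover have "?w \<otimes>\<^bsub>rs_sec X U\<^esub> a = \<zero>\<^bsub>rs_sec X U\<^esub>"
      unfolding A.m_comm[OF v(1) u(1)] A.m_assoc[OF u(1) v(1) aR] v(3) using u(1) by simp
    ultimately show ?thesis using a by blast
  qed
  have "reg z" if z: "z \<in> D u" for z
    unfolding reg_def
  proof (intro ballI impI)
    have zU: "z \<in> U" and uz: "germ X z U u \<in> Units (stalk X z)" using z by (auto simp: D_def)
    interpret S: cring "stalk X z" by (rule stalk_cring'[OF U zU])
    fix x assume x: "x \<in> carrier (stalk X z)" "germ X z U f \<otimes>\<^bsub>stalk X z\<^esub> x = \<zero>\<^bsub>stalk X z\<^esub>"
    obtain b h where b: "b \<in> R" "h \<in> R" "germ X z U h \<in> Units (stalk X z)" "germ X z U h \<otimes>\<^bsub>stalk X z\<^esub> x = germ X z U b"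
      "f \<otimes>\<^bsub>rs_sec X U\<^esub> b = \<zero>\<^bsub>rs_sec X U\<^esub>" using annihilated[OF zU x] by blast
    have "germ X z U u \<otimes>\<^bsub>stalk X z\<^esub> germ X z U b = \<zero>\<^bsub>stalk X z\<^esub>"
      using all[of b] b germ_R_mult[OF zU u(1) b(1)] stalk_zero_germ[OF U zU] by simp
    then have "germ X z U h \<otimes>\<^bsub>stalk X z\<^esub> x = \<zero>\<^bsub>stalk X z\<^esub>" using S.unit_eq_zeroD[OF uz] b zU by simp
    then show "x = \<zero>\<^bsub>stalk X z\<^esub>" using S.unit_eq_zeroD[OF b(3) x(1)] by simp
  qed
  moreover have "y \<in> D u" using y u by (simp add: D_def)
  ultimately show thesis using that u by blast
qed

text \<open>Every neighbourhood of \<open>y\<close> contains \<open>x\<close>. An element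
  \<open>c\<close> whose annihilator is the maximal ideal at \<open>x\<close> is killed by
  \<open>f\<close>, so up to a unit it is the germ of some \<open>b\<close> killed by
  \<open>f\<close> on \<open>U\<close>. Regularity at \<open>y\<close> makes \<open>b\<close> vanish
  near \<open>y\<close>, hence at \<open>x\<close>, and \<open>c\<close> would be zero.\<close>

lemma not_reg_if_Ass:
  assumes x: "x \<in> Ass X" "x \<in> supp X Z" and y: "y \<in> U" "y \<in> rs_top X closure_of {x}"
  shows "\<not> reg y"
proof
  assume reg: "reg y"
  have spec: "x \<in> W" if "opn X W" "y \<in> W" for W using y(2) that unfolding in_closure_of by blast
  have xU: "x \<in> U" using spec[OF U y(1)] .
  have xX: "x \<in> pts X" using U_pts[OF xU] .
  note loc = local_ringD[OF stalk_local[OF xX]]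
  interpret S: cring "stalk X x" by (rule loc)
  obtain c where c: "c \<in> carrier (stalk X x)" "carrier (stalk X x) - Units (stalk X x) = annihilator (stalk X x) c"
    using x(1) loc(4) unfolding Ass_def associated_prime_def by auto
  have "germ X x U f \<in> carrier (stalk X x) - Units (stalk X x)" using supp_unit[OF xU] x(2) xU by simp
  then have "germ X x U f \<in> annihilator (stalk X x) c" unfolding c(2) .
  then have fc: "germ X x U f \<otimes>\<^bsub>stalk X x\<^esub> c = \<zero>\<^bsub>stalk X x\<^esub>" by (simp add: annihilator_def)
  obtain b h where b: "b \<in> R" "h \<in> R" "germ X x U h \<in> Units (stalk X x)" "germ X x U h \<otimes>\<^bsub>stalk X x\<^esub> c = germ X x U b"
    "f \<otimes>\<^bsub>rs_sec X U\<^esub> b = \<zero>\<^bsub>rs_sec X U\<^esub>" using annihilated[OF xU c(1) fc] by blast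
  have "germ X y U f \<otimes>\<^bsub>stalk X y\<^esub> germ X y U b = \<zero>\<^bsub>stalk X y\<^esub>"
    using germ_R_mult[OF y(1) f b(1)] b(5) stalk_zero_germ[OF U y(1)] by simp
  then have "germ X y U b = germ X y U \<zero>\<^bsub>rs_sec X U\<^esub>"
    using regD[OF reg] y(1) b(1) stalk_zero_germ[OF U y(1)] by simp
  then obtain W where "opn X W" "y \<in> W" "\<And>z. z \<in> W \<Longrightarrow> germ X z U b = germ X z U \<zero>\<^bsub>rs_sec X U\<^esub>"
    using germ_eq_nbhd[OF U y(1) R_sec[OF b(1)] U y(1) \<Gamma>.zero_closed] by metis
  then have "germ X x U h \<otimes>\<^bsub>stalk X x\<^esub> c = \<zero>\<^bsub>stalk X x\<^esub>" using spec b(4) stalk_zero_germ[OF U xU] by simp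
  then have "c = \<zero>\<^bsub>stalk X x\<^esub>" using S.unit_eq_zeroD[OF b(3) c(1)] by simp
  then have "\<one>\<^bsub>stalk X x\<^esub> \<in> annihilator (stalk X x) c" by (simp add: annihilator_def)
  then show False using c(2) by auto
qed

lemma Ass_if_not_reg:
  assumes y: "y \<in> U" "\<not> reg y"
  obtains x where "x \<in> Ass X" "x \<in> supp X Z" "y \<in> rs_top X closure_of {x}"
proof -
  let ?ann = "\<lambda>b. {a \<in> R. b \<otimes>\<^bsub>rs_sec X U\<^esub> a = \<zero>\<^bsub>rs_sec X U\<^esub>}"
  let ?F = "{?ann b |b. b \<in> R \<and> f \<otimes>\<^bsub>rs_sec X U\<^esub> b = \<zero>\<^bsub>rs_sec X U\<^esub> \<and> germ X y U b \<noteq> \<zero>\<^bsub>stalk X y\<^esub>}"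
  interpret Sy: cring "stalk X y" by (rule stalk_cring'[OF U y(1)])
  obtain z where z: "z \<in> carrier (stalk X y)" "germ X y U f \<otimes>\<^bsub>stalk X y\<^esub> z = \<zero>\<^bsub>stalk X y\<^esub>" "z \<noteq> \<zero>\<^bsub>stalk X y\<^esub>"
    using y(2) by (auto simp: reg_def)
  obtain b0 h where b0: "b0 \<in> R" "h \<in> R" "germ X y U h \<in> Units (stalk X y)" "germ X y U h \<otimes>\<^bsub>stalk X y\<^esub> z = germ X y U b0"
    "f \<otimes>\<^bsub>rs_sec X U\<^esub> b0 = \<zero>\<^bsub>rs_sec X U\<^esub>" using annihilated[OF y(1) z(1,2)] by blast
  have "germ X y U b0 \<noteq> \<zero>\<^bsub>stalk X y\<^esub>" using Sy.unit_eq_zeroD[OF b0(3) z(1)] z(3) b0(4) by auto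
  then have "?ann b0 \<in> ?F" using b0 by blast
  then obtain P where P: "P \<in> ?F" "\<And>I. I \<in> ?F \<Longrightarrow> P \<subseteq> I \<Longrightarrow> I = P"
    by (rule max_condD[OF max]) (use ann_ideal in auto)
  obtain b where b: "b \<in> R" "f \<otimes>\<^bsub>rs_sec X U\<^esub> b = \<zero>\<^bsub>rs_sec X U\<^esub>" "germ X y U b \<noteq> \<zero>\<^bsub>stalk X y\<^esub>" "P = ?ann b" using P(1) by blast
  have grow: "?ann (s \<otimes>\<^bsub>rs_sec X U\<^esub> b) = ?ann b" if s: "s \<in> R" "germ X y U (s \<otimes>\<^bsub>rs_sec X U\<^esub> b) \<noteq> \<zero>\<^bsub>stalk X y\<^esub>" for s
  proof -
    have "f \<otimes>\<^bsub>rs_sec X U\<^esub> (s \<otimes>\<^bsub>rs_sec X U\<^esub> b) = \<zero>\<^bsub>rs_sec X U\<^esub>" using A.m_lcomm[OF f s(1) b(1)] b(2) s(1) by simp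
    then have "?ann (s \<otimes>\<^bsub>rs_sec X U\<^esub> b) \<in> ?F" using s b(1) by blast
    moreover have "?ann b \<subseteq> ?ann (s \<otimes>\<^bsub>rs_sec X U\<^esub> b)" using s(1) b(1) by (auto simp: A.m_assoc)
    ultimately show ?thesis using P(2) b(4) by blast
  qed
  have "primeideal P A"
  proof (rule primeidealI[OF _ A_cring])
    show "ideal P A" using ann_ideal b by simp
    have "\<one>\<^bsub>rs_sec X U\<^esub> \<notin> P"
    proof
      assume "\<one>\<^bsub>rs_sec X U\<^esub> \<in> P"
      then have "b = \<zero>\<^bsub>rs_sec X U\<^esub>" using b(1,4) by simp
      then show False using b(3) stalk_zero_germ[OF U y(1)] by simp
    qed
    then show "carrier A \<noteq> P" using A.one_closed by auto
    fix r s assume "r \<in> carrier A" "s \<in> carrier A" "r \<otimes>\<^bsub>A\<^esub> s \<in> P"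
    then have rs: "r \<in> R" "s \<in> R" "b \<otimes>\<^bsub>rs_sec X U\<^esub> (r \<otimes>\<^bsub>rs_sec X U\<^esub> s) = \<zero>\<^bsub>rs_sec X U\<^esub>" using b(4) by auto
    show "r \<in> P \<or> s \<in> P"
    proof (cases "germ X y U (s \<otimes>\<^bsub>rs_sec X U\<^esub> b) = \<zero>\<^bsub>stalk X y\<^esub>")
      case False
      have "(s \<otimes>\<^bsub>rs_sec X U\<^esub> b) \<otimes>\<^bsub>rs_sec X U\<^esub> r = \<zero>\<^bsub>rs_sec X U\<^esub>"
        using rs b(1) by (simp add: A.m_ac)
      then have "r \<in> ?ann (s \<otimes>\<^bsub>rs_sec X U\<^esub> b)" using rs(1) by simp
      then show ?thesis using grow[OF rs(2) False] b(4) by simp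
    next
      case True
      \<comment> \<open>Here \<open>s\<close> times \<open>b\<close> is zero at \<open>y\<close> and
        leaves the family. It is killed by some \<open>t\<close> invertible at \<open>y\<close>; the
        multiple \<open>t\<close> times \<open>b\<close> stays in the family and has the same
        annihilator as \<open>b\<close>, which therefore contains \<open>s\<close>.\<close>
      from ann_stalk[OF y(1) A.m_closed[OF rs(2) b(1)] True] obtain t where t: "t \<in> R" "germ X y U t \<in> Units (stalk X y)"
        "t \<otimes>\<^bsub>rs_sec X U\<^esub> (s \<otimes>\<^bsub>rs_sec X U\<^esub> b) = \<zero>\<^bsub>rs_sec X U\<^esub>" by blast
      have "germ X y U (t \<otimes>\<^bsub>rs_sec X U\<^esub> b) \<noteq> \<zero>\<^bsub>stalk X y\<^esub>"
      proof
        assume "germ X y U (t \<otimes>\<^bsub>rs_sec X U\<^esub> b) = \<zero>\<^bsub>stalk X y\<^esub>"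
        then have "germ X y U b = \<zero>\<^bsub>stalk X y\<^esub>"
          using germ_R_mult[OF y(1) t(1) b(1)] Sy.unit_eq_zeroD[OF t(2)] b(1) y(1) by simp
        then show False using b(3) by contradiction
      qed
      moreover have "s \<in> ?ann (t \<otimes>\<^bsub>rs_sec X U\<^esub> b)" using t rs b(1) by (simp add: A.m_ac)
      ultimately show ?thesis using grow[OF t(1)] b(4) by blast
    qed
  qed
  then obtain x where x: "x \<in> U" "P = \<pi> x" using surj by blast
  have xX: "x \<in> pts X" using U_pts[OF x(1)] .
  note loc = local_ringD[OF stalk_local[OF xX]]
  interpret S: cring "stalk X x" by (rule loc)
  have fP: "f \<in> P" using b A.m_comm[OF f b(1)] by simp
  have "x \<in> supp X Z" using supp_unit[OF x(1)] fP x(2) by blast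
  moreover have "y \<in> rs_top X closure_of {x}"
    unfolding in_closure_of
  proof (intro conjI allI impI)
    show "y \<in> pts X" using U_pts[OF y(1)] .
    fix W assume W: "y \<in> W \<and> opn X W"
    then have "opn X (W \<inter> U)" using U by blast
    then obtain g where g: "g \<in> R" "germ X y U g \<in> Units (stalk X y)" "{z \<in> U. germ X z U g \<in> Units (stalk X z)} \<subseteq> W \<inter> U"
      using basis[of "W \<inter> U" y] W y(1) by blast
    \<comment> \<open>Elements of \<open>P\<close> kill \<open>b\<close>, which is nonzero at
      \<open>y\<close>, so none of them is invertible at \<open>y\<close>. Hence every basic
      neighbourhood of \<open>y\<close> contains \<open>x\<close>.\<close>
    have "g \<notin> P"
    proof
      assume "g \<in> P"
      then have "germ X y U g \<otimes>\<^bsub>stalk X y\<^esub> germ X y U b = \<zero>\<^bsub>stalk X y\<^esub>"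
        using germ_R_mult[OF y(1) g(1) b(1)] A.m_comm[OF g(1) b(1)] b(4) stalk_zero_germ[OF U y(1)] by simp
      then show False using Sy.unit_eq_zeroD[OF g(2)] b(1,3) y(1) by simp
    qed
    then have "x \<in> W" using x g by blast
    then show "\<exists>z. z \<in> {x} \<and> z \<in> W" by blast
  qed
  moreover have "x \<in> Ass X"
  proof -
    have bc: "germ X x U b \<in> carrier (stalk X x)" using x b by simp
    \<comment> \<open>The annihilator of \<open>b\<close> has to be computed in the stalk at
      \<open>x\<close> as well: after clearing denominators both conditions say that the numerator
      \<open>a\<close> of \<open>w\<close> lies in \<open>P\<close>.\<close>
    have "w \<notin> Units (stalk X x) \<longleftrightarrow> w \<otimes>\<^bsub>stalk X x\<^esub> germ X x U b = \<zero>\<^bsub>stalk X x\<^esub>" if w: "w \<in> carrier (stalk X x)" for w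
    proof -
      obtain a h where a: "a \<in> R" "h \<in> R" "germ X x U h \<in> Units (stalk X x)" "germ X x U h \<otimes>\<^bsub>stalk X x\<^esub> w = germ X x U a"
        using x(1) w by (rule frac_stalk)
      have hc: "germ X x U h \<in> carrier (stalk X x)" using x a by simp
      have "w \<in> Units (stalk X x) \<longleftrightarrow> germ X x U a \<in> Units (stalk X x)"
        using S.Units_m_closed[OF a(3), of w] S.unit_factors(2)[OF _ hc w] a(4) by auto
      also have "\<dots> \<longleftrightarrow> a \<notin> P" using x(2) a(1) by blast
      finally have 1: "w \<notin> Units (stalk X x) \<longleftrightarrow> a \<in> P" by blast
      have assoc: "germ X x U h \<otimes>\<^bsub>stalk X x\<^esub> (w \<otimes>\<^bsub>stalk X x\<^esub> germ X x U b) = germ X x U (a \<otimes>\<^bsub>rs_sec X U\<^esub> b)"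
        unfolding germ_R_mult[OF x(1) a(1) b(1)] a(4)[symmetric] using hc w bc by (simp add: S.m_assoc)
      have 2: "w \<otimes>\<^bsub>stalk X x\<^esub> germ X x U b = \<zero>\<^bsub>stalk X x\<^esub> \<longleftrightarrow> germ X x U (a \<otimes>\<^bsub>rs_sec X U\<^esub> b) = \<zero>\<^bsub>stalk X x\<^esub>"
        using assoc S.unit_eq_zeroD[OF a(3), of "w \<otimes>\<^bsub>stalk X x\<^esub> germ X x U b"] w bc hc by auto
      have 3: "germ X x U (a \<otimes>\<^bsub>rs_sec X U\<^esub> b) = \<zero>\<^bsub>stalk X x\<^esub> \<longleftrightarrow> a \<in> P"
      proof
        assume "a \<in> P"
        then have "a \<otimes>\<^bsub>rs_sec X U\<^esub> b = \<zero>\<^bsub>rs_sec X U\<^esub>" using A.m_comm[OF a(1) b(1)] b(4) by simp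
        then show "germ X x U (a \<otimes>\<^bsub>rs_sec X U\<^esub> b) = \<zero>\<^bsub>stalk X x\<^esub>" using stalk_zero_germ[OF U x(1)] by simp
      next
        assume "germ X x U (a \<otimes>\<^bsub>rs_sec X U\<^esub> b) = \<zero>\<^bsub>stalk X x\<^esub>"
        from ann_stalk[OF x(1) A.m_closed[OF a(1) b(1)] this] obtain u where u: "u \<in> R" "germ X x U u \<in> Units (stalk X x)"
          "u \<otimes>\<^bsub>rs_sec X U\<^esub> (a \<otimes>\<^bsub>rs_sec X U\<^esub> b) = \<zero>\<^bsub>rs_sec X U\<^esub>" by blast
        then have "b \<otimes>\<^bsub>rs_sec X U\<^esub> (u \<otimes>\<^bsub>rs_sec X U\<^esub> a) = \<zero>\<^bsub>rs_sec X U\<^esub>" using a(1) b(1) by (simp add: A.m_ac)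
        then have "u \<otimes>\<^bsub>rs_sec X U\<^esub> a \<in> P" using b(4) u(1) a(1) by simp
        moreover have "u \<notin> P" using x(2) u by blast
        ultimately show "a \<in> P" using primeideal.I_prime[OF \<open>primeideal P A\<close>, of u a] u(1) a(1) by auto
      qed
      show ?thesis using 1 2 3 by blast
    qed
    then have "carrier (stalk X x) - Units (stalk X x) = annihilator (stalk X x) (germ X x U b)"
      by (auto simp: annihilator_def)
    then show ?thesis
      using xX loc(4) S.maximalideal_prime[OF loc(5)] bc unfolding Ass_def associated_prime_def by auto
  qed
  ultimately show thesis using that by blast
qed

text \<open>The set \<open>N\<close> contains the unit locus of some \<open>h\<close> invertible at
  \<open>y\<close>. So \<open>a\<close> vanishes wherever \<open>f \<otimes> h\<close> is
  invertible, and some power of this product kills \<open>a\<close>. Splitting it leaves a power of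
  \<open>f\<close> and the factor \<open>u\<close>, a power of \<open>h\<close>.\<close>

lemma killed_by_power:
  assumes y: "y \<in> U" and a: "a \<in> R" and N: "opn X N" "y \<in> N" "N \<subseteq> U"
    and van: "\<And>z. z \<in> N \<Longrightarrow> germ X z U f \<in> Units (stalk X z) \<Longrightarrow> germ X z U a = \<zero>\<^bsub>stalk X z\<^esub>"
  obtains u and n :: nat where "u \<in> R" "germ X y U u \<in> Units (stalk X y)"
    "f [^]\<^bsub>A\<^esub> n \<in> R" "f [^]\<^bsub>A\<^esub> n \<otimes>\<^bsub>rs_sec X U\<^esub> (u \<otimes>\<^bsub>rs_sec X U\<^esub> a) = \<zero>\<^bsub>rs_sec X U\<^esub>"
proof -
  have cm: "comm_monoid A" by (rule cring.axioms(2)[OF A_cring])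
  then have m: "monoid A" by (rule comm_monoid.axioms(1))
  obtain h where h: "h \<in> R" "germ X y U h \<in> Units (stalk X y)" "{z \<in> U. germ X z U h \<in> Units (stalk X z)} \<subseteq> N"
    using basis[OF N(1,3,2)] by blast
  have "\<exists>n::nat. (f \<otimes>\<^bsub>A\<^esub> h) [^]\<^bsub>A\<^esub> n \<in> {c \<in> R. a \<otimes>\<^bsub>rs_sec X U\<^esub> c = \<zero>\<^bsub>rs_sec X U\<^esub>}"
  proof (rule ccontr)
    assume "\<not> ?thesis"
    \<comment> \<open>Otherwise some prime contains the annihilator of \<open>a\<close> but not
      \<open>f \<otimes> h\<close>. At the corresponding point \<open>a\<close> has zero germ, so an
      element outside the prime kills \<open>a\<close>, a contradiction.\<close>
    then obtain P where P: "primeideal P A" "{c \<in> R. a \<otimes>\<^bsub>rs_sec X U\<^esub> c = \<zero>\<^bsub>rs_sec X U\<^esub>} \<subseteq> P" "f \<otimes>\<^bsub>A\<^esub> h \<notin> P"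
      using cring.exists_primeideal_avoiding[OF A_cring max ann_ideal[OF a], of "f \<otimes>\<^bsub>A\<^esub> h"] h(1) by auto
    obtain z where z: "z \<in> U" "P = \<pi> z" using surj[OF P(1)] by blast
    interpret S: cring "stalk X z" by (rule stalk_cring'[OF U z(1)])
    have c: "germ X z U f \<in> carrier (stalk X z)" "germ X z U h \<in> carrier (stalk X z)" using z(1) h(1) by simp_all
    have "germ X z U f \<otimes>\<^bsub>stalk X z\<^esub> germ X z U h \<in> Units (stalk X z)"
      using P(3) z(2) h(1) germ_R_mult[OF z(1) f h(1)] by simp
    then have fh: "germ X z U f \<in> Units (stalk X z)" "germ X z U h \<in> Units (stalk X z)"
      using S.unit_factors[OF _ c] by blast+
    then have "germ X z U a = \<zero>\<^bsub>stalk X z\<^esub>" using van h(3) z(1) by blast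
    from ann_stalk[OF z(1) a this] obtain u where u: "u \<in> R" "germ X z U u \<in> Units (stalk X z)"
      "u \<otimes>\<^bsub>rs_sec X U\<^esub> a = \<zero>\<^bsub>rs_sec X U\<^esub>" by blast
    then have "u \<in> P" using P(2) A.m_comm[OF u(1) a] by auto
    then show False using z(2) u by blast
  qed
  then obtain n :: nat where n: "a \<otimes>\<^bsub>rs_sec X U\<^esub> ((f \<otimes>\<^bsub>A\<^esub> h) [^]\<^bsub>A\<^esub> n) = \<zero>\<^bsub>rs_sec X U\<^esub>" by blast
  have pR: "f [^]\<^bsub>A\<^esub> n \<in> R" "h [^]\<^bsub>A\<^esub> n \<in> R" using monoid.nat_pow_closed[OF m, of f n] monoid.nat_pow_closed[OF m, of h n] h(1) by simp_all
  have "(f \<otimes>\<^bsub>A\<^esub> h) [^]\<^bsub>A\<^esub> n = f [^]\<^bsub>A\<^esub> n \<otimes>\<^bsub>rs_sec X U\<^esub> h [^]\<^bsub>A\<^esub> n" using comm_monoid.nat_pow_distrib[OF cm, of f h n] h(1) by simp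
  then have "f [^]\<^bsub>A\<^esub> n \<otimes>\<^bsub>rs_sec X U\<^esub> (h [^]\<^bsub>A\<^esub> n \<otimes>\<^bsub>rs_sec X U\<^esub> a) = \<zero>\<^bsub>rs_sec X U\<^esub>"
    using n pR a by (simp add: A.m_ac)
  moreover have "germ X y U (h [^]\<^bsub>A\<^esub> n) \<in> Units (stalk X y)"
    using ring_hom_pow'[OF germ_A_hom[OF y] A_cring stalk_cring'[OF U y], of h n] h
      cring.pow_Units[OF stalk_cring'[OF U y] h(2), of n] by simp
  ultimately show thesis using that pR by blast
qed

lemma germ_f_pow: "y \<in> U \<Longrightarrow> germ X y U (f [^]\<^bsub>A\<^esub> (n::nat)) = germ X y U f [^]\<^bsub>stalk X y\<^esub> n"
  using ring_hom_pow'[OF germ_A_hom A_cring stalk_cring'[OF U], of y f n] by simp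

end

section \<open>Schematic closure\<close>

context ideal_space
begin

lemma factors_iff:
  assumes T: "locally_ringed_space T" and t: "lrs_morphism T X t"
  shows "factors_through T X t B \<iota> \<longleftrightarrow> (\<forall>U s. opn X U \<longrightarrow> s \<in> J U \<longrightarrow> mor_sec t U s = \<zero>\<^bsub>rs_sec T (preim T t U)\<^esub>)"
proof
  assume "factors_through T X t B \<iota>"
  then show "\<forall>U s. opn X U \<longrightarrow> s \<in> J U \<longrightarrow> mor_sec t U s = \<zero>\<^bsub>rs_sec T (preim T t U)\<^esub>"
    using kills_if_factors T by blast
next
  assume k: "\<forall>U s. opn X U \<longrightarrow> s \<in> J U \<longrightarrow> mor_sec t U s = \<zero>\<^bsub>rs_sec T (preim T t U)\<^esub>"
  obtain g where "lrs_morphism T B g" "mor_eq T X (mor_comp B \<iota> g) t"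
    by (rule closed_sub_universal[OF T t]) (use k in blast)+
  then show "factors_through T X t B \<iota>" by (auto simp: factors_through_def)
qed

text \<open>At points of the support this is read off from the quotient stalks; outside the support
  \<open>Jst\<close> is the whole stalk, so these points impose no condition on either side.\<close>

lemma incl_zero_iff:
  assumes U: "opn X U" "s \<in> sec X U"
  shows "mor_sec \<iota> U s = \<zero>\<^bsub>rs_sec B (U \<inter> supp X J)\<^esub> \<longleftrightarrow> s \<in> J U"
proof
  assume z: "mor_sec \<iota> U s = \<zero>\<^bsub>rs_sec B (U \<inter> supp X J)\<^esub>"
  have "germ X x U s \<in> Jst x" if x: "x \<in> U" for x
  proof (cases "x \<in> supp X J")
    case True
    then have "quot_germ X J x U s = \<zero>\<^bsub>quot_stalk X J x\<^esub>"
      using fun_cong[OF z, of x] x U(1) by simp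
    then show ?thesis using qg_zero_iff[OF U(1) x U(2)] by blast
  next
    case False
    interpret Jx: ideal "Jst x" "stalk X x" by (rule Jst_ideal[OF pts_open[OF U(1) x]])
    have "\<one>\<^bsub>stalk X x\<^esub> \<in> Jst x" using False supp_iff pts_open[OF U(1) x] by blast
    then show ?thesis using Jx.one_imp_carrier germ_in_stalk[OF U(1) x U(2)] by blast
  qed
  then show "s \<in> J U" using J_iff[OF U] by blast
qed (rule incl_zero[OF U(1)])

text \<open>Combines the killing criterion with the kernel of \<open>\<iota>\<close>. Being the
  smallest closed subscheme thereby becomes having the largest ideal sheaf.\<close>

lemma closed_factors_iff:
  assumes "ideal_space X J'"
  shows "factors_through B X \<iota> (closed_sub X J') (closed_incl X J') \<longleftrightarrow> (\<forall>U. opn X U \<longrightarrow> J' U \<subseteq> J U)"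
proof -
  interpret J': ideal_space X J' by fact
  show ?thesis
    unfolding J'.factors_iff[OF B_locally_ringed incl_lrs] preim_incl using incl_zero_iff J'.J_sec by blast
qed

text \<open>Ideal sheaves are meaningful on open sets only, so a schematic closure is unique merely
  up to the values of \<open>J\<close> elsewhere. The associated subspace and inclusion do not see
  these values.\<close>

lemma closed_sub_cong:
  assumes "\<And>U. opn X U \<Longrightarrow> J U = J' U"
  shows "closed_sub X J = closed_sub X J'" "closed_incl X J = closed_incl X J'"
proof -
  have st: "stalk_ideal X J = stalk_ideal X J'" using assms by (fastforce simp: stalk_ideal_def fun_eq_iff)
  have su: "supp X J = supp X J'" and qg: "quot_germ X J = quot_germ X J'"
    unfolding supp_def quot_germ_def st by simp_all
  have "quot_sections X J = quot_sections X J'" unfolding quot_sections_def st su qg ..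
  then show "closed_sub X J = closed_sub X J'" by (simp only: closed_sub_def st su)
  show "closed_incl X J = closed_incl X J'" by (simp only: closed_incl_def su qg)
qed

end

text \<open>For open \<open>V\<close> this is the kernel of restriction to \<open>V\<close>. It is
  phrased by germs, which makes compatibility with restriction and the local condition
  immediate.\<close>

definition vanishing_ideal :: "('a, 'b) rspace \<Rightarrow> 'a set \<Rightarrow> 'a set \<Rightarrow> 'b set" where
  "vanishing_ideal X V W = {s \<in> sec X W. \<forall>z\<in>W \<inter> V. germ X z W s = \<zero>\<^bsub>stalk X z\<^esub>}"

context locally_ringed_space
begin

lemma vanishing_ideal_sheaf: "ideal_sheaf X (vanishing_ideal X V)"
  unfolding ideal_sheaf_def
proof (intro conjI allI impI ballI)
  fix W assume W: "opn X W"
  interpret W: cring "rs_sec X W" by (rule sec_cring[OF W])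
  show "ideal (vanishing_ideal X V W) (rs_sec X W)"
  proof (rule W.idealI')
    show "vanishing_ideal X V W \<subseteq> sec X W" by (auto simp: vanishing_ideal_def)
    show "\<zero>\<^bsub>rs_sec X W\<^esub> \<in> vanishing_ideal X V W" using stalk_zero_germ[OF W] by (simp add: vanishing_ideal_def)
    fix a assume a: "a \<in> vanishing_ideal X V W"
    show "a \<oplus>\<^bsub>rs_sec X W\<^esub> b \<in> vanishing_ideal X V W" if b: "b \<in> vanishing_ideal X V W" for b
    proof -
      have "germ X z W (a \<oplus>\<^bsub>rs_sec X W\<^esub> b) = \<zero>\<^bsub>stalk X z\<^esub>" if z: "z \<in> W \<inter> V" for z
      proof -
        interpret S: cring "stalk X z" using stalk_cring'[OF W] z by blast
        show ?thesis using a b z stalk_add_germ[OF W, of z a b] by (simp add: vanishing_ideal_def)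
      qed
      then show ?thesis using a b by (simp add: vanishing_ideal_def)
    qed
    show "b \<otimes>\<^bsub>rs_sec X W\<^esub> a \<in> vanishing_ideal X V W" if b: "b \<in> sec X W" for b
    proof -
      have "germ X z W (b \<otimes>\<^bsub>rs_sec X W\<^esub> a) = \<zero>\<^bsub>stalk X z\<^esub>" if z: "z \<in> W \<inter> V" for z
      proof -
        interpret S: cring "stalk X z" using stalk_cring'[OF W] z by blast
        show ?thesis using a b z W stalk_mult_germ[OF W, of z b a] by (simp add: vanishing_ideal_def)
      qed
      then show ?thesis using a b by (simp add: vanishing_ideal_def)
    qed
  qed
next
  fix U W assume o: "opn X U \<and> opn X W \<and> W \<subseteq> U"
  show "rs_res X U W ` vanishing_ideal X V U \<subseteq> vanishing_ideal X V W"
  proof (rule image_subsetI)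
    fix s assume s: "s \<in> vanishing_ideal X V U"
    then have sU: "s \<in> sec X U" by (simp add: vanishing_ideal_def)
    have "germ X z W (rs_res X U W s) = \<zero>\<^bsub>stalk X z\<^esub>" if z: "z \<in> W \<inter> V" for z
      using germ_res[of U W z s] o z s sU by (simp add: vanishing_ideal_def subset_iff)
    then show "rs_res X U W s \<in> vanishing_ideal X V W" using o sU by (simp add: vanishing_ideal_def)
  qed
next
  fix U s assume s: "s \<in> sec X U"
    and h: "opn X U \<and> (\<forall>x\<in>U. \<exists>W. opn X W \<and> x \<in> W \<and> W \<subseteq> U \<and> rs_res X U W s \<in> vanishing_ideal X V W)"
  have "germ X z U s = \<zero>\<^bsub>stalk X z\<^esub>" if z: "z \<in> U \<inter> V" for z
  proof -
    obtain W where W: "opn X W" "z \<in> W" "W \<subseteq> U" "rs_res X U W s \<in> vanishing_ideal X V W" using h z by blast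
    then have "germ X z W (rs_res X U W s) = \<zero>\<^bsub>stalk X z\<^esub>" using z by (simp add: vanishing_ideal_def)
    then show ?thesis unfolding germ_res[OF conjunct1[OF h] W(1,3,2) s] .
  qed
  then show "s \<in> vanishing_ideal X V U" using s by (simp add: vanishing_ideal_def)
qed

lemma vanishing_ideal_iff_res:
  assumes V: "opn X V" and U: "opn X U" "s \<in> sec X U"
  shows "s \<in> vanishing_ideal X V U \<longleftrightarrow> rs_res X U (V \<inter> U) s = \<zero>\<^bsub>rs_sec X (V \<inter> U)\<^esub>"
proof
  have o: "opn X (V \<inter> U)" using V U by blast
  have g: "germ X z (V \<inter> U) (rs_res X U (V \<inter> U) s) = germ X z U s" if "z \<in> V \<inter> U" for z
    by (rule germ_res[OF U(1) o Int_lower2 that U(2)])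
  show "rs_res X U (V \<inter> U) s = \<zero>\<^bsub>rs_sec X (V \<inter> U)\<^esub>" if s: "s \<in> vanishing_ideal X V U"
  proof (rule section_eqI[OF o res_closed[OF U(1) o Int_lower2 U(2)] sec_zero[OF o]])
    fix z assume z: "z \<in> V \<inter> U"
    then show "germ X z (V \<inter> U) (rs_res X U (V \<inter> U) s) = germ X z (V \<inter> U) \<zero>\<^bsub>rs_sec X (V \<inter> U)\<^esub>"
      using s unfolding g[OF z] stalk_zero_germ[OF o z, symmetric] vanishing_ideal_def by blast
  qed
  show "s \<in> vanishing_ideal X V U" if r: "rs_res X U (V \<inter> U) s = \<zero>\<^bsub>rs_sec X (V \<inter> U)\<^esub>"
  proof -
    have "germ X z U s = \<zero>\<^bsub>stalk X z\<^esub>" if z: "z \<in> V \<inter> U" for z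
      using g[OF z] unfolding r stalk_zero_germ[OF o z, symmetric] by (rule sym)
    then show ?thesis using U(2) by (simp add: vanishing_ideal_def)
  qed
qed

lemma preim_open_incl: "opn X V \<Longrightarrow> preim (open_sub X V) (open_incl X V) W = V \<inter> W"
  using pts_open_sub[of X V] by (auto simp: preim_def open_incl_def)

lemma open_incl_lrs:
  assumes V: "opn X V"
  shows "lrs_morphism (open_sub X V) X (open_incl X V)"
proof -
  interpret V: locally_ringed_space "open_sub X V" by (rule open_sub_locally_ringed[OF V])
  have ptV: "pts (open_sub X V) = V" by (rule pts_open_sub[OF V])
  have pt: "mor_pt (open_incl X V) = (\<lambda>x. x)" and sc: "mor_sec (open_incl X V) W s = rs_res X W (V \<inter> W) s" for W s
    by (simp_all add: open_incl_def)
  have o: "opn X (V \<inter> W)" if "opn X W" for W using V that by blast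
  have rm: "ringed_morphism (open_sub X V) X (open_incl X V)"
    unfolding ringed_morphism_def preim_open_incl[OF V]
  proof (intro conjI allI impI ballI)
    show "continuous_map (rs_top (open_sub X V)) (rs_top X) (mor_pt (open_incl X V))"
      unfolding pt open_sub_def by (simp add: continuous_map_from_subtopology)
    show "mor_sec (open_incl X V) W \<in> ring_hom (rs_sec X W) (rs_sec (open_sub X V) (V \<inter> W))" if W: "opn X W" for W
      using res_hom[OF W o[OF W] Int_lower2] by (simp add: open_incl_def)
    fix U W s assume UW: "opn X U \<and> opn X W \<and> W \<subseteq> U" "s \<in> sec X U"
    then show "rs_res (open_sub X V) (V \<inter> U) (V \<inter> W) (mor_sec (open_incl X V) U s) = mor_sec (open_incl X V) W (rs_res X U W s)"
      unfolding sc open_sub_simps using o[of U] o[of W] res_res[of U "V \<inter> U" "V \<inter> W" s] res_res[of U W "V \<inter> W" s] by auto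
  qed
  interpret i: ringed_mor "open_sub X V" X "open_incl X V" by unfold_locales (rule rm)
  have "z \<in> Units (stalk X x)"
    if x: "x \<in> V" and z: "z \<in> carrier (stalk X x)" "stalk_map (open_sub X V) (open_incl X V) x z \<in> Units (stalk (open_sub X V) x)" for x z
  proof -
    obtain W s where W: "opn X W" "x \<in> W" "s \<in> sec X W" "z = germ X x W s" using z(1) by (rule stalkE)
    have xW: "x \<in> V \<inter> W" using x W by blast
    have "stalk_map (open_sub X V) (open_incl X V) x z = germ (open_sub X V) x (V \<inter> W) (rs_res X W (V \<inter> W) s)"
      using i.stalk_map_germ[of x W s] x W unfolding pt sc ptV preim_open_incl[OF V] by simp
    then have "germ X x (V \<inter> W) (rs_res X W (V \<inter> W) s) \<in> Units (stalk X x)"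
      using z(2) open_sub_unit_iff[OF V o[OF W(1)] Int_lower1 xW] W o[OF W(1)] by simp
    then show ?thesis using germ_res[OF W(1) o[OF W(1)] Int_lower2 xW W(3)] W(4) by simp
  qed
  then show ?thesis
    using lrs_morphism_iff[OF V.locally_ringed_space_axioms locally_ringed_space_axioms rm] unfolding pt ptV by blast
qed

text \<open>The open inclusion factors through a closed subscheme iff the ideal of the latter
  consists of sections vanishing on \<open>V\<close>. So the vanishing ideal is the largest
  candidate, and it gives the closure as soon as it defines a closed subscheme, which is hypothesis
  \<open>sub\<close>.\<close>

theorem schematic_closure_iff:
  assumes V: "opn X V" and sub: "closed_subscheme X (vanishing_ideal X V)"
  shows "schematic_closure X V J \<longleftrightarrow> closed_subscheme X J \<and> (\<forall>U. opn X U \<longrightarrow> J U = vanishing_ideal X V U)"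
proof -
  have sp: "ideal_space X J" if "closed_subscheme X J" for J
    using that by unfold_locales (simp add: closed_subscheme_def)
  have fac: "factors_through (open_sub X V) X (open_incl X V) (closed_sub X J) (closed_incl X J) \<longleftrightarrow>
      (\<forall>U. opn X U \<longrightarrow> J U \<subseteq> vanishing_ideal X V U)" if J: "closed_subscheme X J" for J
  proof -
    interpret J: ideal_space X J by (rule sp[OF J])
    show ?thesis
      unfolding J.factors_iff[OF open_sub_locally_ringed[OF V] open_incl_lrs[OF V]] preim_open_incl[OF V] open_sub_simps
      using vanishing_ideal_iff_res[OF V] J.J_sec by (fastforce simp: open_incl_def)
  qed
  show ?thesis
  proof
    assume s: "schematic_closure X V J"
    then have J: "closed_subscheme X J" by (simp add: schematic_closure_def schematic_image_def)
    interpret J: ideal_space X J by (rule sp[OF J])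
    have 1: "\<forall>U. opn X U \<longrightarrow> J U \<subseteq> vanishing_ideal X V U"
      using s fac[OF J] by (simp add: schematic_closure_def schematic_image_def)
    have "factors_through (closed_sub X J) X (closed_incl X J) (closed_sub X (vanishing_ideal X V)) (closed_incl X (vanishing_ideal X V))"
      using s sub fac[OF sub] by (simp add: schematic_closure_def schematic_image_def)
    then show "closed_subscheme X J \<and> (\<forall>U. opn X U \<longrightarrow> J U = vanishing_ideal X V U)"
      unfolding J.closed_factors_iff[OF sp[OF sub]] using 1 J by blast
  next
    assume J: "closed_subscheme X J \<and> (\<forall>U. opn X U \<longrightarrow> J U = vanishing_ideal X V U)"
    then interpret J: ideal_space X J using sp by blast
    show "schematic_closure X V J"
      unfolding schematic_closure_def schematic_image_def
    proof (intro conjI allI impI)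
      show "closed_subscheme X J" using J by blast
      then show "factors_through (open_sub X V) X (open_incl X V) (closed_sub X J) (closed_incl X J)"
        using fac J by blast
      fix J' assume J': "closed_subscheme X J' \<and>
        factors_through (open_sub X V) X (open_incl X V) (closed_sub X J') (closed_incl X J')"
      then have "\<forall>U. opn X U \<longrightarrow> J' U \<subseteq> J U" using fac[of J'] J by simp
      then show "factors_through (closed_sub X J) X (closed_incl X J) (closed_sub X J') (closed_incl X J')"
        using J.closed_factors_iff[OF sp] J' by blast
    qed
  qed
qed

end

section \<open>The blow-up\<close>

text \<open>Effective Cartier divisors are defined by sections over all smaller open sets, whereas
  the argument works in stalks. A relation in a stalk already holds over a neighbourhood, and a
  section is zero if all its germs are.\<close>

lemma (in ringed_space) regular_section_iff:
  assumes U: "opn X U" "f \<in> sec X U"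
  shows "(\<forall>W. opn X W \<and> W \<subseteq> U \<longrightarrow> regular_element (rs_sec X W) (rs_res X U W f)) \<longleftrightarrow>
    (\<forall>x\<in>U. regular_element (stalk X x) (germ X x U f))"
proof (intro iffI allI impI ballI)
  fix x assume reg: "\<forall>W. opn X W \<and> W \<subseteq> U \<longrightarrow> regular_element (rs_sec X W) (rs_res X U W f)" and x: "x \<in> U"
  have "z = \<zero>\<^bsub>stalk X x\<^esub>" if z: "z \<in> carrier (stalk X x)" "z \<otimes>\<^bsub>stalk X x\<^esub> germ X x U f = \<zero>\<^bsub>stalk X x\<^esub>" for z
  proof -
    obtain N s where N: "opn X N" "x \<in> N" "N \<subseteq> U" "s \<in> sec X N" "z = germ X x N s"
      using z(1) U(1) x by (rule stalk_nbhdE)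
    interpret N: cring "rs_sec X N" by (rule sec_cring[OF N(1)])
    have rf: "rs_res X U N f \<in> sec X N" by (rule res_closed[OF U(1) N(1,3) U(2)])
    have "germ X x N (s \<otimes>\<^bsub>rs_sec X N\<^esub> rs_res X U N f) = germ X x N \<zero>\<^bsub>rs_sec X N\<^esub>"
      using z(2) stalk_mult_germ[OF N(1,2,4) rf] germ_res[OF U(1) N(1,3,2) U(2)] N(5) stalk_zero_germ[OF N(1,2)] by simp
    then obtain M where M: "opn X M" "x \<in> M" "M \<subseteq> N"
      "rs_res X N M (s \<otimes>\<^bsub>rs_sec X N\<^esub> rs_res X U N f) = rs_res X N M \<zero>\<^bsub>rs_sec X N\<^esub>"
      by (rule germ_eq_nbhd[OF N(1,2) N.m_closed[OF N(4) rf] N(1,2) N.zero_closed])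
    have MU: "M \<subseteq> U" using M N by blast
    have "rs_res X N M s \<otimes>\<^bsub>rs_sec X M\<^esub> rs_res X U M f = \<zero>\<^bsub>rs_sec X M\<^esub>"
      using M(4) ring_hom_mult[OF res_hom[OF N(1) M(1,3)] N(4) rf] res_res[OF U(1) N(1) M(1,3) N(3) U(2)]
        res_zero[OF N(1) M(1,3)] by simp
    then have "rs_res X N M s = \<zero>\<^bsub>rs_sec X M\<^esub>"
      using reg M(1) MU res_closed[OF N(1) M(1,3) N(4)] by (simp add: regular_element_def)
    then have "germ X x M (rs_res X N M s) = \<zero>\<^bsub>stalk X x\<^esub>" using stalk_zero_germ[OF M(1,2)] by simp
    then show ?thesis unfolding germ_res[OF N(1) M(1,3,2) N(4)] N(5) .
  qed
  then show "regular_element (stalk X x) (germ X x U f)" using germ_in_stalk[OF U(1) x U(2)] by (simp add: regular_element_def)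
next
  fix W assume reg: "\<forall>x\<in>U. regular_element (stalk X x) (germ X x U f)" and W: "opn X W \<and> W \<subseteq> U"
  then have W': "opn X W" "W \<subseteq> U" by blast+
  have rf: "rs_res X U W f \<in> sec X W" by (rule res_closed[OF U(1) W' U(2)])
  have "a = \<zero>\<^bsub>rs_sec X W\<^esub>" if a: "a \<in> sec X W" "a \<otimes>\<^bsub>rs_sec X W\<^esub> rs_res X U W f = \<zero>\<^bsub>rs_sec X W\<^esub>" for a
  proof (rule section_eqI[OF W'(1) a(1) sec_zero[OF W'(1)]])
    fix x assume x: "x \<in> W"
    have "germ X x W a \<otimes>\<^bsub>stalk X x\<^esub> germ X x U f = \<zero>\<^bsub>stalk X x\<^esub>"
      using stalk_mult_germ[OF W'(1) x a(1) rf] germ_res[OF U(1) W' x U(2)] a(2) stalk_zero_germ[OF W'(1) x] by simp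
    then have "germ X x W a = \<zero>\<^bsub>stalk X x\<^esub>"
      using reg subsetD[OF W'(2) x] germ_in_stalk[OF W'(1) x a(1)] by (simp add: regular_element_def)
    then show "germ X x W a = germ X x W \<zero>\<^bsub>rs_sec X W\<^esub>" unfolding stalk_zero_germ[OF W'(1) x] .
  qed
  then show "regular_element (rs_sec X W) (rs_res X U W f)" using rf by (simp add: regular_element_def)
qed

text \<open>The given generator need not belong to a chart ring. Its germ times that of some
  \<open>h\<close> invertible at \<open>x\<close> is the germ of some \<open>a\<close> in
  \<open>R\<close>; on a basic open set where this identity holds and \<open>h\<close> is a unit,
  \<open>a\<close> generates instead.\<close>

lemma (in ideal_space) good_chart_exists:
  assumes noeth: "locally_noetherian_scheme X" and x: "x \<in> pts X"
    and gen: "opn X U\<^sub>2" "x \<in> U\<^sub>2" "generated_on X J U\<^sub>2 f\<^sub>2"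
  obtains U R f where "x \<in> U" "good_chart X U R J f"
proof -
  obtain U R where U: "x \<in> U" "chart X U R" "max_cond (rs_sec X U\<lparr>carrier := R\<rparr>)"
    using noeth x by (rule locally_noetherian_chart)
  interpret C: chart X U R by (rule U(2))
  interpret S: cring "stalk X x" by (rule stalk_cring[OF x])
  have sg: "stalkwise_generated X J U\<^sub>2 f\<^sub>2" by (rule generated_onD[OF gen(1,3)])
  then have f2: "f\<^sub>2 \<in> sec X U\<^sub>2" by (simp add: stalkwise_generated_def)
  let ?W = "U \<inter> U\<^sub>2"
  have W: "opn X ?W" "x \<in> ?W" using C.U gen U by auto
  interpret W: cring "rs_sec X ?W" by (rule sec_cring[OF W(1)])
  obtain a h where a: "a \<in> R" "h \<in> R" "germ X x U h \<in> Units (stalk X x)"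
    "germ X x U h \<otimes>\<^bsub>stalk X x\<^esub> germ X x U\<^sub>2 f\<^sub>2 = germ X x U a"
    by (rule C.frac_stalk[OF U(1) germ_in_stalk[OF gen(1,2) f2]])
  let ?h = "rs_res X U ?W h" and ?f = "rs_res X U\<^sub>2 ?W f\<^sub>2"
  have hs: "?h \<in> sec X ?W" by (rule res_closed[OF C.U W(1) Int_lower1 C.R_sec[OF a(2)]])
  have fs: "?f \<in> sec X ?W" by (rule res_closed[OF gen(1) W(1) Int_lower2 f2])
  have prod: "germ X y ?W (?h \<otimes>\<^bsub>rs_sec X ?W\<^esub> ?f) = germ X y U h \<otimes>\<^bsub>stalk X y\<^esub> germ X y U\<^sub>2 f\<^sub>2" if y: "y \<in> ?W" for y
    using stalk_mult_germ[OF W(1) y hs fs] germ_res[OF C.U W(1) Int_lower1 y C.R_sec[OF a(2)]]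
      germ_res[OF gen(1) W(1) Int_lower2 y f2] by simp
  have "germ X x ?W (?h \<otimes>\<^bsub>rs_sec X ?W\<^esub> ?f) = germ X x U a" using prod[OF W(2)] a(4) by simp
  then obtain N where N: "opn X N" "x \<in> N" "N \<subseteq> ?W"
    "\<And>y. y \<in> N \<Longrightarrow> germ X y ?W (?h \<otimes>\<^bsub>rs_sec X ?W\<^esub> ?f) = germ X y U a"
    by (rule germ_eq_nbhd[OF W W.m_closed[OF hs fs] C.U U(1) C.R_sec[OF a(1)]]) blast
  have "opn X (N \<inter> C.D h)" using N(1) C.D_open[OF a(2)] by blast
  moreover have "x \<in> N \<inter> C.D h" using N(2) U(1) a(3) by (simp add: C.D_def)
  moreover have "N \<inter> C.D h \<subseteq> U" using N(3) by blast
  ultimately obtain g where g: "g \<in> R" "germ X x U g \<in> Units (stalk X x)"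
    "{z \<in> U. germ X z U g \<in> Units (stalk X z)} \<subseteq> N \<inter> C.D h"
    using C.basis[of "N \<inter> C.D h" x] by blast
  have Dg: "C.D g \<subseteq> N \<inter> C.D h" using g(3) by (simp add: C.D_def)
  have xD: "x \<in> C.D g" using U(1) g(2) by (simp add: C.D_def)
  let ?a = "rs_res X U (C.D g) a"
  have as: "?a \<in> sec X (C.D g)" by (rule res_closed[OF C.U C.D_open[OF g(1)] C.D_U C.R_sec[OF a(1)]])
  have "stalkwise_generated X J (C.D g) ?a"
  proof (rule stalkwise_generated_shrink[OF sg C.D_open[OF g(1)] _ as])
    show "C.D g \<subseteq> U\<^sub>2" using Dg N(3) by blast
    fix y assume y: "y \<in> C.D g"
    have yN: "y \<in> N" "y \<in> ?W" and hu: "germ X y U h \<in> Units (stalk X y)" using y Dg N(3) by (auto simp: C.D_def)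
    have "germ X y (C.D g) ?a = germ X y U h \<otimes>\<^bsub>stalk X y\<^esub> germ X y U\<^sub>2 f\<^sub>2"
      using C.res_germ_D[OF g(1) y a(1)] N(4)[OF yN(1)] prod[OF yN(2)] by simp
    then show "\<exists>u\<in>Units (stalk X y). germ X y (C.D g) ?a = u \<otimes>\<^bsub>stalk X y\<^esub> germ X y U\<^sub>2 f\<^sub>2" using hu by blast
  qed
  then have "good_chart X (C.D g) (C.fractions_on g) J ?a"
    using C.chart_D[OF g(1)] U(3) C.res_fractions_on[OF g(1) a(1)] ideal_space_axioms
    by (intro good_chart.intro good_chart_axioms.intro) simp_all
  then show thesis using that xD by blast
qed

section \<open>The open set \<open>V\<close> and its closure\<close>

locale locally_principal = ideal_space X Z for X :: "('a, 'b) rspace" and Z :: "'a set \<Rightarrow> 'b set" +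
  assumes noeth: "locally_noetherian_scheme X"
    and principal: "x \<in> pts X \<Longrightarrow> \<exists>U f. opn X U \<and> x \<in> U \<and> generated_on X Z U f"
begin

lemma good_chart:
  assumes "x \<in> pts X"
  obtains U R f where "x \<in> U" "good_chart X U R Z f"
  using principal[OF assms] good_chart_exists[OF noeth assms] by blast

definition V :: "'a set" where
  "V = pts X - (\<Union>x \<in> Ass X \<inter> supp X Z. rs_top X closure_of {x})"

text \<open>Turns the definition of \<open>V\<close> by associated points into a condition on
  stalks. In particular, regularity of the local equation at \<open>y\<close> does not depend on the
  chosen chart.\<close>

lemma V_iff_reg:
  assumes "good_chart X U R Z f" and y: "y \<in> U"
  shows "y \<in> V \<longleftrightarrow> good_chart.reg X U f y"
proof -
  interpret G: good_chart X U R Z f by fact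
  show ?thesis
    using G.not_reg_if_Ass[OF _ _ y] G.Ass_if_not_reg[OF y] G.U_pts[OF y] unfolding V_def by blast
qed

text \<open>Regularity at \<open>y\<close> persists on some \<open>D u\<close>, and
  \<open>D u\<close> is again a chart. The same neighbourhood gives openness of \<open>V\<close> and
  its scheme structure.\<close>

lemma V_nbhd:
  assumes "y \<in> V"
  obtains U R where "y \<in> U" "opn X U" "U \<subseteq> V" "chart X U R"
proof -
  have "y \<in> pts X" using assms by (simp add: V_def)
  then obtain U R f where U: "y \<in> U" "good_chart X U R Z f" by (rule good_chart)
  interpret G: good_chart X U R Z f by (rule U)
  have "G.reg y" using V_iff_reg[OF U(2,1)] assms by blast
  then obtain u where u: "u \<in> R" "y \<in> G.D u" "\<And>z. z \<in> G.D u \<Longrightarrow> G.reg z" by (rule G.reg_open[OF U(1)]) blast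
  have "G.D u \<subseteq> V" using V_iff_reg[OF U(2)] u(3) G.D_U by blast
  then show thesis using that u(2) G.D_open[OF u(1)] G.chart_D(1)[OF u(1)] by blast
qed

lemma V_open: "opn X V"
  by (subst openin_subopen) (meson V_nbhd)

lemma V_subscheme: "open_subscheme X V"
proof -
  interpret V: locally_ringed_space "open_sub X V" by (rule open_sub_locally_ringed[OF V_open])
  have "scheme (open_sub X V)"
  proof (rule V.schemeI)
    fix x assume "x \<in> pts (open_sub X V)"
    then have "x \<in> V" using pts_open_sub[OF V_open] by blast
    then obtain U R where U: "x \<in> U" "opn X U" "U \<subseteq> V" "chart X U R" by (rule V_nbhd)
    then show "\<exists>U R. x \<in> U \<and> chart (open_sub X V) U R" using chart_open_sub_iff[OF V_open U(3)] by blast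
  qed
  then show ?thesis using V_open by (simp add: open_subscheme_def)
qed

abbreviation "K \<equiv> vanishing_ideal X V"

sublocale K: ideal_space X K
  by unfold_locales (rule vanishing_ideal_sheaf)

lemma K_germ_iff:
  assumes U: "opn X U" "y \<in> U" "s \<in> sec X U"
  shows "germ X y U s \<in> K.Jst y \<longleftrightarrow> (\<exists>W. opn X W \<and> y \<in> W \<and> W \<subseteq> U \<and> (\<forall>z\<in>W \<inter> V. germ X z U s = \<zero>\<^bsub>stalk X z\<^esub>))"
proof -
  have "rs_res X U W s \<in> K W \<longleftrightarrow> (\<forall>z\<in>W \<inter> V. germ X z U s = \<zero>\<^bsub>stalk X z\<^esub>)" if W: "opn X W" "W \<subseteq> U" for W
    using germ_res[OF U(1) W _ U(3)] res_closed[OF U(1) W U(3)] by (simp add: vanishing_ideal_def)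
  then show ?thesis unfolding K.Jst_germ_iff[OF U] by blast
qed

text \<open>Where \<open>f\<close> is invertible it is regular, so such points belong to
  \<open>V\<close>. A section that vanishes on \<open>V\<close> near \<open>y\<close> thus meets the
  hypothesis of \<open>killed_by_power\<close>.\<close>

lemma K_killed_by_power:
  assumes "good_chart X U R Z f" and y: "y \<in> U" and a: "a \<in> R" "germ X y U a \<in> K.Jst y"
  obtains u and n :: nat where "u \<in> R" "germ X y U u \<in> Units (stalk X y)"
    "f [^]\<^bsub>rs_sec X U\<lparr>carrier := R\<rparr>\<^esub> n \<in> R"
    "f [^]\<^bsub>rs_sec X U\<lparr>carrier := R\<rparr>\<^esub> n \<otimes>\<^bsub>rs_sec X U\<^esub> (u \<otimes>\<^bsub>rs_sec X U\<^esub> a) = \<zero>\<^bsub>rs_sec X U\<^esub>"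
proof -
  interpret G: good_chart X U R Z f by fact
  obtain W where W: "opn X W" "y \<in> W" "W \<subseteq> U" "\<And>z. z \<in> W \<inter> V \<Longrightarrow> germ X z U a = \<zero>\<^bsub>stalk X z\<^esub>"
    using a(2) unfolding K_germ_iff[OF G.U y G.R_sec[OF a(1)]] by blast
  have "germ X z U a = \<zero>\<^bsub>stalk X z\<^esub>" if z: "z \<in> W" "germ X z U f \<in> Units (stalk X z)" for z
  proof -
    have zU: "z \<in> U" using z W by blast
    then show ?thesis using W(4) z G.unit_reg[OF zU z(2)] V_iff_reg[OF assms(1) zU] by blast
  qed
  from G.killed_by_power[OF y a(1) W(1-3) this] show thesis using that by blast
qed

text \<open>The passage from a neighbourhood of \<open>y\<close> to all of \<open>U\<close>: the
  relation \<open>f ^ n u a = 0\<close> holds on the whole chart, and \<open>f\<close> can be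
  cancelled at every point of \<open>V\<close>, so \<open>u a\<close> vanishes on all of
  \<open>U \<inter> V\<close>.\<close>

lemma K_qc:
  assumes good: "good_chart X U R Z f" and y: "y \<in> U" and a: "a \<in> R" "germ X y U a \<in> K.Jst y"
  shows "\<exists>u\<in>R. germ X y U u \<in> Units (stalk X y) \<and> u \<otimes>\<^bsub>rs_sec X U\<^esub> a \<in> K U"
proof -
  interpret G: good_chart X U R Z f by fact
  obtain u and n :: nat where u: "u \<in> R" "germ X y U u \<in> Units (stalk X y)" "f [^]\<^bsub>G.A\<^esub> n \<in> R"
    "f [^]\<^bsub>G.A\<^esub> n \<otimes>\<^bsub>rs_sec X U\<^esub> (u \<otimes>\<^bsub>rs_sec X U\<^esub> a) = \<zero>\<^bsub>rs_sec X U\<^esub>"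
    by (rule K_killed_by_power[OF good y a])
  have ua: "u \<otimes>\<^bsub>rs_sec X U\<^esub> a \<in> R" by (rule G.A.m_closed[OF u(1) a(1)])
  have "germ X z U (u \<otimes>\<^bsub>rs_sec X U\<^esub> a) = \<zero>\<^bsub>stalk X z\<^esub>" if z: "z \<in> U" "z \<in> V" for z
  proof (rule G.regD_pow)
    show "G.reg z" using V_iff_reg[OF good z(1)] z(2) by blast
    show "germ X z U f [^]\<^bsub>stalk X z\<^esub> n \<otimes>\<^bsub>stalk X z\<^esub> germ X z U (u \<otimes>\<^bsub>rs_sec X U\<^esub> a) = \<zero>\<^bsub>stalk X z\<^esub>"
      unfolding G.germ_f_pow[OF z(1), symmetric] G.germ_R_mult[OF z(1) u(3) ua, symmetric] u(4)
      by (rule stalk_zero_germ[OF G.U z(1), symmetric])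
  qed (use z ua in simp_all)
  then have "u \<otimes>\<^bsub>rs_sec X U\<^esub> a \<in> K U" using G.R_sec[OF ua] by (simp add: vanishing_ideal_def)
  then show ?thesis using u by blast
qed

lemma closure_chart:
  assumes good: "good_chart X U R Z f"
  shows "chart K.B (U \<inter> supp X K) (mor_sec K.\<iota> U ` R)"
  by (rule K.closed_chart[OF _ K_qc[OF good]]) (use good in \<open>auto simp: good_chart_def\<close>)

lemma closure_subscheme: "closed_subscheme X K"
proof -
  interpret B: locally_ringed_space K.B by (rule K.B_locally_ringed)
  have "scheme K.B"
  proof (rule B.schemeI)
    fix x assume x: "x \<in> pts K.B"
    then have xs: "x \<in> supp X K" unfolding K.pts_B .
    obtain U R f where U: "x \<in> U" "good_chart X U R Z f" by (rule good_chart[OF K.supp_pts[OF xs]])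
    then show "\<exists>U R. x \<in> U \<and> chart K.B U R" using closure_chart[OF U(2)] xs by blast
  qed
  then show ?thesis using K.J by (simp add: closed_subscheme_def)
qed

text \<open>Membership in \<open>K\<close> is tested at points of \<open>V\<close>, and at those
  \<open>f\<close> is regular. This is what makes \<open>f\<close> a nonzerodivisor on the
  closure.\<close>

lemma cancel_f:
  assumes good: "good_chart X U R Z f" and x: "x \<in> U" and w: "w \<in> carrier (stalk X x)"
    and fw: "germ X x U f \<otimes>\<^bsub>stalk X x\<^esub> w \<in> K.Jst x"
  shows "w \<in> K.Jst x"
proof -
  interpret G: good_chart X U R Z f by (rule good)
  obtain N s where N: "opn X N" "x \<in> N" "N \<subseteq> U" "s \<in> sec X N" "w = germ X x N s"
    using w G.U x by (rule stalk_nbhdE)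
  interpret N: cring "rs_sec X N" by (rule sec_cring[OF N(1)])
  have fs: "f \<in> sec X U" by (rule G.R_sec[OF G.f])
  have rf: "rs_res X U N f \<in> sec X N" by (rule res_closed[OF G.U N(1,3) fs])
  have prod: "germ X z N (rs_res X U N f \<otimes>\<^bsub>rs_sec X N\<^esub> s) = germ X z U f \<otimes>\<^bsub>stalk X z\<^esub> germ X z N s" if z: "z \<in> N" for z
    using stalk_mult_germ[OF N(1) z rf N(4)] germ_res[OF G.U N(1,3) z fs] by simp
  have "germ X x N (rs_res X U N f \<otimes>\<^bsub>rs_sec X N\<^esub> s) \<in> K.Jst x" unfolding prod[OF N(2)] using fw N(5) by simp
  then obtain M where M: "opn X M" "x \<in> M" "M \<subseteq> N"
    "\<And>z. z \<in> M \<inter> V \<Longrightarrow> germ X z N (rs_res X U N f \<otimes>\<^bsub>rs_sec X N\<^esub> s) = \<zero>\<^bsub>stalk X z\<^esub>"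
    unfolding K_germ_iff[OF N(1,2) N.m_closed[OF rf N(4)]] by blast
  have "germ X z N s = \<zero>\<^bsub>stalk X z\<^esub>" if z: "z \<in> M \<inter> V" for z
  proof (rule G.regD)
    have zN: "z \<in> N" "z \<in> U" using z M N by blast+
    show "G.reg z" using V_iff_reg[OF good zN(2)] z by blast
    show "germ X z N s \<in> carrier (stalk X z)" by (rule germ_in_stalk[OF N(1) zN(1) N(4)])
    show "germ X z U f \<otimes>\<^bsub>stalk X z\<^esub> germ X z N s = \<zero>\<^bsub>stalk X z\<^esub>" using prod[OF zN(1)] M(4)[OF z] by simp
  qed
  then show ?thesis unfolding N(5) K_germ_iff[OF N(1,2,4)] using M by blast
qed

section \<open>The closure as a blow up\<close>

sublocale P: ideal_pullback X Z K.B K.\<iota>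
proof -
  interpret B: locally_ringed_space K.B by (rule K.B_locally_ringed)
  show "ideal_pullback X Z K.B K.\<iota>"
    by unfold_locales (rule K.incl_ringed)
qed

lemma closure_cartier: "effective_cartier K.B P.I"
proof -
  interpret I: ideal_space K.B P.I
    by (intro ideal_space.intro K.B_locally_ringed ideal_space_axioms.intro P.preimage_ideal_sheaf)
  have gen: "stalkwise_generated K.B P.I (U \<inter> supp X K) (mor_sec K.\<iota> U f)" if "good_chart X U R Z f" for U R f
  proof -
    interpret G: good_chart X U R Z f by fact
    show ?thesis using P.preimage_generated[OF G.gen] unfolding K.preim_incl .
  qed
  interpret BI: locally_ringed_space "closed_sub K.B P.I" by (rule I.B_locally_ringed)
  have "scheme (closed_sub K.B P.I)"
  proof (rule BI.schemeI)
    fix x assume "x \<in> pts (closed_sub K.B P.I)"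
    then have xI: "x \<in> supp K.B P.I" unfolding I.pts_B .
    then have xs: "x \<in> supp X K" using I.supp_pts unfolding K.pts_B by blast
    obtain U R f where U: "x \<in> U" "good_chart X U R Z f" by (rule good_chart[OF K.supp_pts[OF xs]])
    interpret G: good_chart X U R Z f by (rule U(2))
    note ch = closure_chart[OF U(2)]
    have fm: "mor_sec K.\<iota> U f \<in> mor_sec K.\<iota> U ` R" using G.f by (rule imageI)
    have "x \<in> (U \<inter> supp X K) \<inter> supp K.B P.I" using U(1) xs xI by blast
    \<comment> \<open>The preimage of \<open>Z\<close> in the closure is generated by the image of
      \<open>f\<close>, an element of the chart ring, so its quasi-coherence is that of a principal
      ideal.\<close>
    moreover have "chart (closed_sub K.B P.I) ((U \<inter> supp X K) \<inter> supp K.B P.I)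
        (mor_sec (closed_incl K.B P.I) (U \<inter> supp X K) ` (mor_sec K.\<iota> U ` R))"
      by (rule I.closed_chart[OF ch I.principal_qc[OF ch fm gen[OF U(2)]]])
    ultimately show "\<exists>U R. x \<in> U \<and> chart (closed_sub K.B P.I) U R" by (intro exI conjI)
  qed
  then have sub: "closed_subscheme K.B P.I" using P.preimage_ideal_sheaf by (simp add: closed_subscheme_def)
  show ?thesis
    unfolding effective_cartier_def
  proof (intro conjI ballI sub)
    fix x assume "x \<in> pts K.B"
    then have xs: "x \<in> supp X K" unfolding K.pts_B .
    obtain U R f where U: "x \<in> U" "good_chart X U R Z f" by (rule good_chart[OF K.supp_pts[OF xs]])
    interpret G: good_chart X U R Z f by (rule U(2))
    let ?W = "U \<inter> supp X K" and ?f = "mor_sec K.\<iota> U f"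
    have fs: "f \<in> sec X U" by (rule G.R_sec[OF G.f])
    have W: "opn K.B ?W" "?f \<in> sec K.B ?W" using gen[OF U(2)] unfolding stalkwise_generated_def by blast+
    have "regular_element (stalk K.B y) (germ K.B y ?W ?f)" if y: "y \<in> ?W" for y
      unfolding regular_element_def
    proof (intro conjI ballI impI)
      show "germ K.B y ?W ?f \<in> carrier (stalk K.B y)" by (rule K.B.F.germ_in_stalk[OF W(1) y W(2)])
      fix z assume z: "z \<in> carrier (stalk K.B y)" "z \<otimes>\<^bsub>stalk K.B y\<^esub> germ K.B y ?W ?f = \<zero>\<^bsub>stalk K.B y\<^esub>"
      have yU: "y \<in> U" and ys: "y \<in> supp X K" using y by blast+
      interpret S: cring "stalk X y" by (rule stalk_cring'[OF G.U yU])
      obtain N s where N: "opn X N" "y \<in> N" "s \<in> sec X N" "z = stalk_map K.B K.\<iota> y (germ X y N s)"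
        using z(1) by (rule K.B_stalkE)
      let ?w = "germ X y N s"
      have w: "?w \<in> carrier (stalk X y)" by (rule germ_in_stalk[OF N(1-3)])
      have fc: "germ X y U f \<in> carrier (stalk X y)" by (rule germ_in_stalk[OF G.U yU fs])
      have hom: "stalk_map K.B K.\<iota> y \<in> ring_hom (stalk X y) (stalk K.B y)"
        using K.incl.stalk_map_hom[of y] ys unfolding K.pts_B by simp
      \<comment> \<open>A germ on the closure that is killed by \<open>f\<close> lifts to a germ
        \<open>?w\<close> on \<open>X\<close> whose product with \<open>f\<close> lies in
        \<open>K\<close>; then \<open>cancel_f\<close> puts \<open>?w\<close> itself into
        \<open>K\<close>.\<close>
      have "stalk_map K.B K.\<iota> y (?w \<otimes>\<^bsub>stalk X y\<^esub> germ X y U f) = \<zero>\<^bsub>stalk K.B y\<^esub>"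
        using ring_hom_mult[OF hom w fc] K.incl_stalk_map[OF G.U yU ys fs] z(2) N(4) by simp
      then have "germ X y U f \<otimes>\<^bsub>stalk X y\<^esub> ?w \<in> K.Jst y"
        using K.incl_germ_eq_iff(1)[OF ys S.m_closed[OF w fc]] S.m_comm[OF w fc] by simp
      then have "?w \<in> K.Jst y" by (rule cancel_f[OF U(2) yU w])
      then show "z = \<zero>\<^bsub>stalk K.B y\<^esub>" unfolding N(4) using K.incl_germ_eq_iff(1)[OF ys w] by blast
    qed
    then have "\<forall>W. opn K.B W \<and> W \<subseteq> ?W \<longrightarrow> regular_element (rs_sec K.B W) (rs_res K.B ?W W ?f)"
      by (intro K.B.F.regular_section_iff[OF W, THEN iffD2] ballI)
    then show "\<exists>U f. opn K.B U \<and> x \<in> U \<and> generated_on K.B P.I U f \<and>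
        (\<forall>W. opn K.B W \<and> W \<subseteq> U \<longrightarrow> regular_element (rs_sec K.B W) (rs_res K.B U W f))"
      using W(1) U(1) xs I.generated_onI[OF gen[OF U(2)]] by (intro exI[of _ ?W] exI[of _ ?f] conjI IntI)
  qed
qed

text \<open>In the stalk a germ of \<open>K\<close> is killed by a power of \<open>f\<close>, up to
  units that can be cancelled. The Cartier condition makes the pullback of \<open>f\<close> a
  nonzerodivisor on \<open>T\<close>, so the pullback of the germ is zero.\<close>

lemma pullback_kills_K:
  assumes T: "locally_ringed_space T" and t: "lrs_morphism T X t"
    and cart: "effective_cartier T (preimage_ideal T X t Z)" and W: "opn X W" and s: "s \<in> K W"
  shows "mor_sec t W s = \<zero>\<^bsub>rs_sec T (preim T t W)\<^esub>"
proof -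
  interpret Q: ideal_pullback X Z T t
    using T t by (intro ideal_pullback.intro ringed_mor.intro ringed_mor_axioms.intro ideal_space_axioms)
      (simp_all add: locally_ringed_space_def lrs_morphism_def ringed_space_axioms)
  interpret I: ideal_space T Q.I
    by (intro ideal_space.intro T ideal_space_axioms.intro Q.preimage_ideal_sheaf)
  have sW: "s \<in> sec X W" using s by (simp add: vanishing_ideal_def)
  have tW: "opn T (preim T t W)" using W by simp
  show ?thesis
  proof (rule Q.T.section_eqI[OF tW Q.t.sec_closed[OF W sW] Q.T.sec_zero[OF tW]])
    fix x assume xW: "x \<in> preim T t W"
    then have x: "x \<in> pts T" and yW: "mor_pt t x \<in> W" by (simp_all add: preim_def)
    let ?y = "mor_pt t x" and ?\<tau> = "stalk_map T t x"
    have y: "?y \<in> pts X" by (rule pts_open[OF W yW])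
    interpret S: cring "stalk X ?y" by (rule stalk_cring[OF y])
    interpret Tx: cring "stalk T x" by (rule Q.T.stalk_cring[OF x])
    note hom = Q.t.stalk_map_hom[OF x]
    obtain U R f where U: "?y \<in> U" "good_chart X U R Z f" by (rule good_chart[OF y])
    interpret G: good_chart X U R Z f by (rule U(2))
    have fs: "f \<in> sec X U" by (rule G.R_sec[OF G.f])
    have fc: "germ X ?y U f \<in> carrier (stalk X ?y)" by (rule germ_in_stalk[OF G.U U(1) fs])
    let ?F = "?\<tau> (germ X ?y U f)"
    have Fc: "?F \<in> carrier (stalk T x)" by (rule ring_hom_closed[OF hom fc])
    have xU: "x \<in> preim T t U" using x U(1) by (simp add: preim_def)
    \<comment> \<open>The Cartier condition supplies some regular generator \<open>g\<close>, which
      need not be the pullback of \<open>f\<close>. But in the stalk \<open>g\<close> is a multiple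
      of \<open>?F\<close>, so whatever is killed by \<open>?F\<close> is killed by
      \<open>g\<close>.\<close>
    have Freg: "z = \<zero>\<^bsub>stalk T x\<^esub>" if z: "z \<in> carrier (stalk T x)" "?F \<otimes>\<^bsub>stalk T x\<^esub> z = \<zero>\<^bsub>stalk T x\<^esub>" for z
    proof -
      from bspec[OF conjunct2[OF cart[unfolded effective_cartier_def]] x]
      obtain N g where N: "opn T N" "x \<in> N" "generated_on T Q.I N g"
        "\<forall>M. opn T M \<and> M \<subseteq> N \<longrightarrow> regular_element (rs_sec T M) (rs_res T N M g)"
        by (elim exE conjE)
      have sg: "stalkwise_generated T Q.I N g" by (rule I.generated_onD[OF N(1,3)])
      have gs: "g \<in> sec T N" using sg by (simp add: stalkwise_generated_def)
      have greg: "regular_element (stalk T x) (germ T x N g)"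
        by (rule bspec[OF Q.T.regular_section_iff[OF N(1) gs, THEN iffD1, OF N(4)] N(2)])
      then have gc: "germ T x N g \<in> carrier (stalk T x)" by (simp add: regular_element_def)
      have "germ T x N g \<in> stalk_ideal T Q.I x" by (rule I.JstI[OF N(1,2) I.generator_mem[OF sg]])
      then obtain c where c: "c \<in> carrier (stalk T x)" "germ T x N g = c \<otimes>\<^bsub>stalk T x\<^esub> germ T x (preim T t U) (mor_sec t U f)"
        using Q.preimage_generated[OF G.gen] xU unfolding stalkwise_generated_def by blast
      have "germ T x N g = c \<otimes>\<^bsub>stalk T x\<^esub> ?F" unfolding c(2) Q.t.stalk_map_germ[OF x G.U U(1) fs] ..
      then have "z \<otimes>\<^bsub>stalk T x\<^esub> germ T x N g = c \<otimes>\<^bsub>stalk T x\<^esub> (?F \<otimes>\<^bsub>stalk T x\<^esub> z)"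
        using z(1) c(1) Fc by (simp add: Tx.m_ac)
      then have "z \<otimes>\<^bsub>stalk T x\<^esub> germ T x N g = \<zero>\<^bsub>stalk T x\<^esub>" using z(2) c(1) by simp
      then show ?thesis using greg z(1) by (simp add: regular_element_def)
    qed
    let ?z = "germ X ?y W s"
    have zc: "?z \<in> carrier (stalk X ?y)" by (rule germ_in_stalk[OF W yW sW])
    obtain a h where a: "a \<in> R" "h \<in> R" "germ X ?y U h \<in> Units (stalk X ?y)"
      "germ X ?y U h \<otimes>\<^bsub>stalk X ?y\<^esub> ?z = germ X ?y U a"
      by (rule G.frac_stalk[OF U(1) zc])
    have hc: "germ X ?y U h \<in> carrier (stalk X ?y)" using a(3) by (rule S.Units_closed)
    have "germ X ?y U a \<in> K.Jst ?y"
      unfolding a(4)[symmetric] by (rule ideal.I_l_closed[OF K.Jst_ideal[OF y] K.JstI[OF W yW s] hc])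
    then obtain u and n :: nat where u: "u \<in> R" "germ X ?y U u \<in> Units (stalk X ?y)" "f [^]\<^bsub>G.A\<^esub> n \<in> R"
      "f [^]\<^bsub>G.A\<^esub> n \<otimes>\<^bsub>rs_sec X U\<^esub> (u \<otimes>\<^bsub>rs_sec X U\<^esub> a) = \<zero>\<^bsub>rs_sec X U\<^esub>"
      by (rule K_killed_by_power[OF U(2,1) a(1)])
    let ?Fn = "germ X ?y U f [^]\<^bsub>stalk X ?y\<^esub> n"
    have uc: "germ X ?y U u \<in> carrier (stalk X ?y)" using u(2) by (rule S.Units_closed)
    have "?Fn \<otimes>\<^bsub>stalk X ?y\<^esub> (germ X ?y U u \<otimes>\<^bsub>stalk X ?y\<^esub> (germ X ?y U h \<otimes>\<^bsub>stalk X ?y\<^esub> ?z)) = \<zero>\<^bsub>stalk X ?y\<^esub>"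
      unfolding a(4) G.germ_f_pow[OF U(1), symmetric] G.germ_R_mult[OF U(1) u(1) a(1), symmetric]
        G.germ_R_mult[OF U(1) u(3) G.A.m_closed[OF u(1) a(1)], symmetric] u(4)
      by (rule stalk_zero_germ[OF G.U U(1), symmetric])
    \<comment> \<open>The germs of \<open>u\<close> and \<open>h\<close> are units, so both can be
      stripped off, and the power of \<open>f\<close> kills the germ of \<open>s\<close>
      itself.\<close>
    then have "germ X ?y U u \<otimes>\<^bsub>stalk X ?y\<^esub> (germ X ?y U h \<otimes>\<^bsub>stalk X ?y\<^esub> (?Fn \<otimes>\<^bsub>stalk X ?y\<^esub> ?z)) = \<zero>\<^bsub>stalk X ?y\<^esub>"
      using fc zc uc hc by (simp add: S.m_ac)
    then have "germ X ?y U h \<otimes>\<^bsub>stalk X ?y\<^esub> (?Fn \<otimes>\<^bsub>stalk X ?y\<^esub> ?z) = \<zero>\<^bsub>stalk X ?y\<^esub>"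
      using S.unit_eq_zeroD[OF u(2)] fc zc hc by simp
    then have "?Fn \<otimes>\<^bsub>stalk X ?y\<^esub> ?z = \<zero>\<^bsub>stalk X ?y\<^esub>"
      using S.unit_eq_zeroD[OF a(3)] fc zc by simp
    then have "?\<tau> (?Fn \<otimes>\<^bsub>stalk X ?y\<^esub> ?z) = \<zero>\<^bsub>stalk T x\<^esub>"
      using ring_hom_zero'[OF hom S.is_cring Tx.is_cring] by simp
    then have p: "?F [^]\<^bsub>stalk T x\<^esub> n \<otimes>\<^bsub>stalk T x\<^esub> ?\<tau> ?z = \<zero>\<^bsub>stalk T x\<^esub>"
      using ring_hom_mult[OF hom S.nat_pow_closed[OF fc] zc] ring_hom_pow'[OF hom S.is_cring Tx.is_cring fc] by simp
    have "?\<tau> ?z = \<zero>\<^bsub>stalk T x\<^esub>" by (rule Tx.cancel_pow[OF Fc Freg ring_hom_closed[OF hom zc] p])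
    then show "germ T x (preim T t W) (mor_sec t W s) = germ T x (preim T t W) \<zero>\<^bsub>rs_sec T (preim T t W)\<^esub>"
      unfolding Q.t.stalk_map_germ[OF x W yW sW] Q.T.stalk_zero_germ[OF tW xW] .
  qed
qed

text \<open>The universal property is that of the closed subspace, because every morphism that turns
  the preimage of \<open>Z\<close> into an effective Cartier divisor kills \<open>K\<close>.\<close>

theorem closure_blow_up: "blow_up TYPE(('c, 'd) rspace) X Z K.B K.\<iota>"
  unfolding blow_up_def
proof (intro conjI allI impI)
  show "scheme K.B" using closure_subscheme by (simp add: closed_subscheme_def)
  show "lrs_morphism K.B X K.\<iota>" by (rule K.incl_lrs)
  show "effective_cartier K.B P.I" by (rule closure_cartier)
  fix T :: "('c, 'd) rspace" and t
  assume h: "scheme T \<and> lrs_morphism T X t \<and> effective_cartier T (preimage_ideal T X t Z)"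
  then have T: "locally_ringed_space T" and t: "lrs_morphism T X t" by (simp_all add: scheme_def)
  obtain g where "lrs_morphism T K.B g" "mor_eq T X (mor_comp K.B K.\<iota> g) t"
    "\<And>g'. lrs_morphism T K.B g' \<Longrightarrow> mor_eq T X (mor_comp K.B K.\<iota> g') t \<Longrightarrow> mor_eq T K.B g' g"
    using K.closed_sub_universal[OF T t pullback_kills_K[OF T t]] h by blast
  then show "\<exists>g. lrs_morphism T K.B g \<and> mor_eq T X (mor_comp K.B K.\<iota> g) t \<and>
      (\<forall>g'. lrs_morphism T K.B g' \<and> mor_eq T X (mor_comp K.B K.\<iota> g') t \<longrightarrow> mor_eq T K.B g' g)" by blast
qed

end

text \<open>A schematic closure is determined only by its values on open sets. Therefore existence
  is asserted separately, and the blow up property is shown for every \<open>J\<close> that is a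
  closure, by comparison with \<open>P.K\<close>.\<close>

theorem theorem2p3:
  fixes X :: "('a, 'b) rspace" and Z :: "'a set \<Rightarrow> 'b set" and T\<^sub>Z V :: "'a set"
  assumes "locally_noetherian_scheme X"
    and "locally_principal_subscheme X Z"
    and "T\<^sub>Z = (\<Union>x \<in> Ass X \<inter> supp X Z. rs_top X closure_of {x})"
    and "V = pts X - T\<^sub>Z"
  shows "open_subscheme X V \<and>
    (\<exists>J. schematic_closure X V J) \<and>
    (\<forall>J. schematic_closure X V J \<longrightarrow>
       blow_up TYPE(('c, 'd) rspace) X Z (closed_sub X J) (closed_incl X J))"
proof -
  interpret X: locally_ringed_space X using assms(1) by (simp add: locally_noetherian_scheme_def scheme_def)
  interpret P: locally_principal X Z
    using assms(1,2) by unfold_locales (auto simp: locally_principal_subscheme_def closed_subscheme_def)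
  have V: "V = P.V" unfolding P.V_def assms(3,4) ..
  note cl = X.schematic_closure_iff[OF P.V_open P.closure_subscheme]
  have "blow_up TYPE(('c, 'd) rspace) X Z (closed_sub X J) (closed_incl X J)" if J: "schematic_closure X P.V J" for J
  proof -
    interpret J: ideal_space X J
      using J unfolding cl by unfold_locales (simp add: closed_subscheme_def)
    have "J U = P.K U" if "opn X U" for U using J that unfolding cl by blast
    from J.closed_sub_cong[OF this] show ?thesis using P.closure_blow_up by simp
  qed
  moreover have "schematic_closure X P.V P.K" unfolding cl using P.closure_subscheme by blast
  ultimately show ?thesis unfolding V using P.V_subscheme by blast
qed
end
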